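(* Let $G^c_{\rm hom}=\lambda G^c_A+(1-\lambda)G^c_B$. Let $[t_a,t_b]\subset[0,T)$ be a time interval such that $\ell_{\rm hom}(t_a)<\ell_{\rm hom}(t_b)$ and $J(\ell_{\rm hom})\cap[t_a,t_b]=\emptyset$. Then $$G^c_{\rm hom}\le G^c_{\rm eff}(l)\qquad\text{for every }l\in[\ell_{\rm hom}(t_a),\ell_{\rm hom}(t_b)].$$
   Context: Geometry. $L,H>0$, $\Omega=(0,L)\times(-H,H)$, $K_l=[0,l]\times\{0\}$ for $l\in(0,L]$; $\partial_D\Omega=\{0\}\times((-H,0)\cup(0,H))\ \cup\ \{L\}\times(-H,H)$; $g\in H^{1/2}(\partial_D\Omega)$ (on each of the three open segments); $\mathcal U_l=\{u\in H^1(\Omega\setminus K_l):u=g\text{ on }\partial_D\Omega\}$. Vertical layers. $\lambda\in(0,1)$, $n\in\mathbb N\setminus\{0\}$; $l_{n,k}=kL/n$ ($k=0,\dots,n$), $l_{n,k+\lambda}=(k+\lambda)L/n$ ($k=0,\dots,n-1$); $\Lambda_n$ is the set of all these points. $\boldsymbol C_A=\mathrm{diag}(\mu_{A,1},\mu_{A,2})$, $\boldsymbol C_B=\mathrm{diag}(\mu_{B,1},\mu_{B,2})$ with positive entries; toughnesses $G^c_A,G^c_B>0$. $\boldsymbol C_n(x)=\boldsymbol C_A$ if $x_1\in(l_{n,k},l_{n,k+\lambda})$, $\boldsymbol C_n(x)=\boldsymbol C_B$ if $x_1\in(l_{n,k+\lambda},l_{n,k+1})$. $G^c_n(l)=G^c_A$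 for $l\in[l_{n,k},l_{n,k+\lambda})$, $G^c_n(l)=G^c_B$ for $l\in[l_{n,k+\lambda},l_{n,k+1})$, $G^c_n(L)=G^c_A$. Energy and energy release. $\mathcal E_n(l)=\min\{\tfrac12\int_{\Omega\setminus K_l}\nabla u\,\boldsymbol C_n\nabla u^T\,dx:u\in\mathcal U_l\}$, which is of class $C^1$ in $(0,L)\setminus\Lambda_n$. $\mathcal G_n(l)=-\mathcal E_n'(l)$ for $l\in(0,L)\setminus\Lambda_n$, $\mathcal G_n(l)=\liminf_{s\to l^+}\mathcal G_n(s)$ for $l\in\Lambda_n\setminus\{L\}$ (possibly $+\infty$), $\mathcal G_n(L)=0$. Evolutions. $T>0$, $f\in C^1([0,T])$, $f(0)=0$, $f'>0$; $L_0\in(0,L)$. $G_n(0,l)=0$, $G_n(t,l)=f^2(t)\mathcal G_n(l)$ for $t>0$ (possibly $+\infty$). For monotone $\ell$, $\ell^\pm$ denote right/left limits and $J(\ell)$ the set of discontinuity points. $\ell_n:[0,T)\to[L_0,L]$ is the unique non-decreasing, right continuous function with $\ell_n(0)=L_0$ such that: $G_n(t,\ell_n(t))\le G^c_n(\ell_n(t))$ for every $t\in[0,T)$; if $G_n(t,\ell_n(t))<G^c_n(\ell_n(t))$ then $\ell_n$ is right differentiable in $t$ with zero right derivative; if $t\in J(\ell_n)$ then $G_n(t,l)\ge G^c_n(l)$ for every $l\in[\ell_n^-(t),\ell_n(t))$. Homogenized quantities. $\boldsymbol C_{\rm hom}=\mathrm{diag}(\mu_{{\rm hom},1},\mu_{{\rm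 hom},2})$ with $1/\mu_{{\rm hom},1}=\lambda/\mu_{A,1}+(1-\lambda)/\mu_{B,1}$, $\mu_{{\rm hom},2}=\lambda\mu_{A,2}+(1-\lambda)\mu_{B,2}$. $\mathcal E_{\rm hom}(l)=\min\{\tfrac12\int_{\Omega\setminus K_l}\nabla u\,\boldsymbol C_{\rm hom}\nabla u^T\,dx:u\in\mathcal U_l\}$, of class $C^1(0,L)$. $\mathcal G_{\rm hom}(l)=-\mathcal E_{\rm hom}'(l)$ for $l\in(0,L)$, $\mathcal G_{\rm hom}(L)=0$. Limit evolution and effective toughness. A subsequence $(n_j)$ is fixed such that $\ell_{n_j}\to\ell$ pointwise in $[0,T)$, and $\ell_{\rm hom}=\ell^+$ is the right continuous representative of $\ell$. For $l\in(0,L]$ put $\gamma(l)=\inf\{\liminf_{j\to\infty}\mathcal G_{n_j}(l_j)/G^c_{n_j}(l_j):l_j\in[0,L],\ l_j\to l\}$ (the $\Gamma$-liminf). Then $G^c_{\rm eff}(l)=\mathcal G_{\rm hom}(l)/\gamma(l)$ if $\mathcal G_{\rm hom}(l)\neq0$ ($+\infty$ if $\gamma(l)=0$), and $G^c_{\rm eff}(l)=+\infty$ if $\mathcal G_{\rm hom}(l)=0$. *)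

theory Defs
  imports "HOL-Analysis.Analysis"
begin

text \<open>A function belongs to the class \<open>L2 U\<close> up to modification on null sets; functions are total
  and their values outside \<open>U\<close> are irrelevant.\<close>

definition L2 :: "'a::euclidean_space set \<Rightarrow> ('a \<Rightarrow> 'b::euclidean_space) \<Rightarrow> bool" where
  "L2 U f \<longleftrightarrow> f \<in> borel_measurable (lebesgue_on U) \<and>
              integrable (lebesgue_on U) (\<lambda>x. (norm (f x))\<^sup>2)"

definition L2_tendsto ::
    "'a::euclidean_space set \<Rightarrow> (nat \<Rightarrow> 'a \<Rightarrow> 'b::euclidean_space) \<Rightarrow> ('a \<Rightarrow> 'b) \<Rightarrow> bool" where
  "L2_tendsto U \<phi> f \<longleftrightarrow> (\<forall>k. L2 U (\<phi> k)) \<and> L2 U f \<and>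
     (\<lambda>k. LINT x|lebesgue_on U. (norm (\<phi> k x - f x))\<^sup>2) \<longlonglongrightarrow> 0"

definition partial1 :: "(real \<times> real \<Rightarrow> real) \<Rightarrow> real \<times> real \<Rightarrow> real" where
  "partial1 \<phi> x = frechet_derivative \<phi> (at x) (1, 0)"

definition partial2 :: "(real \<times> real \<Rightarrow> real) \<Rightarrow> real \<times> real \<Rightarrow> real" where
  "partial2 \<phi> x = frechet_derivative \<phi> (at x) (0, 1)"

definition gradient :: "(real \<times> real \<Rightarrow> real) \<Rightarrow> real \<times> real \<Rightarrow> real \<times> real" where
  "gradient \<phi> x = (partial1 \<phi> x, partial2 \<phi> x)"

text \<open>Coinduction makes \<open>smooth \<phi>\<close> say that all iterated partial derivatives of \<open>\<phi>\<close> are (Frechet)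
  differentiable on the whole plane, i.e. that \<open>\<phi>\<close> is of class \<open>C\<^sup>\<infinity>\<close>.\<close>

coinductive smooth :: "(real \<times> real \<Rightarrow> real) \<Rightarrow> bool" where
  "(\<And>x. \<phi> differentiable (at x)) \<Longrightarrow> smooth (partial1 \<phi>) \<Longrightarrow> smooth (partial2 \<phi>) \<Longrightarrow> smooth \<phi>"

definition test_function :: "(real \<times> real) set \<Rightarrow> (real \<times> real \<Rightarrow> real) \<Rightarrow> bool" where
  "test_function U \<phi> \<longleftrightarrow> smooth \<phi> \<and> compact (closure {x. \<phi> x \<noteq> 0}) \<and> closure {x. \<phi> x \<noteq> 0} \<subseteq> U"

text \<open>\<open>H1_gradient U u v\<close>: the function \<open>u\<close> is in \<open>H\<^sup>1(U)\<close> and \<open>v\<close> is (a representative of)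
  its distributional gradient.\<close>

definition H1_gradient ::
    "(real \<times> real) set \<Rightarrow> (real \<times> real \<Rightarrow> real) \<Rightarrow> (real \<times> real \<Rightarrow> real \<times> real) \<Rightarrow> bool" where
  "H1_gradient U u v \<longleftrightarrow> L2 U u \<and> L2 U v \<and>
     (\<forall>\<phi>. test_function U \<phi> \<longrightarrow>
        (LINT x|lebesgue_on U. u x *\<^sub>R gradient \<phi> x) = - (LINT x|lebesgue_on U. \<phi> x *\<^sub>R v x))"

definition H1 :: "(real \<times> real) set \<Rightarrow> (real \<times> real \<Rightarrow> real) set" where
  "H1 U = {u. \<exists>v. H1_gradient U u v}"

text \<open>\<open>H_half I h\<close>: the function \<open>h\<close> is in \<open>H\<^sup>1\<^sup>/\<^sup>2(I)\<close> (finite Gagliardo seminorm). The integrand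
  vanishes on the diagonal, by division by zero.\<close>

definition H_half :: "real set \<Rightarrow> (real \<Rightarrow> real) \<Rightarrow> bool" where
  "H_half I h \<longleftrightarrow> L2 I h \<and>
     integrable (lebesgue_on (I \<times> I)) (\<lambda>(s, t). (h s - h t)\<^sup>2 / (s - t)\<^sup>2)"

text \<open>The trace of a function \<open>u \<in> H\<^sup>1(R)\<close> on a vertical segment \<open>{c} \<times> I\<close> contained in a side of an
  open rectangle \<open>R\<close> is \<open>g\<close>. This is the continuous extension to \<open>H\<^sup>1(R)\<close> of the restriction map
  on functions that are smooth up to the boundary, which are dense in \<open>H\<^sup>1(R)\<close>.\<close>

definition has_trace ::
    "(real \<times> real) set \<Rightarrow> real \<Rightarrow> real set \<Rightarrow> (real \<times> real \<Rightarrow> real) \<Rightarrow> (real \<times> real \<Rightarrow> real) \<Rightarrow> bool"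
  where
  "has_trace R c I u g \<longleftrightarrow>
     (\<exists>v \<phi>. H1_gradient R u v \<and> (\<forall>k. smooth (\<phi> k)) \<and>
        L2_tendsto R \<phi> u \<and> L2_tendsto R (\<lambda>k. gradient (\<phi> k)) v \<and>
        L2_tendsto I (\<lambda>k y. \<phi> k (c, y)) (\<lambda>y. g (c, y)))"

definition Omega :: "real \<Rightarrow> real \<Rightarrow> (real \<times> real) set" where
  "Omega L H = {0<..<L} \<times> {-H<..<H}"

definition crack :: "real \<Rightarrow> (real \<times> real) set" where
  "crack l = {0..l} \<times> {0}"

text \<open>\<open>g\<close> is in \<open>H\<^sup>1\<^sup>/\<^sup>2\<close> of each of the three open segments that make up the Dirichlet boundary.\<close>

definition boundary_datum :: "real \<Rightarrow> real \<Rightarrow> (real \<times> real \<Rightarrow> real) \<Rightarrow> bool" where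
  "boundary_datum L H g \<longleftrightarrow>
     H_half {-H<..<0} (\<lambda>y. g (0, y)) \<and> H_half {0<..<H} (\<lambda>y. g (0, y)) \<and>
     H_half {-H<..<H} (\<lambda>y. g (L, y))"

text \<open>Functions in \<open>H\<^sup>1\<close> of the cracked domain with \<open>u = g\<close> on the Dirichlet boundary. Since the
  cracked domain lies on both sides of the crack, the traces are taken from the upper and from the
  lower half rectangle; for the right side \<open>{L} \<times> (-H, H)\<close> this misses only the point \<open>(L, 0)\<close>.\<close>

definition admissible ::
    "real \<Rightarrow> real \<Rightarrow> (real \<times> real \<Rightarrow> real) \<Rightarrow> real \<Rightarrow> (real \<times> real \<Rightarrow> real) set" where
  "admissible L H g l =
     {u \<in> H1 (Omega L H - crack l).
        has_trace ({0<..<L} \<times> {0<..<H}) 0 {0<..<H} u g \<and>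
        has_trace ({0<..<L} \<times> {-H<..<0}) 0 {-H<..<0} u g \<and>
        has_trace ({0<..<L} \<times> {0<..<H}) L {0<..<H} u g \<and>
        has_trace ({0<..<L} \<times> {-H<..<0}) L {-H<..<0} u g}"

text \<open>A diagonal tensor is represented by the pair of its diagonal entries.\<close>

definition quad_form :: "real \<times> real \<Rightarrow> real \<times> real \<Rightarrow> real" where
  "quad_form C v = fst C * (fst v)\<^sup>2 + snd C * (snd v)\<^sup>2"

definition energy ::
    "real \<Rightarrow> real \<Rightarrow> (real \<times> real \<Rightarrow> real) \<Rightarrow> (real \<times> real \<Rightarrow> real \<times> real) \<Rightarrow> real \<Rightarrow> real" where
  "energy L H g C l =
     Inf {1/2 * (LINT x|lebesgue_on (Omega L H - crack l). quad_form (C x) (v x)) | u v.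
            u \<in> admissible L H g l \<and> H1_gradient (Omega L H - crack l) u v}"

definition interfaces :: "real \<Rightarrow> real \<Rightarrow> nat \<Rightarrow> real set" where
  "interfaces L lam n =
     {real k * L / real n | k. k \<le> n} \<union> {(real k + lam) * L / real n | k. k < n}"

text \<open>On the (negligible) interfaces the value of the tensor is immaterial.\<close>

definition layer_tensor ::
    "real \<Rightarrow> real \<Rightarrow> real \<times> real \<Rightarrow> real \<times> real \<Rightarrow> nat \<Rightarrow> real \<times> real \<Rightarrow> real \<times> real" where
  "layer_tensor L lam CA CB n x =
     (if \<exists>k<n. real k * L / real n < fst x \<and> fst x < (real k + lam) * L / real n
      then CA else CB)"

definition layer_toughness :: "real \<Rightarrow> real \<Rightarrow> real \<Rightarrow> real \<Rightarrow> nat \<Rightarrow> real \<Rightarrow> real" where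
  "layer_toughness L lam GA GB n l =
     (if l = L \<or> (\<exists>k<n. real k * L / real n \<le> l \<and> l < (real k + lam) * L / real n)
      then GA else GB)"

definition hom_tensor :: "real \<Rightarrow> real \<times> real \<Rightarrow> real \<times> real \<Rightarrow> real \<times> real" where
  "hom_tensor lam CA CB =
     (1 / (lam / fst CA + (1 - lam) / fst CB), lam * snd CA + (1 - lam) * snd CB)"

definition layer_release ::
    "real \<Rightarrow> real \<Rightarrow> (real \<times> real \<Rightarrow> real) \<Rightarrow> real \<Rightarrow> real \<times> real \<Rightarrow> real \<times> real \<Rightarrow> nat \<Rightarrow>
     real \<Rightarrow> ereal" where
  "layer_release L H g lam CA CB n l =
     (let E = energy L H g (layer_tensor L lam CA CB n)
      in if l = L then 0
         else if l \<in> interfaces L lam n then Liminf (at_right l) (\<lambda>s. ereal (- deriv E s))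
         else ereal (- deriv E l))"

definition hom_release ::
    "real \<Rightarrow> real \<Rightarrow> (real \<times> real \<Rightarrow> real) \<Rightarrow> real \<Rightarrow> real \<times> real \<Rightarrow> real \<times> real \<Rightarrow> real \<Rightarrow> real" where
  "hom_release L H g lam CA CB l =
     (if l = L then 0 else - deriv (energy L H g (\<lambda>_. hom_tensor lam CA CB)) l)"

text \<open>Here \<open>R\<close> stands for the energy release rate under unit load.\<close>

definition loaded_release :: "(real \<Rightarrow> real) \<Rightarrow> (real \<Rightarrow> ereal) \<Rightarrow> real \<Rightarrow> real \<Rightarrow> ereal" where
  "loaded_release f R t l = (if t = 0 then 0 else ereal ((f t)\<^sup>2) * R l)"

definition jump_set :: "real \<Rightarrow> (real \<Rightarrow> real) \<Rightarrow> real set" where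
  "jump_set T ell = {t \<in> {0..<T}. \<not> continuous (at t within {0..<T}) ell}"

definition left_limit :: "(real \<Rightarrow> real) \<Rightarrow> real \<Rightarrow> real" where
  "left_limit ell t = Lim (at_left t) ell"

definition right_limit :: "(real \<Rightarrow> real) \<Rightarrow> real \<Rightarrow> real" where
  "right_limit ell t = Lim (at_right t) ell"

definition evolution ::
    "real \<Rightarrow> (real \<Rightarrow> real) \<Rightarrow> real \<Rightarrow> real \<Rightarrow> (real \<Rightarrow> ereal) \<Rightarrow> (real \<Rightarrow> real) \<Rightarrow> (real \<Rightarrow> real) \<Rightarrow> bool"
  where
  "evolution T f L0 L R Gc ell \<longleftrightarrow>
     ell ` {0..<T} \<subseteq> {L0..L} \<and> mono_on {0..<T} ell \<and>
     (\<forall>t\<in>{0..<T}. continuous (at_right t) ell) \<and>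
     ell 0 = L0 \<and>
     (\<forall>t\<in>{0..<T}. loaded_release f R t (ell t) \<le> ereal (Gc (ell t))) \<and>
     (\<forall>t\<in>{0..<T}. loaded_release f R t (ell t) < ereal (Gc (ell t)) \<longrightarrow>
        (ell has_real_derivative 0) (at_right t)) \<and>
     (\<forall>t\<in>jump_set T ell. \<forall>l\<in>{left_limit ell t..<ell t}. loaded_release f R t l \<ge> ereal (Gc l))"

definition Gamma_liminf :: "real \<Rightarrow> (nat \<Rightarrow> real \<Rightarrow> ereal) \<Rightarrow> real \<Rightarrow> ereal" where
  "Gamma_liminf L F l =
     Inf {liminf (\<lambda>j. F j (x j)) | x. (\<forall>j. x j \<in> {0..L}) \<and> x \<longlonglongrightarrow> l}"

definition eff_toughness :: "(real \<Rightarrow> real) \<Rightarrow> (real \<Rightarrow> ereal) \<Rightarrow> real \<Rightarrow> ereal" where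
  "eff_toughness Ghom \<gamma> l =
     (if Ghom l = 0 \<or> \<gamma> l = 0 then \<infinity> else ereal (Ghom l) / \<gamma> l)"

end

theory Submission
  imports Defs
begin

text \<open>The lower bound on the effective toughness is a statement about the release rates near one crack length
\<open>l\<close>. The evolutions take values in \<open>[L0, L]\<close>, hence so do their limit and \<open>l\<close>, and at \<open>l = L\<close> the effective
toughness is infinite by convention. So let \<open>0 < l < L\<close> and \<open>c < \<gamma>(l)\<close>. By the definition of the
\<open>\<Gamma>\<close>-liminf there are a neighbourhood of \<open>l\<close> and an index from which on
\<open>c * G\<^sup>c\<^sub>n \<le> - E\<^sub>n'\<close> there, away from the interfaces (\<open>Gamma_liminf_lower\<close>). Every energy is nonincreasing in the
crack length, so it can only drop at an interface; integrating the inequality over whole periods, on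
which the toughness has mean \<open>G\<^sub>h\<^sub>o\<^sub>m = \<lambda> G\<^sub>A + (1 - \<lambda>) G\<^sub>B\<close>, gives (\<open>energy_drop\<close>)
\<open>c * G\<^sub>h\<^sub>o\<^sub>m * (x2 - x1 - 2 L / n) \<le> E\<^sub>n(x1) - E\<^sub>n(x2)\<close>.
The pointwise convergence \<open>E\<^sub>n \<rightarrow> E\<^sub>h\<^sub>o\<^sub>m\<close> (\<open>energy_homogenization\<close>) carries this to the limit and the
differentiability of \<open>E\<^sub>h\<^sub>o\<^sub>m\<close> at \<open>l\<close> (\<open>energy_differentiable\<close>) turns it into
\<open>c * G\<^sub>h\<^sub>o\<^sub>m \<le> - E\<^sub>h\<^sub>o\<^sub>m'(l)\<close> (\<open>hom_release_lower\<close>). Letting \<open>c\<close> increase to \<open>\<gamma>(l)\<close> proves the claim.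

The analysis behind these steps is done with infima and near-minimizers; no minimizer is ever
constructed.

\<^item> Homogenization. The coefficients depend on the first variable only and the tensors are diagonal,
so both \<open>\<mu>\<^sub>2\<close> and \<open>1 / \<mu>\<^sub>1\<close> of the layered material are their homogenized values plus a multiple of the
oscillation \<open>chi\<close>, which is small in the mean. For the lower bound (\<open>energy_liminf\<close>) the layered energy is bounded
below by its convex dual form at the stress of a near-minimizer \<open>w\<close> of the homogenized problem; the
error terms are integrals of \<open>chi\<close> against \<open>(\<partial>\<^sub>1 w)\<^sup>2\<close>, \<open>(\<partial>\<^sub>2 w)\<^sup>2\<close> and \<open>\<partial>\<^sub>2 w * \<partial>\<^sub>2 v\<close>. The last one contains the
unknown competitor \<open>v\<close> and tends to zero uniformly in \<open>v\<close> because a gradient is curl free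
(\<open>chi_weak_curl\<close>): the \<open>x\<^sub>1\<close>-derivative that is integrated out of the oscillation falls on \<open>\<partial>\<^sub>2 v\<close>,
where it may be exchanged for an \<open>x\<^sub>2\<close>-derivative of \<open>\<partial>\<^sub>1 v\<close>. The upper bound (\<open>energy_limsup\<close>) uses the usual corrector.

\<^item> Differentiability. A horizontal diffeomorphism \<open>t + s * \<psi> t\<close> that fixes the interfaces
maps layers to layers and moves the crack tip; it transports the energy at the moved tip to the energy at
\<open>l\<close> of a tensor that depends smoothly on \<open>s\<close> (\<open>transport_energy\<close>). Near-minimizers
of a quadratic functional are close to each other, hence that energy has a first-order expansion in \<open>s\<close>
(\<open>warped_energy_expansion\<close>).

\<^item> If no function satisfies the boundary condition, the same transport shows that this persists nearby
(\<open>nonempty_locally_constant\<close>); the energy is then locally constant, the homogenized release rate is zero and the effective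
toughness is infinite.\<close>

section \<open>Calculus of smooth functions\<close>

lemma partial_eqI:
  assumes "(\<phi> has_derivative D) (at x)"
  shows "partial1 \<phi> x = D (1, 0)" "partial2 \<phi> x = D (0, 1)"
  using frechet_derivative_at[OF assms] by (auto simp: partial1_def partial2_def)

lemma smooth_differentiable: "smooth \<phi> \<Longrightarrow> \<phi> differentiable (at x)"
  by (auto elim: smooth.cases)

lemma smooth_partial1: "smooth \<phi> \<Longrightarrow> smooth (partial1 \<phi>)"
  by (auto elim: smooth.cases)

lemma smooth_partial2: "smooth \<phi> \<Longrightarrow> smooth (partial2 \<phi>)"
  by (auto elim: smooth.cases)

lemma has_derivative_partials:
  assumes "\<phi> differentiable (at x)"
  shows "(\<phi> has_derivative (\<lambda>h. fst h * partial1 \<phi> x + snd h * partial2 \<phi> x)) (at x)"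
proof -
  let ?D = "frechet_derivative \<phi> (at x)"
  have D: "(\<phi> has_derivative ?D) (at x)"
    using assms frechet_derivative_works by blast
  have "?D h = fst h * partial1 \<phi> x + snd h * partial2 \<phi> x" for h
  proof -
    have lin: "linear ?D" using D has_derivative_linear by blast
    have "h = fst h *\<^sub>R (1, 0) + snd h *\<^sub>R (0, 1)" by (cases h) simp
    then have "?D h = ?D (fst h *\<^sub>R (1, 0) + snd h *\<^sub>R (0, 1))" by metis
    also have "\<dots> = fst h *\<^sub>R ?D (1, 0) + snd h *\<^sub>R ?D (0, 1)"
      by (simp only: linear_add[OF lin] linear_scale[OF lin])
    finally show ?thesis by (simp add: partial1_def partial2_def)
  qed
  then show ?thesis using D by (metis (no_types, lifting) ext)
qed

lemma partial_const: "partial1 (\<lambda>_. c) = (\<lambda>_. 0)" "partial2 (\<lambda>_. c) = (\<lambda>_. 0)"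
  using partial_eqI[OF has_derivative_const] by auto

lemma partial_fst: "partial1 fst = (\<lambda>_. 1)" "partial2 fst = (\<lambda>_. 0)"
  using partial_eqI[OF has_derivative_fst[OF has_derivative_ident]] by auto

lemma partial_snd: "partial1 snd = (\<lambda>_. 0)" "partial2 snd = (\<lambda>_. 1)"
  using partial_eqI[OF has_derivative_snd[OF has_derivative_ident]] by auto

lemma partial_add:
  assumes "\<And>x. \<phi> differentiable (at x)" "\<And>x. \<psi> differentiable (at x)"
  shows "partial1 (\<lambda>x. \<phi> x + \<psi> x) = (\<lambda>x. partial1 \<phi> x + partial1 \<psi> x)"
    "partial2 (\<lambda>x. \<phi> x + \<psi> x) = (\<lambda>x. partial2 \<phi> x + partial2 \<psi> x)"
  using partial_eqI[OF has_derivative_add[OF has_derivative_partials[OF assms(1)] has_derivative_partials[OF assms(2)]]]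
  by auto

lemma partial_mult:
  assumes "\<And>x. \<phi> differentiable (at x)" "\<And>x. \<psi> differentiable (at x)"
  shows "partial1 (\<lambda>x. \<phi> x * \<psi> x) = (\<lambda>x. \<phi> x * partial1 \<psi> x + partial1 \<phi> x * \<psi> x)"
    "partial2 (\<lambda>x. \<phi> x * \<psi> x) = (\<lambda>x. \<phi> x * partial2 \<psi> x + partial2 \<phi> x * \<psi> x)"
  using partial_eqI[OF has_derivative_mult[OF has_derivative_partials[OF assms(1)] has_derivative_partials[OF assms(2)]]]
  by auto

lemma has_derivative_comp2:
  assumes "\<And>x. \<phi> differentiable (at x)" "\<And>x. h differentiable (at x)" "\<And>x. k differentiable (at x)"
  shows "((\<lambda>x. \<phi> (h x, k x)) has_derivative (\<lambda>y.
     (fst y * partial1 h x + snd y * partial2 h x) * partial1 \<phi> (h x, k x)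
   + (fst y * partial1 k x + snd y * partial2 k x) * partial2 \<phi> (h x, k x))) (at x)"
  using has_derivative_compose[OF has_derivative_Pair[OF has_derivative_partials[OF assms(2)]
        has_derivative_partials[OF assms(3)]] has_derivative_partials[OF assms(1)], of x]
  by simp

lemma partial_comp2:
  assumes "\<And>x. \<phi> differentiable (at x)" "\<And>x. h differentiable (at x)" "\<And>x. k differentiable (at x)"
  shows "partial1 (\<lambda>x. \<phi> (h x, k x)) =
      (\<lambda>x. partial1 \<phi> (h x, k x) * partial1 h x + partial2 \<phi> (h x, k x) * partial1 k x)"
    "partial2 (\<lambda>x. \<phi> (h x, k x)) =
      (\<lambda>x. partial1 \<phi> (h x, k x) * partial2 h x + partial2 \<phi> (h x, k x) * partial2 k x)"
  using partial_eqI[OF has_derivative_comp2[OF assms]] by (auto simp: mult.commute)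

text \<open>Coinduction up to closure: to prove that a family of functions is smooth it suffices that the partial
derivatives of its members are built from the family by sums, products and composition.\<close>

inductive gen :: "(real \<times> real \<Rightarrow> real) set \<Rightarrow> (real \<times> real \<Rightarrow> real) \<Rightarrow> bool" for B where
  base: "\<phi> \<in> B \<Longrightarrow> gen B \<phi>"
| smooth: "smooth \<phi> \<Longrightarrow> gen B \<phi>"
| const: "gen B (\<lambda>_. c)"
| fst: "gen B fst"
| snd: "gen B snd"
| add: "gen B \<phi> \<Longrightarrow> gen B \<psi> \<Longrightarrow> gen B (\<lambda>x. \<phi> x + \<psi> x)"
| mult: "gen B \<phi> \<Longrightarrow> gen B \<psi> \<Longrightarrow> gen B (\<lambda>x. \<phi> x * \<psi> x)"
| comp: "gen B \<phi> \<Longrightarrow> gen B h \<Longrightarrow> gen B k \<Longrightarrow> gen B (\<lambda>x. \<phi> (h x, k x))"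

text \<open>The sum, product and chain rules express the partials of a compound in terms of its constituents and their
partials, so the property passes from the generators to everything generated.\<close>

lemma gen_partials:
  assumes B: "\<And>\<phi>. \<phi> \<in> B \<Longrightarrow> (\<forall>x. \<phi> differentiable (at x)) \<and> gen B (partial1 \<phi>) \<and> gen B (partial2 \<phi>)"
  assumes "gen B \<phi>"
  shows "(\<forall>x. \<phi> differentiable (at x)) \<and> gen B (partial1 \<phi>) \<and> gen B (partial2 \<phi>)"
  using assms(2)
proof induction
  case (base \<phi>) then show ?case using B by blast
next
  case (smooth \<phi>) then show ?case
    using smooth_differentiable smooth_partial1 smooth_partial2 gen.smooth by blast
next
  case (const c) show ?case unfolding partial_const by (auto intro: gen.const)
next
  case fst show ?case unfolding partial_fst
    by (auto intro: gen.const simp: differentiable_def intro!: exI has_derivative_fst[OF has_derivative_ident])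
next
  case snd show ?case unfolding partial_snd
    by (auto intro: gen.const simp: differentiable_def intro!: exI has_derivative_snd[OF has_derivative_ident])
next
  case (add \<phi> \<psi>)
  then have d: "\<And>x. \<phi> differentiable (at x)" "\<And>x. \<psi> differentiable (at x)" by auto
  show ?case unfolding partial_add[OF d] using add d by (auto intro: gen.add)
next
  case (mult \<phi> \<psi>)
  then have d: "\<And>x. \<phi> differentiable (at x)" "\<And>x. \<psi> differentiable (at x)" by auto
  show ?case unfolding partial_mult[OF d] using mult d by (auto intro!: gen.add gen.mult)
next
  case (comp \<phi> h k)
  then have d: "\<And>x. \<phi> differentiable (at x)" "\<And>x. h differentiable (at x)"
    "\<And>x. k differentiable (at x)" by auto
  show ?case unfolding partial_comp2[OF d]
    using comp has_derivative_comp2[OF d]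
    by (auto intro!: gen.add gen.mult gen.comp simp: differentiable_def)
qed

lemma smooth_genI:
  assumes B: "\<And>\<phi>. \<phi> \<in> B \<Longrightarrow> (\<forall>x. \<phi> differentiable (at x)) \<and> gen B (partial1 \<phi>) \<and> gen B (partial2 \<phi>)"
  assumes "gen B \<phi>"
  shows "smooth \<phi>"
  using assms(2)
proof (coinduction arbitrary: \<phi>)
  case smooth
  then show ?case using gen_partials[OF B] by blast
qed

lemma smooth_gen_empty: "gen {} \<phi> \<Longrightarrow> smooth \<phi>"
  by (rule smooth_genI[of "{}"]) auto

lemma smooth_const: "smooth (\<lambda>_. c)"
  and smooth_fst: "smooth fst"
  and smooth_snd: "smooth snd"
  and smooth_add: "smooth \<phi> \<Longrightarrow> smooth \<psi> \<Longrightarrow> smooth (\<lambda>x. \<phi> x + \<psi> x)"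
  and smooth_mult: "smooth \<phi> \<Longrightarrow> smooth \<psi> \<Longrightarrow> smooth (\<lambda>x. \<phi> x * \<psi> x)"
  and smooth_comp: "smooth \<phi> \<Longrightarrow> smooth h \<Longrightarrow> smooth k \<Longrightarrow> smooth (\<lambda>x. \<phi> (h x, k x))"
  by (auto intro!: smooth_gen_empty gen.const gen.fst gen.snd
      intro: gen.add gen.mult gen.comp gen.smooth)

lemma smooth_scale: "smooth \<phi> \<Longrightarrow> smooth (\<lambda>x. c * \<phi> x)"
  by (intro smooth_mult smooth_const)

lemma smooth_diff: "smooth \<phi> \<Longrightarrow> smooth \<psi> \<Longrightarrow> smooth (\<lambda>x. \<phi> x - \<psi> x)"
  using smooth_add[of \<phi> "\<lambda>x. (-1) * \<psi> x"] smooth_scale[of \<psi> "-1"] by simp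

lemma smooth_continuous: "smooth \<phi> \<Longrightarrow> continuous_on S \<phi>"
  using smooth_differentiable
  by (meson continuous_at_imp_continuous_on differentiable_imp_continuous_within)

lemma smooth_borel: "smooth \<phi> \<Longrightarrow> \<phi> \<in> borel_measurable borel"
  using smooth_continuous borel_measurable_continuous_onI by blast

lemma smooth_gradient_borel: "smooth \<phi> \<Longrightarrow> gradient \<phi> \<in> borel_measurable borel"
proof -
  assume s: "smooth \<phi>"
  have "(\<lambda>x. (partial1 \<phi> x, partial2 \<phi> x)) \<in> borel_measurable borel"
    using s by (intro borel_measurable_Pair smooth_borel smooth_partial1 smooth_partial2)
  then show ?thesis by (simp add: gradient_def[abs_def])
qed

lemma gradient_add: "smooth \<phi> \<Longrightarrow> smooth \<psi> \<Longrightarrow> gradient (\<lambda>x. \<phi> x + \<psi> x) x = gradient \<phi> x + gradient \<psi> x"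
  by (simp add: gradient_def partial_add smooth_differentiable)

lemma partial_scale:
  "smooth \<phi> \<Longrightarrow> partial1 (\<lambda>x. c * \<phi> x) = (\<lambda>x. c * partial1 \<phi> x)"
  "smooth \<phi> \<Longrightarrow> partial2 (\<lambda>x. c * \<phi> x) = (\<lambda>x. c * partial2 \<phi> x)"
  by (simp_all add: partial_mult partial_const smooth_differentiable smooth_const)

lemma gradient_scale: "smooth \<phi> \<Longrightarrow> gradient (\<lambda>x. c * \<phi> x) x = c *\<^sub>R gradient \<phi> x"
  by (simp add: gradient_def partial_scale)

section \<open>Smooth functions of one variable\<close>

text \<open>Smoothness in one variable is encoded through the plane, so that a single notion of smoothness (and
its closure properties) serves for both.\<close>

abbreviation smooth1 :: "(real \<Rightarrow> real) \<Rightarrow> bool" where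
  "smooth1 h \<equiv> smooth (\<lambda>x. h (fst x))"

lemma partial_of_fst:
  assumes "\<And>t. (h has_real_derivative h' t) (at t)"
  shows "partial1 (\<lambda>x. h (fst x)) = (\<lambda>x. h' (fst x))" "partial2 (\<lambda>x. h (fst x)) = (\<lambda>x. 0)"
    "(\<lambda>x::real\<times>real. h (fst x)) differentiable (at x)"
proof -
  have *: "((\<lambda>x::real\<times>real. h (fst x)) has_derivative (\<lambda>y. h' (fst x) * fst y)) (at x)" for x
    using has_derivative_compose[OF has_derivative_fst[OF has_derivative_ident] assms[unfolded has_field_derivative_def]]
    by (simp add: mult.commute)
  show "partial1 (\<lambda>x. h (fst x)) = (\<lambda>x. h' (fst x))" "partial2 (\<lambda>x. h (fst x)) = (\<lambda>x. 0)"
    using partial_eqI[OF *] by auto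
  show "(\<lambda>x::real\<times>real. h (fst x)) differentiable (at x)"
    using * differentiable_def by blast
qed

lemma smooth1_has_derivative:
  assumes "smooth1 h"
  shows "(h has_real_derivative partial1 (\<lambda>x. h (fst x)) (t, c)) (at t)"
proof -
  have "((\<lambda>x. (x, c)) has_derivative (\<lambda>y. (y, 0))) (at t)"
    by (auto intro!: derivative_eq_intros)
  then have "((\<lambda>x. h (fst (x, c))) has_derivative (\<lambda>y. fst (y, 0::real) * partial1 (\<lambda>x. h (fst x)) (t, c)
     + snd (y, 0::real) * partial2 (\<lambda>x. h (fst x)) (t, c))) (at t)"
    using has_derivative_compose has_derivative_partials[OF smooth_differentiable[OF assms]] by blast
  then show ?thesis by (simp add: has_field_derivative_def mult.commute[of _ "partial1 _ _"])
qed

lemma smooth1_deriv: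
  assumes "smooth1 h" "\<And>t. (h has_real_derivative h' t) (at t)"
  shows "smooth1 h'"
  using smooth_partial1[OF assms(1)] partial_of_fst(1)[OF assms(2)] by simp

lemma smooth1_genI:
  fixes F F' :: "'i \<Rightarrow> real \<Rightarrow> real"
  assumes "\<And>i t. (F i has_real_derivative F' i t) (at t)"
    and "\<And>i. gen (range (\<lambda>i x. F i (fst x))) (\<lambda>x. F' i (fst x))"
  shows "smooth1 (F i)"
  by (rule smooth_genI[of "range (\<lambda>i x. F i (fst x))"])
     (auto simp: partial_of_fst[OF assms(1)] intro: assms(2) gen.const gen.base)

lemma smooth1_comp: "smooth1 h \<Longrightarrow> smooth \<phi> \<Longrightarrow> smooth (\<lambda>x. h (\<phi> x))"
  using smooth_comp[of "\<lambda>x. h (fst x)" \<phi> \<phi>] by simp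

text \<open>The derivative of \<open>c * sin (a t + b)\<close> is \<open>(c a) * sin (a t + b + \<pi>/2)\<close>, which is again a member of the
family indexed by \<open>c\<close> and \<open>b\<close>.\<close>

lemma smooth1_sin: "smooth1 (\<lambda>t. sin (a * t + b))"
proof -
  define F where "F = (\<lambda>i t. fst i * sin (a * t + (snd i :: real)))"
  define F' where "F' = (\<lambda>i t. fst i * a * sin (a * t + (snd i + pi / 2)))"
  have "smooth1 (F i)" for i
  proof (rule smooth1_genI)
    show "(F i has_real_derivative F' i t) (at t)" for i t
      unfolding F_def F'_def
      by (rule derivative_eq_intros refl | simp add: sin_add cos_add algebra_simps)+
    show "gen (range (\<lambda>i x. F i (fst x))) (\<lambda>x. F' i (fst x))" for i
      by (intro gen.base image_eqI[of _ _ "(fst i * a, snd i + pi / 2)"]) (auto simp: F_def F'_def)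
  qed
  from this[of "(1, b)"] show ?thesis by (simp add: F_def)
qed

section \<open>Bumps and test functions\<close>

text \<open>The family \<open>t\<^sup>-\<^sup>k * exp (- 1 / t)\<close>, extended by zero, is closed under differentiation up to linear combinations;
its member \<open>k = 0\<close> is the standard smooth function that vanishes exactly on the negative half-line.\<close>

definition flat :: "nat \<Rightarrow> real \<Rightarrow> real" where
  "flat k t = (if 0 < t then (1 / t) ^ k * exp (- (1 / t)) else 0)"

text \<open>The substitution \<open>x = 1 / t\<close> reduces the limit from the right to the decay of \<open>x\<^sup>k / exp x\<close>.\<close>

lemma flat_tendsto_0: "(flat k \<longlongrightarrow> 0) (at 0)"
proof -
  have "((\<lambda>t::real. (inverse t) ^ k / exp (inverse t)) \<longlongrightarrow> 0) (at_right 0)"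
    by (rule filterlim_compose[OF tendsto_power_div_exp_0 filterlim_inverse_at_top_right])
  then have R: "(flat k \<longlongrightarrow> 0) (at_right 0)"
    by (rule Lim_transform_eventually)
       (auto simp: eventually_at_filter flat_def exp_minus field_simps)
  have L: "(flat k \<longlongrightarrow> 0) (at_left 0)"
    by (rule Lim_transform_eventually[OF tendsto_const]) (auto simp: eventually_at_filter flat_def)
  show ?thesis using L R filterlim_at_split by blast
qed

lemma flat_has_derivative:
  "(flat k has_real_derivative flat (k + 2) t - real k * flat (k + 1) t) (at t)"
proof -
  consider "t > 0" | "t < 0" | "t = 0" by linarith
  then show ?thesis
  proof cases
    case 1
    have "((\<lambda>t. (1 / t) ^ k * exp (- (1 / t))) has_real_derivative
        (1 / t) ^ (k + 2) * exp (- (1 / t)) - real k * ((1 / t) ^ (k + 1) * exp (- (1 / t)))) (at t)"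
    proof -
      have inv: "((\<lambda>t. 1 / t) has_real_derivative - ((1 / t) ^ 2)) (at t)"
        using 1 by (auto intro!: derivative_eq_intros simp: power2_eq_square)
      have pow: "((\<lambda>t. (1 / t) ^ k) has_real_derivative - real k * (1 / t) ^ (k + 1)) (at t)"
      proof (rule DERIV_cong[OF DERIV_power[OF inv]])
        define s where "s = 1 / t"
        show "real k * (- ((1 / t) ^ 2) * (1 / t) ^ (k - Suc 0)) = - real k * (1 / t) ^ (k + 1)"
          unfolding s_def[symmetric] by (cases k) (simp_all add: power2_eq_square algebra_simps)
      qed
      have ex: "((\<lambda>t. exp (- (1 / t))) has_real_derivative (1 / t) ^ 2 * exp (- (1 / t))) (at t)"
        by (rule DERIV_cong[OF DERIV_fun_exp[OF DERIV_minus[OF inv]]]) (simp add: power2_eq_square)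
      show ?thesis
        by (rule DERIV_cong[OF DERIV_mult[OF pow ex]]) (simp add: algebra_simps power_add power2_eq_square)
    qed
    then have "(flat k has_real_derivative
        (1 / t) ^ (k + 2) * exp (- (1 / t)) - real k * ((1 / t) ^ (k + 1) * exp (- (1 / t)))) (at t)"
      by (rule has_field_derivative_transform_within_open[of _ _ _ "{0<..}"]) (use 1 in \<open>auto simp: flat_def\<close>)
    then show ?thesis using 1 by (simp add: flat_def)
  next
    case 2
    have "(flat k has_real_derivative 0) (at t)"
      by (rule has_field_derivative_transform_within_open[of "\<lambda>_. 0" _ _ "{..<0}"]) (use 2 in \<open>auto simp: flat_def\<close>)
    then show ?thesis using 2 by (simp add: flat_def)
  next
    case 3
    have "((\<lambda>h. (flat k (0 + h) - flat k 0) / h) \<longlongrightarrow> 0) (at 0)"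
      by (rule Lim_transform_eventually[OF flat_tendsto_0[of "k+1"]])
         (auto simp: eventually_at_filter flat_def)
    then show ?thesis using 3 by (simp add: DERIV_def flat_def)
  qed
qed

lemma smooth1_flat: "smooth1 (flat k)"
proof (rule smooth1_genI)
  show "(flat k has_real_derivative flat (k + 2) t - real k * flat (k + 1) t) (at t)" for k t
    by (rule flat_has_derivative)
  let ?B = "range (\<lambda>i (x::real \<times> real). flat i (fst x))"
  show "gen ?B (\<lambda>x. flat (k + 2) (fst x) - real k * flat (k + 1) (fst x))" for k
  proof -
    have "gen ?B (\<lambda>x. flat (k + 2) (fst x) + (- real k) * flat (k + 1) (fst x))"
      by (intro gen.add gen.mult gen.const gen.base) auto
    then show ?thesis by simp
  qed
qed

abbreviation ramp :: "real \<Rightarrow> real" where "ramp \<equiv> flat 0"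

lemma ramp_bounds: "0 \<le> ramp t" "ramp t \<le> 1" "ramp t = 0 \<longleftrightarrow> t \<le> 0"
  by (auto simp: flat_def)

lemma ramp_limit:
  "(\<lambda>m. ramp (real m * t - c)) \<longlonglongrightarrow> (if t > 0 then 1 else 0)" if "c \<ge> 0"
proof (cases "t > 0")
  case True
  have f: "filterlim (\<lambda>m. real m * t - c) at_top sequentially"
  proof -
    have "filterlim (\<lambda>m. t * real m) at_top sequentially"
      by (rule filterlim_tendsto_pos_mult_at_top[OF tendsto_const True filterlim_real_sequentially])
    from filterlim_tendsto_add_at_top[OF tendsto_const this, of "- c"]
    show ?thesis by (simp add: mult.commute)
  qed
  have "((\<lambda>x::real. exp (- (1 / x))) \<longlongrightarrow> 1) at_top"
    using tendsto_exp[OF tendsto_minus[OF tendsto_inverse_0_at_top[OF filterlim_ident[of at_top]]]]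
    by (simp add: inverse_eq_divide)
  then have "(ramp \<longlongrightarrow> 1) at_top"
    by (rule Lim_transform_eventually) (rule eventually_mono[OF eventually_gt_at_top[of 0]], simp add: flat_def)
  from filterlim_compose[OF this f] show ?thesis using True by simp
next
  case False
  then have "real m * t - c \<le> 0" for m using that
    by (smt (verit) mult_nonneg_nonpos of_nat_0_le_iff)
  then have "ramp (real m * t - c) = 0" for m by (simp add: ramp_bounds(3))
  then show ?thesis using False by simp
qed

lemma smooth1_derivE:
  assumes "smooth1 h"
  shows "\<exists>h'. \<forall>t. (h has_real_derivative h' t) (at t)"
  by (intro exI allI) (rule smooth1_has_derivative[OF assms, of _ 0])

lemma partial_of_snd:
  assumes "\<And>t. (h has_real_derivative h' t) (at t)"
  shows "partial1 (\<lambda>x. h (snd x)) = (\<lambda>x. 0)" "partial2 (\<lambda>x. h (snd x)) = (\<lambda>x. h' (snd x))"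
proof -
  have *: "((\<lambda>x::real\<times>real. h (snd x)) has_derivative (\<lambda>y. h' (snd x) * snd y)) (at x)" for x
    using has_derivative_compose[OF has_derivative_snd[OF has_derivative_ident] assms[unfolded has_field_derivative_def]]
    by (simp add: mult.commute)
  show "partial1 (\<lambda>x. h (snd x)) = (\<lambda>x. 0)" "partial2 (\<lambda>x. h (snd x)) = (\<lambda>x. h' (snd x))"
    using partial_eqI[OF *] by auto
qed

text \<open>Symmetry of the second derivatives is made part of the class. This loses nothing: the class contains sums of products
of one-variable functions, and these are already dense.\<close>

definition mixed_test :: "(real \<times> real) set \<Rightarrow> (real \<times> real \<Rightarrow> real) \<Rightarrow> bool" where
  "mixed_test U \<phi> \<longleftrightarrow> test_function U \<phi> \<and> partial1 (partial2 \<phi>) = partial2 (partial1 \<phi>)"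

lemma test_functionI:
  assumes "smooth \<phi>" "compact K" "K \<subseteq> U" "\<And>x. x \<notin> K \<Longrightarrow> \<phi> x = 0"
  shows "test_function U \<phi>"
proof -
  have "closure {x. \<phi> x \<noteq> 0} \<subseteq> K"
    using assms by (intro closure_minimal) (auto intro: compact_imp_closed)
  moreover then have "compact (closure {x. \<phi> x \<noteq> 0})"
    using assms(2) by (metis closed_Int_compact closed_closure inf.absorb_iff1)
  ultimately show ?thesis using assms by (auto simp: test_function_def)
qed

lemma test_functionD:
  assumes "test_function U \<phi>"
  shows "\<exists>K. smooth \<phi> \<and> compact K \<and> K \<subseteq> U \<and> (\<forall>x. x \<notin> K \<longrightarrow> \<phi> x = 0)"
  using assms closure_subset[of "{x. \<phi> x \<noteq> 0}"] unfolding test_function_def by blast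

lemma test_function_smooth: "test_function U \<phi> \<Longrightarrow> smooth \<phi>"
  by (simp add: test_function_def)

lemma test_function_mono: "test_function U \<phi> \<Longrightarrow> U \<subseteq> V \<Longrightarrow> test_function V \<phi>"
  by (auto simp: test_function_def)

lemma test_function_outside: "test_function U \<phi> \<Longrightarrow> x \<notin> U \<Longrightarrow> \<phi> x = 0"
  using test_functionD by blast

lemma test_function_add:
  assumes "test_function U \<phi>" "test_function U \<psi>" shows "test_function U (\<lambda>x. \<phi> x + \<psi> x)"
proof -
  obtain K where K: "smooth \<phi>" "compact K" "K \<subseteq> U" "\<And>x. x \<notin> K \<Longrightarrow> \<phi> x = 0"
    using test_functionD[OF assms(1)] by blast
  obtain K' where K': "smooth \<psi>" "compact K'" "K' \<subseteq> U" "\<And>x. x \<notin> K' \<Longrightarrow> \<psi> x = 0"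
    using test_functionD[OF assms(2)] by blast
  show ?thesis
    by (rule test_functionI[of _ "K \<union> K'"]) (use K K' in \<open>auto intro: smooth_add\<close>)
qed

lemma test_function_mult:
  assumes "test_function U \<phi>" "smooth \<psi>" shows "test_function U (\<lambda>x. \<psi> x * \<phi> x)"
proof -
  obtain K where K: "smooth \<phi>" "compact K" "K \<subseteq> U" "\<And>x. x \<notin> K \<Longrightarrow> \<phi> x = 0"
    using test_functionD[OF assms(1)] by blast
  show ?thesis
    by (rule test_functionI[of _ K]) (use K assms in \<open>auto intro: smooth_mult\<close>)
qed

lemma test_function_partial:
  assumes "test_function U \<phi>"
  shows "test_function U (partial1 \<phi>)" "test_function U (partial2 \<phi>)"
proof -
  obtain K where K: "smooth \<phi>" "compact K" "K \<subseteq> U" "\<And>x. x \<notin> K \<Longrightarrow> \<phi> x = 0"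
    using test_functionD[OF assms] by blast
  have "(\<phi> has_derivative (\<lambda>_. 0)) (at x)" if "x \<notin> K" for x
  proof -
    have "open (- K)" using K(2) by (simp add: compact_imp_closed open_Compl)
    show ?thesis
      by (rule has_derivative_transform_within_open[OF has_derivative_const \<open>open (- K)\<close>]) (use K that in auto)
  qed
  from partial_eqI[OF this] have "x \<notin> K \<Longrightarrow> partial1 \<phi> x = 0" "x \<notin> K \<Longrightarrow> partial2 \<phi> x = 0" for x by auto
  then show "test_function U (partial1 \<phi>)" "test_function U (partial2 \<phi>)"
    using K by (auto intro!: test_functionI[of _ K] smooth_partial1 smooth_partial2)
qed

lemma test_function_bounded:
  assumes "test_function U \<phi>" obtains B where "B \<ge> 0" "\<And>x. \<bar>\<phi> x\<bar> \<le> B"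
proof -
  obtain K where K: "smooth \<phi>" "compact K" "K \<subseteq> U" "\<And>x. x \<notin> K \<Longrightarrow> \<phi> x = 0"
    using test_functionD[OF assms] by blast
  have "compact (\<phi> ` K)" using K by (intro compact_continuous_image smooth_continuous) auto
  then obtain B where "\<And>x. x \<in> K \<Longrightarrow> \<bar>\<phi> x\<bar> \<le> B"
    using compact_imp_bounded bounded_real by (metis imageI)
  then have "\<bar>\<phi> x\<bar> \<le> max B 0" for x using K(4)[of x] by (cases "x \<in> K") (auto simp: max.coboundedI1)
  then show ?thesis using that[of "max B 0"] by auto
qed

lemma mixed_test_zero: "mixed_test U (\<lambda>_. 0)"
  unfolding mixed_test_def
  by (auto intro!: test_functionI[of _ "{}"] smooth_const simp: partial_const)

lemma mixed_test_add:
  assumes "mixed_test U \<phi>" "mixed_test U \<psi>" shows "mixed_test U (\<lambda>x. \<phi> x + \<psi> x)"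
proof -
  have s: "smooth \<phi>" "smooth \<psi>" using assms by (auto simp: mixed_test_def test_function_smooth)
  then show ?thesis using assms unfolding mixed_test_def
    by (simp add: test_function_add partial_add smooth_differentiable smooth_partial1 smooth_partial2)
qed

lemma partial_mult_fst:
  assumes "smooth \<phi>" "\<And>t. (D has_real_derivative D' t) (at t)"
  shows "partial1 (\<lambda>x. D (fst x) * \<phi> x) = (\<lambda>x. D (fst x) * partial1 \<phi> x + D' (fst x) * \<phi> x)"
    "partial2 (\<lambda>x. D (fst x) * \<phi> x) = (\<lambda>x. D (fst x) * partial2 \<phi> x)"
  using partial_mult[OF partial_of_fst(3)[OF assms(2)] smooth_differentiable[OF assms(1)]]
  by (simp_all add: partial_of_fst(1,2)[OF assms(2)])

text \<open>Needed for \<open>D(x\<^sub>1) * \<phi>\<close> with \<open>D\<close> the oscillating corrector, which is then inserted in the curl identity.\<close>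

lemma mixed_test_mult_fst:
  assumes "mixed_test U \<phi>" "smooth1 D"
  shows "mixed_test U (\<lambda>x. D (fst x) * \<phi> x)"
proof -
  have s: "smooth \<phi>" "test_function U \<phi>" and mix: "partial1 (partial2 \<phi>) = partial2 (partial1 \<phi>)"
    using assms by (auto simp: mixed_test_def test_function_smooth)
  obtain D' where D': "\<And>t. (D has_real_derivative D' t) (at t)"
    using smooth1_derivE[OF assms(2)] by blast
  have sD': "smooth1 D'" using smooth1_deriv[OF assms(2) D'] .
  obtain D'' where D'': "\<And>t. (D' has_real_derivative D'' t) (at t)"
    using smooth1_derivE[OF sD'] by blast
  note p = partial_mult_fst[OF _ D'] partial_mult_fst(2)[OF _ D'']
  have "partial2 (partial1 (\<lambda>x. D (fst x) * \<phi> x)) =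
      (\<lambda>x. partial2 (\<lambda>x. D (fst x) * partial1 \<phi> x) x + partial2 (\<lambda>x. D' (fst x) * \<phi> x) x)"
    unfolding p(1)[OF s(1)]
    using assms(2) s(1) sD' by (intro partial_add smooth_differentiable smooth_mult smooth_partial1)
  then have "partial1 (partial2 (\<lambda>x. D (fst x) * \<phi> x)) = partial2 (partial1 (\<lambda>x. D (fst x) * \<phi> x))"
    by (simp add: p s smooth_partial1 smooth_partial2 mix)
  then show ?thesis
    using test_function_mult[OF s(2) assms(2)] by (simp add: mixed_test_def)
qed

lemma mixed_test_scale: "mixed_test U \<phi> \<Longrightarrow> mixed_test U (\<lambda>x. c * \<phi> x)"
  using mixed_test_mult_fst[of U \<phi> "\<lambda>_. c"] smooth_const by auto

lemma mixed_test_product: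
  assumes "smooth1 h" "smooth1 k" "test_function U (\<lambda>x. h (fst x) * k (snd x))"
  shows "mixed_test U (\<lambda>x. h (fst x) * k (snd x))"
proof -
  obtain h' where h': "\<And>t. (h has_real_derivative h' t) (at t)"
    using smooth1_derivE[OF assms(1)] by blast
  obtain k' where k': "\<And>t. (k has_real_derivative k' t) (at t)"
    using smooth1_derivE[OF assms(2)] by blast
  have sh: "smooth1 h'" and sk: "smooth (\<lambda>x. k' (snd x))" "smooth (\<lambda>x. k (snd x))"
    using smooth1_deriv[OF assms(1) h'] smooth1_comp[OF smooth1_deriv[OF assms(2) k'] smooth_snd]
      smooth1_comp[OF assms(2) smooth_snd] by auto
  obtain h'' where h'': "\<And>t. (h' has_real_derivative h'' t) (at t)"
    using smooth1_derivE[OF sh] by blast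
  have "partial1 (partial2 (\<lambda>x. h (fst x) * k (snd x))) = partial2 (partial1 (\<lambda>x. h (fst x) * k (snd x)))"
    unfolding partial_mult_fst[OF sk(2) h'] partial_of_snd[OF k']
    by (simp add: partial_mult_fst[OF sk(1) h'] partial_mult_fst[OF sk(2) h''] partial_of_snd[OF k'])
      (simp add: partial_of_snd[where h=k', OF smooth1_has_derivative[OF smooth1_deriv[OF assms(2) k'], of _ 0]])
  then show ?thesis using assms(3) by (simp add: mixed_test_def)
qed

definition bump :: "real \<Rightarrow> real \<Rightarrow> nat \<Rightarrow> real \<Rightarrow> real" where
  "bump a b m t = ramp (real m * (t - a) - 1) * ramp (real m * (b - t) - 1)"

lemma smooth1_bump: "smooth1 (bump a b m)"
proof -
  have "smooth (\<lambda>x::real\<times>real. ramp (real m * (fst x - a) - 1))" "smooth (\<lambda>x::real\<times>real. ramp (real m * (b - fst x) - 1))"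
    by (intro smooth1_comp[OF smooth1_flat] smooth_diff smooth_mult smooth_const smooth_fst)+
  then show ?thesis by (auto simp: bump_def[abs_def] intro: smooth_mult)
qed

lemma bump_bounds: "0 \<le> bump a b m t" "bump a b m t \<le> 1"
  by (auto simp: bump_def ramp_bounds mult_le_one)

text \<open>The bumps converge to the indicator of the open interval; the shift by \<open>1\<close> in their definition keeps their
supports compactly inside it.\<close>

lemma bump_limit: "(\<lambda>m. bump a b m t) \<longlonglongrightarrow> indicator {a<..<b} t"
proof -
  have "(\<lambda>m. bump a b m t) \<longlonglongrightarrow> (if t - a > 0 then 1 else 0) * (if b - t > 0 then 1 else 0)"
    unfolding bump_def by (intro tendsto_mult ramp_limit) auto
  also have "(if t - a > 0 then 1 else 0) * (if b - t > 0 then 1 else 0) = (indicator {a<..<b} t :: real)"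
    by (auto simp: indicator_def)
  finally show ?thesis .
qed

lemma bump_support: "bump a b m t \<noteq> 0 \<Longrightarrow> m > 0 \<and> a + 1 / real m \<le> t \<and> t \<le> b - 1 / real m"
proof -
  assume "bump a b m t \<noteq> 0"
  then have *: "1 < real m * (t - a)" "1 < real m * (b - t)"
    by (auto simp: bump_def ramp_bounds)
  then have "m > 0" by (cases m) auto
  moreover have "1 / real m < t - a" "1 / real m < b - t"
    using * \<open>m > 0\<close> by (simp_all add: pos_divide_less_eq mult.commute)
  ultimately show ?thesis by linarith
qed

lemma mixed_test_bump:
  "mixed_test ({a<..<b} \<times> {c<..<d}) (\<lambda>x. bump a b m (fst x) * bump c d m (snd x))"
proof (rule mixed_test_product[OF smooth1_bump smooth1_bump])
  let ?K = "{a + 1 / real m..b - 1 / real m} \<times> {c + 1 / real m..d - 1 / real m}"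
  show "test_function ({a<..<b} \<times> {c<..<d}) (\<lambda>x. bump a b m (fst x) * bump c d m (snd x))"
  proof (cases "m = 0")
    case True then show ?thesis
      using mixed_test_zero by (auto simp: bump_def ramp_bounds mixed_test_def flat_def)
  next
    case False
    show ?thesis
    proof (rule test_functionI[of _ ?K])
      show "smooth (\<lambda>x. bump a b m (fst x) * bump c d m (snd x))"
        by (intro smooth_mult smooth1_bump smooth1_comp[OF smooth1_bump] smooth_snd)
      define p where "p = 1 / real m"
      have p: "p > 0" using False by (simp add: p_def)
      show "?K \<subseteq> {a<..<b} \<times> {c<..<d}" unfolding p_def[symmetric] using p by auto
      show "bump a b m (fst x) * bump c d m (snd x) = 0" if "x \<notin> ?K" for x
      proof (rule ccontr)
        assume "bump a b m (fst x) * bump c d m (snd x) \<noteq> 0"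
        then have "x \<in> ?K" using bump_support[of a b m "fst x"] bump_support[of c d m "snd x"]
          by (simp add: mem_Times_iff)
        with that show False by simp
      qed
    qed (auto intro: compact_Times)
  qed
qed

section \<open>Square integrable functions\<close>

text \<open>Square integrability and the \<open>L\<^sup>2\<close> seminorm of concrete functions on an arbitrary measure space; working
with seminorms of functions, not with classes modulo null sets, keeps all pointwise algebra elementary.\<close>

definition sqi :: "'a measure \<Rightarrow> ('a \<Rightarrow> real) \<Rightarrow> bool" where
  "sqi M f \<longleftrightarrow> f \<in> borel_measurable M \<and> integrable M (\<lambda>x. (f x)\<^sup>2)"

definition l2 :: "'a measure \<Rightarrow> ('a \<Rightarrow> real) \<Rightarrow> real" where
  "l2 M f = sqrt (LINT x|M. (f x)\<^sup>2)"

lemma sqi_measurable: "sqi M f \<Longrightarrow> f \<in> borel_measurable M"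
  and sqi_integrable: "sqi M f \<Longrightarrow> integrable M (\<lambda>x. (f x)\<^sup>2)"
  by (auto simp: sqi_def)

lemma l2_nonneg: "0 \<le> l2 M f"
  by (simp add: l2_def)

lemma l2_square: "(l2 M f)\<^sup>2 = (LINT x|M. (f x)\<^sup>2)"
  by (simp add: l2_def)

lemma sqi_mono:
  assumes "f \<in> borel_measurable M" "sqi M g" "AE x in M. \<bar>f x\<bar> \<le> \<bar>g x\<bar>"
  shows "sqi M f" "l2 M f \<le> l2 M g"
proof -
  have *: "AE x in M. (f x)\<^sup>2 \<le> (g x)\<^sup>2" using assms(3) by eventually_elim (simp add: abs_le_square_iff)
  have i: "integrable M (\<lambda>x. (f x)\<^sup>2)"
    by (rule Bochner_Integration.integrable_bound[OF sqi_integrable[OF assms(2)]]) (use assms(1) * in auto)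
  then show "sqi M f" using assms(1) by (simp add: sqi_def)
  show "l2 M f \<le> l2 M g"
    unfolding l2_def by (intro real_sqrt_le_mono integral_mono_AE i sqi_integrable[OF assms(2)] *)
qed

lemma sqi_cong_AE:
  assumes "sqi M g" "f \<in> borel_measurable M" "AE x in M. f x = g x"
  shows "sqi M f" "l2 M f = l2 M g"
proof -
  have a: "AE x in M. \<bar>f x\<bar> \<le> \<bar>g x\<bar>" "AE x in M. \<bar>g x\<bar> \<le> \<bar>f x\<bar>"
    using assms(3) by (eventually_elim, simp)+
  show f: "sqi M f" by (rule sqi_mono(1)[OF assms(2,1) a(1)])
  show "l2 M f = l2 M g"
    using sqi_mono(2)[OF assms(2,1) a(1)] sqi_mono(2)[OF sqi_measurable[OF assms(1)] f a(2)] by simp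
qed

lemma sqi_scale: "sqi M f \<Longrightarrow> sqi M (\<lambda>x. c * f x)"
  and l2_scale: "l2 M (\<lambda>x. c * f x) = \<bar>c\<bar> * l2 M f"
  by (auto simp: sqi_def l2_def power_mult_distrib real_sqrt_mult)

lemma sqi_add:
  assumes "sqi M f" "sqi M g" shows "sqi M (\<lambda>x. f x + g x)"
proof -
  note [measurable] = assms[THEN sqi_measurable]
  have "integrable M (\<lambda>x. 2 * (f x)\<^sup>2 + 2 * (g x)\<^sup>2)"
    using assms by (auto simp: sqi_def)
  then have "integrable M (\<lambda>x. (f x + g x)\<^sup>2)"
  proof (rule Bochner_Integration.integrable_bound)
    have "(f x + g x)\<^sup>2 \<le> 2 * (f x)\<^sup>2 + 2 * (g x)\<^sup>2" for x
      using sum_squares_bound[of "f x" "g x"] by (simp add: power2_sum)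
    then show "AE x in M. norm ((f x + g x)\<^sup>2) \<le> norm (2 * (f x)\<^sup>2 + 2 * (g x)\<^sup>2)" by simp
  qed measurable
  then show ?thesis by (simp add: sqi_def)
qed

lemma sqi_diff: "sqi M f \<Longrightarrow> sqi M g \<Longrightarrow> sqi M (\<lambda>x. f x - g x)"
  using sqi_add[of M f "\<lambda>x. (-1) * g x"] sqi_scale[of M g "-1"] by simp

lemma sqi_mult_integrable:
  assumes "sqi M f" "sqi M g" shows "integrable M (\<lambda>x. f x * g x)"
proof -
  note [measurable] = assms[THEN sqi_measurable]
  have "integrable M (\<lambda>x. (f x)\<^sup>2 + (g x)\<^sup>2)"
    using assms by (auto simp: sqi_def)
  then show ?thesis
  proof (rule Bochner_Integration.integrable_bound)
    have "\<bar>f x * g x\<bar> \<le> (f x)\<^sup>2 + (g x)\<^sup>2" for x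
    proof -
      have "2 * \<bar>f x * g x\<bar> \<le> (f x)\<^sup>2 + (g x)\<^sup>2"
        using sum_squares_bound[of "\<bar>f x\<bar>" "\<bar>g x\<bar>"] by (simp add: abs_mult)
      then show ?thesis using abs_ge_zero[of "f x * g x"] by linarith
    qed
    then show "AE x in M. norm (f x * g x) \<le> norm ((f x)\<^sup>2 + (g x)\<^sup>2)" by simp
  qed measurable
qed

lemma sqi_bounded_mult:
  assumes "sqi M f" "h \<in> borel_measurable M" "AE x in M. \<bar>h x\<bar> \<le> c" "0 \<le> c"
  shows "sqi M (\<lambda>x. h x * f x)" "l2 M (\<lambda>x. h x * f x) \<le> c * l2 M f"
proof -
  note [measurable] = assms(1)[THEN sqi_measurable] assms(2)
  have *: "AE x in M. \<bar>h x * f x\<bar> \<le> \<bar>c * f x\<bar>" using assms(3)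
    by eventually_elim (use assms(4) in \<open>simp add: abs_mult mult_right_mono\<close>)
  note a = sqi_mono[OF _ sqi_scale[OF assms(1), of c] *]
  show "sqi M (\<lambda>x. h x * f x)" by (rule a(1)) measurable
  have "l2 M (\<lambda>x. h x * f x) \<le> l2 M (\<lambda>x. c * f x)" by (rule a(2)) measurable
  then show "l2 M (\<lambda>x. h x * f x) \<le> c * l2 M f" using assms(4) by (simp add: l2_scale)
qed

text \<open>Evaluate at the minimizing \<open>t = - B / C\<close>; for \<open>C = 0\<close> the expression is affine in \<open>t\<close>, so \<open>B = 0\<close>.\<close>

lemma quadratic_nonneg_discriminant:
  fixes A B C :: real
  assumes "\<And>t. 0 \<le> A + 2 * t * B + t\<^sup>2 * C" "0 \<le> C" shows "B\<^sup>2 \<le> A * C"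
proof (cases "C = 0")
  case True
  have "B = 0"
  proof (rule ccontr)
    assume "B \<noteq> 0"
    with assms(1)[of "- (A + 1) / (2 * B)"] True show False by (simp add: field_simps)
  qed
  with True show ?thesis by simp
next
  case False
  with assms(2) have "C > 0" by simp
  have "A + 2 * (- B / C) * B + (- B / C)\<^sup>2 * C = A - B\<^sup>2 / C"
    using \<open>C > 0\<close> by (simp add: power2_eq_square field_simps)
  with assms(1)[of "- B / C"] have "B\<^sup>2 / C \<le> A" by simp
  with \<open>C > 0\<close> show ?thesis by (simp add: pos_divide_le_eq)
qed

lemma integral_add_square:
  assumes "sqi M f" "sqi M g"
  shows "(LINT x|M. (f x + t * g x)\<^sup>2) =
    (LINT x|M. (f x)\<^sup>2) + 2 * t * (LINT x|M. f x * g x) + t\<^sup>2 * (LINT x|M. (g x)\<^sup>2)"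
proof -
  have "(LINT x|M. (f x + t * g x)\<^sup>2) = (LINT x|M. (f x)\<^sup>2 + (2 * t) * (f x * g x) + t\<^sup>2 * (g x)\<^sup>2)"
    by (rule Bochner_Integration.integral_cong) (auto simp: power2_sum power_mult_distrib)
  also have "\<dots> = (LINT x|M. (f x)\<^sup>2) + 2 * t * (LINT x|M. f x * g x) + t\<^sup>2 * (LINT x|M. (g x)\<^sup>2)"
    using assms[THEN sqi_integrable] sqi_mult_integrable[OF assms] by simp
  finally show ?thesis .
qed

lemma l2_Cauchy_Schwarz:
  assumes "sqi M f" "sqi M g"
  shows "\<bar>LINT x|M. f x * g x\<bar> \<le> l2 M f * l2 M g"
proof -
  have "(LINT x|M. f x * g x)\<^sup>2 \<le> (LINT x|M. (f x)\<^sup>2) * (LINT x|M. (g x)\<^sup>2)"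
    by (rule quadratic_nonneg_discriminant) (auto simp: integral_add_square[OF assms, symmetric])
  also have "\<dots> = (l2 M f * l2 M g)\<^sup>2" by (simp add: power_mult_distrib l2_square)
  finally have "\<bar>LINT x|M. f x * g x\<bar> \<le> \<bar>l2 M f * l2 M g\<bar>" by (simp only: abs_le_square_iff)
  then show ?thesis by (simp add: l2_nonneg)
qed

lemma l2_triangle:
  assumes "sqi M f" "sqi M g" shows "l2 M (\<lambda>x. f x + g x) \<le> l2 M f + l2 M g"
proof -
  have "(l2 M (\<lambda>x. f x + g x))\<^sup>2 \<le> (l2 M f + l2 M g)\<^sup>2"
    using integral_add_square[OF assms, of 1] abs_le_D1[OF l2_Cauchy_Schwarz[OF assms]]
    by (simp add: l2_square power2_sum)
  then show ?thesis by (rule power2_le_imp_le) (simp add: l2_nonneg)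
qed

lemma l2_minus_commute: "l2 M (\<lambda>x. f x - g x) = l2 M (\<lambda>x. g x - f x)"
  by (simp add: l2_def power2_commute)

lemma l2_triangle_diff:
  assumes "sqi M f" "sqi M g" "sqi M h"
  shows "l2 M (\<lambda>x. f x - h x) \<le> l2 M (\<lambda>x. f x - g x) + l2 M (\<lambda>x. g x - h x)"
  using l2_triangle[OF sqi_diff[OF assms(1,2)] sqi_diff[OF assms(2,3)]] by simp

text \<open>Dominated convergence for the squares, with the dominating function \<open>4 w\<^sup>2\<close>.\<close>

lemma l2_dominated:
  assumes "\<And>i. f i \<in> borel_measurable M" "g \<in> borel_measurable M" "sqi M w"
    and "AE x in M. (\<lambda>i. f i x) \<longlonglongrightarrow> g x" "\<And>i. AE x in M. \<bar>f i x\<bar> \<le> \<bar>w x\<bar>" "AE x in M. \<bar>g x\<bar> \<le> \<bar>w x\<bar>"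
  shows "(\<lambda>i. l2 M (\<lambda>x. f i x - g x)) \<longlonglongrightarrow> 0"
proof -
  note [measurable] = assms(1,2) sqi_measurable[OF assms(3)]
  have "(\<lambda>i. LINT x|M. (f i x - g x)\<^sup>2) \<longlonglongrightarrow> (LINT x|M. 0)"
  proof (rule integral_dominated_convergence)
    show "integrable M (\<lambda>x. 4 * (w x)\<^sup>2)" using sqi_integrable[OF assms(3)] by simp
    show "AE x in M. (\<lambda>i. (f i x - g x)\<^sup>2) \<longlonglongrightarrow> 0"
      using assms(4)
    proof eventually_elim
      case (elim x)
      have "(\<lambda>i. (f i x - g x)\<^sup>2) \<longlonglongrightarrow> (g x - g x)\<^sup>2" by (intro tendsto_intros elim)
      then show ?case by simp
    qed
    show "AE x in M. norm ((f i x - g x)\<^sup>2) \<le> 4 * (w x)\<^sup>2" for i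
      using assms(5)[of i] assms(6)
    proof eventually_elim
      case (elim x)
      then have "\<bar>f i x - g x\<bar> \<le> \<bar>2 * w x\<bar>" by linarith
      then have "(f i x - g x)\<^sup>2 \<le> (2 * w x)\<^sup>2" using abs_le_square_iff by blast
      then show ?case by simp
    qed
  qed measurable
  from tendsto_real_sqrt[OF this] show ?thesis by (simp add: l2_def)
qed

section \<open>Lebesgue measure on the rectangle\<close>

text \<open>This identifies integration on the cracked rectangle with integration on the rectangle, so that
energies at different crack lengths live on one measure space.\<close>

lemma lebesgue_on_null_diff:
  fixes f :: "'a::euclidean_space \<Rightarrow> 'b::euclidean_space"
  assumes "U \<subseteq> V" "V - U \<in> null_sets lebesgue" "V \<in> sets lebesgue"
  shows "f \<in> borel_measurable (lebesgue_on U) \<longleftrightarrow> f \<in> borel_measurable (lebesgue_on V)" (is ?A)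
    "integrable (lebesgue_on U) f \<longleftrightarrow> integrable (lebesgue_on V) f" (is ?B)
    "integral\<^sup>L (lebesgue_on U) f = integral\<^sup>L (lebesgue_on V) f" (is ?C)
    "L2 U f \<longleftrightarrow> L2 V f" (is ?D)
proof -
  have U: "U = V - (V - U)" using assms by auto
  have Us: "U \<in> sets lebesgue" using assms by (subst U) (auto intro: sets.Diff)
  have meas: "f \<in> borel_measurable (lebesgue_on U) \<longleftrightarrow> f \<in> borel_measurable (lebesgue_on V)"
    for f :: "'a \<Rightarrow> 'c::euclidean_space"
    by (subst U, rule borel_measurable_diff_null)
       (use assms in \<open>auto simp: null_sets_restrict_space\<close>)
  have ae: "AE x in lebesgue. indicator U x *\<^sub>R f x = indicator V x *\<^sub>R f x" for f :: "'a \<Rightarrow> 'c::euclidean_space"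
    using AE_not_in[OF assms(2)] by eventually_elim (use assms(1) in \<open>auto simp: indicator_def\<close>)
  have int: "integrable (lebesgue_on U) f \<longleftrightarrow> integrable (lebesgue_on V) f"
      and "integral\<^sup>L (lebesgue_on U) f = integral\<^sup>L (lebesgue_on V) f" for f :: "'a \<Rightarrow> 'c::euclidean_space"
  proof -
    consider (m) "f \<in> borel_measurable (lebesgue_on U)" "f \<in> borel_measurable (lebesgue_on V)"
      | (n) "f \<notin> borel_measurable (lebesgue_on U)" "f \<notin> borel_measurable (lebesgue_on V)"
      using meas by blast
    then have "(integrable (lebesgue_on U) f \<longleftrightarrow> integrable (lebesgue_on V) f) \<and>
        integral\<^sup>L (lebesgue_on U) f = integral\<^sup>L (lebesgue_on V) f"
    proof cases
      case m
      then have "(\<lambda>x. indicator U x *\<^sub>R f x) \<in> borel_measurable lebesgue" "(\<lambda>x. indicator V x *\<^sub>R f x) \<in> borel_measurable lebesgue"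
        using borel_measurable_restrict_space_iff[of U lebesgue f] borel_measurable_restrict_space_iff[of V lebesgue f] Us assms(3) by auto
      then show ?thesis using Us assms(3)
        by (simp add: integrable_restrict_space integral_restrict_space integrable_cong_AE[OF _ _ ae] integral_cong_AE[OF _ _ ae])
    next
      case n
      then have "\<not> integrable (lebesgue_on U) f" "\<not> integrable (lebesgue_on V) f"
        by (meson borel_measurable_integrable)+
      then show ?thesis by (simp add: not_integrable_integral_eq)
    qed
    then show "integrable (lebesgue_on U) f \<longleftrightarrow> integrable (lebesgue_on V) f"
      "integral\<^sup>L (lebesgue_on U) f = integral\<^sup>L (lebesgue_on V) f" by auto
  qed
  then show ?A ?B ?C ?D using meas unfolding L2_def by auto
qed

lemma L2_real: "L2 U f \<longleftrightarrow> sqi (lebesgue_on U) f" for f :: "'a::euclidean_space \<Rightarrow> real"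
  by (simp add: L2_def sqi_def)

lemma L2_pair:
  fixes v :: "'a::euclidean_space \<Rightarrow> real \<times> real"
  shows "L2 U v \<longleftrightarrow> sqi (lebesgue_on U) (\<lambda>x. fst (v x)) \<and> sqi (lebesgue_on U) (\<lambda>x. snd (v x))"
proof
  let ?M = "lebesgue_on U"
  assume v: "L2 U v"
  then have [measurable]: "v \<in> borel_measurable ?M" by (simp add: L2_def)
  have f: "(\<lambda>x. fst (v x)) \<in> borel_measurable ?M" and s: "(\<lambda>x. snd (v x)) \<in> borel_measurable ?M"
    by (auto intro!: measurable_compose[OF \<open>v \<in> borel_measurable ?M\<close>] borel_measurable_continuous_onI continuous_intros)
  have n: "sqi ?M (\<lambda>x. norm (v x))" using v by (simp add: L2_def sqi_def)
  show "sqi ?M (\<lambda>x. fst (v x)) \<and> sqi ?M (\<lambda>x. snd (v x))"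
  proof (intro conjI)
    have "\<bar>fst (v x)\<bar> \<le> norm (v x)" "\<bar>snd (v x)\<bar> \<le> norm (v x)" for x
      using norm_fst_le[of "fst (v x)" "snd (v x)"] norm_snd_le[of "snd (v x)" "fst (v x)"] by auto
    then show "sqi ?M (\<lambda>x. fst (v x))" "sqi ?M (\<lambda>x. snd (v x))"
      using sqi_mono(1)[OF f n] sqi_mono(1)[OF s n] by auto
  qed
next
  let ?M = "lebesgue_on U"
  assume v: "sqi ?M (\<lambda>x. fst (v x)) \<and> sqi ?M (\<lambda>x. snd (v x))"
  then have "(\<lambda>x. (fst (v x), snd (v x))) \<in> borel_measurable ?M"
    by (intro borel_measurable_Pair) (auto simp: sqi_def)
  moreover have "(norm (v x))\<^sup>2 = (fst (v x))\<^sup>2 + (snd (v x))\<^sup>2" for x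
    by (simp add: norm_prod_def)
  ultimately show "L2 U v" using v by (simp add: L2_def sqi_def)
qed

text \<open>The rectangle off its mid-line is contained in the cracked domain for every crack length. Test functions on it are admissible variations for all of them.\<close>

definition split_domain :: "real \<Rightarrow> real \<Rightarrow> (real \<times> real) set" where
  "split_domain L H = {0<..<L} \<times> {-H<..<0} \<union> {0<..<L} \<times> {0<..<H}"

lemma null_axis: "(UNIV :: real set) \<times> {0::real} \<in> null_sets lebesgue"
proof -
  have "negligible {x::real \<times> real. (0, 1) \<bullet> x = 0}"
    by (rule negligible_hyperplane) (simp add: prod_eq_iff)
  moreover have "{x::real \<times> real. (0, 1) \<bullet> x = 0} = UNIV \<times> {0}" by auto
  ultimately show ?thesis by (simp add: negligible_iff_null_sets)
qed

lemma null_subset: "A \<subseteq> UNIV \<times> {0::real} \<Longrightarrow> A \<in> null_sets lebesgue" for A :: "(real \<times> real) set"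
  using null_axis negligible_subset by (metis negligible_iff_null_sets)

lemma Omega_facts:
  "Omega L H = box (0, -H) (L, H)" "open (Omega L H)" "Omega L H \<in> sets borel" "Omega L H \<in> sets lebesgue"
  "Omega L H \<in> lmeasurable"
proof -
  show O: "Omega L H = box (0, -H) (L, H)"
    by (auto simp: Omega_def box_def Basis_prod_def)
  show "open (Omega L H)" unfolding O by (rule open_box)
  show "Omega L H \<in> sets borel" unfolding O by (intro borel_open open_box)
  then show "Omega L H \<in> sets lebesgue" by simp
  show "Omega L H \<in> lmeasurable" unfolding O by simp
qed

lemma sqi_bounded_on:
  assumes "U \<in> lmeasurable" "f \<in> borel_measurable (lebesgue_on U)" "\<And>x. \<bar>f x\<bar> \<le> B"
  shows "sqi (lebesgue_on U) f"
proof -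
  interpret finite_measure "lebesgue_on U" using assms finite_measure_lebesgue_on by blast
  have "sqi (lebesgue_on U) (\<lambda>_. B)" by (simp add: sqi_def)
  from sqi_mono(1)[OF assms(2) this] assms(3) show ?thesis by (simp add: order_trans[OF _ abs_ge_self])
qed

lemma sqi_bounded:
  assumes "f \<in> borel_measurable (lebesgue_on (Omega L H))" "\<And>x. \<bar>f x\<bar> \<le> B"
  shows "sqi (lebesgue_on (Omega L H)) f"
  by (rule sqi_bounded_on[OF Omega_facts(5) assms])

lemma borel_measurable_lebesgue_onI: "f \<in> borel_measurable borel \<Longrightarrow> f \<in> borel_measurable (lebesgue_on U)"
  for f :: "'a::euclidean_space \<Rightarrow> 'b::euclidean_space"
  by (simp add: measurable_completion measurable_restrict_space1)

lemma sqi_bump: "sqi (lebesgue_on (Omega L H)) (\<lambda>x. bump a b m (fst x) * bump c d m (snd x))"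
proof (rule sqi_bounded[of _ _ _ 1])
  have "smooth (\<lambda>x. bump a b m (fst x) * bump c d m (snd x))"
    by (intro smooth_mult smooth1_bump smooth1_comp[OF smooth1_bump] smooth_snd)
  then show "(\<lambda>x. bump a b m (fst x) * bump c d m (snd x)) \<in> borel_measurable (lebesgue_on (Omega L H))"
    by (intro borel_measurable_lebesgue_onI smooth_borel)
qed (simp add: abs_mult bump_bounds mult_le_one)

section \<open>Density of test functions\<close>

definition approximable :: "real \<Rightarrow> real \<Rightarrow> (real \<times> real \<Rightarrow> real) \<Rightarrow> bool" where
  "approximable L H f \<longleftrightarrow> sqi (lebesgue_on (Omega L H)) f \<and>
     (\<forall>\<epsilon>>0. \<exists>\<phi>. mixed_test (split_domain L H) \<phi> \<and> l2 (lebesgue_on (Omega L H)) (\<lambda>x. f x - \<phi> x) \<le> \<epsilon>)"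

lemma test_sqi_on:
  assumes "test_function V \<phi>" "U \<in> lmeasurable" shows "sqi (lebesgue_on U) \<phi>"
proof -
  obtain B where "\<And>x. \<bar>\<phi> x\<bar> \<le> B" using test_function_bounded[OF assms(1)] by metis
  then show ?thesis using assms
    by (intro sqi_bounded_on[of _ _ B] borel_measurable_lebesgue_onI smooth_borel) (auto simp: test_function_def)
qed

lemma test_sqi:
  assumes "test_function U \<phi>" shows "sqi (lebesgue_on (Omega L H)) \<phi>"
  by (rule test_sqi_on[OF assms Omega_facts(5)])

text \<open>Approximability is a closed condition; the following lemmas climb from rectangles to Borel sets, to
nonnegative functions and to all of \<open>L\<^sup>2\<close>.\<close>

lemma approximable_limit:
  assumes "sqi (lebesgue_on (Omega L H)) f" "\<And>i. approximable L H (F i)"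
    "(\<lambda>i. l2 (lebesgue_on (Omega L H)) (\<lambda>x. F i x - f x)) \<longlonglongrightarrow> 0"
  shows "approximable L H f"
  unfolding approximable_def
proof (intro conjI allI impI assms(1))
  fix \<epsilon> :: real assume "\<epsilon> > 0"
  then obtain i where i: "l2 (lebesgue_on (Omega L H)) (\<lambda>x. F i x - f x) < \<epsilon> / 2"
    using order_tendstoD(2)[OF assms(3), of "\<epsilon> / 2"] by (auto simp: eventually_sequentially)
  obtain \<phi> where \<phi>: "mixed_test (split_domain L H) \<phi>" "l2 (lebesgue_on (Omega L H)) (\<lambda>x. F i x - \<phi> x) \<le> \<epsilon> / 2"
    using assms(2)[of i] \<open>\<epsilon> > 0\<close> unfolding approximable_def by (meson half_gt_zero)
  have "l2 (lebesgue_on (Omega L H)) (\<lambda>x. f x - \<phi> x) \<le> \<epsilon>"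
    using l2_triangle_diff[OF assms(1), of "F i" \<phi>] i \<phi> assms(2)[of i]
    by (auto simp: approximable_def mixed_test_def test_sqi l2_minus_commute[of _ f "F i"])
  then show "\<exists>\<phi>. mixed_test (split_domain L H) \<phi> \<and> l2 (lebesgue_on (Omega L H)) (\<lambda>x. f x - \<phi> x) \<le> \<epsilon>"
    using \<phi> by blast
qed

lemma approximable_mixed_test: "mixed_test (split_domain L H) \<phi> \<Longrightarrow> approximable L H \<phi>"
  unfolding approximable_def by (auto simp: mixed_test_def test_sqi l2_def intro!: exI[of _ \<phi>])

lemma approximable_zero: "approximable L H (\<lambda>_. 0)"
  by (intro approximable_mixed_test mixed_test_zero)

lemma approximable_add:
  assumes "approximable L H f" "approximable L H g" shows "approximable L H (\<lambda>x. f x + g x)"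
  unfolding approximable_def
proof (intro conjI allI impI)
  let ?M = "lebesgue_on (Omega L H)"
  have s: "sqi ?M f" "sqi ?M g" using assms by (auto simp: approximable_def)
  then show "sqi ?M (\<lambda>x. f x + g x)" by (rule sqi_add)
  fix \<epsilon> :: real assume "\<epsilon> > 0"
  then have "\<epsilon> / 2 > 0" by simp
  then obtain \<phi> \<psi> where *: "mixed_test (split_domain L H) \<phi>" "l2 ?M (\<lambda>x. f x - \<phi> x) \<le> \<epsilon> / 2"
    "mixed_test (split_domain L H) \<psi>" "l2 ?M (\<lambda>x. g x - \<psi> x) \<le> \<epsilon> / 2"
    using assms unfolding approximable_def by meson
  then have t: "sqi ?M \<phi>" "sqi ?M \<psi>" by (auto simp: mixed_test_def test_sqi)
  have "l2 ?M (\<lambda>x. (f x + g x) - (\<phi> x + \<psi> x)) \<le> \<epsilon>"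
    using l2_triangle[OF sqi_diff[OF s(1) t(1)] sqi_diff[OF s(2) t(2)]] * by (simp add: algebra_simps)
  then show "\<exists>\<phi>. mixed_test (split_domain L H) \<phi> \<and> l2 ?M (\<lambda>x. (f x + g x) - \<phi> x) \<le> \<epsilon>"
    using mixed_test_add[OF *(1,3)] by blast
qed

lemma approximable_scale:
  assumes "approximable L H f" shows "approximable L H (\<lambda>x. c * f x)"
  unfolding approximable_def
proof (intro conjI allI impI)
  let ?M = "lebesgue_on (Omega L H)"
  have s: "sqi ?M f" using assms by (auto simp: approximable_def)
  then show "sqi ?M (\<lambda>x. c * f x)" by (rule sqi_scale)
  fix \<epsilon> :: real assume "\<epsilon> > 0"
  then have "\<epsilon> / (\<bar>c\<bar> + 1) > 0" by simp
  then obtain \<phi> where *: "mixed_test (split_domain L H) \<phi>" "l2 ?M (\<lambda>x. f x - \<phi> x) \<le> \<epsilon> / (\<bar>c\<bar> + 1)"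
    using assms unfolding approximable_def by meson
  have "l2 ?M (\<lambda>x. c * f x - c * \<phi> x) = \<bar>c\<bar> * l2 ?M (\<lambda>x. f x - \<phi> x)"
    using l2_scale[of ?M c "\<lambda>x. f x - \<phi> x"] by (simp add: algebra_simps)
  also have "\<dots> \<le> (\<bar>c\<bar> + 1) * (\<epsilon> / (\<bar>c\<bar> + 1))"
    using * l2_nonneg by (intro mult_mono) auto
  finally have "l2 ?M (\<lambda>x. c * f x - c * \<phi> x) \<le> \<epsilon>" by simp
  then show "\<exists>\<phi>. mixed_test (split_domain L H) \<phi> \<and> l2 ?M (\<lambda>x. c * f x - \<phi> x) \<le> \<epsilon>"
    using mixed_test_scale[OF *(1)] by blast
qed

text \<open>Products of bumps converge to the indicator of the rectangle, dominated by 1.\<close>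

lemma approximable_rectangle:
  assumes "{a<..<b} \<times> {c<..<d} \<subseteq> split_domain L H"
  shows "approximable L H (indicator ({a<..<b} \<times> {c<..<d}))"
proof (rule approximable_limit[where F="\<lambda>m x. bump a b m (fst x) * bump c d m (snd x)"])
  let ?M = "lebesgue_on (Omega L H)"
  show "approximable L H (\<lambda>x. bump a b m (fst x) * bump c d m (snd x))" for m
    using mixed_test_bump[of a b c d m] assms
    by (auto intro!: approximable_mixed_test simp: mixed_test_def intro: test_function_mono)
  have m: "(indicator ({a<..<b} \<times> {c<..<d}) :: _ \<Rightarrow> real) \<in> borel_measurable ?M"
    by (rule borel_measurable_lebesgue_onI[OF borel_measurable_indicator]) (simp add: open_Times)
  then show s: "sqi ?M (indicator ({a<..<b} \<times> {c<..<d}))"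
    by (rule sqi_bounded[of _ _ _ 1]) (auto simp: indicator_def)
  show "(\<lambda>m. l2 ?M (\<lambda>x. bump a b m (fst x) * bump c d m (snd x) - indicator ({a<..<b} \<times> {c<..<d}) x)) \<longlonglongrightarrow> 0"
  proof (rule l2_dominated[where w="\<lambda>_. 1"])
    show "(\<lambda>x. bump a b m (fst x) * bump c d m (snd x)) \<in> borel_measurable ?M" for m
      by (rule sqi_measurable[OF sqi_bump])
    show "sqi ?M (\<lambda>_. 1)" by (rule sqi_bounded[of _ _ _ 1]) auto
    have "(\<lambda>m. bump a b m (fst x) * bump c d m (snd x)) \<longlonglongrightarrow> indicator ({a<..<b} \<times> {c<..<d}) x" for x
      using tendsto_mult[OF bump_limit[of a b "fst x"] bump_limit[of c d "snd x"]]
      by (cases x) (simp add: indicator_times)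
    then show "AE x in ?M. (\<lambda>m. bump a b m (fst x) * bump c d m (snd x)) \<longlonglongrightarrow> indicator ({a<..<b} \<times> {c<..<d}) x"
      by simp
  qed (rule m, auto simp: abs_mult bump_bounds mult_le_one indicator_def)
qed

lemma box_prod: "box a b = {fst a<..<fst b} \<times> {snd a<..<snd b}" for a b :: "real \<times> real"
  by (cases a; cases b) (auto simp: box_def Basis_prod_def)

lemma sqi_indicator: "A \<in> sets borel \<Longrightarrow> sqi (lebesgue_on (Omega L H)) (indicator A)"
  by (rule sqi_bounded[of _ _ _ 1])
     (auto simp: indicator_def intro!: borel_measurable_lebesgue_onI[OF borel_measurable_indicator])

text \<open>A Dynkin argument: boxes are intersection stable, and approximability is preserved by complements in the
fixed rectangle \<open>Q\<close> and by countable disjoint unions. Intersecting with \<open>Q\<close> keeps the supports away from the mid-line.\<close>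

lemma approximable_borel_set:
  assumes "A \<in> sets borel"
    and Q: "Q = {a<..<b} \<times> {c<..<d}" "Q \<subseteq> split_domain L H"
  shows "approximable L H (indicator (A \<inter> Q))"
proof -
  let ?M = "lebesgue_on (Omega L H)"
  let ?E = "range (\<lambda>(a, b). box a b :: (real \<times> real) set)"
  have Qb: "Q \<in> sets borel" unfolding Q by (simp add: open_Times)
  have "Int_stable ?E" by (auto simp: Int_stable_def box_Int_box)
  moreover have "?E \<subseteq> Pow UNIV" by simp
  moreover have "A \<in> sigma_sets UNIV ?E" using assms(1) by (simp add: borel_eq_box)
  ultimately show ?thesis
  proof (induction rule: sigma_sets_induct_disjoint)
    case (basic A)
    then obtain p q where A: "A = box p q" by auto
    have "A \<inter> Q = {max (fst p) a<..<min (fst q) b} \<times> {max (snd p) c<..<min (snd q) d}"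
      unfolding A Q box_prod by auto
    then show ?case using approximable_rectangle Q by (metis inf.cobounded2 order_trans)
  next
    case empty
    show ?case using approximable_zero by (simp add: indicator_def)
  next
    case (compl A)
    have "approximable L H (\<lambda>x. indicator Q x + (-1) * indicator (A \<inter> Q) x)"
      using approximable_rectangle Q compl by (intro approximable_add approximable_scale) auto
    also have "(\<lambda>x. indicator Q x + (-1) * indicator (A \<inter> Q) x) = (indicator ((UNIV - A) \<inter> Q) :: _ \<Rightarrow> real)"
      by (auto simp: indicator_def fun_eq_iff)
    finally show ?case .
  next
    case (union A)
    have Ab: "A i \<in> sets borel" for i using union(2) by (auto simp: borel_eq_box)
    have fin: "approximable L H (indicator ((\<Union>i<n. A i) \<inter> Q))" for n
    proof (induction n)
      case 0
      show ?case using approximable_zero by (simp add: indicator_def)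
    next
      case (Suc n)
      have "A n \<inter> A i = {}" if "i < n" for i
        using disjoint_family_onD[OF union(1), of n i] that by simp
      then have "A n \<inter> (\<Union>i<n. A i) = {}" by blast
      then have "(indicator ((\<Union>i<Suc n. A i) \<inter> Q) :: _ \<Rightarrow> real) =
          (\<lambda>x. indicator (A n \<inter> Q) x + indicator ((\<Union>i<n. A i) \<inter> Q) x)"
        unfolding lessThan_Suc fun_eq_iff indicator_def by auto
      then show ?case using approximable_add[OF union(3) Suc, of n] by simp
    qed
    show ?case
    proof (rule approximable_limit[OF _ fin])
      show "sqi ?M (indicator ((\<Union>i. A i) \<inter> Q))" using Ab Qb by (intro sqi_indicator) auto
      show "(\<lambda>n. l2 ?M (\<lambda>x. indicator ((\<Union>i<n. A i) \<inter> Q) x - indicator ((\<Union>i. A i) \<inter> Q) x)) \<longlonglongrightarrow> 0"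
      proof (rule l2_dominated[where w="\<lambda>_. 1"])
        show "sqi ?M (\<lambda>_. 1)" by (rule sqi_bounded[of _ _ _ 1]) auto
        show "(indicator ((\<Union>i<n. A i) \<inter> Q) :: _ \<Rightarrow> real) \<in> borel_measurable ?M" for n
          using Ab Qb by (intro sqi_measurable sqi_indicator) auto
        show "(indicator ((\<Union>i. A i) \<inter> Q) :: _ \<Rightarrow> real) \<in> borel_measurable ?M"
          using Ab Qb by (intro sqi_measurable sqi_indicator) auto
        have "(\<lambda>n. indicator ((\<Union>i<n. A i) \<inter> Q) x :: real) \<longlonglongrightarrow> indicator ((\<Union>i. A i) \<inter> Q) x" for x
        proof (cases "x \<in> (\<Union>i. A i) \<inter> Q")
          case True
          then obtain i where "x \<in> A i" "x \<in> Q" by auto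
          then have "indicator ((\<Union>i<n. A i) \<inter> Q) x = (1 :: real)" if "n > i" for n
            using that by (intro indicator_eq_1_iff[THEN iffD2]) auto
          then have "eventually (\<lambda>n. indicator ((\<Union>i<n. A i) \<inter> Q) x = (1 :: real)) sequentially"
            by (intro eventually_sequentiallyI[of "Suc i"]) simp
          then show ?thesis using True by (simp add: tendsto_eventually)
        next
          case False
          then have "indicator ((\<Union>i<n. A i) \<inter> Q) x = (0 :: real)" for n by (auto simp: indicator_def)
          with False show ?thesis by simp
        qed
        then show "AE x in ?M. (\<lambda>n. indicator ((\<Union>i<n. A i) \<inter> Q) x :: real) \<longlonglongrightarrow> indicator ((\<Union>i. A i) \<inter> Q) x"
          by simp
      qed (auto simp: indicator_def)
    qed
  qed
qed

lemma AE_split_domain: "AE x in lebesgue_on (Omega L H). x \<in> split_domain L H"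
proof -
  have "Omega L H - split_domain L H \<in> null_sets lebesgue"
    by (rule null_subset) (auto simp: Omega_def split_domain_def)
  then have "AE x in lebesgue. x \<notin> Omega L H - split_domain L H" by (rule AE_not_in)
  then show ?thesis using Omega_facts(4)[of L H] by (auto simp: AE_restrict_space_iff elim: eventually_mono)
qed

lemma approximable_cong:
  assumes "approximable L H f" "g \<in> borel_measurable (lebesgue_on (Omega L H))"
    "AE x in lebesgue_on (Omega L H). g x = f x"
  shows "approximable L H g"
proof (rule approximable_limit[where F="\<lambda>_. f"])
  let ?M = "lebesgue_on (Omega L H)"
  have f: "sqi ?M f" using assms(1) by (simp add: approximable_def)
  show g: "sqi ?M g" by (rule sqi_cong_AE(1)[OF f assms(2,3)])
  have "l2 ?M (\<lambda>x. f x - g x) = l2 ?M (\<lambda>x. 0 * f x)"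
  proof (rule sqi_cong_AE(2)[OF sqi_scale[OF f]])
    show "(\<lambda>x. f x - g x) \<in> borel_measurable ?M" using f g by (intro sqi_measurable sqi_diff)
    show "AE x in ?M. f x - g x = 0 * f x" using assms(3) by eventually_elim simp
  qed
  then show "(\<lambda>i. l2 ?M (\<lambda>x. f x - g x)) \<longlonglongrightarrow> 0" by (simp add: l2_scale[of _ 0, simplified])
qed (rule assms(1))

lemma approximable_borel_nonneg:
  assumes "u \<in> borel_measurable borel" "\<And>x. 0 \<le> u x" "sqi (lebesgue_on (Omega L H)) u"
  shows "approximable L H u"
proof -
  let ?M = "lebesgue_on (Omega L H)"
  have dom: "sqi ?M v" if "sqi ?M w" "v \<in> borel_measurable borel" "\<And>x. 0 \<le> v x" "\<And>x. x \<in> Omega L H \<Longrightarrow> v x \<le> w x" for v w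
  proof (rule sqi_mono(1)[OF borel_measurable_lebesgue_onI[OF that(2)] that(1)], rule AE_I2)
    show "\<bar>v x\<bar> \<le> \<bar>w x\<bar>" if "x \<in> space ?M" for x
      using \<open>0 \<le> v x\<close> \<open>x \<in> Omega L H \<Longrightarrow> v x \<le> w x\<close> that by simp
  qed
  from assms show ?thesis
  proof (induction u rule: borel_measurable_induct_real)
    case (set A)
    let ?P = "{0<..<L} \<times> {0<..<H}" and ?N = "{0<..<L} \<times> {-H<..<0}"
    have "approximable L H (\<lambda>x. indicator (A \<inter> ?P) x + indicator (A \<inter> ?N) x)"
      using set by (intro approximable_add approximable_borel_set) (auto simp: split_domain_def)
    then show ?case
    proof (rule approximable_cong)
      show "(indicator A :: _ \<Rightarrow> real) \<in> borel_measurable ?M"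
        using set by (intro sqi_measurable sqi_indicator) auto
      show "AE x in ?M. indicator A x = (indicator (A \<inter> ?P) x + indicator (A \<inter> ?N) x :: real)"
        using AE_split_domain[of L H] by eventually_elim (auto simp: split_domain_def indicator_def)
    qed
  next
    case (mult u c)
    show ?case
    proof (cases "c = 0")
      case True
      then show ?thesis using approximable_zero by simp
    next
      case False
      then have "sqi ?M u" using sqi_scale[OF mult.prems, of "1 / c"] by simp
      then show ?thesis using mult.IH approximable_scale by blast
    qed
  next
    case (add u v)
    have "sqi ?M u" "sqi ?M v"
      using add.hyps by (auto intro!: dom[OF add.prems])
    then show ?case using add.IH approximable_add by blast
  next
    case (seq U)
    have le: "U i x \<le> u x" for i x
      using le_funD[OF incseqD[OF seq.hyps(3)]] by (intro LIMSEQ_le_const[OF seq.hyps(4)] exI[of _ i]) auto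
    have sU: "sqi ?M (U i)" for i using seq.hyps le by (intro dom[OF seq.prems]) auto
    show ?case
    proof (rule approximable_limit[OF seq.prems])
      show "approximable L H (U i)" for i using seq.IH sU by blast
      show "(\<lambda>i. l2 ?M (\<lambda>x. U i x - u x)) \<longlonglongrightarrow> 0"
      proof (rule l2_dominated[where w=u])
        show "AE x in ?M. \<bar>U i x\<bar> \<le> \<bar>u x\<bar>" for i
          using le[of i] seq.hyps(2)[of i] by (intro AE_I2) (simp add: order_trans[OF _ abs_ge_self])
        show "AE x in ?M. (\<lambda>i. U i x) \<longlonglongrightarrow> u x" by (rule AE_I2, rule seq.hyps(4)) simp
      qed (use sqi_measurable[OF sU] sqi_measurable[OF seq.prems] seq.prems in auto)
    qed
  qed
qed

text \<open>Positive and negative parts are treated separately after passing to a Borel representative.\<close>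

lemma approximable_sqi:
  assumes "sqi (lebesgue_on (Omega L H)) f" shows "approximable L H f"
proof -
  let ?M = "lebesgue_on (Omega L H)"
  have "(\<lambda>x. indicator (Omega L H) x *\<^sub>R f x) \<in> borel_measurable lebesgue"
    using assms borel_measurable_restrict_space_iff[of "Omega L H" lebesgue f] Omega_facts(4)
    by (auto simp: sqi_def)
  then obtain g where g: "g \<in> borel_measurable lborel" "AE x in lborel. indicator (Omega L H) x *\<^sub>R f x = g x"
    using completion_ex_borel_measurable_real[of _ lborel] by (auto simp del: scaleR_conv_of_real real_scaleR_def)
  have ae: "AE x in ?M. f x = g x"
    using AE_completion[OF g(2)] Omega_facts(4)[of L H]
    by (auto simp: AE_restrict_space_iff elim!: eventually_mono)
  have gb: "g \<in> borel_measurable borel" using g(1) by simp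
  have sg: "sqi ?M g"
  proof (rule sqi_cong_AE(1)[OF assms borel_measurable_lebesgue_onI[OF gb]])
    show "AE x in ?M. g x = f x" using ae by eventually_elim simp
  qed
  have pb: "(\<lambda>x. max 0 (g x)) \<in> borel_measurable borel" "(\<lambda>x. max 0 (- g x)) \<in> borel_measurable borel"
    by (intro borel_measurable_max borel_measurable_const borel_measurable_uminus gb)+
  have "sqi ?M (\<lambda>x. max 0 (g x))" "sqi ?M (\<lambda>x. max 0 (- g x))"
    by (rule sqi_mono(1)[OF borel_measurable_lebesgue_onI[OF pb(1)] sg], simp)
       (rule sqi_mono(1)[OF borel_measurable_lebesgue_onI[OF pb(2)] sg], simp)
  then have "approximable L H (\<lambda>x. max 0 (g x) + (-1) * max 0 (- g x))"
    using pb by (intro approximable_add approximable_scale approximable_borel_nonneg) auto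
  also have "(\<lambda>x. max 0 (g x) + (-1) * max 0 (- g x)) = g" by (auto simp: max_def)
  finally show ?thesis by (rule approximable_cong[OF _ sqi_measurable[OF assms] ae])
qed

section \<open>Weak gradients\<close>

lemma integral_Pair:
  fixes a b :: "'a \<Rightarrow> real"
  assumes "integrable M a" "integrable M b"
  shows "(LINT x|M. (a x, b x)) = (LINT x|M. a x, LINT x|M. b x)"
proof -
  have "(LINT x|M. (a x, b x)) = (LINT x|M. a x *\<^sub>R (1, 0) + b x *\<^sub>R (0, 1))"
    by (rule Bochner_Integration.integral_cong) auto
  also have "\<dots> = (LINT x|M. a x *\<^sub>R (1, 0)) + (LINT x|M. b x *\<^sub>R (0, 1))"
    using assms by (intro Bochner_Integration.integral_add integrable_scaleR_left)
  also have "\<dots> = (LINT x|M. a x) *\<^sub>R (1, 0) + (LINT x|M. b x) *\<^sub>R (0, 1)"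
    using assms by (simp only: integral_scaleR_left)
  also have "\<dots> = (LINT x|M. a x, LINT x|M. b x)"
    by (simp only: scaleR_Pair add_Pair real_scaleR_def mult_1_right mult_zero_right add_0_left add_0_right)
  finally show ?thesis .
qed

text \<open>The vector-valued weak identity splits into two scalar ones, which is the form used everywhere below.\<close>

lemma H1_gradient_iff:
  assumes "U \<in> lmeasurable"
  shows "H1_gradient U u v \<longleftrightarrow> sqi (lebesgue_on U) u \<and> sqi (lebesgue_on U) (\<lambda>x. fst (v x)) \<and>
     sqi (lebesgue_on U) (\<lambda>x. snd (v x)) \<and>
     (\<forall>\<phi>. test_function U \<phi> \<longrightarrow>
        (LINT x|lebesgue_on U. u x * partial1 \<phi> x) = - (LINT x|lebesgue_on U. \<phi> x * fst (v x)) \<and>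
        (LINT x|lebesgue_on U. u x * partial2 \<phi> x) = - (LINT x|lebesgue_on U. \<phi> x * snd (v x)))"
proof -
  let ?M = "lebesgue_on U"
  have "((LINT x|?M. u x *\<^sub>R gradient \<phi> x) = - (LINT x|?M. \<phi> x *\<^sub>R v x)) \<longleftrightarrow>
      (LINT x|?M. u x * partial1 \<phi> x) = - (LINT x|?M. \<phi> x * fst (v x)) \<and>
      (LINT x|?M. u x * partial2 \<phi> x) = - (LINT x|?M. \<phi> x * snd (v x))"
    if "sqi ?M u" "sqi ?M (\<lambda>x. fst (v x))" "sqi ?M (\<lambda>x. snd (v x))" "test_function U \<phi>" for \<phi>
  proof -
    note t = test_sqi_on[OF that(4) assms] test_sqi_on[OF test_function_partial(1)[OF that(4)] assms]
      test_sqi_on[OF test_function_partial(2)[OF that(4)] assms]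
    have "(LINT x|?M. u x *\<^sub>R gradient \<phi> x) = (LINT x|?M. (u x * partial1 \<phi> x, u x * partial2 \<phi> x))"
      by (simp add: gradient_def)
    also have "\<dots> = (LINT x|?M. u x * partial1 \<phi> x, LINT x|?M. u x * partial2 \<phi> x)"
      using that t by (intro integral_Pair sqi_mult_integrable)
    finally have 1: "(LINT x|?M. u x *\<^sub>R gradient \<phi> x) = (LINT x|?M. u x * partial1 \<phi> x, LINT x|?M. u x * partial2 \<phi> x)" .
    have "(LINT x|?M. \<phi> x *\<^sub>R v x) = (LINT x|?M. (\<phi> x * fst (v x), \<phi> x * snd (v x)))"
      by (simp add: scaleR_prod_def)
    also have "\<dots> = (LINT x|?M. \<phi> x * fst (v x), LINT x|?M. \<phi> x * snd (v x))"
      using that t by (intro integral_Pair sqi_mult_integrable)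
    finally show ?thesis using 1 by (simp add: prod_eq_iff)
  qed
  then show ?thesis unfolding H1_gradient_def L2_real L2_pair by blast
qed

lemma L2_lincomb:
  fixes f g :: "'a::euclidean_space \<Rightarrow> 'b::euclidean_space"
  assumes "L2 U f" "L2 U g" shows "L2 U (\<lambda>x. a *\<^sub>R f x + b *\<^sub>R g x)"
proof -
  let ?M = "lebesgue_on U"
  have m: "f \<in> borel_measurable ?M" "g \<in> borel_measurable ?M" using assms by (auto simp: L2_def)
  then have m2: "(\<lambda>x. a *\<^sub>R f x + b *\<^sub>R g x) \<in> borel_measurable ?M" by measurable
  have "sqi ?M (\<lambda>x. norm (f x))" "sqi ?M (\<lambda>x. norm (g x))" using assms m by (auto simp: L2_def sqi_def)
  then have *: "sqi ?M (\<lambda>x. \<bar>a\<bar> * norm (f x) + \<bar>b\<bar> * norm (g x))"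
    by (intro sqi_add sqi_scale)
  have "norm (a *\<^sub>R f x + b *\<^sub>R g x) \<le> \<bar>a\<bar> * norm (f x) + \<bar>b\<bar> * norm (g x)" for x
    by (rule norm_triangle_le) simp
  then have "sqi ?M (\<lambda>x. norm (a *\<^sub>R f x + b *\<^sub>R g x))"
    using m2 by (intro sqi_mono(1)[OF _ *]) auto
  then show ?thesis using m2 by (simp add: L2_def sqi_def)
qed

lemma L2_norm: "L2 U f \<Longrightarrow> sqi (lebesgue_on U) (\<lambda>x. norm (f x))"
  by (auto simp: L2_def sqi_def)

lemma L2_tendsto_iff:
  "L2_tendsto U \<phi> f \<longleftrightarrow> (\<forall>k. L2 U (\<phi> k)) \<and> L2 U f \<and>
     (\<lambda>k. l2 (lebesgue_on U) (\<lambda>x. norm (\<phi> k x - f x))) \<longlonglongrightarrow> 0"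
proof -
  have "((\<lambda>k. sqrt (F k)) \<longlonglongrightarrow> 0) \<longleftrightarrow> F \<longlonglongrightarrow> 0" if "\<And>k. F k \<ge> 0" for F :: "nat \<Rightarrow> real"
  proof
    assume "(\<lambda>k. sqrt (F k)) \<longlonglongrightarrow> 0"
    then have "(\<lambda>k. \<bar>sqrt (F k)\<bar> ^ 2) \<longlonglongrightarrow> 0 ^ 2" by (intro tendsto_power tendsto_rabs_zero)
    then show "F \<longlonglongrightarrow> 0" using that by simp
  next
    assume "F \<longlonglongrightarrow> 0"
    from tendsto_real_sqrt[OF this] show "(\<lambda>k. sqrt (F k)) \<longlonglongrightarrow> 0" by simp
  qed
  from this[of "\<lambda>k. LINT x|lebesgue_on U. (norm (\<phi> k x - f x))\<^sup>2"]
  show ?thesis unfolding L2_tendsto_def l2_def by simp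
qed

lemma L2_tendsto_lincomb:
  fixes f g :: "'a::euclidean_space \<Rightarrow> 'b::euclidean_space"
  assumes "L2_tendsto U \<phi> f" "L2_tendsto U \<psi> g"
  shows "L2_tendsto U (\<lambda>k x. a *\<^sub>R \<phi> k x + b *\<^sub>R \<psi> k x) (\<lambda>x. a *\<^sub>R f x + b *\<^sub>R g x)"
  unfolding L2_tendsto_iff
proof (intro conjI allI)
  let ?M = "lebesgue_on U"
  have l: "L2 U (\<phi> k)" "L2 U f" "L2 U (\<psi> k)" "L2 U g" for k
    using assms by (auto simp: L2_tendsto_def)
  show "L2 U (\<lambda>x. a *\<^sub>R \<phi> k x + b *\<^sub>R \<psi> k x)" for k using l by (intro L2_lincomb)
  show "L2 U (\<lambda>x. a *\<^sub>R f x + b *\<^sub>R g x)" using l by (intro L2_lincomb)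
  have d: "L2 U (\<lambda>x. \<phi> k x - f x)" "L2 U (\<lambda>x. \<psi> k x - g x)" for k
    using L2_lincomb[OF l(1,2), where a=1 and b="-1"] L2_lincomb[OF l(3,4), where a=1 and b="-1"] by simp_all
  have *: "l2 ?M (\<lambda>x. norm (a *\<^sub>R \<phi> k x + b *\<^sub>R \<psi> k x - (a *\<^sub>R f x + b *\<^sub>R g x)))
      \<le> \<bar>a\<bar> * l2 ?M (\<lambda>x. norm (\<phi> k x - f x)) + \<bar>b\<bar> * l2 ?M (\<lambda>x. norm (\<psi> k x - g x))" for k
  proof -
    have s: "sqi ?M (\<lambda>x. norm (\<phi> k x - f x))" "sqi ?M (\<lambda>x. norm (\<psi> k x - g x))"
      using L2_norm[OF d(1)] L2_norm[OF d(2)] by auto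
    let ?d = "\<lambda>x. a *\<^sub>R (\<phi> k x - f x) + b *\<^sub>R (\<psi> k x - g x)"
    have e: "a *\<^sub>R \<phi> k x + b *\<^sub>R \<psi> k x - (a *\<^sub>R f x + b *\<^sub>R g x) = ?d x" for x
      by (simp add: algebra_simps)
    have "l2 ?M (\<lambda>x. norm (?d x)) \<le> l2 ?M (\<lambda>x. \<bar>a\<bar> * norm (\<phi> k x - f x) + \<bar>b\<bar> * norm (\<psi> k x - g x))"
    proof (rule sqi_mono(2))
      show "(\<lambda>x. norm (?d x)) \<in> borel_measurable ?M"
        using L2_norm[OF L2_lincomb[OF d]] by (rule sqi_measurable)
      show "sqi ?M (\<lambda>x. \<bar>a\<bar> * norm (\<phi> k x - f x) + \<bar>b\<bar> * norm (\<psi> k x - g x))"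
        using s by (intro sqi_add sqi_scale)
      have "norm (?d x) \<le> \<bar>a\<bar> * norm (\<phi> k x - f x) + \<bar>b\<bar> * norm (\<psi> k x - g x)" for x
        by (rule norm_triangle_le) simp
      then show "AE x in ?M. \<bar>norm (?d x)\<bar> \<le> \<bar>\<bar>a\<bar> * norm (\<phi> k x - f x) + \<bar>b\<bar> * norm (\<psi> k x - g x)\<bar>"
        by (intro AE_I2) (simp add: order_trans[OF _ abs_ge_self])
    qed
    also have "\<dots> \<le> l2 ?M (\<lambda>x. \<bar>a\<bar> * norm (\<phi> k x - f x)) + l2 ?M (\<lambda>x. \<bar>b\<bar> * norm (\<psi> k x - g x))"
      using s by (intro l2_triangle sqi_scale)
    finally show ?thesis by (simp add: e l2_scale)
  qed
  have lim: "(\<lambda>k. \<bar>a\<bar> * l2 ?M (\<lambda>x. norm (\<phi> k x - f x)) + \<bar>b\<bar> * l2 ?M (\<lambda>x. norm (\<psi> k x - g x))) \<longlonglongrightarrow> \<bar>a\<bar> * 0 + \<bar>b\<bar> * 0"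
    using assms unfolding L2_tendsto_iff by (intro tendsto_intros) auto
  show "(\<lambda>k. l2 ?M (\<lambda>x. norm (a *\<^sub>R \<phi> k x + b *\<^sub>R \<psi> k x - (a *\<^sub>R f x + b *\<^sub>R g x)))) \<longlonglongrightarrow> 0"
  proof (rule tendsto_sandwich)
    show "(\<lambda>_. 0) \<longlonglongrightarrow> (0::real)" by simp
    show "(\<lambda>k. \<bar>a\<bar> * l2 ?M (\<lambda>x. norm (\<phi> k x - f x)) + \<bar>b\<bar> * l2 ?M (\<lambda>x. norm (\<psi> k x - g x))) \<longlonglongrightarrow> 0"
      using lim by simp
    show "\<forall>\<^sub>F k in sequentially. 0 \<le> l2 ?M (\<lambda>x. norm (a *\<^sub>R \<phi> k x + b *\<^sub>R \<psi> k x - (a *\<^sub>R f x + b *\<^sub>R g x)))"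
      by (rule always_eventually, rule allI, rule l2_nonneg)
    show "\<forall>\<^sub>F k in sequentially. l2 ?M (\<lambda>x. norm (a *\<^sub>R \<phi> k x + b *\<^sub>R \<psi> k x - (a *\<^sub>R f x + b *\<^sub>R g x)))
        \<le> \<bar>a\<bar> * l2 ?M (\<lambda>x. norm (\<phi> k x - f x)) + \<bar>b\<bar> * l2 ?M (\<lambda>x. norm (\<psi> k x - g x))"
      by (rule always_eventually, rule allI, rule *)
  qed
qed

lemma L2_tendsto_const: "L2 U f \<Longrightarrow> L2_tendsto U (\<lambda>_. f) f"
  by (simp add: L2_tendsto_def)

lemma H1_gradient_lincomb:
  assumes "U \<in> lmeasurable" "H1_gradient U u v" "H1_gradient U u' v'"
  shows "H1_gradient U (\<lambda>x. a * u x + b * u' x) (\<lambda>x. a *\<^sub>R v x + b *\<^sub>R v' x)"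
proof -
  let ?M = "lebesgue_on U"
  note H = assms(2,3)[unfolded H1_gradient_iff[OF assms(1)]]
  have lin: "(LINT x|?M. (a * p x + b * q x) * r x) = a * (LINT x|?M. p x * r x) + b * (LINT x|?M. q x * r x)"
    if "sqi ?M p" "sqi ?M q" "sqi ?M r" for p q r
  proof -
    have "(LINT x|?M. (a * p x + b * q x) * r x) = (LINT x|?M. a * (p x * r x) + b * (q x * r x))"
      by (rule Bochner_Integration.integral_cong) (auto simp: algebra_simps)
    then show ?thesis using that by (simp add: sqi_mult_integrable)
  qed
  show ?thesis unfolding H1_gradient_iff[OF assms(1)] fst_add snd_add fst_scaleR snd_scaleR real_scaleR_def
  proof (intro conjI allI impI)
    fix \<phi> assume \<phi>: "test_function U \<phi>"
    note t = test_sqi_on[OF \<phi> assms(1)] test_sqi_on[OF test_function_partial(1)[OF \<phi>] assms(1)]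
      test_sqi_on[OF test_function_partial(2)[OF \<phi>] assms(1)]
    show "(LINT x|?M. (a * u x + b * u' x) * partial1 \<phi> x) = - (LINT x|?M. \<phi> x * (a * fst (v x) + b * fst (v' x)))"
      "(LINT x|?M. (a * u x + b * u' x) * partial2 \<phi> x) = - (LINT x|?M. \<phi> x * (a * snd (v x) + b * snd (v' x)))"
      using H t \<phi> by (simp_all add: lin mult.commute[of "\<phi> _"])
  qed (use H in \<open>auto intro!: sqi_add sqi_scale\<close>)
qed

lemma test_function_integrable_lborel:
  assumes "test_function U \<phi>" shows "integrable lborel \<phi>"
proof -
  obtain K where K: "smooth \<phi>" "compact K" "K \<subseteq> U" "\<forall>x. x \<notin> K \<longrightarrow> \<phi> x = 0"
    using test_functionD[OF assms] by blast
  have "integrable lborel (\<lambda>x. indicator K x *\<^sub>R \<phi> x)"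
    using borel_integrable_compact[OF K(2) smooth_continuous[OF K(1)]] by simp
  also have "(\<lambda>x. indicator K x *\<^sub>R \<phi> x) = \<phi>" using K(4) by (auto simp: indicator_def fun_eq_iff)
  finally show ?thesis .
qed

lemma integral_lebesgue_on_lborel:
  fixes f :: "'a::euclidean_space \<Rightarrow> real"
  assumes "f \<in> borel_measurable borel" "U \<in> sets lebesgue" "\<And>x. x \<notin> U \<Longrightarrow> f x = 0"
  shows "(LINT x|lebesgue_on U. f x) = (LINT x|lborel. f x)"
    "integrable (lebesgue_on U) f \<longleftrightarrow> integrable lborel f"
proof -
  have i: "(\<lambda>x. indicator U x *\<^sub>R f x) = f" using assms(3) by (auto simp: indicator_def fun_eq_iff)
  show "(LINT x|lebesgue_on U. f x) = (LINT x|lborel. f x)"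
    using assms(1,2) by (simp add: integral_restrict_space integral_completion i del: real_scaleR_def)
  show "integrable (lebesgue_on U) f \<longleftrightarrow> integrable lborel f"
    using assms(1,2) by (simp add: integrable_restrict_space integrable_completion i del: real_scaleR_def)
qed

lemma integral_compact_support_deriv:
  fixes F :: "real \<Rightarrow> real"
  assumes "\<And>t. (F has_real_derivative f t) (at t)" "\<And>t. isCont f t"
    and "\<And>t. \<bar>t\<bar> \<ge> B \<Longrightarrow> F t = 0" "\<And>t. \<bar>t\<bar> > B \<Longrightarrow> f t = 0" "B > 0"
  shows "(LINT t|lborel. f t) = 0"
proof -
  have "(LINT t|lborel. f t * indicator {-B..B} t) = F B - F (- B)"
    using assms by (intro integral_FTC_Icc_real) auto
  also have "(\<lambda>t. f t * indicator {-B..B} t) = f"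
    using assms(4) by (auto simp: indicator_def fun_eq_iff abs_le_iff not_le[symmetric]) (smt (verit))
  finally show ?thesis using assms(3)[of B] assms(3)[of "-B"] \<open>B > 0\<close> by simp
qed

text \<open>Fubini reduces this to the fundamental theorem of calculus on lines, where the boundary terms
vanish by compact support.\<close>

lemma integral_partial_test_function:
  assumes "test_function U \<phi>" "U \<in> sets lebesgue"
  shows "(LINT x|lebesgue_on U. partial1 \<phi> x) = 0" "(LINT x|lebesgue_on U. partial2 \<phi> x) = 0"
proof -
  note t = test_function_partial[OF assms(1)]
  obtain K where K: "smooth \<phi>" "compact K" "K \<subseteq> U" "\<forall>x. x \<notin> K \<longrightarrow> \<phi> x = 0"
    using test_functionD[OF assms(1)] by blast
  obtain B where B: "B > 0" "\<And>x. x \<in> K \<Longrightarrow> norm x < B"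
    using compact_imp_bounded[OF K(2)] bounded_pos_less by metis
  have z: "\<phi> x = 0" if "norm x \<ge> B" for x using B K(4) that by (meson not_le)
  have open_z: "open {x::real \<times> real. B < norm x}" by (intro open_Collect_less continuous_intros)
  have "(\<phi> has_derivative (\<lambda>_. 0)) (at x)" if "norm x > B" for x
    by (rule has_derivative_transform_within_open[OF has_derivative_const open_z]) (use z that in auto)
  from partial_eqI[OF this] have pz: "partial1 \<phi> x = 0" "partial2 \<phi> x = 0" if "norm x > B" for x
    using that by auto
  have n: "\<bar>a\<bar> \<le> norm (a, b)" "\<bar>b\<bar> \<le> norm (a, b)" for a b :: real
    using norm_fst_le[of a b] norm_snd_le[of b a] by auto
  note D = has_derivative_partials[OF smooth_differentiable[OF K(1)]]
  have 1: "((\<lambda>s. \<phi> (s, c)) has_real_derivative partial1 \<phi> (s, c)) (at s)" for s c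
    unfolding has_field_derivative_def
  proof (rule has_derivative_eq_rhs[OF has_derivative_compose[OF _ D]])
    show "((\<lambda>s. (s, c)) has_derivative (\<lambda>h. (h, 0))) (at s)"
      by (auto intro!: derivative_eq_intros)
  qed (auto simp: mult.commute)
  have 2: "((\<lambda>s. \<phi> (c, s)) has_real_derivative partial2 \<phi> (c, s)) (at s)" for s c
    unfolding has_field_derivative_def
  proof (rule has_derivative_eq_rhs[OF has_derivative_compose[OF _ D]])
    show "((\<lambda>s. (c, s)) has_derivative (\<lambda>h. (0, h))) (at s)"
      by (auto intro!: derivative_eq_intros)
  qed (auto simp: mult.commute)
  have cont: "isCont (partial1 \<phi>) x" "isCont (partial2 \<phi>) x" for x
    using smooth_partial1[OF K(1)] smooth_partial2[OF K(1)] smooth_differentiable differentiable_imp_continuous_within by blast+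
  have c1: "isCont (\<lambda>s. partial1 \<phi> (s, c)) s" and c2: "isCont (\<lambda>s. partial2 \<phi> (c, s)) s" for s c
    by (rule isCont_o2[OF _ cont(1)], auto intro!: continuous_intros)
       (rule isCont_o2[OF _ cont(2)], auto intro!: continuous_intros)
  have i1: "(LINT s|lborel. partial1 \<phi> (s, c)) = 0" for c
    using order_trans[OF _ n(1), of B _ c] less_le_trans[OF _ n(1), of B _ c] z pz B(1)
    by (intro integral_compact_support_deriv[OF 1 c1, of B]) blast+
  have i2: "(LINT s|lborel. partial2 \<phi> (c, s)) = 0" for c
    using order_trans[OF _ n(2), of B _ c] less_le_trans[OF _ n(2), of B _ c] z pz B(1)
    by (intro integral_compact_support_deriv[OF 2 c2, of B]) blast+
  have "(LINT x|lborel. partial1 \<phi> x) = (LINT c|lborel. LINT s|lborel. partial1 \<phi> (s, c))"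
    using lborel_pair.integral_snd[of "\<lambda>s c. partial1 \<phi> (s, c)"] test_function_integrable_lborel[OF t(1)]
    by (simp add: lborel_prod)
  then show "(LINT x|lebesgue_on U. partial1 \<phi> x) = 0"
    using i1 integral_lebesgue_on_lborel(1)[OF smooth_borel[OF smooth_partial1[OF K(1)]] assms(2) test_function_outside[OF t(1)]] by simp
  have "(LINT x|lborel. partial2 \<phi> x) = (LINT c|lborel. LINT s|lborel. partial2 \<phi> (c, s))"
    using lborel_pair.integral_fst[of "\<lambda>c s. partial2 \<phi> (c, s)"] test_function_integrable_lborel[OF t(2)]
    by (simp add: lborel_prod)
  then show "(LINT x|lebesgue_on U. partial2 \<phi> x) = 0"
    using i2 integral_lebesgue_on_lborel(1)[OF smooth_borel[OF smooth_partial2[OF K(1)]] assms(2) test_function_outside[OF t(2)]] by simp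
qed

lemma smooth_bounded_on:
  assumes "smooth \<psi>" "bounded U" obtains B where "\<And>x. x \<in> U \<Longrightarrow> \<bar>\<psi> x\<bar> \<le> B"
proof -
  have "compact (\<psi> ` closure U)" using assms
    by (intro compact_continuous_image smooth_continuous) (auto simp: compact_closure)
  then obtain B where "\<And>x. x \<in> closure U \<Longrightarrow> \<bar>\<psi> x\<bar> \<le> B"
    using compact_imp_bounded bounded_real by (metis imageI)
  then show ?thesis using that closure_subset by blast
qed

lemma smooth_sqi:
  assumes "smooth \<psi>" "bounded U" "U \<in> lmeasurable" shows "sqi (lebesgue_on U) \<psi>"
proof -
  obtain B where B: "\<And>x. x \<in> U \<Longrightarrow> \<bar>\<psi> x\<bar> \<le> B" using smooth_bounded_on[OF assms(1,2)] by blast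
  have U: "U \<in> sets lebesgue" using assms(3) by auto
  have m: "(\<lambda>x. indicator U x * \<psi> x) \<in> borel_measurable (lebesgue_on U)"
  proof (rule borel_measurable_times)
    show "(indicator U :: _ \<Rightarrow> real) \<in> borel_measurable (lebesgue_on U)"
      using U by (intro borel_measurable_indicator) (simp add: sets_restrict_space_iff)
  qed (rule borel_measurable_lebesgue_onI[OF smooth_borel[OF assms(1)]])
  have "sqi (lebesgue_on U) (\<lambda>x. indicator U x * \<psi> x)"
    by (rule sqi_bounded_on[OF assms(3) m, of "max B 0"]) (use B in \<open>auto simp: indicator_def max.coboundedI1\<close>)
  then show ?thesis
    by (rule sqi_cong_AE(1)) (use assms(1) in \<open>auto intro!: borel_measurable_lebesgue_onI smooth_borel AE_I2\<close>)
qed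

text \<open>Integration by parts: the integral of the partial derivatives of the product \<open>\<psi> * \<phi>\<close> is zero.\<close>

lemma H1_gradient_smooth:
  assumes "smooth \<psi>" "bounded U" "U \<in> lmeasurable"
  shows "H1_gradient U \<psi> (gradient \<psi>)"
  unfolding H1_gradient_iff[OF assms(3)]
proof (intro conjI allI impI)
  let ?M = "lebesgue_on U"
  have s: "smooth (partial1 \<psi>)" "smooth (partial2 \<psi>)" using assms smooth_partial1 smooth_partial2 by auto
  show q: "sqi ?M \<psi>" "sqi ?M (\<lambda>x. fst (gradient \<psi> x))" "sqi ?M (\<lambda>x. snd (gradient \<psi> x))"
    using s assms by (auto simp: gradient_def intro: smooth_sqi)
  fix \<phi> assume \<phi>: "test_function U \<phi>"
  note t = test_sqi_on[OF \<phi> assms(3)] test_sqi_on[OF test_function_partial(1)[OF \<phi>] assms(3)]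
      test_sqi_on[OF test_function_partial(2)[OF \<phi>] assms(3)]
  note d = smooth_differentiable[OF assms(1)] smooth_differentiable[OF test_function_smooth[OF \<phi>]]
  have "integrable ?M (\<lambda>x. \<psi> x * partial1 \<phi> x)" "integrable ?M (\<lambda>x. partial1 \<psi> x * \<phi> x)"
    "integrable ?M (\<lambda>x. \<psi> x * partial2 \<phi> x)" "integrable ?M (\<lambda>x. partial2 \<psi> x * \<phi> x)"
    using q t by (auto simp: gradient_def intro!: sqi_mult_integrable)
  then show "(LINT x|?M. \<psi> x * partial1 \<phi> x) = - (LINT x|?M. \<phi> x * fst (gradient \<psi> x))"
    "(LINT x|?M. \<psi> x * partial2 \<phi> x) = - (LINT x|?M. \<phi> x * snd (gradient \<psi> x))"
    using integral_partial_test_function[OF test_function_mult[OF \<phi> assms(1)]] assms(3)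
    by (auto simp: partial_mult[OF d] gradient_def mult.commute[of "\<phi> _"] fmeasurable_def)
qed

section \<open>The cracked domain and admissible gradients\<close>

abbreviation cracked :: "real \<Rightarrow> real \<Rightarrow> real \<Rightarrow> (real \<times> real) set" where
  "cracked L H l \<equiv> Omega L H - crack l"

abbreviation OM :: "real \<Rightarrow> real \<Rightarrow> (real \<times> real) measure" where
  "OM L H \<equiv> lebesgue_on (Omega L H)"

lemma crack_subset: "crack l \<subseteq> UNIV \<times> {0}"
  by (auto simp: crack_def)

lemma cracked_null: "Omega L H - cracked L H l \<in> null_sets lebesgue"
  by (rule null_subset) (use crack_subset in blast)

lemma cracked_lmeasurable: "cracked L H l \<in> lmeasurable"
  by (intro fmeasurable_Diff Omega_facts null_setsD2[OF null_subset[OF crack_subset]])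

lemma cracked_bounded: "bounded (cracked L H l)" "bounded (Omega L H)"
  using bounded_box by (auto simp: Omega_facts(1) intro: bounded_subset)

lemmas cracked_measure = lebesgue_on_null_diff[OF Diff_subset cracked_null Omega_facts(4)]

lemma cracked_sqi: "sqi (lebesgue_on (cracked L H l)) f \<longleftrightarrow> sqi (OM L H) f"
  using cracked_measure(4)[of L H l f] by (simp add: L2_real)

lemma split_domain_subset: "split_domain L H \<subseteq> cracked L H l"
  by (auto simp: split_domain_def Omega_def crack_def)

lemma H1_gradient_cracked_iff:
  "H1_gradient (cracked L H l) u v \<longleftrightarrow> sqi (OM L H) u \<and> sqi (OM L H) (\<lambda>x. fst (v x)) \<and>
     sqi (OM L H) (\<lambda>x. snd (v x)) \<and>
     (\<forall>\<phi>. test_function (cracked L H l) \<phi> \<longrightarrow>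
        (LINT x|OM L H. u x * partial1 \<phi> x) = - (LINT x|OM L H. \<phi> x * fst (v x)) \<and>
        (LINT x|OM L H. u x * partial2 \<phi> x) = - (LINT x|OM L H. \<phi> x * snd (v x)))"
  unfolding H1_gradient_iff[OF cracked_lmeasurable] cracked_sqi cracked_measure(3) ..

lemma has_trace_lincomb:
  assumes "has_trace R c I u g" "has_trace R c I u' g'" "R \<in> lmeasurable"
  shows "has_trace R c I (\<lambda>x. a * u x + b * u' x) (\<lambda>x. a * g x + b * g' x)"
proof -
  obtain v \<phi> where 1: "H1_gradient R u v" "\<forall>k. smooth (\<phi> k)" "L2_tendsto R \<phi> u"
    "L2_tendsto R (\<lambda>k. gradient (\<phi> k)) v" "L2_tendsto I (\<lambda>k y. \<phi> k (c, y)) (\<lambda>y. g (c, y))"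
    using assms(1) unfolding has_trace_def by blast
  obtain v' \<phi>' where 2: "H1_gradient R u' v'" "\<forall>k. smooth (\<phi>' k)" "L2_tendsto R \<phi>' u'"
    "L2_tendsto R (\<lambda>k. gradient (\<phi>' k)) v'" "L2_tendsto I (\<lambda>k y. \<phi>' k (c, y)) (\<lambda>y. g' (c, y))"
    using assms(2) unfolding has_trace_def by blast
  let ?\<phi> = "\<lambda>k x. a * \<phi> k x + b * \<phi>' k x"
  have gr: "gradient (?\<phi> k) = (\<lambda>x. a *\<^sub>R gradient (\<phi> k) x + b *\<^sub>R gradient (\<phi>' k) x)" for k
  proof
    fix x
    have "smooth (\<lambda>x. a * \<phi> k x)" "smooth (\<lambda>x. b * \<phi>' k x)" using 1 2 by (auto intro: smooth_scale)
    from gradient_add[OF this] show "gradient (?\<phi> k) x = a *\<^sub>R gradient (\<phi> k) x + b *\<^sub>R gradient (\<phi>' k) x"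
      using 1 2 by (simp add: gradient_scale)
  qed
  show ?thesis unfolding has_trace_def
  proof (intro exI conjI allI)
    show "H1_gradient R (\<lambda>x. a * u x + b * u' x) (\<lambda>x. a *\<^sub>R v x + b *\<^sub>R v' x)"
      using 1 2 assms by (intro H1_gradient_lincomb)
    show "smooth (?\<phi> k)" for k using 1 2 by (intro smooth_add smooth_scale) auto
    show "L2_tendsto R ?\<phi> (\<lambda>x. a * u x + b * u' x)"
      using L2_tendsto_lincomb[OF 1(3) 2(3), of a b] by simp
    show "L2_tendsto R (\<lambda>k. gradient (?\<phi> k)) (\<lambda>x. a *\<^sub>R v x + b *\<^sub>R v' x)"
      unfolding gr using 1 2 by (intro L2_tendsto_lincomb)
    show "L2_tendsto I (\<lambda>k y. ?\<phi> k (c, y)) (\<lambda>y. a * g (c, y) + b * g' (c, y))"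
      using L2_tendsto_lincomb[OF 1(5) 2(5), of a b] by simp
  qed
qed

lemma rect_lmeasurable: "{a<..<b} \<times> {c<..<d} \<in> lmeasurable" "bounded ({a<..<b} \<times> {c<..<d})" for a b c d :: real
proof -
  have "{a<..<b} \<times> {c<..<d} = box (a, c) (b, d)" by (auto simp: box_prod)
  then show "{a<..<b} \<times> {c<..<d} \<in> lmeasurable" "bounded ({a<..<b} \<times> {c<..<d})" by auto
qed

text \<open>The constant sequence \<open>\<psi>\<close> realizes the trace.\<close>

lemma has_trace_smooth:
  assumes "smooth \<psi>" "R \<in> lmeasurable" "bounded R" "\<And>y. y \<in> I \<Longrightarrow> \<psi> (c, y) = 0"
  shows "has_trace R c I \<psi> (\<lambda>_. 0)"
  unfolding has_trace_def
proof (intro exI[of _ "gradient \<psi>"] exI[of _ "\<lambda>_. \<psi>"] conjI allI)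
  show h: "H1_gradient R \<psi> (gradient \<psi>)" using assms by (intro H1_gradient_smooth)
  then show "L2_tendsto R (\<lambda>_. \<psi>) \<psi>" "L2_tendsto R (\<lambda>_. gradient \<psi>) (gradient \<psi>)"
    by (auto simp: H1_gradient_def intro: L2_tendsto_const)
  show "L2_tendsto I (\<lambda>k y. \<psi> (c, y)) (\<lambda>y. 0)"
  proof -
    have sm: "(\<lambda>y. \<psi> (c, y)) \<in> borel_measurable borel"
      using smooth_continuous[OF assms(1), of UNIV]
      by (intro borel_measurable_continuous_onI) (auto intro!: continuous_on_compose2[of UNIV \<psi>] continuous_intros)
    have z: "sqi (lebesgue_on I) (\<lambda>_. 0)" by (simp add: sqi_def)
    have "sqi (lebesgue_on I) (\<lambda>y. \<psi> (c, y))"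
      by (rule sqi_cong_AE(1)[OF z borel_measurable_lebesgue_onI[OF sm]]) (use assms(4) in auto)
    moreover have "(LINT y|lebesgue_on I. (norm (\<psi> (c, y) - 0))\<^sup>2) = (LINT y|lebesgue_on I. 0)"
      by (rule Bochner_Integration.integral_cong) (use assms(4) in auto)
    ultimately show ?thesis using z by (simp add: L2_tendsto_def L2_real)
  qed
qed (rule assms(1))

text \<open>Only gradients enter the energy. The set of admissible gradients is an affine space, increasing in the crack
length, and its image under the quadratic form has the energy as infimum.\<close>

definition grads :: "real \<Rightarrow> real \<Rightarrow> (real \<times> real \<Rightarrow> real) \<Rightarrow> real \<Rightarrow> (real \<times> real \<Rightarrow> real \<times> real) set" where
  "grads L H g l = {v. \<exists>u. u \<in> admissible L H g l \<and> H1_gradient (cracked L H l) u v}"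

definition en :: "real \<Rightarrow> real \<Rightarrow> (real \<times> real \<Rightarrow> real \<times> real) \<Rightarrow> (real \<times> real \<Rightarrow> real \<times> real) \<Rightarrow> real" where
  "en L H C v = (LINT x|OM L H. quad_form (C x) (v x))"

lemma energy_eq: "energy L H g C l = Inf ((\<lambda>v. 1/2 * en L H C v) ` grads L H g l)"
proof -
  have "{1/2 * (LINT x|lebesgue_on (Omega L H - crack l). quad_form (C x) (v x)) | u v.
            u \<in> admissible L H g l \<and> H1_gradient (Omega L H - crack l) u v}
     = ((\<lambda>v. 1/2 * en L H C v) ` grads L H g l)"
    unfolding grads_def en_def cracked_measure(3) by blast
  then show ?thesis unfolding energy_def by simp
qed

lemma grads_sqi:
  assumes "v \<in> grads L H g l"
  shows "sqi (OM L H) (\<lambda>x. fst (v x))" "sqi (OM L H) (\<lambda>x. snd (v x))"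
  using assms by (auto simp: grads_def H1_gradient_cracked_iff)

lemma grads_affine:
  assumes "v \<in> grads L H g l" "w \<in> grads L H g l"
  shows "(\<lambda>x. v x + t *\<^sub>R (w x - v x)) \<in> grads L H g l"
proof -
  obtain u where u: "u \<in> admissible L H g l" "H1_gradient (cracked L H l) u v"
    using assms(1) by (auto simp: grads_def)
  obtain u' where u': "u' \<in> admissible L H g l" "H1_gradient (cracked L H l) u' w"
    using assms(2) by (auto simp: grads_def)
  let ?u = "\<lambda>x. (1 - t) * u x + t * u' x"
  have h: "H1_gradient (cracked L H l) ?u (\<lambda>x. (1 - t) *\<^sub>R v x + t *\<^sub>R w x)"
    using u u' by (intro H1_gradient_lincomb cracked_lmeasurable)
  have e: "(\<lambda>x. (1 - t) *\<^sub>R v x + t *\<^sub>R w x) = (\<lambda>x. v x + t *\<^sub>R (w x - v x))"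
    by (auto simp: algebra_simps)
  have "has_trace ({0<..<L} \<times> J) c J ?u g"
    if "has_trace ({0<..<L} \<times> J) c J u g" "has_trace ({0<..<L} \<times> J) c J u' g" "{0<..<L} \<times> J \<in> lmeasurable" for c J
    using has_trace_lincomb[OF that, of "1 - t" t] by (simp add: algebra_simps)
  then have "?u \<in> admissible L H g l"
    using u(1) u'(1) h rect_lmeasurable(1) unfolding admissible_def H1_def by blast
  then show ?thesis using h unfolding e grads_def by blast
qed

text \<open>A test function away from the mid-line changes neither the traces nor the jump across the crack.\<close>

lemma grads_add_test:
  assumes "v \<in> grads L H g l" "test_function (split_domain L H) \<phi>"
  shows "(\<lambda>x. v x + gradient \<phi> x) \<in> grads L H g l"
proof -
  obtain u where u: "u \<in> admissible L H g l" "H1_gradient (cracked L H l) u v"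
    using assms(1) by (auto simp: grads_def)
  let ?u = "\<lambda>x. u x + \<phi> x"
  note sm = test_function_smooth[OF assms(2)]
  have h: "H1_gradient (cracked L H l) ?u (\<lambda>x. v x + gradient \<phi> x)"
    using H1_gradient_lincomb[OF cracked_lmeasurable u(2) H1_gradient_smooth[OF sm cracked_bounded(1) cracked_lmeasurable], of 1 1]
    by simp
  have z: "\<phi> (0, y) = 0" "\<phi> (L, y) = 0" for y
    by (rule test_function_outside[OF assms(2)], simp add: split_domain_def)+
  have "has_trace ({0<..<L} \<times> J) c J ?u g"
    if "has_trace ({0<..<L} \<times> J) c J u g" "J = {a<..<b}" "c = 0 \<or> c = L" for c J a b
    using has_trace_lincomb[OF that(1) has_trace_smooth[OF sm, of _ J c], of 1 1] rect_lmeasurable that z by auto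
  then have "?u \<in> admissible L H g l"
    using u(1) h unfolding admissible_def H1_def by blast
  then show ?thesis using h unfolding grads_def by blast
qed

text \<open>The weak form of \<open>\<partial>\<^sub>1 \<partial>\<^sub>2 u = \<partial>\<^sub>2 \<partial>\<^sub>1 u\<close>: integrate by parts twice, in either order.\<close>

lemma grads_curl:
  assumes "v \<in> grads L H g l" "mixed_test (split_domain L H) \<phi>"
  shows "(LINT x|OM L H. partial1 \<phi> x * snd (v x)) = (LINT x|OM L H. partial2 \<phi> x * fst (v x))"
proof -
  obtain u where u: "H1_gradient (cracked L H l) u v" using assms(1) by (auto simp: grads_def)
  have t: "test_function (cracked L H l) \<phi>"
    using assms(2) split_domain_subset test_function_mono unfolding mixed_test_def by blast
  have ibp: "(LINT x|OM L H. u x * partial1 \<psi> x) = - (LINT x|OM L H. \<psi> x * fst (v x))"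
    "(LINT x|OM L H. u x * partial2 \<psi> x) = - (LINT x|OM L H. \<psi> x * snd (v x))"
    if "test_function (cracked L H l) \<psi>" for \<psi>
    using u that unfolding H1_gradient_cracked_iff by blast+
  have "partial1 (partial2 \<phi>) = partial2 (partial1 \<phi>)" using assms(2) by (simp add: mixed_test_def)
  then show ?thesis
    using ibp(2)[OF test_function_partial(1)[OF t]] ibp(1)[OF test_function_partial(2)[OF t]] by simp
qed

text \<open>A longer crack leaves fewer test functions, hence fewer conditions on a weak gradient.\<close>

lemma grads_mono:
  assumes "l \<le> l'" shows "grads L H g l \<subseteq> grads L H g l'"
proof -
  have sub: "cracked L H l' \<subseteq> cracked L H l" using assms by (auto simp: crack_def)
  have h: "H1_gradient (cracked L H l') u v" if "H1_gradient (cracked L H l) u v" for u v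
    using that test_function_mono[OF _ sub] unfolding H1_gradient_cracked_iff by blast
  then have "H1 (cracked L H l) \<subseteq> H1 (cracked L H l')" unfolding H1_def by blast
  then have "admissible L H g l \<subseteq> admissible L H g l'" unfolding admissible_def by blast
  with h show ?thesis unfolding grads_def by blast
qed

section \<open>Elliptic tensors and near-minimizers\<close>

definition elliptic :: "real \<Rightarrow> real \<Rightarrow> (real \<times> real \<Rightarrow> real \<times> real) \<Rightarrow> bool" where
  "elliptic m K C \<longleftrightarrow> 0 < m \<and> C \<in> borel_measurable borel \<and>
     (\<forall>x. m \<le> fst (C x) \<and> fst (C x) \<le> K \<and> m \<le> snd (C x) \<and> snd (C x) \<le> K)"

definition bil :: "real \<Rightarrow> real \<Rightarrow> (real \<times> real \<Rightarrow> real \<times> real) \<Rightarrow> (real \<times> real \<Rightarrow> real \<times> real) \<Rightarrow> (real \<times> real \<Rightarrow> real \<times> real) \<Rightarrow> real" where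
  "bil L H C v w = (LINT x|OM L H. fst (C x) * fst (v x) * fst (w x) + snd (C x) * snd (v x) * snd (w x))"

definition sq2 :: "real \<Rightarrow> real \<Rightarrow> (real \<times> real \<Rightarrow> real \<times> real) \<Rightarrow> bool" where
  "sq2 L H v \<longleftrightarrow> sqi (OM L H) (\<lambda>x. fst (v x)) \<and> sqi (OM L H) (\<lambda>x. snd (v x))"

lemma elliptic_components:
  assumes "elliptic m K C"
  shows "(\<lambda>x. fst (C x)) \<in> borel_measurable borel" "(\<lambda>x. snd (C x)) \<in> borel_measurable borel"
    "\<bar>fst (C x)\<bar> \<le> K" "\<bar>snd (C x)\<bar> \<le> K" "0 < K" "0 < m" "m \<le> fst (C x)" "m \<le> snd (C x)"
proof -
  have [measurable]: "C \<in> borel_measurable borel" using assms by (simp add: elliptic_def)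
  show "(\<lambda>x. fst (C x)) \<in> borel_measurable borel" "(\<lambda>x. snd (C x)) \<in> borel_measurable borel"
    using measurable_compose[OF \<open>C \<in> _\<close> borel_measurable_continuous_onI[OF continuous_on_fst[OF continuous_on_id]]]
      measurable_compose[OF \<open>C \<in> _\<close> borel_measurable_continuous_onI[OF continuous_on_snd[OF continuous_on_id]]]
    by auto
  have *: "0 < m" "m \<le> fst (C x)" "fst (C x) \<le> K" "m \<le> snd (C x)" "snd (C x) \<le> K" for x
    using assms unfolding elliptic_def by blast+
  then show "\<bar>fst (C x)\<bar> \<le> K" "\<bar>snd (C x)\<bar> \<le> K" "0 < K" "0 < m" "m \<le> fst (C x)" "m \<le> snd (C x)"
    using *(1) *(2)[of x] *(3)[of x] *(4)[of x] *(5)[of x] by linarith+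
qed

lemma bil_integrable:
  assumes "elliptic m K C" "sq2 L H v" "sq2 L H w"
  shows "integrable (OM L H) (\<lambda>x. fst (C x) * fst (v x) * fst (w x))"
    "integrable (OM L H) (\<lambda>x. snd (C x) * snd (v x) * snd (w x))"
  using elliptic_components[OF assms(1)] assms(2,3)
  by (auto simp: sq2_def intro!: sqi_mult_integrable sqi_bounded_mult(1)[where c=K] borel_measurable_lebesgue_onI intro: less_imp_le)

lemma en_bil: "en L H C v = bil L H C v v"
  by (simp add: en_def bil_def quad_form_def power2_eq_square algebra_simps)

lemma bil_commute: "bil L H C v w = bil L H C w v"
  by (simp add: bil_def algebra_simps)

lemma sq2_add_scale:
  assumes "sq2 L H v" "sq2 L H w" shows "sq2 L H (\<lambda>x. v x + t *\<^sub>R w x)"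
  using assms by (auto simp: sq2_def intro!: sqi_add sqi_scale)

lemma sq2_diff: "sq2 L H v \<Longrightarrow> sq2 L H w \<Longrightarrow> sq2 L H (\<lambda>x. v x - w x)"
  by (auto simp: sq2_def intro!: sqi_diff)

lemma grads_sq2: "v \<in> grads L H g l \<Longrightarrow> sq2 L H v"
  using grads_sqi by (auto simp: sq2_def)

lemma bil_add_right:
  assumes "elliptic m K C" "sq2 L H v" "sq2 L H w" "sq2 L H z"
  shows "bil L H C v (\<lambda>x. w x + t *\<^sub>R z x) = bil L H C v w + t * bil L H C v z"
proof -
  have "bil L H C v (\<lambda>x. w x + t *\<^sub>R z x) = (LINT x|OM L H.
     (fst (C x) * fst (v x) * fst (w x) + snd (C x) * snd (v x) * snd (w x)) +
     t * (fst (C x) * fst (v x) * fst (z x) + snd (C x) * snd (v x) * snd (z x)))"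
    unfolding bil_def by (rule Bochner_Integration.integral_cong) (auto simp: algebra_simps)
  then show ?thesis using bil_integrable[OF assms(1,2)] assms unfolding bil_def by simp
qed

lemma en_add:
  assumes "elliptic m K C" "sq2 L H v" "sq2 L H w"
  shows "en L H C (\<lambda>x. v x + t *\<^sub>R w x) = en L H C v + 2 * t * bil L H C v w + t\<^sup>2 * en L H C w"
proof -
  have s: "sq2 L H (\<lambda>x. v x + t *\<^sub>R w x)" using assms by (intro sq2_add_scale)
  have "en L H C (\<lambda>x. v x + t *\<^sub>R w x) = bil L H C (\<lambda>x. v x + t *\<^sub>R w x) v + t * bil L H C (\<lambda>x. v x + t *\<^sub>R w x) w"
    unfolding en_bil using assms s by (intro bil_add_right)
  also have "\<dots> = bil L H C v (\<lambda>x. v x + t *\<^sub>R w x) + t * bil L H C w (\<lambda>x. v x + t *\<^sub>R w x)"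
    by (simp add: bil_commute)
  also have "\<dots> = (bil L H C v v + t * bil L H C v w) + t * (bil L H C w v + t * bil L H C w w)"
    using assms by (simp only: bil_add_right)
  finally show ?thesis by (simp add: en_bil bil_commute[of L H C w v] power2_eq_square algebra_simps)
qed

lemma en_bounds:
  assumes "elliptic m K C" "sq2 L H v"
  shows "m * ((l2 (OM L H) (\<lambda>x. fst (v x)))\<^sup>2 + (l2 (OM L H) (\<lambda>x. snd (v x)))\<^sup>2) \<le> en L H C v"
    "en L H C v \<le> K * ((l2 (OM L H) (\<lambda>x. fst (v x)))\<^sup>2 + (l2 (OM L H) (\<lambda>x. snd (v x)))\<^sup>2)"
    "0 \<le> en L H C v"
proof -
  note c = elliptic_components[OF assms(1)]
  have i: "integrable (OM L H) (\<lambda>x. (fst (v x))\<^sup>2)" "integrable (OM L H) (\<lambda>x. (snd (v x))\<^sup>2)"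
    using assms(2) by (auto simp: sq2_def sqi_def)
  have q: "integrable (OM L H) (\<lambda>x. quad_form (C x) (v x))"
    using bil_integrable[OF assms(1,2,2)] by (simp add: quad_form_def power2_eq_square algebra_simps)
  have e: "k * ((l2 (OM L H) (\<lambda>x. fst (v x)))\<^sup>2 + (l2 (OM L H) (\<lambda>x. snd (v x)))\<^sup>2) =
      (LINT x|OM L H. k * ((fst (v x))\<^sup>2 + (snd (v x))\<^sup>2))" for k
    using i by (simp add: l2_square)
  have K: "fst (C x) \<le> K" "snd (C x) \<le> K" for x using c(3,4)[of x] by auto
  show "m * ((l2 (OM L H) (\<lambda>x. fst (v x)))\<^sup>2 + (l2 (OM L H) (\<lambda>x. snd (v x)))\<^sup>2) \<le> en L H C v"
    unfolding e en_def
    by (rule Bochner_Integration.integral_mono) (use i q c in \<open>auto simp: quad_form_def distrib_left intro!: add_mono mult_right_mono\<close>)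
  show "en L H C v \<le> K * ((l2 (OM L H) (\<lambda>x. fst (v x)))\<^sup>2 + (l2 (OM L H) (\<lambda>x. snd (v x)))\<^sup>2)"
    unfolding e en_def
    by (rule Bochner_Integration.integral_mono) (use i q K in \<open>auto simp: quad_form_def distrib_left intro!: add_mono mult_right_mono\<close>)
  show "0 \<le> en L H C v" unfolding en_def
  proof (rule Bochner_Integration.integral_nonneg)
    show "0 \<le> quad_form (C x) (v x)" for x
      using c(6) c(7,8)[of x] by (simp add: quad_form_def)
  qed
qed

lemma bil_Cauchy_Schwarz:
  assumes "elliptic m K C" "sq2 L H v" "sq2 L H w"
  shows "(bil L H C v w)\<^sup>2 \<le> en L H C v * en L H C w"
proof (rule quadratic_nonneg_discriminant)
  show "0 \<le> en L H C v + 2 * t * bil L H C v w + t\<^sup>2 * en L H C w" for t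
    using en_bounds(3)[OF assms(1) sq2_add_scale[OF assms(2,3)]] en_add[OF assms] by simp
  show "0 \<le> en L H C w" by (rule en_bounds(3)[OF assms(1,3)])
qed

lemma energy_lower:
  assumes "elliptic m K C" "v \<in> grads L H g l"
  shows "energy L H g C l \<le> 1/2 * en L H C v"
  unfolding energy_eq
proof (rule cInf_lower)
  have "0 \<le> 1/2 * en L H C v" if "v \<in> grads L H g l" for v
    using en_bounds(3)[OF assms(1) grads_sq2[OF that]] by simp
  then show "bdd_below ((\<lambda>v. 1/2 * en L H C v) ` grads L H g l)"
    by (intro bdd_belowI2[of _ 0])
qed (rule imageI[OF assms(2)])

lemma energy_approx:
  assumes "elliptic m K C" "grads L H g l \<noteq> {}" "\<epsilon> > 0"
  shows "\<exists>v. v \<in> grads L H g l \<and> 1/2 * en L H C v < energy L H g C l + \<epsilon>"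
proof -
  have "\<exists>y \<in> (\<lambda>v. 1/2 * en L H C v) ` grads L H g l. y < energy L H g C l + \<epsilon>"
    using assms(2,3) by (intro cInf_lessD) (auto simp: energy_eq)
  then show ?thesis by blast
qed

lemma energy_greatest:
  assumes "grads L H g l \<noteq> {}" "\<And>v. v \<in> grads L H g l \<Longrightarrow> e \<le> 1/2 * en L H C v"
  shows "e \<le> energy L H g C l"
  unfolding energy_eq
proof (rule cInf_greatest)
  show "(\<lambda>v. 1/2 * en L H C v) ` grads L H g l \<noteq> {}" using assms(1) by simp
  show "e \<le> y" if "y \<in> (\<lambda>v. 1/2 * en L H C v) ` grads L H g l" for y
    using that by (rule imageE) (simp only: assms(2))
qed

lemma energy_antimono:
  assumes "elliptic m K C" "grads L H g l \<noteq> {}" "l \<le> l'"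
  shows "energy L H g C l' \<le> energy L H g C l"
  using assms(2) by (rule energy_greatest) (use energy_lower[OF assms(1)] grads_mono[OF assms(3)] in blast)

text \<open>An approximate Euler--Lagrange equation: moving from \<open>v\<close> towards \<open>w\<close> lowers the energy by at most \<open>\<epsilon>\<close>, so the
quadratic polynomial in the step is nonnegative after adding \<open>2 \<epsilon>\<close>, and its discriminant is not positive.\<close>

lemma near_minimizer_EL:
  assumes "elliptic m K C" "v \<in> grads L H g l" "w \<in> grads L H g l"
    "1/2 * en L H C v \<le> energy L H g C l + \<epsilon>" "0 \<le> \<epsilon>"
  shows "(bil L H C v (\<lambda>x. w x - v x))\<^sup>2 \<le> 2 * \<epsilon> * en L H C (\<lambda>x. w x - v x)"
proof (rule quadratic_nonneg_discriminant)
  let ?z = "\<lambda>x. w x - v x"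
  note s = grads_sq2[OF assms(2)] sq2_diff[OF grads_sq2[OF assms(3)] grads_sq2[OF assms(2)]]
  show "0 \<le> 2 * \<epsilon> + 2 * t * bil L H C v ?z + t\<^sup>2 * en L H C ?z" for t
    using energy_lower[OF assms(1) grads_affine[OF assms(2,3), of t]] assms(4)
    by (simp add: en_add[OF assms(1) s])
  show "0 \<le> en L H C ?z" by (rule en_bounds(3)[OF assms(1) s(2)])
qed

text \<open>The parallelogram identity, with the midpoint of \<open>v\<close> and \<open>w\<close> as a competitor.\<close>

lemma near_minimizers_close:
  assumes "elliptic m K C" "v \<in> grads L H g l" "w \<in> grads L H g l"
    "1/2 * en L H C v \<le> energy L H g C l + \<epsilon>" "1/2 * en L H C w \<le> energy L H g C l + \<delta>"
  shows "en L H C (\<lambda>x. w x - v x) \<le> 4 * (\<epsilon> + \<delta>)"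
proof -
  let ?z = "\<lambda>x. w x - v x"
  note s = grads_sq2[OF assms(2)] sq2_diff[OF grads_sq2[OF assms(3)] grads_sq2[OF assms(2)]]
  have "en L H C w = en L H C v + 2 * bil L H C v ?z + en L H C ?z"
    using en_add[OF assms(1) s, of 1] by simp
  moreover have "2 * energy L H g C l \<le> en L H C v + bil L H C v ?z + en L H C ?z / 4"
    using energy_lower[OF assms(1) grads_affine[OF assms(2,3), of "1/2"]]
    by (simp add: en_add[OF assms(1) s] power2_eq_square)
  ultimately show ?thesis using assms(4,5) by (simp add: field_simps)
qed

section \<open>The layers and a smooth corrector\<close>

definition in_layer :: "real \<Rightarrow> real \<Rightarrow> nat \<Rightarrow> real \<Rightarrow> bool" where
  "in_layer L lam n t \<longleftrightarrow> (\<exists>k<n. real k * L / real n < t \<and> t < (real k + lam) * L / real n)"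

text \<open>The oscillating part of the layering: the indicator of the material \<open>A\<close> minus its volume fraction.\<close>

definition chi :: "real \<Rightarrow> real \<Rightarrow> nat \<Rightarrow> real \<Rightarrow> real" where
  "chi L lam n t = (if in_layer L lam n t then 1 else 0) - lam"

text \<open>A smooth function of period 1 that is positive exactly on the translates of \<open>(0, \<lambda>)\<close>. It describes the
layers by a single inequality, so that smooth approximations of their indicator are obtained by composition with a ramp.\<close>

definition wave :: "real \<Rightarrow> real \<Rightarrow> real" where
  "wave lam y = cos (2 * pi * y - pi * lam) - cos (pi * lam)"

lemma wave_periodic: "wave lam (y + real k) = wave lam y"
proof -
  have "2 * pi * (y + real k) - pi * lam = (2 * pi * y - pi * lam) + of_nat k * (2 * of_real pi)"
    by (simp add: algebra_simps)
  then show ?thesis unfolding wave_def by (simp only: cos.plus_of_nat)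
qed

text \<open>The cosine exceeds \<open>cos (\<pi> \<lambda>)\<close> at \<open>2 \<pi> z - \<pi> \<lambda>\<close> iff this angle is in \<open>(- \<pi> \<lambda>, \<pi> \<lambda>)\<close>, modulo \<open>2 \<pi>\<close>.\<close>

lemma wave_pos_iff:
  assumes "0 < lam" "lam < 1" "0 \<le> z" "z < 1"
  shows "wave lam z > 0 \<longleftrightarrow> 0 < z \<and> z < lam"
proof -
  let ?\<theta> = "2 * pi * z - pi * lam"
  have pl: "0 < pi * lam" "pi * lam < pi" using assms by simp_all
  have p: "2 * pi * z < 2 * pi" "0 \<le> 2 * pi * z" using assms by simp_all
  consider "z = 0" | "0 < z" "z < lam" | "lam \<le> z" "?\<theta> \<le> pi" | "lam \<le> z" "pi < ?\<theta>"
    using assms by linarith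
  then show ?thesis
  proof cases
    case 1 then show ?thesis by (simp add: wave_def)
  next
    case 2
    have "2 * pi * z < 2 * pi * lam" "0 < 2 * pi * z" using 2 by simp_all
    then have "\<bar>?\<theta>\<bar> < pi * lam" by linarith
    then have "cos (pi * lam) < cos \<bar>?\<theta>\<bar>" using pl by (intro cos_monotone_0_pi) auto
    then show ?thesis using 2 by (simp add: wave_def)
  next
    case 3
    have "2 * pi * lam \<le> 2 * pi * z" using 3 by simp
    then have "pi * lam \<le> ?\<theta>" by linarith
    then have "cos ?\<theta> \<le> cos (pi * lam)" using 3 pl by (intro cos_monotone_0_pi_le) auto
    then show ?thesis using 3 by (simp add: wave_def)
  next
    case 4
    have "cos (2 * pi - ?\<theta>) \<le> cos (pi * lam)" using 4 pl p by (intro cos_monotone_0_pi_le) auto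
    moreover have "cos (2 * pi - ?\<theta>) = cos ?\<theta>" by (simp add: cos_diff)
    ultimately show ?thesis using 4 by (simp add: wave_def)
  qed
qed

lemma in_layer_wave:
  assumes "0 < lam" "lam < 1" "L > 0" "n \<ge> 1" "0 < t" "t < L"
  shows "in_layer L lam n t \<longleftrightarrow> wave lam (real n * t / L) > 0"
proof -
  let ?y = "real n * t / L"
  define k where "k = nat \<lfloor>?y\<rfloor>"
  have n: "real n > 0" using assms by simp
  have y: "0 < ?y" "?y < real n" using assms n by (simp_all add: pos_divide_less_eq)
  have k: "real k \<le> ?y" "?y < real k + 1"
    using y(1) floor_correct[of ?y] unfolding k_def by (simp_all add: of_nat_nat zero_le_floor)
  then have kn: "k < n" using y by linarith
  have iff: "real j * L / real n < t \<and> t < (real j + lam) * L / real n \<longleftrightarrow> real j < ?y \<and> ?y < real j + lam" for j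
    using n assms(3) by (simp add: pos_divide_less_eq pos_less_divide_eq mult.commute)
  have "in_layer L lam n t \<longleftrightarrow> real k < ?y \<and> ?y < real k + lam"
  proof
    assume "in_layer L lam n t"
    then obtain j where j: "real j < ?y" "?y < real j + lam" unfolding in_layer_def iff by blast
    then have "real j < real k + 1" "real k < real j + 1" using k assms by linarith+
    then have "j = k" by linarith
    with j show "real k < ?y \<and> ?y < real k + lam" by simp
  next
    assume "real k < ?y \<and> ?y < real k + lam"
    then show "in_layer L lam n t" unfolding in_layer_def iff using kn by blast
  qed
  also have "\<dots> \<longleftrightarrow> wave lam (?y - real k) > 0"
    using wave_pos_iff[OF assms(1,2), of "?y - real k"] k by auto
  also have "wave lam (?y - real k) = wave lam ?y"
    using wave_periodic[of lam "?y - real k" k] by simp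
  finally show ?thesis .
qed

definition smear :: "real \<Rightarrow> nat \<Rightarrow> real \<Rightarrow> real" where
  "smear lam m y = ramp (real m * wave lam y)"

lemma smear_bounds: "0 \<le> smear lam m y" "smear lam m y \<le> 1" "wave lam y \<le> 0 \<Longrightarrow> smear lam m y = 0"
  by (auto simp: smear_def ramp_bounds mult_nonneg_nonpos)

lemma smear_periodic: "smear lam m (y + real k) = smear lam m y"
  by (simp add: smear_def wave_periodic)

lemma smooth1_smear: "smooth1 (smear lam m)"
proof -
  have "smooth1 (wave lam)"
  proof -
    have "smooth1 (\<lambda>t. sin (2 * pi * t + (pi / 2 - pi * lam)))" by (rule smooth1_sin)
    also have "(\<lambda>t. sin (2 * pi * t + (pi / 2 - pi * lam))) = (\<lambda>t. cos (2 * pi * t - pi * lam))"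
    proof
      fix t
      have "2 * pi * t + (pi / 2 - pi * lam) = (2 * pi * t - pi * lam) + pi / 2" by simp
      then show "sin (2 * pi * t + (pi / 2 - pi * lam)) = cos (2 * pi * t - pi * lam)"
        by (simp only: sin_add) simp
    qed
    finally show ?thesis unfolding wave_def by (intro smooth_diff smooth_const)
  qed
  then have "smooth (\<lambda>x::real \<times> real. real m * wave lam (fst x))" by (rule smooth_scale)
  from smooth1_comp[OF smooth1_flat this, of 0] show ?thesis by (simp add: smear_def[abs_def])
qed

lemma smear_isCont: "isCont (smear lam m) y"
  using smooth1_has_derivative[OF smooth1_smear, of lam m y 0] DERIV_isCont by blast

lemma smear_antiderivative:
  "\<exists>A. \<forall>y. (A has_real_derivative smear lam m y) (at y)"
proof -
  have "\<exists>F. \<forall>x::real. - \<infinity> < ereal x \<longrightarrow> ereal x < \<infinity> \<longrightarrow> (F has_vector_derivative smear lam m x) (at x)"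
    by (rule einterval_antiderivative) (auto simp: smear_isCont)
  then show ?thesis by (auto simp: has_real_derivative_iff_has_vector_derivative)
qed

text \<open>After subtraction of the mean \<open>\<mu>\<close> over a period, the primitive is periodic, hence bounded.\<close>

lemma smear_primitive:
  "\<exists>E \<mu> B. (\<forall>y. (E has_real_derivative smear lam m y - \<mu>) (at y)) \<and> 0 \<le> \<mu> \<and> \<mu> \<le> 1 \<and>
     (\<forall>k. E (real k) = E 0) \<and> (\<forall>y\<ge>0. \<bar>E y\<bar> \<le> B)"
proof -
  obtain A where A: "\<And>y. (A has_real_derivative smear lam m y) (at y)"
    using smear_antiderivative by blast
  define \<mu> where "\<mu> = A 1 - A 0"
  define E where "E = (\<lambda>y. A y - \<mu> * y)"
  have E: "(E has_real_derivative smear lam m y - \<mu>) (at y)" for y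
    unfolding E_def by (auto intro!: derivative_eq_intros A)
  obtain \<xi> where "A 1 - A 0 = (1 - 0) * smear lam m \<xi>" using MVT2[of 0 1 A, OF _ A] by auto
  then have \<mu>: "0 \<le> \<mu>" "\<mu> \<le> 1" using smear_bounds(1,2)[where y=\<xi> and m=m and lam=lam] by (simp_all add: \<mu>_def)
  have per1: "E (y + 1) = E y" for y
  proof -
    have "((\<lambda>y. E (y + 1) - E y) has_real_derivative 0) (at y)" for y
    proof -
      have "((\<lambda>y. E (y + 1)) has_real_derivative smear lam m (y + 1) - \<mu>) (at y)"
        using DERIV_shift E by blast
      from DERIV_diff[OF this E[of y]] show ?thesis using smear_periodic[of lam m y 1] by simp
    qed
    from DERIV_isconst_all[rule_format, OF this, of y 0]
    show ?thesis by (simp add: E_def \<mu>_def)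
  qed
  have per: "E (y + real k) = E y" for y k
    by (induction k) (use per1 in \<open>simp_all add: add.assoc[symmetric]\<close>, metis add.assoc add.commute per1)
  have "continuous_on {0..1} E" using E by (meson DERIV_isCont continuous_at_imp_continuous_on)
  then have "bounded (E ` {0..1})" by (intro compact_imp_bounded compact_continuous_image) auto
  then obtain B where B: "\<And>y. y \<in> {0..1} \<Longrightarrow> \<bar>E y\<bar> \<le> B" unfolding bounded_real by blast
  have "\<bar>E y\<bar> \<le> B" if "y \<ge> 0" for y
  proof -
    have "y - real (nat \<lfloor>y\<rfloor>) \<in> {0..1}" using that floor_correct[of y] by (simp add: of_nat_nat) linarith
    from B[OF this] show ?thesis using per[of "y - real (nat \<lfloor>y\<rfloor>)" "nat \<lfloor>y\<rfloor>"] by simp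
  qed
  moreover have "E (real k) = E 0" for k using per[of 0 k] by simp
  ultimately show ?thesis using E \<mu> by blast
qed

lemma integral_fst_Omega:
  assumes "f \<in> borel_measurable borel" "\<And>t. \<bar>f t\<bar> \<le> B" "H > 0"
  shows "(LINT x|OM L H. f (fst x)) = 2 * H * (LINT t|lborel. indicator {0<..<L} t * f t)"
proof -
  let ?F = "\<lambda>x. (indicator {0<..<L} (fst x) * f (fst x)) * indicator {-H<..<H} (snd x) :: real"
  have fb: "(\<lambda>x::real \<times> real. f (fst x)) \<in> borel_measurable borel"
    by (rule measurable_compose[OF borel_measurable_continuous_onI assms(1)]) (intro continuous_intros)
  have F: "?F = (\<lambda>x. indicator (Omega L H) x * f (fst x))"
    by (auto simp: Omega_def indicator_def fun_eq_iff)
  let ?G = "\<lambda>x. indicator (Omega L H) x * f (fst x)"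
  have Gb: "?G \<in> borel_measurable borel"
    by (intro borel_measurable_times fb borel_measurable_indicator Omega_facts)
  have "(LINT x|OM L H. f (fst x)) = (LINT x|OM L H. ?G x)"
    by (rule Bochner_Integration.integral_cong) auto
  also have "\<dots> = (LINT x|lborel. ?G x)"
    using Gb by (intro integral_lebesgue_on_lborel Omega_facts) auto
  also have "\<dots> = (LINT x|lborel. ?F x)" unfolding F ..
  finally have 1: "(LINT x|OM L H. f (fst x)) = (LINT x|lborel. ?F x)" .
  interpret finite_measure "OM L H" using Omega_facts finite_measure_lebesgue_on by blast
  have "integrable (OM L H) ?G"
  proof (rule integrable_const_bound[of _ "\<bar>B\<bar>"])
    show "AE x in OM L H. norm (?G x) \<le> \<bar>B\<bar>"
      using assms(2) by (intro AE_I2) (auto simp: indicator_def intro: order_trans[OF _ abs_ge_self])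
  qed (rule borel_measurable_lebesgue_onI[OF Gb])
  then have "integrable lborel ?G"
    using integral_lebesgue_on_lborel(2)[OF Gb Omega_facts(4)[of L H]] by auto
  then have "integrable lborel ?F" unfolding F .
  then have "integrable (lborel \<Otimes>\<^sub>M lborel) (\<lambda>(t, s). (indicator {0<..<L} t * f t) * indicator {-H<..<H} s :: real)"
    by (simp add: lborel_prod case_prod_beta')
  from lborel_pair.integral_fst[OF this]
  have "(LINT x|lborel. ?F x) = (LINT t|lborel. LINT s|lborel. (indicator {0<..<L} t * f t) * indicator {-H<..<H} s)"
    by (simp add: lborel_prod case_prod_beta')
  also have "\<dots> = (LINT t|lborel. 2 * H * (indicator {0<..<L} t * f t))"
    using assms(3) by (simp add: mult.commute)
  finally show ?thesis using 1 by simp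
qed

lemma smear_limit: "(\<lambda>m. smear lam m y) \<longlonglongrightarrow> (if wave lam y > 0 then 1 else 0)"
  using ramp_limit[of 0 "wave lam y"] by (simp add: smear_def)

lemma smear_borel: "smear lam m \<in> borel_measurable borel" "wave lam \<in> borel_measurable borel"
  using smear_isCont[where lam=lam and m=m]
  by (auto intro!: borel_measurable_continuous_onI continuous_at_imp_continuous_on continuous_intros simp: wave_def[abs_def])

lemma smear_integral:
  assumes "L > 0" "n \<ge> 1" "\<forall>y. (E has_real_derivative smear lam m y - \<mu>) (at y)" "\<forall>k. E (real k) = E 0"
  shows "(LINT t|lborel. indicator {0<..<L} t * smear lam m (real n * t / L)) = L * \<mu>"
proof -
  have n: "real n > 0" using assms by simp
  define F where "F = (\<lambda>t. L / real n * (E (real n * t / L)) + \<mu> * t)"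
  have F: "(F has_real_derivative smear lam m (real n * t / L)) (at t)" for t
  proof -
    have "((\<lambda>t. E (real n * t / L)) has_real_derivative (smear lam m (real n * t / L) - \<mu>) * (real n / L)) (at t)"
      by (rule DERIV_chain2[OF assms(3)[rule_format]]) (use assms(1) in \<open>auto intro!: derivative_eq_intros\<close>)
    then show ?thesis unfolding F_def using n assms(1)
      by (auto intro!: derivative_eq_intros simp: field_simps)
  qed
  have "(LINT t|lborel. smear lam m (real n * t / L) * indicator {0..L} t) = F L - F 0"
    using assms(1) F by (intro integral_FTC_Icc_real) (auto intro!: isCont_o2[OF _ smear_isCont] continuous_intros)
  also have "\<dots> = L * \<mu>" using assms n by (simp add: F_def)
  also have "(LINT t|lborel. smear lam m (real n * t / L) * indicator {0..L} t) =
      (LINT t|lborel. indicator {0<..<L} t * smear lam m (real n * t / L))"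
  proof (rule integral_cong_AE)
    have [measurable]: "(\<lambda>t. smear lam m (real n * t / L)) \<in> borel_measurable borel"
      by (rule measurable_compose[OF borel_measurable_continuous_onI smear_borel(1)]) (use assms in \<open>intro continuous_intros, simp\<close>)
    show "(\<lambda>t. smear lam m (real n * t / L) * indicator {0..L} t) \<in> borel_measurable lborel"
      "(\<lambda>t. indicator {0<..<L} t * smear lam m (real n * t / L)) \<in> borel_measurable lborel" by simp_all
    show "AE t in lborel. smear lam m (real n * t / L) * indicator {0..L} t = indicator {0<..<L} t * smear lam m (real n * t / L)"
      using AE_lborel_singleton[of 0] AE_lborel_singleton[of L]
      by eventually_elim (auto simp: indicator_def)
  qed
  finally show ?thesis .
qed

lemma chi_borel: "chi L lam n \<in> borel_measurable borel"
proof -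
  have "{t. in_layer L lam n t} = (\<Union>k\<in>{..<n}. {real k * L / real n<..<(real k + lam) * L / real n})"
    by (auto simp: in_layer_def)
  then have s: "{t. in_layer L lam n t} \<in> sets borel" by auto
  have "chi L lam n = (\<lambda>t. indicator {t. in_layer L lam n t} t - lam)" by (auto simp: chi_def fun_eq_iff)
  also have "\<dots> \<in> borel_measurable borel" using s by (intro borel_measurable_diff borel_measurable_indicator) auto
  finally show ?thesis .
qed

text \<open>The left-hand side does not mention \<open>n\<close>: the mean of the smeared indicator over \<open>n\<close> periods is that over one
period.\<close>

lemma wave_integral_limit:
  fixes \<mu> :: "nat \<Rightarrow> real"
  assumes "0 < lam" "lam < 1" "L > 0" "n \<ge> 1" "\<And>m. \<exists>E. (\<forall>y. (E has_real_derivative smear lam m y - \<mu> m) (at y)) \<and> (\<forall>k. E (real k) = E 0)"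
  shows "(\<lambda>m. L * \<mu> m) \<longlonglongrightarrow> (LINT t|lborel. indicator {0<..<L} t * (if wave lam (real n * t / L) > 0 then 1 else 0))"
proof -
  have m: "(\<lambda>t. h (real n * t / L)) \<in> borel_measurable borel" if "h \<in> borel_measurable borel" for h :: "real \<Rightarrow> real"
    by (rule measurable_compose[OF borel_measurable_continuous_onI that]) (use assms in \<open>intro continuous_intros, simp\<close>)
  note [measurable] = m[OF smear_borel(1)] m[OF smear_borel(2)]
  have "(\<lambda>m. LINT t|lborel. indicator {0<..<L} t * smear lam m (real n * t / L)) \<longlonglongrightarrow>
     (LINT t|lborel. indicator {0<..<L} t * (if wave lam (real n * t / L) > 0 then 1 else 0))"
  proof (rule integral_dominated_convergence[where w="indicator {0<..<L}"])
    show "AE t in lborel. norm (indicator {0<..<L} t * smear lam m (real n * t / L)) \<le> indicator {0<..<L} t" for m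
      using smear_bounds(1,2)[of lam m] by (intro AE_I2) (auto simp: indicator_def)
    show "AE t in lborel. (\<lambda>m. indicator {0<..<L} t * smear lam m (real n * t / L)) \<longlonglongrightarrow>
      indicator {0<..<L} t * (if wave lam (real n * t / L) > 0 then 1 else 0)"
      by (intro AE_I2 tendsto_mult tendsto_const smear_limit)
    show "integrable lborel (indicator {0<..<L} :: real \<Rightarrow> real)" using assms(3) by simp
  qed auto
  moreover have "(LINT t|lborel. indicator {0<..<L} t * smear lam m (real n * t / L)) = L * \<mu> m" for m
    using smear_integral[OF assms(3,4)] assms(5)[of m] by blast
  ultimately show ?thesis by simp
qed

text \<open>For \<open>n = 1\<close> the positivity set of the wave in \<open>(0, L)\<close> is one interval of length \<open>\<lambda> L\<close>; for larger \<open>n\<close>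
the value is the same because the smeared integrals do not depend on \<open>n\<close>.\<close>

lemma wave_integral:
  assumes "0 < lam" "lam < 1" "L > 0" "n \<ge> 1"
  shows "(LINT t|lborel. indicator {0<..<L} t * (if wave lam (real n * t / L) > 0 then 1 else 0)) = L * lam"
proof -
  have ex: "\<exists>\<mu>. \<exists>E. (\<forall>y. (E has_real_derivative smear lam m y - \<mu>) (at y)) \<and> (\<forall>k. E (real k) = E 0)" for m
    using smear_primitive[of lam m] by blast
  define \<mu> where "\<mu> = (\<lambda>m. SOME \<mu>. \<exists>E. (\<forall>y. (E has_real_derivative smear lam m y - \<mu>) (at y)) \<and> (\<forall>k. E (real k) = E 0))"
  have \<mu>: "\<exists>E. (\<forall>y. (E has_real_derivative smear lam m y - \<mu> m) (at y)) \<and> (\<forall>k. E (real k) = E 0)" for m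
    unfolding \<mu>_def by (rule someI_ex[OF ex])
  have "(LINT t|lborel. indicator {0<..<L} t * (if wave lam (real 1 * t / L) > 0 then 1 else 0 :: real)) =
     (LINT t|lborel. indicator {0<..<lam * L} t)"
  proof (rule Bochner_Integration.integral_cong)
    fix t
    show "indicator {0<..<L} t * (if wave lam (real 1 * t / L) > 0 then 1 else 0) = (indicator {0<..<lam * L} t :: real)"
    proof (cases "0 < t \<and> t < L")
      case True
      then have "wave lam (t / L) > 0 \<longleftrightarrow> t < lam * L"
        using wave_pos_iff[OF assms(1,2), of "t / L"] assms(3) by (simp add: pos_divide_less_eq)
      then show ?thesis using True by (simp add: indicator_def)
    next
      case False
      have "lam * L < L" using assms by simp
      then show ?thesis using False by (auto simp: indicator_def)
    qed
  qed simp
  also have "\<dots> = lam * L" using assms by simp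
  finally have 1: "(\<lambda>m. L * \<mu> m) \<longlonglongrightarrow> lam * L"
    using wave_integral_limit[OF assms(1-3) order_refl \<mu>] by simp
  from LIMSEQ_unique[OF wave_integral_limit[OF assms \<mu>] 1] show ?thesis by (simp add: mult.commute)
qed

text \<open>A smooth substitute for the primitive of \<open>chi\<close>: of size \<open>O(1/n)\<close> on \<open>[0, L]\<close>, with a derivative that is
within \<open>\<delta>\<close> of \<open>chi\<close> in \<open>L\<^sup>2\<close>. Smoothness matters because \<open>D(x\<^sub>1) * \<phi>\<close> has to be a test function.\<close>

definition corrector :: "real \<Rightarrow> real \<Rightarrow> real \<Rightarrow> real \<Rightarrow> real \<Rightarrow> nat \<Rightarrow> (real \<Rightarrow> real) \<Rightarrow> (real \<Rightarrow> real) \<Rightarrow> bool" where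
  "corrector L H lam \<delta> B n D D' \<longleftrightarrow> smooth1 D \<and> (\<forall>t. (D has_real_derivative D' t) (at t)) \<and>
     (\<forall>t\<in>{0..L}. \<bar>D t\<bar> \<le> B / real n) \<and> (\<forall>t. \<bar>D' t\<bar> \<le> 1) \<and>
     l2 (OM L H) (\<lambda>x. D' (fst x) - chi L lam n (fst x)) \<le> \<delta>"

text \<open>The constant \<open>B\<close> is independent of \<open>n\<close>: the same periodic primitive is rescaled. The \<open>L\<^sup>2\<close> error is also independent
of \<open>n\<close>; since the smeared indicator lies below the sharp one, it is controlled by the difference of
the means, \<open>\<lambda> - \<mu>\<close>, which tends to zero as the smearing is refined.\<close>

lemma corrector_exists:
  assumes "0 < lam" "lam < 1" "L > 0" "H > 0" "\<delta> > 0"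
  shows "\<exists>B\<ge>0. \<forall>n\<ge>1. \<exists>D D'. corrector L H lam \<delta> B n D D'"
proof -
  define Q where "Q = (\<lambda>m p. (\<forall>y. ((fst p) has_real_derivative smear lam m y - fst (snd p)) (at y)) \<and> 0 \<le> fst (snd p) \<and> fst (snd p) \<le> 1 \<and>
     (\<forall>k. fst p (real k) = fst p 0) \<and> (\<forall>y\<ge>0. \<bar>fst p y\<bar> \<le> snd (snd p)))"
  have "\<exists>p. Q m p" for m
    using smear_primitive[of lam m] unfolding Q_def by simp
  then obtain p where p: "\<And>m. Q m (p m)" using choice[of Q] by blast
  define E \<mu> C where "E = (\<lambda>m. fst (p m))" and "\<mu> = (\<lambda>m. fst (snd (p m)))" and "C = (\<lambda>m. snd (snd (p m)))"
  have E: "\<forall>y. (E m has_real_derivative smear lam m y - \<mu> m) (at y)" "0 \<le> \<mu> m" "\<mu> m \<le> 1"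
    "\<forall>k. E m (real k) = E m 0" "\<And>y. y \<ge> 0 \<Longrightarrow> \<bar>E m y\<bar> \<le> C m" for m
    using p[of m] by (auto simp: Q_def E_def \<mu>_def C_def)
  have "(\<lambda>m. L * \<mu> m) \<longlonglongrightarrow> L * lam"
    using wave_integral_limit[OF assms(1-3) order_refl, of \<mu>] E(1,4) unfolding wave_integral[OF assms(1-3) order_refl] by blast
  from tendsto_mult[OF tendsto_const[of "1 / L"] this] have \<mu>lim: "\<mu> \<longlonglongrightarrow> lam" using assms(3) by simp
  have "(\<lambda>m. 2 * H * (2 * (L * (lam - \<mu> m)) + 2 * L * (lam - \<mu> m)\<^sup>2)) \<longlonglongrightarrow> 2 * H * (2 * (L * (lam - lam)) + 2 * L * (lam - lam)\<^sup>2)"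
    by (intro tendsto_intros \<mu>lim)
  then have "\<forall>\<^sub>F m in sequentially. 2 * H * (2 * (L * (lam - \<mu> m)) + 2 * L * (lam - \<mu> m)\<^sup>2) < \<delta>\<^sup>2"
    using assms(5) by (intro order_tendstoD) auto
  then obtain m where m: "2 * H * (2 * (L * (lam - \<mu> m)) + 2 * L * (lam - \<mu> m)\<^sup>2) < \<delta>\<^sup>2"
    by (auto simp: eventually_sequentially)
  have C: "C m \<ge> 0" using E(5)[of 0 m] by linarith
  have "corrector L H lam \<delta> (L * C m) n (\<lambda>t. L / real n * E m (real n * t / L)) (\<lambda>t. smear lam m (real n * t / L) - \<mu> m)"
    if n: "n \<ge> 1" for n
    unfolding corrector_def
  proof (intro conjI allI ballI)
    have n': "real n > 0" using n by simp
    let ?D = "\<lambda>t. L / real n * E m (real n * t / L)" and ?D' = "\<lambda>t. smear lam m (real n * t / L) - \<mu> m"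
    have "smooth1 (E m)"
    proof -
      have "smooth1 ((\<lambda>_::unit. E m) ())"
        by (rule smooth1_genI[where F="\<lambda>_::unit. E m" and F'="\<lambda>_ y. smear lam m y - \<mu> m"])
          (auto intro!: gen.smooth smooth_diff smooth1_smear smooth_const E(1)[rule_format])
      then show ?thesis by simp
    qed
    moreover have "smooth (\<lambda>x::real \<times> real. real n / L * fst x)" by (intro smooth_scale smooth_fst)
    ultimately have "smooth (\<lambda>x::real \<times> real. E m (real n / L * fst x))" by (rule smooth1_comp)
    from smooth_scale[OF this, of "L / real n"] show "smooth1 ?D" by simp
    show "(?D has_real_derivative ?D' t) (at t)" for t
    proof -
      have "((\<lambda>t. E m (real n * t / L)) has_real_derivative (smear lam m (real n * t / L) - \<mu> m) * (real n / L)) (at t)"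
        by (rule DERIV_chain2[OF E(1)[rule_format]]) (use assms(3) in \<open>auto intro!: derivative_eq_intros\<close>)
      from DERIV_cmult[OF this, of "L / real n"] show ?thesis using n' assms(3) by simp
    qed
    show "\<bar>?D t\<bar> \<le> L * C m / real n" if "t \<in> {0..L}" for t
      using E(5)[of "real n * t / L" m] that n' assms(3) by (simp add: abs_mult divide_right_mono)
    show "\<bar>?D' t\<bar> \<le> 1" for t using E(2,3)[of m] smear_bounds(1,2)[where y="real n * t / L" and m=m and lam=lam] by linarith
    define w where "w = (\<lambda>t. if wave lam (real n * t / L) > 0 then 1 else (0::real))"
    define s where "s = (\<lambda>t. smear lam m (real n * t / L))"
    have meas: "(\<lambda>t. h (real n * t / L)) \<in> borel_measurable borel" if "h \<in> borel_measurable borel" for h :: "real \<Rightarrow> real"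
      by (rule measurable_compose[OF borel_measurable_continuous_onI that]) (use assms in \<open>intro continuous_intros, simp\<close>)
    have [measurable]: "s \<in> borel_measurable borel" "w \<in> borel_measurable borel" "chi L lam n \<in> borel_measurable borel"
      using meas[OF smear_borel(1)] meas[OF smear_borel(2)] chi_borel by (auto simp: s_def w_def)
    have s01: "0 \<le> s t" "s t \<le> w t" "w t \<le> 1" for t
      using smear_bounds[where y="real n * t / L" and m=m and lam=lam] by (auto simp: s_def w_def not_less)
    have ii: "integrable lborel (\<lambda>t. indicator {0<..<L} t * h t)" if "h \<in> borel_measurable borel" "\<And>t. \<bar>h t\<bar> \<le> b" for h :: "real \<Rightarrow> real" and b
    proof (rule Bochner_Integration.integrable_bound)
      show "integrable lborel (\<lambda>t. b * indicator {0<..<L} t :: real)" using assms(3) by simp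
      show "AE t in lborel. norm (indicator {0<..<L} t * h t) \<le> norm (b * indicator {0<..<L} t :: real)"
        using that(2) by (intro AE_I2) (auto simp: indicator_def intro: order_trans[OF _ abs_ge_self])
    qed (use that in simp)
    have q: "(s t - \<mu> m - chi L lam n t)\<^sup>2 \<le> 2 * (w t - s t) + 2 * (lam - \<mu> m)\<^sup>2" if "0 < t" "t < L" for t
    proof -
      have "chi L lam n t = w t - lam"
        using in_layer_wave[OF assms(1-3) n that] by (simp add: chi_def w_def)
      then have "s t - \<mu> m - chi L lam n t = (s t - w t) + (lam - \<mu> m)" by simp
      then have "(s t - \<mu> m - chi L lam n t)\<^sup>2 = ((s t - w t) + (lam - \<mu> m))\<^sup>2" by (simp only:)
      also have "\<dots> \<le> 2 * (s t - w t)\<^sup>2 + 2 * (lam - \<mu> m)\<^sup>2"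
        using sum_squares_bound[of "s t - w t" "lam - \<mu> m"] by (simp add: power2_sum)
      also have "(s t - w t)\<^sup>2 = (w t - s t) * (w t - s t)" by (simp add: power2_eq_square algebra_simps)
      also have "\<dots> \<le> (w t - s t) * 1" using s01[of t] by (intro mult_left_mono) auto
      finally show ?thesis by simp
    qed
    have b: "\<bar>s t - \<mu> m - chi L lam n t\<bar> \<le> 3" for t
      using s01[of t] E(2,3)[of m] assms(1,2) by (auto simp: chi_def)
    have "(l2 (OM L H) (\<lambda>x. ?D' (fst x) - chi L lam n (fst x)))\<^sup>2 = (LINT x|OM L H. (s (fst x) - \<mu> m - chi L lam n (fst x))\<^sup>2)"
      by (simp add: l2_square s_def)
    also have "\<dots> = 2 * H * (LINT t|lborel. indicator {0<..<L} t * (s t - \<mu> m - chi L lam n t)\<^sup>2)"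
    proof (rule integral_fst_Omega[where B="3\<^sup>2"])
      show "\<bar>(s t - \<mu> m - chi L lam n t)\<^sup>2\<bar> \<le> 3\<^sup>2" for t
        using power_mono[OF b[of t], of 2] by simp
    qed (use assms in measurable)
    also have "\<dots> \<le> 2 * H * (LINT t|lborel. 2 * (indicator {0<..<L} t * w t - indicator {0<..<L} t * s t) + 2 * (lam - \<mu> m)\<^sup>2 * indicator {0<..<L} t)"
    proof (intro mult_left_mono Bochner_Integration.integral_mono)
      show "integrable lborel (\<lambda>t. indicator {0<..<L} t * (s t - \<mu> m - chi L lam n t)\<^sup>2)"
      proof (rule ii[where b="3\<^sup>2"])
        show "\<bar>(s t - \<mu> m - chi L lam n t)\<^sup>2\<bar> \<le> 3\<^sup>2" for t
          using power_mono[OF b[of t], of 2] by simp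
      qed measurable
      have "\<bar>w t\<bar> \<le> 1" "\<bar>s t\<bar> \<le> 1" for t using s01[of t] by auto
      then show "integrable lborel (\<lambda>t. 2 * (indicator {0<..<L} t * w t - indicator {0<..<L} t * s t) + 2 * (lam - \<mu> m)\<^sup>2 * indicator {0<..<L} t)"
        using assms(3) by (intro Bochner_Integration.integrable_add integrable_mult_right Bochner_Integration.integrable_diff ii[where b=1]) auto
      show "indicator {0<..<L} t * (s t - \<mu> m - chi L lam n t)\<^sup>2
         \<le> 2 * (indicator {0<..<L} t * w t - indicator {0<..<L} t * s t) + 2 * (lam - \<mu> m)\<^sup>2 * indicator {0<..<L} t" for t
        using q[of t] by (auto simp: indicator_def)
    qed (use assms in auto)
    also have "(LINT t|lborel. 2 * (indicator {0<..<L} t * w t - indicator {0<..<L} t * s t) + 2 * (lam - \<mu> m)\<^sup>2 * indicator {0<..<L} t)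
       = 2 * (L * lam - L * \<mu> m) + 2 * (lam - \<mu> m)\<^sup>2 * L"
    proof -
      have 1: "\<bar>w t\<bar> \<le> 1" "\<bar>s t\<bar> \<le> 1" for t using s01[of t] by auto
      have i: "integrable lborel (\<lambda>t. indicator {0<..<L} t * w t)" "integrable lborel (\<lambda>t. indicator {0<..<L} t * s t)"
        "integrable lborel (indicator {0<..<L} :: real \<Rightarrow> real)"
        using assms(3) 1 by (auto intro!: ii[where b=1])
      have "(LINT t|lborel. indicator {0<..<L} t * w t) = L * lam"
        unfolding w_def by (rule wave_integral[OF assms(1-3) n])
      moreover have "(LINT t|lborel. indicator {0<..<L} t * s t) = L * \<mu> m"
        unfolding s_def by (rule smear_integral[OF assms(3) n E(1,4)])
      moreover have "(LINT t|lborel. indicator {0<..<L} t) = L" using assms(3) by simp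
      ultimately show ?thesis using i by simp
    qed
    finally have "(l2 (OM L H) (\<lambda>x. ?D' (fst x) - chi L lam n (fst x)))\<^sup>2 \<le> \<delta>\<^sup>2"
      using m by (simp add: algebra_simps)
    then show "l2 (OM L H) (\<lambda>x. ?D' (fst x) - chi L lam n (fst x)) \<le> \<delta>"
      by (rule power2_le_imp_le) (use assms in simp)
  qed
  then show ?thesis using C assms(3) by (intro exI[of _ "L * C m"]) auto
qed

section \<open>Weak limits of the layer oscillation\<close>

lemma chi_bounds: "0 < lam \<Longrightarrow> lam < 1 \<Longrightarrow> \<bar>chi L lam n t\<bar> \<le> 1"
  by (auto simp: chi_def)

lemma fst_borel:
  assumes "h \<in> borel_measurable borel"
  shows "(\<lambda>x::real \<times> real. h (fst x) :: real) \<in> borel_measurable (OM L H)"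
  by (rule borel_measurable_lebesgue_onI, rule measurable_compose[OF borel_measurable_continuous_onI assms])
     (intro continuous_intros)

lemma integral_CS_bound:
  assumes "sqi M f" "sqi M g" "l2 M f \<le> a" "l2 M g \<le> b"
  shows "\<bar>LINT x|M. f x * g x\<bar> \<le> a * b"
  using l2_Cauchy_Schwarz[OF assms(1,2)] mult_mono[OF assms(3,4) order_trans[OF l2_nonneg assms(3)] l2_nonneg]
  by linarith

lemma corrector_facts:
  assumes "corrector L H lam \<delta> B n D D'" "n \<ge> 1" "0 < lam" "lam < 1"
  shows "(\<lambda>x. D (fst x)) \<in> borel_measurable (OM L H)" "(\<lambda>x. D' (fst x)) \<in> borel_measurable (OM L H)"
    "AE x in OM L H. \<bar>D (fst x)\<bar> \<le> B / real n" "smooth1 D" "\<And>t. (D has_real_derivative D' t) (at t)"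
    "sqi (OM L H) (\<lambda>x. D' (fst x) - chi L lam n (fst x))"
    "AE x in OM L H. \<bar>D' (fst x)\<bar> \<le> 1"
proof -
  note c = assms(1)[unfolded corrector_def]
  show D: "smooth1 D" "\<And>t. (D has_real_derivative D' t) (at t)" using c by blast+
  show "(\<lambda>x. D (fst x)) \<in> borel_measurable (OM L H)" "(\<lambda>x. D' (fst x)) \<in> borel_measurable (OM L H)"
    using D(1) smooth1_deriv[OF D] by (auto intro: borel_measurable_lebesgue_onI smooth_borel)
  show "AE x in OM L H. \<bar>D (fst x)\<bar> \<le> B / real n"
    using c by (intro AE_I2) (auto simp: Omega_def)
  show "AE x in OM L H. \<bar>D' (fst x)\<bar> \<le> 1" using c by (intro AE_I2) auto
  show "sqi (OM L H) (\<lambda>x. D' (fst x) - chi L lam n (fst x))"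
  proof (rule sqi_bounded[of _ _ _ 2])
    show "(\<lambda>x. D' (fst x) - chi L lam n (fst x)) \<in> borel_measurable (OM L H)"
      by (rule borel_measurable_diff[OF \<open>(\<lambda>x. D' (fst x)) \<in> borel_measurable (OM L H)\<close> fst_borel[OF chi_borel]])
    fix x :: "real \<times> real"
    have "\<bar>D' (fst x)\<bar> \<le> 1" using c by blast
    then show "\<bar>D' (fst x) - chi L lam n (fst x)\<bar> \<le> 2" using chi_bounds[OF assms(3,4), of L n "fst x"] by linarith
  qed
qed

text \<open>Replace \<open>chi\<close> by \<open>D'\<close> at the cost \<open>b \<delta> K\<close>; then \<open>D' \<phi> = \<partial>\<^sub>1 (D \<phi>) - D \<partial>\<^sub>1 \<phi>\<close>, and the curl identity turns
the first term into the integral of \<open>D \<partial>\<^sub>2 \<phi> * v\<^sub>1\<close>. Everything left over contains the small factor \<open>D\<close>.\<close>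

lemma chi_test_curl:
  assumes c: "corrector L H lam \<delta> B n D D'" and n: "n \<ge> 1" and lam: "0 < lam" "lam < 1"
    and \<phi>: "mixed_test (split_domain L H) \<phi>" "\<And>x. \<bar>\<phi> x\<bar> \<le> b"
    and v: "v \<in> grads L H g l" "l2 (OM L H) (\<lambda>x. fst (v x)) \<le> K" "l2 (OM L H) (\<lambda>x. snd (v x)) \<le> K"
    and "B \<ge> 0"
  shows "\<bar>LINT x|OM L H. (chi L lam n (fst x) * \<phi> x) * snd (v x)\<bar>
     \<le> b * \<delta> * K + B / real n * (l2 (OM L H) (partial1 \<phi>) + l2 (OM L H) (partial2 \<phi>)) * K"
proof -
  let ?N = "OM L H"
  note cf = corrector_facts[OF c n lam]
  have t: "test_function (split_domain L H) \<phi>" "smooth \<phi>" using \<phi>(1) by (auto simp: mixed_test_def test_function_smooth)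
  have b0: "b \<ge> 0" using \<phi>(2)[of 0] by linarith
  have Bn: "B / real n \<ge> 0" using \<open>B \<ge> 0\<close> by simp
  note sv = grads_sqi[OF v(1)]
  note s\<phi> = test_sqi[OF t(1), of L H] test_sqi[OF test_function_partial(1)[OF t(1)], of L H] test_sqi[OF test_function_partial(2)[OF t(1)], of L H]
  have m\<phi>: "\<phi> \<in> borel_measurable ?N" using s\<phi>(1) by (rule sqi_measurable)
  let ?\<rho> = "\<lambda>x. \<phi> x * (D' (fst x) - chi L lam n (fst x))"
  have \<rho>: "sqi ?N ?\<rho>" "l2 ?N ?\<rho> \<le> b * \<delta>"
  proof -
    have "l2 ?N ?\<rho> \<le> b * l2 ?N (\<lambda>x. D' (fst x) - chi L lam n (fst x))"
      by (rule sqi_bounded_mult(2)[OF cf(6) m\<phi> _ b0]) (use \<phi>(2) in simp)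
    also have "\<dots> \<le> b * \<delta>" using c b0 by (intro mult_left_mono) (auto simp: corrector_def)
    finally show "l2 ?N ?\<rho> \<le> b * \<delta>" .
    show "sqi ?N ?\<rho>" by (rule sqi_bounded_mult(1)[OF cf(6) m\<phi> _ b0]) (use \<phi>(2) in simp)
  qed
  note D1 = sqi_bounded_mult[OF s\<phi>(2) cf(1) cf(3) Bn] and D2 = sqi_bounded_mult[OF s\<phi>(3) cf(1) cf(3) Bn]
    and D'\<phi> = sqi_bounded_mult(1)[OF s\<phi>(1) cf(2) cf(7) zero_le_one]
  have "(LINT x|?N. (chi L lam n (fst x) * \<phi> x) * snd (v x)) =
      (LINT x|?N. (D (fst x) * partial1 \<phi> x + D' (fst x) * \<phi> x) * snd (v x) - D (fst x) * partial1 \<phi> x * snd (v x) - ?\<rho> x * snd (v x))"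
    by (rule Bochner_Integration.integral_cong) (auto simp: algebra_simps)
  also have "\<dots> = (LINT x|?N. (D (fst x) * partial1 \<phi> x + D' (fst x) * \<phi> x) * snd (v x))
      - (LINT x|?N. D (fst x) * partial1 \<phi> x * snd (v x)) - (LINT x|?N. ?\<rho> x * snd (v x))"
    using sqi_mult_integrable[OF sqi_add[OF D1(1) D'\<phi>] sv(2)] sqi_mult_integrable[OF D1(1) sv(2)] sqi_mult_integrable[OF \<rho>(1) sv(2)]
    by (simp only: Bochner_Integration.integral_diff Bochner_Integration.integrable_diff)
  also have "(LINT x|?N. (D (fst x) * partial1 \<phi> x + D' (fst x) * \<phi> x) * snd (v x)) = (LINT x|?N. D (fst x) * partial2 \<phi> x * fst (v x))"
    using grads_curl[OF v(1) mixed_test_mult_fst[OF \<phi>(1) cf(4)]] by (simp add: partial_mult_fst[OF t(2) cf(5)])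
  finally have e: "(LINT x|?N. (chi L lam n (fst x) * \<phi> x) * snd (v x)) =
    (LINT x|?N. D (fst x) * partial2 \<phi> x * fst (v x)) - (LINT x|?N. D (fst x) * partial1 \<phi> x * snd (v x)) - (LINT x|?N. ?\<rho> x * snd (v x))" .
  have "\<bar>LINT x|?N. D (fst x) * partial2 \<phi> x * fst (v x)\<bar> \<le> B / real n * l2 ?N (partial2 \<phi>) * K"
    by (rule integral_CS_bound[OF D2(1) sv(1) D2(2) v(2)])
  moreover have "\<bar>LINT x|?N. D (fst x) * partial1 \<phi> x * snd (v x)\<bar> \<le> B / real n * l2 ?N (partial1 \<phi>) * K"
    by (rule integral_CS_bound[OF D1(1) sv(2) D1(2) v(3)])
  moreover have "\<bar>LINT x|?N. ?\<rho> x * snd (v x)\<bar> \<le> b * \<delta> * K"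
    by (rule integral_CS_bound[OF \<rho>(1) sv(2) \<rho>(2) v(3)])
  ultimately show ?thesis unfolding e by (simp add: distrib_left distrib_right)
qed

text \<open>The same replacement, now with \<open>D' \<phi>\<^sup>2 = \<partial>\<^sub>1 (D \<phi>\<^sup>2) - 2 D \<phi> \<partial>\<^sub>1 \<phi>\<close>.\<close>

lemma chi_test_square:
  assumes c: "corrector L H lam \<delta> B n D D'" and n: "n \<ge> 1" and lam: "0 < lam" "lam < 1"
    and \<phi>: "mixed_test (split_domain L H) \<phi>" "\<And>x. \<bar>\<phi> x\<bar> \<le> b" and "B \<ge> 0"
  shows "\<bar>LINT x|OM L H. (chi L lam n (fst x) * \<phi> x) * \<phi> x\<bar>
     \<le> b * \<delta> * l2 (OM L H) \<phi> + B / real n * (2 * l2 (OM L H) (partial1 \<phi>) * l2 (OM L H) \<phi>)"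
proof -
  let ?N = "OM L H"
  note cf = corrector_facts[OF c n lam]
  have t: "test_function (split_domain L H) \<phi>" "smooth \<phi>" using \<phi>(1) by (auto simp: mixed_test_def test_function_smooth)
  have b0: "b \<ge> 0" using \<phi>(2)[of 0] by linarith
  have Bn: "B / real n \<ge> 0" using \<open>B \<ge> 0\<close> by simp
  note s\<phi> = test_sqi[OF t(1), of L H] test_sqi[OF test_function_partial(1)[OF t(1)], of L H]
  have m\<phi>: "\<phi> \<in> borel_measurable ?N" using s\<phi>(1) by (rule sqi_measurable)
  let ?\<rho> = "\<lambda>x. \<phi> x * (D' (fst x) - chi L lam n (fst x))"
  have \<rho>: "sqi ?N ?\<rho>" "l2 ?N ?\<rho> \<le> b * \<delta>"
  proof -
    have "l2 ?N ?\<rho> \<le> b * l2 ?N (\<lambda>x. D' (fst x) - chi L lam n (fst x))"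
      by (rule sqi_bounded_mult(2)[OF cf(6) m\<phi> _ b0]) (use \<phi>(2) in simp)
    also have "\<dots> \<le> b * \<delta>" using c b0 by (intro mult_left_mono) (auto simp: corrector_def)
    finally show "l2 ?N ?\<rho> \<le> b * \<delta>" .
    show "sqi ?N ?\<rho>" by (rule sqi_bounded_mult(1)[OF cf(6) m\<phi> _ b0]) (use \<phi>(2) in simp)
  qed
  note D1 = sqi_bounded_mult[OF s\<phi>(2) cf(1) cf(3) Bn]
    and D'\<phi> = sqi_bounded_mult(1)[OF s\<phi>(1) cf(2) cf(7) zero_le_one]
  have t2: "test_function (split_domain L H) (\<lambda>x. \<phi> x * \<phi> x)" using t by (rule test_function_mult)
  have t3: "test_function (split_domain L H) (\<lambda>x. D (fst x) * (\<phi> x * \<phi> x))" using test_function_mult[OF t2 cf(4)] by simp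
  have O: "split_domain L H \<subseteq> Omega L H" using split_domain_subset by blast
  have p: "partial1 (\<lambda>x. D (fst x) * (\<phi> x * \<phi> x)) = (\<lambda>x. D (fst x) * partial1 \<phi> x * \<phi> x + D (fst x) * partial1 \<phi> x * \<phi> x + D' (fst x) * \<phi> x * \<phi> x)"
    unfolding partial_mult_fst[OF smooth_mult[OF t(2,2)] cf(5)] partial_mult[OF smooth_differentiable[OF t(2)] smooth_differentiable[OF t(2)]]
    by (simp add: algebra_simps)
  have z: "(LINT x|?N. D (fst x) * partial1 \<phi> x * \<phi> x + D (fst x) * partial1 \<phi> x * \<phi> x + D' (fst x) * \<phi> x * \<phi> x) = 0"
    using integral_partial_test_function(1)[OF test_function_mono[OF t3 O] Omega_facts(4)] unfolding p .
  note i = sqi_mult_integrable[OF D1(1) s\<phi>(1)] sqi_mult_integrable[OF D'\<phi> s\<phi>(1)] sqi_mult_integrable[OF \<rho>(1) s\<phi>(1)]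
  have "(LINT x|?N. (chi L lam n (fst x) * \<phi> x) * \<phi> x) =
      (LINT x|?N. D' (fst x) * \<phi> x * \<phi> x - ?\<rho> x * \<phi> x)"
    by (rule Bochner_Integration.integral_cong) (auto simp: algebra_simps)
  also have "\<dots> = (LINT x|?N. D' (fst x) * \<phi> x * \<phi> x) - (LINT x|?N. ?\<rho> x * \<phi> x)"
    using i by (simp only: Bochner_Integration.integral_diff)
  also have "(LINT x|?N. D' (fst x) * \<phi> x * \<phi> x) = - 2 * (LINT x|?N. D (fst x) * partial1 \<phi> x * \<phi> x)"
    using z i by (simp only: Bochner_Integration.integral_add Bochner_Integration.integrable_add)
  finally have e: "(LINT x|?N. (chi L lam n (fst x) * \<phi> x) * \<phi> x) = - 2 * (LINT x|?N. D (fst x) * partial1 \<phi> x * \<phi> x) - (LINT x|?N. ?\<rho> x * \<phi> x)" .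
  have "\<bar>LINT x|?N. D (fst x) * partial1 \<phi> x * \<phi> x\<bar> \<le> B / real n * l2 ?N (partial1 \<phi>) * l2 ?N \<phi>"
    by (rule integral_CS_bound[OF D1(1) s\<phi>(1) D1(2) order_refl])
  moreover have "\<bar>LINT x|?N. ?\<rho> x * \<phi> x\<bar> \<le> b * \<delta> * l2 ?N \<phi>"
    by (rule integral_CS_bound[OF \<rho>(1) s\<phi>(1) \<rho>(2) order_refl])
  moreover have "B / real n * (2 * l2 ?N (partial1 \<phi>) * l2 ?N \<phi>) = 2 * (B / real n * l2 ?N (partial1 \<phi>) * l2 ?N \<phi>)" by simp
  moreover have "\<bar>- 2 * a - c\<bar> \<le> y + z" if "\<bar>a\<bar> \<le> x" "\<bar>c\<bar> \<le> y" "z = 2 * x" for a c x y z :: real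
    using that by linarith
  ultimately show ?thesis unfolding e by blast
qed

lemma eventually_div_le:
  fixes c e :: real assumes "e > 0"
  shows "\<forall>\<^sub>F n in sequentially. n \<ge> 1 \<and> c / real n * k \<le> e"
proof -
  have "(\<lambda>n. c / real n * k) \<longlonglongrightarrow> 0 * k"
    by (intro tendsto_mult tendsto_const tendsto_divide_0[OF tendsto_const] filterlim_at_top_imp_at_infinity filterlim_real_sequentially)
  then have "\<forall>\<^sub>F n in sequentially. c / real n * k < e" using assms by (intro order_tendstoD(2)) auto
  then show ?thesis using eventually_ge_at_top[of 1] by eventually_elim simp
qed

context
  fixes L H lam :: real
  assumes dom: "L > 0" "H > 0" "0 < lam" "lam < 1"
begin

lemma chi_mult:
  assumes "sqi (OM L H) p"
  shows "sqi (OM L H) (\<lambda>x. chi L lam n (fst x) * p x)" "l2 (OM L H) (\<lambda>x. chi L lam n (fst x) * p x) \<le> l2 (OM L H) p"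
proof -
  have a: "AE x in OM L H. \<bar>chi L lam n (fst x)\<bar> \<le> 1" using chi_bounds[OF dom(3,4)] by simp
  show "sqi (OM L H) (\<lambda>x. chi L lam n (fst x) * p x)" "l2 (OM L H) (\<lambda>x. chi L lam n (fst x) * p x) \<le> l2 (OM L H) p"
    using sqi_bounded_mult[OF assms fst_borel[OF chi_borel] a zero_le_one] by auto
qed

lemma density:
  assumes "sqi (OM L H) p" "\<epsilon> > 0"
  shows "\<exists>\<phi> b. mixed_test (split_domain L H) \<phi> \<and> l2 (OM L H) (\<lambda>x. p x - \<phi> x) \<le> \<epsilon> \<and> (\<forall>x. \<bar>\<phi> x\<bar> \<le> b) \<and> b > 0"
proof -
  obtain \<phi> where \<phi>: "mixed_test (split_domain L H) \<phi>" "l2 (OM L H) (\<lambda>x. p x - \<phi> x) \<le> \<epsilon>"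
    using approximable_sqi[OF assms(1)] assms(2) unfolding approximable_def by blast
  obtain b where "b \<ge> 0" "\<And>x. \<bar>\<phi> x\<bar> \<le> b"
    using test_function_bounded[of "split_domain L H" \<phi>] \<phi>(1) unfolding mixed_test_def by metis
  then have "\<forall>x. \<bar>\<phi> x\<bar> \<le> b + 1" "b + 1 > 0" by (auto intro: add_increasing2)
  with \<phi> show ?thesis by blast
qed

lemma chi_weak_square:
  assumes p: "sqi (OM L H) p" and "\<epsilon> > 0"
  shows "\<forall>\<^sub>F n in sequentially. \<bar>LINT x|OM L H. (chi L lam n (fst x) * p x) * p x\<bar> \<le> \<epsilon>"
proof -
  let ?N = "OM L H"
  define P where "P = l2 ?N p"
  have P: "P \<ge> 0" by (simp add: P_def l2_nonneg)
  define \<eta> where "\<eta> = min 1 (\<epsilon> / (4 * (2 * P + 1)))"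
  have \<eta>: "\<eta> > 0" "\<eta> \<le> 1" "\<eta> * (2 * P + 1) \<le> \<epsilon> / 4"
  proof -
    show "\<eta> > 0" "\<eta> \<le> 1" using assms P by (auto simp: \<eta>_def)
    have "\<eta> * (2 * P + 1) \<le> (\<epsilon> / (4 * (2 * P + 1))) * (2 * P + 1)"
      using P by (intro mult_right_mono) (auto simp: \<eta>_def)
    also have "\<dots> = \<epsilon> / 4" using P by (simp add: field_simps)
    finally show "\<eta> * (2 * P + 1) \<le> \<epsilon> / 4" .
  qed
  obtain \<phi> b where \<phi>: "mixed_test (split_domain L H) \<phi>" "l2 ?N (\<lambda>x. p x - \<phi> x) \<le> \<eta>" "\<And>x. \<bar>\<phi> x\<bar> \<le> b" "b > 0"
    using density[OF p \<eta>(1)] by blast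
  have s\<phi>: "sqi ?N \<phi>" using \<phi>(1) by (auto simp: mixed_test_def test_sqi)
  have l\<phi>: "l2 ?N \<phi> \<le> P + \<eta>"
    using l2_triangle[OF p sqi_diff[OF s\<phi> p]] \<phi>(2) l2_minus_commute[of ?N p \<phi>] by (simp add: P_def)
  define \<delta> where "\<delta> = \<epsilon> / (4 * b * (P + 1))"
  have \<delta>: "\<delta> > 0" "b * \<delta> * (P + 1) = \<epsilon> / 4"
  proof -
    have *: "b * (\<epsilon> / (4 * b * Q)) * Q = \<epsilon> / 4" if "Q > 0" for Q using that \<phi>(4) by simp
    show "\<delta> > 0" "b * \<delta> * (P + 1) = \<epsilon> / 4" using assms \<phi>(4) P *[of "P + 1"] by (auto simp: \<delta>_def)
  qed
  obtain B where B: "B \<ge> 0" "\<And>n. n \<ge> 1 \<Longrightarrow> \<exists>D D'. corrector L H lam \<delta> B n D D'"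
    using corrector_exists[OF dom(3,4,1,2) \<delta>(1)] by blast
  have "\<forall>\<^sub>F n in sequentially. n \<ge> 1 \<and> B / real n * (2 * l2 ?N (partial1 \<phi>) * l2 ?N \<phi>) \<le> \<epsilon> / 4"
    using assms by (intro eventually_div_le) auto
  then show ?thesis
  proof eventually_elim
    case (elim n)
    then obtain D D' where "corrector L H lam \<delta> B n D D'" using B(2) by blast
    from chi_test_square[OF this _ dom(3,4) \<phi>(1,3) B(1)] elim
    have 1: "\<bar>LINT x|?N. (chi L lam n (fst x) * \<phi> x) * \<phi> x\<bar> \<le> b * \<delta> * l2 ?N \<phi> + \<epsilon> / 4" by auto
    have "b * \<delta> * l2 ?N \<phi> \<le> b * \<delta> * (P + 1)"
      using \<phi>(4) \<delta>(1) l\<phi> \<eta>(2) by (intro mult_left_mono) auto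
    then have 2: "b * \<delta> * l2 ?N \<phi> \<le> \<epsilon> / 4" using \<delta>(2) by simp
    note sd = sqi_diff[OF p s\<phi>]
    have "(LINT x|?N. (chi L lam n (fst x) * p x) * p x) =
       (LINT x|?N. (chi L lam n (fst x) * p x) * (p x - \<phi> x) + (chi L lam n (fst x) * \<phi> x) * (p x - \<phi> x) + (chi L lam n (fst x) * \<phi> x) * \<phi> x)"
      by (rule Bochner_Integration.integral_cong) (auto simp: algebra_simps)
    also have "\<dots> = (LINT x|?N. (chi L lam n (fst x) * p x) * (p x - \<phi> x)) + (LINT x|?N. (chi L lam n (fst x) * \<phi> x) * (p x - \<phi> x)) + (LINT x|?N. (chi L lam n (fst x) * \<phi> x) * \<phi> x)"
      using sqi_mult_integrable[OF chi_mult(1)[OF p] sd, of n] sqi_mult_integrable[OF chi_mult(1)[OF s\<phi>] sd, of n] sqi_mult_integrable[OF chi_mult(1)[OF s\<phi>] s\<phi>, of n]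
      by (simp only: Bochner_Integration.integral_add Bochner_Integration.integrable_add)
    finally have e: "(LINT x|?N. (chi L lam n (fst x) * p x) * p x) = (LINT x|?N. (chi L lam n (fst x) * p x) * (p x - \<phi> x)) + (LINT x|?N. (chi L lam n (fst x) * \<phi> x) * (p x - \<phi> x)) + (LINT x|?N. (chi L lam n (fst x) * \<phi> x) * \<phi> x)" .
    have 3: "\<bar>LINT x|?N. (chi L lam n (fst x) * p x) * (p x - \<phi> x)\<bar> \<le> P * \<eta>"
      using chi_mult(2)[OF p, of n] by (intro integral_CS_bound[OF chi_mult(1)[OF p] sd]) (auto simp: P_def \<phi>)
    have 4: "\<bar>LINT x|?N. (chi L lam n (fst x) * \<phi> x) * (p x - \<phi> x)\<bar> \<le> (P + 1) * \<eta>"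
      using chi_mult(2)[OF s\<phi>, of n] l\<phi> \<eta>(2) by (intro integral_CS_bound[OF chi_mult(1)[OF s\<phi>] sd]) (auto simp: \<phi>)
    have "P * \<eta> + (P + 1) * \<eta> = \<eta> * (2 * P + 1)" by (simp add: algebra_simps)
    then show ?case using 1 2 3 4 \<eta>(3) assms(2) unfolding e by linarith
  qed
qed

text \<open>Uniformity over all gradients with a common norm bound is the point: compensated compactness
replaces strong convergence of the competitors.\<close>

lemma chi_weak_curl:
  assumes q: "sqi (OM L H) q" and "\<epsilon> > 0" "K > 0"
  shows "\<forall>\<^sub>F n in sequentially. \<forall>v\<in>grads L H g l. l2 (OM L H) (\<lambda>x. fst (v x)) \<le> K \<longrightarrow> l2 (OM L H) (\<lambda>x. snd (v x)) \<le> K \<longrightarrow>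
     \<bar>LINT x|OM L H. (chi L lam n (fst x) * q x) * snd (v x)\<bar> \<le> \<epsilon>"
proof -
  let ?N = "OM L H"
  define \<eta> where "\<eta> = \<epsilon> / (3 * K)"
  have \<eta>: "\<eta> > 0" "\<eta> * K = \<epsilon> / 3" using assms by (auto simp: \<eta>_def)
  obtain \<phi> b where \<phi>: "mixed_test (split_domain L H) \<phi>" "l2 ?N (\<lambda>x. q x - \<phi> x) \<le> \<eta>" "\<And>x. \<bar>\<phi> x\<bar> \<le> b" "b > 0"
    using density[OF q \<eta>(1)] by blast
  have s\<phi>: "sqi ?N \<phi>" using \<phi>(1) by (auto simp: mixed_test_def test_sqi)
  define \<delta> where "\<delta> = \<epsilon> / (3 * b * K)"
  have \<delta>: "\<delta> > 0" "b * \<delta> * K = \<epsilon> / 3" using assms \<phi>(4) by (auto simp: \<delta>_def)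
  obtain B where B: "B \<ge> 0" "\<And>n. n \<ge> 1 \<Longrightarrow> \<exists>D D'. corrector L H lam \<delta> B n D D'"
    using corrector_exists[OF dom(3,4,1,2) \<delta>(1)] by blast
  have "\<forall>\<^sub>F n in sequentially. n \<ge> 1 \<and> B / real n * ((l2 ?N (partial1 \<phi>) + l2 ?N (partial2 \<phi>)) * K) \<le> \<epsilon> / 3"
    using assms by (intro eventually_div_le) auto
  then show ?thesis
  proof eventually_elim
    case (elim n)
    then obtain D D' where c: "corrector L H lam \<delta> B n D D'" using B(2) by blast
    show ?case
    proof (intro ballI impI)
      fix v assume v: "v \<in> grads L H g l" "l2 ?N (\<lambda>x. fst (v x)) \<le> K" "l2 ?N (\<lambda>x. snd (v x)) \<le> K"
      note sv = grads_sqi(2)[OF v(1)]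
      have 1: "\<bar>LINT x|?N. (chi L lam n (fst x) * \<phi> x) * snd (v x)\<bar> \<le> \<epsilon> / 3 + \<epsilon> / 3"
      proof -
        have "B / real n * (l2 ?N (partial1 \<phi>) + l2 ?N (partial2 \<phi>)) * K \<le> \<epsilon> / 3"
          using elim by (simp only: mult.assoc)
        then show ?thesis using chi_test_curl[OF c _ dom(3,4) \<phi>(1,3) v B(1)] elim \<delta>(2) by linarith
      qed
      note sd = sqi_diff[OF q s\<phi>]
      have "(LINT x|?N. (chi L lam n (fst x) * q x) * snd (v x)) =
         (LINT x|?N. (chi L lam n (fst x) * (q x - \<phi> x)) * snd (v x) + (chi L lam n (fst x) * \<phi> x) * snd (v x))"
        by (rule Bochner_Integration.integral_cong) (auto simp: algebra_simps)
      also have "\<dots> = (LINT x|?N. (chi L lam n (fst x) * (q x - \<phi> x)) * snd (v x)) + (LINT x|?N. (chi L lam n (fst x) * \<phi> x) * snd (v x))"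
        using sqi_mult_integrable[OF chi_mult(1)[OF sd] sv, of n] sqi_mult_integrable[OF chi_mult(1)[OF s\<phi>] sv, of n]
        by (simp only: Bochner_Integration.integral_add)
      finally have e: "(LINT x|?N. (chi L lam n (fst x) * q x) * snd (v x)) =
         (LINT x|?N. (chi L lam n (fst x) * (q x - \<phi> x)) * snd (v x)) + (LINT x|?N. (chi L lam n (fst x) * \<phi> x) * snd (v x))" .
      have "\<bar>LINT x|?N. (chi L lam n (fst x) * (q x - \<phi> x)) * snd (v x)\<bar> \<le> \<eta> * K"
        by (rule integral_CS_bound[OF chi_mult(1)[OF sd] sv order_trans[OF chi_mult(2)[OF sd] \<phi>(2)] v(3)])
      then show "\<bar>LINT x|?N. (chi L lam n (fst x) * q x) * snd (v x)\<bar> \<le> \<epsilon>" using 1 \<eta>(2) unfolding e by linarith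
    qed
  qed
qed

end

section \<open>Homogenization of the energy\<close>

lemma layer_tensor_eq: "layer_tensor L lam CA CB n x = (if in_layer L lam n (fst x) then CA else CB)"
  by (simp add: layer_tensor_def in_layer_def)

lemma layer_tensor_borel: "layer_tensor L lam CA CB n \<in> borel_measurable borel"
proof -
  have "(\<lambda>x::real \<times> real. chi L lam n (fst x)) \<in> borel_measurable borel"
    by (rule measurable_compose[OF borel_measurable_continuous_onI chi_borel]) (intro continuous_intros)
  then have "{x::real \<times> real. - lam < chi L lam n (fst x)} \<in> sets borel" by simp
  moreover have "{x::real \<times> real. - lam < chi L lam n (fst x)} = {x. in_layer L lam n (fst x)}"
    by (auto simp: chi_def)
  ultimately have "{x::real \<times> real. in_layer L lam n (fst x)} \<in> sets borel" by simp
  then show ?thesis unfolding layer_tensor_eq[abs_def] by (intro measurable_If) auto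
qed

lemma common_ellipticity:
  assumes "0 < lam" "lam < 1" "fst CA > 0" "snd CA > 0" "fst CB > 0" "snd CB > 0"
  shows "\<exists>m K. elliptic m K (\<lambda>_. hom_tensor lam CA CB) \<and> (\<forall>L n. elliptic m K (layer_tensor L lam CA CB n))"
proof -
  let ?h = "hom_tensor lam CA CB"
  define S where "S = {fst CA, snd CA, fst CB, snd CB, fst ?h, snd ?h}"
  have h: "fst ?h > 0" "snd ?h > 0" using assms by (simp_all add: hom_tensor_def add_pos_pos)
  have S: "finite S" "S \<noteq> {}" "\<And>s. s \<in> S \<Longrightarrow> s > 0" using assms h by (auto simp: S_def)
  define m K where "m = Min S" and "K = Max S"
  have m: "m > 0" unfolding m_def using S(3)[OF Min_in[OF S(1,2)]] .
  have mK: "m \<le> s \<and> s \<le> K" if "s \<in> S" for s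
    unfolding m_def K_def using Min_le[OF S(1) that] Max_ge[OF S(1) that] by simp
  have *: "m \<le> fst CA \<and> fst CA \<le> K" "m \<le> snd CA \<and> snd CA \<le> K" "m \<le> fst CB \<and> fst CB \<le> K" "m \<le> snd CB \<and> snd CB \<le> K"
    "m \<le> fst ?h \<and> fst ?h \<le> K" "m \<le> snd ?h \<and> snd ?h \<le> K"
    by (rule mK, simp add: S_def)+
  have "elliptic m K (\<lambda>_. ?h)" "elliptic m K (layer_tensor L lam CA CB n)" for L n
    using layer_tensor_borel[of L lam CA CB n] m * unfolding elliptic_def layer_tensor_eq by simp_all
  then show ?thesis by blast
qed

context
  fixes L H lam :: real and CA CB :: "real \<times> real"
  assumes dom: "L > 0" "H > 0" "0 < lam" "lam < 1"
    and CA: "fst CA > 0" "snd CA > 0" and CB: "fst CB > 0" "snd CB > 0"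
begin

abbreviation "Cn \<equiv> layer_tensor L lam CA CB"
abbreviation "Ch \<equiv> (\<lambda>_::real \<times> real. hom_tensor lam CA CB)"
definition "ah = fst (hom_tensor lam CA CB)"
definition "bh = snd (hom_tensor lam CA CB)"
text \<open>The multiples of the oscillation in \<open>a\<^sub>h\<^sub>o\<^sub>m / a\<^sub>n\<close> (\<open>kap\<close>) and in the second diagonal entry (\<open>bet\<close>).\<close>

definition "kap = ah * (1 / fst CA - 1 / fst CB)"
definition "bet = snd CA - snd CB"

lemma ah_pos: "ah > 0" "bh > 0"
  using dom CA CB by (auto simp: ah_def bh_def hom_tensor_def intro!: divide_pos_pos add_pos_pos)

lemma tensor_pointwise:
  "snd (Cn n x) = bh + bet * chi L lam n (fst x)"
  "ah / fst (Cn n x) = 1 + kap * chi L lam n (fst x)"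
  "fst (Cn n x) > 0"
proof -
  show "snd (Cn n x) = bh + bet * chi L lam n (fst x)"
    by (auto simp: layer_tensor_eq bh_def bet_def chi_def hom_tensor_def algebra_simps)
  show "fst (Cn n x) > 0" using CA CB by (simp add: layer_tensor_eq)
  have "1 / ah = lam / fst CA + (1 - lam) / fst CB" by (simp add: ah_def hom_tensor_def)
  then have inv: "1 = ah * (lam / fst CA + (1 - lam) / fst CB)" using ah_pos by (simp add: field_simps)
  show "ah / fst (Cn n x) = 1 + kap * chi L lam n (fst x)"
  proof -
    have "ah * (1 / c) = ah * (lam / fst CA + (1 - lam) / fst CB) + ah * (1 / fst CA - 1 / fst CB) * (i - lam)"
      if "c = fst CA \<and> i = 1 \<or> c = fst CB \<and> i = 0" for c i
    proof -
      have "1 / c = (lam / fst CA + (1 - lam) / fst CB) + (1 / fst CA - 1 / fst CB) * (i - lam)"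
        using that CA CB by (auto simp: field_simps)
      then have "ah * (1 / c) = ah * ((lam / fst CA + (1 - lam) / fst CB) + (1 / fst CA - 1 / fst CB) * (i - lam))" by simp
      then show ?thesis by (simp only: distrib_left mult.assoc)
    qed
    from this[of "fst (Cn n x)" "if in_layer L lam n (fst x) then 1 else 0"] show ?thesis
      unfolding inv[symmetric] kap_def chi_def by (simp add: layer_tensor_eq)
  qed
qed

lemma integral_layer_form:
  assumes "sqi (OM L H) p" "sqi (OM L H) q"
  shows "(LINT x|OM L H. (ah * (1 + kap * chi L lam n (fst x)) * p x) * p x + (bh + bet * chi L lam n (fst x)) * q x * q x)
    = (LINT x|OM L H. ah * p x * p x + bh * q x * q x)
     + ah * kap * (LINT x|OM L H. (chi L lam n (fst x) * p x) * p x) + bet * (LINT x|OM L H. (chi L lam n (fst x) * q x) * q x)"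
proof -
  let ?N = "OM L H" and ?c = "\<lambda>x. chi L lam n (fst x)"
  have i: "integrable ?N (\<lambda>x. (?c x * p x) * p x)" "integrable ?N (\<lambda>x. (?c x * q x) * q x)"
    using assms chi_mult(1)[OF dom] by (auto intro!: sqi_mult_integrable)
  have j: "integrable ?N (\<lambda>x. ah * p x * p x + bh * q x * q x)"
    using assms by (intro Bochner_Integration.integrable_add sqi_mult_integrable sqi_scale)
  have "(LINT x|?N. (ah * (1 + kap * ?c x) * p x) * p x + (bh + bet * ?c x) * q x * q x) =
    (LINT x|?N. (ah * p x * p x + bh * q x * q x) + ah * kap * ((?c x * p x) * p x) + bet * ((?c x * q x) * q x))"
    by (rule Bochner_Integration.integral_cong) (auto simp: algebra_simps)
  then show ?thesis using i j by simp
qed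

lemma en_hom: "en L H Ch v = (LINT x|OM L H. ah * fst (v x) * fst (v x) + bh * snd (v x) * snd (v x))"
  by (simp add: en_def quad_form_def ah_def bh_def power2_eq_square mult.assoc)

text \<open>Pointwise Young inequality \<open>a p\<^sup>2 \<ge> 2 a p p' - a p'\<^sup>2\<close>, in the first variable at \<open>p' = (a\<^sub>h\<^sub>o\<^sub>m / a\<^sub>n) w\<^sub>1\<close>, for which the
mixed term is the homogenized one, and in the second at \<open>p' = w\<^sub>2\<close>.\<close>

lemma en_layer_lower:
  assumes ell: "elliptic m K Ch" "elliptic m K (Cn n)" and w: "sq2 L H w" and v: "sq2 L H v"
  shows "en L H (Cn n) v \<ge> 2 * bil L H Ch w v - en L H Ch w
     - ah * kap * (LINT x|OM L H. (chi L lam n (fst x) * fst (w x)) * fst (w x))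
     - bet * (LINT x|OM L H. (chi L lam n (fst x) * snd (w x)) * snd (w x))
     + 2 * bet * (LINT x|OM L H. (chi L lam n (fst x) * snd (w x)) * snd (v x))"
proof -
  let ?N = "OM L H" and ?c = "\<lambda>x. chi L lam n (fst x)"
  have sv: "sqi ?N (\<lambda>x. fst (v x))" "sqi ?N (\<lambda>x. snd (v x))" and sw: "sqi ?N (\<lambda>x. fst (w x))" "sqi ?N (\<lambda>x. snd (w x))"
    using v w by (auto simp: sq2_def)
  let ?F = "\<lambda>x. (ah * (1 + kap * ?c x) * fst (w x)) * fst (w x) + (bh + bet * ?c x) * snd (w x) * snd (w x)"
  let ?B = "\<lambda>x. fst (Ch x) * fst (w x) * fst (v x) + snd (Ch x) * snd (w x) * snd (v x)"
  let ?X = "\<lambda>x. (?c x * snd (w x)) * snd (v x)"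
  have iF: "integrable ?N ?F"
  proof -
    have "integrable ?N (\<lambda>x. (ah * fst (w x) * fst (w x) + bh * snd (w x) * snd (w x)) + ah * kap * ((?c x * fst (w x)) * fst (w x)) + bet * ((?c x * snd (w x)) * snd (w x)))"
      using sw chi_mult(1)[OF dom] by (intro Bochner_Integration.integrable_add integrable_mult_right sqi_mult_integrable sqi_scale) auto
    then show ?thesis by (simp add: algebra_simps)
  qed
  have iB: "integrable ?N ?B" using bil_integrable[OF ell(1) w v] by auto
  have iX: "integrable ?N ?X" using sv sw chi_mult(1)[OF dom] by (intro sqi_mult_integrable)
  have lin: "integrable ?N (\<lambda>x. 2 * F1 x + k * F2 x - F3 x)"
    "(LINT x|?N. 2 * F1 x + k * F2 x - F3 x) = 2 * (LINT x|?N. F1 x) + k * (LINT x|?N. F2 x) - (LINT x|?N. F3 x)"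
    if "integrable ?N F1" "integrable ?N F2" "integrable ?N F3" for F1 F2 F3 :: "real \<times> real \<Rightarrow> real" and k
    using that by simp_all
  have "(LINT x|?N. 2 * ?B x + 2 * bet * ?X x - ?F x) \<le> en L H (Cn n) v"
    unfolding en_def
  proof (rule Bochner_Integration.integral_mono)
    show "integrable ?N (\<lambda>x. 2 * ?B x + 2 * bet * ?X x - ?F x)" by (rule lin(1)[OF iB iX iF])
    show "integrable ?N (\<lambda>x. quad_form (Cn n x) (v x))"
      using bil_integrable[OF ell(2) v v] by (simp add: quad_form_def power2_eq_square mult.assoc)
    fix x
    let ?a = "fst (Cn n x)" and ?b = "snd (Cn n x)"
    have a: "?a > 0" "ah / ?a = 1 + kap * ?c x" using tensor_pointwise by auto
    have b: "?b \<ge> 0" using CA CB by (simp add: layer_tensor_eq)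
    have "0 \<le> ?a * (fst (v x) - (ah / ?a) * fst (w x))\<^sup>2" using a by simp
    also have "\<dots> = ?a * (fst (v x))\<^sup>2 - 2 * ah * fst (w x) * fst (v x) + ah * (ah / ?a) * (fst (w x))\<^sup>2"
      using a(1) by (simp add: power2_eq_square field_simps)
    finally have 1: "2 * ah * fst (w x) * fst (v x) - ah * (1 + kap * ?c x) * (fst (w x))\<^sup>2 \<le> ?a * (fst (v x))\<^sup>2"
      unfolding a(2) by simp
    have "0 \<le> ?b * (snd (v x) - snd (w x))\<^sup>2" using b by simp
    then have 2: "2 * (?b * snd (w x) * snd (v x)) - ?b * (snd (w x))\<^sup>2 \<le> ?b * (snd (v x))\<^sup>2"
      by (simp add: power2_eq_square algebra_simps)
    have e: "2 * ?B x + 2 * bet * ?X x - ?F x = (2 * ah * fst (w x) * fst (v x) - ah * (1 + kap * ?c x) * (fst (w x))\<^sup>2)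
      + (2 * (?b * snd (w x) * snd (v x)) - ?b * (snd (w x))\<^sup>2)"
      unfolding tensor_pointwise(1) by (simp add: ah_def[symmetric] bh_def[symmetric] power2_eq_square algebra_simps)
    show "2 * ?B x + 2 * bet * ?X x - ?F x \<le> quad_form (Cn n x) (v x)"
      unfolding e quad_form_def using 1 2 by linarith
  qed
  also have "(LINT x|?N. 2 * ?B x + 2 * bet * ?X x - ?F x) = 2 * bil L H Ch w v + 2 * bet * (LINT x|?N. ?X x) - (LINT x|?N. ?F x)"
    unfolding bil_def by (rule lin(2)[OF iB iX iF])
  finally show ?thesis unfolding integral_layer_form[OF sw] en_hom by linarith
qed

text \<open>The first component of the corrected field carries the same stress \<open>a\<^sub>h\<^sub>o\<^sub>m v\<^sub>1\<close> in both materials, which is what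
makes the harmonic mean appear.\<close>

lemma en_layer_corrected:
  assumes v: "sq2 L H v"
  shows "en L H (Cn n) (\<lambda>x. ((1 + kap * chi L lam n (fst x)) * fst (v x), snd (v x))) = en L H Ch v
     + ah * kap * (LINT x|OM L H. (chi L lam n (fst x) * fst (v x)) * fst (v x))
     + bet * (LINT x|OM L H. (chi L lam n (fst x) * snd (v x)) * snd (v x))"
proof -
  let ?c = "\<lambda>x. chi L lam n (fst x)"
  have "quad_form (Cn n x) ((1 + kap * ?c x) * fst (v x), snd (v x)) =
     (ah * (1 + kap * ?c x) * fst (v x)) * fst (v x) + (bh + bet * ?c x) * snd (v x) * snd (v x)" for x
  proof -
    have "fst (Cn n x) * (1 + kap * ?c x)\<^sup>2 = ah * (1 + kap * ?c x)"
      unfolding tensor_pointwise(2)[symmetric] using tensor_pointwise(3)[of n x] by (simp add: power2_eq_square)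
    then have "fst (Cn n x) * ((1 + kap * ?c x) * fst (v x))\<^sup>2 = ah * (1 + kap * ?c x) * (fst (v x))\<^sup>2"
      by (simp add: power_mult_distrib mult.assoc[symmetric])
    then show ?thesis by (simp add: quad_form_def tensor_pointwise(1) power2_eq_square mult.assoc)
  qed
  then show ?thesis using integral_layer_form[of "\<lambda>x. fst (v x)" "\<lambda>x. snd (v x)" n] v
    by (simp add: en_def[of _ _ "Cn n"] en_hom sq2_def)
qed

text \<open>Apply the lower bound at a near-minimizer \<open>w\<close> of the homogenized energy. The main term \<open>2 bil w v - en w\<close> equals
\<open>en w + 2 bil w (v - w)\<close>, and the last summand is small by the approximate Euler--Lagrange equation.\<close>

lemma energy_liminf:
  assumes ne: "grads L H g l \<noteq> {}" and "\<epsilon> > 0"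
  shows "\<forall>\<^sub>F n in sequentially. energy L H g Ch l - \<epsilon> \<le> energy L H g (Cn n) l"
proof -
  let ?N = "OM L H"
  obtain m K where ell: "elliptic m K Ch" "\<And>n. elliptic m K (Cn n)"
    using common_ellipticity[OF dom(3,4) CA CB] by blast
  have mK: "m > 0" "K > 0" using elliptic_components(5,6)[OF ell(1)] by auto
  define E where "E = energy L H g Ch l"
  have E0: "E \<ge> 0" unfolding E_def
    by (rule energy_greatest[OF ne]) (use en_bounds(3)[OF ell(1) grads_sq2] in simp)
  define R where "R = sqrt (2 * (E + 1) / m)"
  have R: "R > 0" "R\<^sup>2 = 2 * (E + 1) / m" using E0 mK by (auto simp: R_def)
  \<comment> \<open>\<open>8 R\<^sup>2\<close> bounds the squared \<open>L\<^sup>2\<close> norm of \<open>v - w\<close> (twice \<open>(2 R)\<^sup>2\<close>), so \<open>M\<close> bounds its energy.\<close>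
  define M where "M = K * (8 * R\<^sup>2)"
  have M: "M > 0" unfolding M_def using mK(2) R(1) by (intro mult_pos_pos zero_less_power) auto
  define \<eta> where "\<eta> = min 1 (min (\<epsilon> / 4) ((\<epsilon> / 4)\<^sup>2 / (2 * M)))"
  have \<eta>: "\<eta> > 0" "\<eta> \<le> 1" "\<eta> \<le> \<epsilon> / 4" "2 * \<eta> * M \<le> (\<epsilon> / 4)\<^sup>2"
  proof -
    show "\<eta> > 0" "\<eta> \<le> 1" "\<eta> \<le> \<epsilon> / 4" using assms M by (auto simp: \<eta>_def)
    have "\<eta> * (2 * M) \<le> (\<epsilon> / 4)\<^sup>2 / (2 * M) * (2 * M)" using M by (intro mult_right_mono) (auto simp: \<eta>_def)
    then show "2 * \<eta> * M \<le> (\<epsilon> / 4)\<^sup>2" using M by (simp add: mult.commute mult.left_commute)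
  qed
  obtain w where w: "w \<in> grads L H g l" "1/2 * en L H Ch w < E + \<eta>"
    using energy_approx[OF ell(1) ne \<eta>(1)] unfolding E_def by blast
  have sw: "sq2 L H w" "sqi ?N (\<lambda>x. fst (w x))" "sqi ?N (\<lambda>x. snd (w x))" using w(1) grads_sq2 grads_sqi by auto
  have small: "l2 ?N (\<lambda>x. fst (v x)) \<le> R \<and> l2 ?N (\<lambda>x. snd (v x)) \<le> R"
    if "elliptic m K C" "sq2 L H v" "1/2 * en L H C v \<le> E + 1" for C v
  proof -
    have "m * ((l2 ?N (\<lambda>x. fst (v x)))\<^sup>2 + (l2 ?N (\<lambda>x. snd (v x)))\<^sup>2) \<le> 2 * (E + 1)"
      using that(3) by (intro order_trans[OF en_bounds(1)[OF that(1,2)]]) simp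
    then have "(l2 ?N (\<lambda>x. fst (v x)))\<^sup>2 + (l2 ?N (\<lambda>x. snd (v x)))\<^sup>2 \<le> R\<^sup>2"
      unfolding R(2) using mK by (simp add: pos_le_divide_eq mult.commute)
    then have "(l2 ?N (\<lambda>x. fst (v x)))\<^sup>2 \<le> R\<^sup>2" "(l2 ?N (\<lambda>x. snd (v x)))\<^sup>2 \<le> R\<^sup>2"
      using zero_le_power2[of "l2 ?N (\<lambda>x. fst (v x))"] zero_le_power2[of "l2 ?N (\<lambda>x. snd (v x))"] by linarith+
    then show ?thesis using power2_le_imp_le[OF _ less_imp_le[OF R(1)]] by blast
  qed
  have wR: "l2 ?N (\<lambda>x. fst (w x)) \<le> R" "l2 ?N (\<lambda>x. snd (w x)) \<le> R"
    using small[OF ell(1) sw(1)] w(2) \<eta>(2) by auto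
  define c where "c = \<bar>ah * kap\<bar> + \<bar>bet\<bar> + 2 * \<bar>bet\<bar> + 1"
  have c: "c > 0" by (simp add: c_def)
  define \<zeta> where "\<zeta> = \<epsilon> / (4 * c)"
  have \<zeta>: "\<zeta> > 0" "c * \<zeta> = \<epsilon> / 4" using assms c by (auto simp: \<zeta>_def)
  have "\<forall>\<^sub>F n in sequentially. \<bar>LINT x|?N. (chi L lam n (fst x) * fst (w x)) * fst (w x)\<bar> \<le> \<zeta>"
    "\<forall>\<^sub>F n in sequentially. \<bar>LINT x|?N. (chi L lam n (fst x) * snd (w x)) * snd (w x)\<bar> \<le> \<zeta>"
    using chi_weak_square[OF dom sw(2) \<zeta>(1)] chi_weak_square[OF dom sw(3) \<zeta>(1)] by auto
  moreover have "\<forall>\<^sub>F n in sequentially. \<forall>v\<in>grads L H g l. l2 ?N (\<lambda>x. fst (v x)) \<le> R \<longrightarrow> l2 ?N (\<lambda>x. snd (v x)) \<le> R \<longrightarrow>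
     \<bar>LINT x|?N. (chi L lam n (fst x) * snd (w x)) * snd (v x)\<bar> \<le> \<zeta>"
    by (rule chi_weak_curl[OF dom sw(3) \<zeta>(1) R(1)])
  ultimately show ?thesis
  proof eventually_elim
    case (elim n)
    show ?case
    proof (rule energy_greatest[OF ne])
      fix v assume v: "v \<in> grads L H g l"
      note sv = grads_sq2[OF v]
      show "energy L H g Ch l - \<epsilon> \<le> 1/2 * en L H (Cn n) v"
      proof (cases "1/2 * en L H (Cn n) v \<le> E + 1")
        case False
        then show ?thesis using assms(2) by (simp add: E_def)
      next
        case True
        have vR: "l2 ?N (\<lambda>x. fst (v x)) \<le> R" "l2 ?N (\<lambda>x. snd (v x)) \<le> R"
          using small[OF ell(2) sv True] by auto
        let ?P = "LINT x|?N. (chi L lam n (fst x) * fst (w x)) * fst (w x)"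
        let ?Q = "LINT x|?N. (chi L lam n (fst x) * snd (w x)) * snd (w x)"
        let ?X = "LINT x|?N. (chi L lam n (fst x) * snd (w x)) * snd (v x)"
        have abs: "\<bar>?P\<bar> \<le> \<zeta>" "\<bar>?Q\<bar> \<le> \<zeta>" "\<bar>?X\<bar> \<le> \<zeta>" using elim v vR by auto
        have "\<bar>ah * kap * ?P\<bar> \<le> \<bar>ah * kap\<bar> * \<zeta>" "\<bar>bet * ?Q\<bar> \<le> \<bar>bet\<bar> * \<zeta>" "\<bar>2 * bet * ?X\<bar> \<le> 2 * \<bar>bet\<bar> * \<zeta>"
          using abs by (auto simp only: abs_mult abs_numeral intro!: mult_left_mono abs_ge_zero mult_nonneg_nonneg zero_le_numeral)
        moreover have "\<bar>ah * kap\<bar> * \<zeta> + \<bar>bet\<bar> * \<zeta> + 2 * \<bar>bet\<bar> * \<zeta> \<le> \<epsilon> / 4"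
          using \<zeta> unfolding c_def by (simp add: algebra_simps)
        ultimately have err: "ah * kap * ?P + bet * ?Q - 2 * bet * ?X \<le> \<epsilon> / 4" by linarith
        let ?z = "\<lambda>x. v x - w x"
        have sz: "sq2 L H ?z" by (rule sq2_diff[OF sv sw(1)])
        have "l2 ?N (\<lambda>x. fst (v x) - fst (w x)) \<le> 2 * R" "l2 ?N (\<lambda>x. snd (v x) - snd (w x)) \<le> 2 * R"
          using l2_triangle[of ?N "\<lambda>x. fst (v x)" "\<lambda>x. (-1) * fst (w x)"] l2_triangle[of ?N "\<lambda>x. snd (v x)" "\<lambda>x. (-1) * snd (w x)"]
            sv sw sqi_scale[OF sw(2), of "-1"] sqi_scale[OF sw(3), of "-1"] l2_scale[of ?N "-1"] vR wR by (auto simp: sq2_def)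
        from power_mono[OF this(1) l2_nonneg, of 2] power_mono[OF this(2) l2_nonneg, of 2]
        have "(l2 ?N (\<lambda>x. fst (?z x)))\<^sup>2 \<le> (2 * R)\<^sup>2" "(l2 ?N (\<lambda>x. snd (?z x)))\<^sup>2 \<le> (2 * R)\<^sup>2"
          by simp_all
        then have "(l2 ?N (\<lambda>x. fst (?z x)))\<^sup>2 + (l2 ?N (\<lambda>x. snd (?z x)))\<^sup>2 \<le> 8 * R\<^sup>2" by (simp add: power_mult_distrib)
        then have "en L H Ch ?z \<le> M"
          unfolding M_def using mK by (intro order_trans[OF en_bounds(2)[OF ell(1) sz]] mult_left_mono) auto
        then have "2 * \<eta> * en L H Ch ?z \<le> 2 * \<eta> * M" using \<eta>(1) by (intro mult_left_mono) auto
        moreover have "(bil L H Ch w ?z)\<^sup>2 \<le> 2 * \<eta> * en L H Ch ?z"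
          using w(2) \<eta>(1) by (intro near_minimizer_EL[OF ell(1) w(1) v]) (auto simp: E_def)
        ultimately have "(bil L H Ch w ?z)\<^sup>2 \<le> (\<epsilon> / 4)\<^sup>2" using \<eta>(4) by linarith
        then have "\<bar>bil L H Ch w ?z\<bar> \<le> \<epsilon> / 4" using assms(2) by (simp add: abs_le_square_iff[symmetric])
        moreover have "bil L H Ch w v = en L H Ch w + bil L H Ch w ?z"
          using bil_add_right[OF ell(1) sw(1) sw(1) sz, of 1] by (simp add: en_bil)
        moreover have "2 * E \<le> en L H Ch w" using energy_lower[OF ell(1) w(1)] by (simp add: E_def)
        ultimately show ?thesis
          using en_layer_lower[OF ell(1) ell(2) sw(1) sv, of n] err assms(2) unfolding E_def[symmetric] by linarith
      qed
    qed
  qed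
qed

text \<open>For a near-minimizer \<open>w\<close> of the homogenized energy the competitor is \<open>w\<close> plus the gradient of \<open>kap * D(x\<^sub>1) * \<phi>\<close> with \<open>\<phi>\<close> a test function close to \<open>w\<^sub>1\<close>; it differs
from the corrected field \<open>((1 + kap * chi) w\<^sub>1, w\<^sub>2)\<close> by little in \<open>L\<^sup>2\<close>.\<close>

lemma energy_limsup:
  assumes ne: "grads L H g l \<noteq> {}" and "\<epsilon> > 0"
  shows "\<forall>\<^sub>F n in sequentially. energy L H g (Cn n) l \<le> energy L H g Ch l + \<epsilon>"
proof -
  let ?N = "OM L H"
  obtain m K where ell: "elliptic m K Ch" "\<And>n. elliptic m K (Cn n)"
    using common_ellipticity[OF dom(3,4) CA CB] by blast
  have mK: "m > 0" "K > 0" using elliptic_components(5,6)[OF ell(1)] by auto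
  define E where "E = energy L H g Ch l"
  have "\<epsilon> / 4 > 0" using assms by simp
  then obtain w where w: "w \<in> grads L H g l" "1/2 * en L H Ch w < E + \<epsilon> / 4"
    using energy_approx[OF ell(1) ne] unfolding E_def by blast
  have sw: "sq2 L H w" "sqi ?N (\<lambda>x. fst (w x))" "sqi ?N (\<lambda>x. snd (w x))" using w(1) grads_sq2 grads_sqi by auto
  define W where "W = en L H Ch w + \<epsilon> + 1"
  have W: "W > 0" using en_bounds(3)[OF ell(1) sw(1)] assms by (simp add: W_def)
  \<comment> \<open>\<open>S * r\<close> bounds the change of the energy under a perturbation with components of norm at most \<open>r \<le> 1\<close>.\<close>
  define S where "S = 2 * sqrt (W * K) + 2 * K"
  have S: "S > 0" using W mK by (simp add: S_def add_pos_pos)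
  define r where "r = min 1 (\<epsilon> / (2 * S))"
  have r: "r > 0" "r \<le> 1" "S * r \<le> \<epsilon> / 2"
  proof -
    show "r > 0" "r \<le> 1" using S assms by (auto simp: r_def)
    have "S * r \<le> S * (\<epsilon> / (2 * S))" using S by (intro mult_left_mono) (auto simp: r_def)
    then show "S * r \<le> \<epsilon> / 2" using S by simp
  qed
  define k where "k = \<bar>kap\<bar> + 1"
  have k: "k > 0" "\<bar>kap\<bar> \<le> k" by (auto simp: k_def)
  define \<eta> where "\<eta> = r / (3 * k)"
  have \<eta>: "\<eta> > 0" "k * \<eta> = r / 3" using r k by (auto simp: \<eta>_def)
  obtain \<phi> b where \<phi>: "mixed_test (split_domain L H) \<phi>" "l2 ?N (\<lambda>x. fst (w x) - \<phi> x) \<le> \<eta>" "\<And>x. \<bar>\<phi> x\<bar> \<le> b" "b > 0"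
    using density[OF dom sw(2) \<eta>(1)] by blast
  have t\<phi>: "test_function (split_domain L H) \<phi>" "smooth \<phi>" using \<phi>(1) by (auto simp: mixed_test_def test_function_smooth)
  note s\<phi> = test_sqi[OF t\<phi>(1), of L H] test_sqi[OF test_function_partial(1)[OF t\<phi>(1)], of L H] test_sqi[OF test_function_partial(2)[OF t\<phi>(1)], of L H]
  define \<delta> where "\<delta> = r / (3 * (k * b))"
  have \<delta>: "\<delta> > 0" "k * (b * \<delta>) = r / 3" using r k \<phi>(4) by (auto simp: \<delta>_def)
  obtain B where B: "B \<ge> 0" "\<And>n. n \<ge> 1 \<Longrightarrow> \<exists>D D'. corrector L H lam \<delta> B n D D'"
    using corrector_exists[OF dom(3,4,1,2) \<delta>(1)] by blast
  define c where "c = \<bar>ah * kap\<bar> + \<bar>bet\<bar> + 1"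
  have c: "c > 0" by (simp add: c_def)
  define \<zeta> where "\<zeta> = min 1 \<epsilon> / (2 * c)"
  have \<zeta>: "\<zeta> > 0" "c * \<zeta> = min 1 \<epsilon> / 2" using assms c by (auto simp: \<zeta>_def)
  have "\<forall>\<^sub>F n in sequentially. \<bar>LINT x|?N. (chi L lam n (fst x) * fst (w x)) * fst (w x)\<bar> \<le> \<zeta>"
    "\<forall>\<^sub>F n in sequentially. \<bar>LINT x|?N. (chi L lam n (fst x) * snd (w x)) * snd (w x)\<bar> \<le> \<zeta>"
    using chi_weak_square[OF dom sw(2) \<zeta>(1)] chi_weak_square[OF dom sw(3) \<zeta>(1)] by auto
  moreover have "\<forall>\<^sub>F n in sequentially. n \<ge> 1 \<and> B / real n * ((l2 ?N (partial1 \<phi>) + l2 ?N (partial2 \<phi>)) * k) \<le> r / 3"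
    using r by (intro eventually_div_le) auto
  ultimately show ?thesis
  proof eventually_elim
    case (elim n)
    then have n: "n \<ge> 1" by simp
    obtain D D' where cor: "corrector L H lam \<delta> B n D D'" using B(2)[OF n] by blast
    note cf = corrector_facts[OF cor n dom(3,4)]
    have Bn: "B / real n \<ge> 0" using B by simp
    let ?c = "\<lambda>x. chi L lam n (fst x)"
    let ?\<psi> = "\<lambda>x. kap * (D (fst x) * \<phi> x)"
    let ?v = "\<lambda>x. w x + gradient ?\<psi> x"
    have \<psi>: "test_function (split_domain L H) (\<lambda>x. D (fst x) * \<phi> x)" by (rule test_function_mult[OF t\<phi>(1) cf(4)])
    have t\<psi>: "test_function (split_domain L H) ?\<psi>" by (rule test_function_mult[OF \<psi> smooth_const])
    have v: "?v \<in> grads L H g l" by (rule grads_add_test[OF w(1) t\<psi>])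
    have grad: "gradient ?\<psi> x = (kap * (D (fst x) * partial1 \<phi> x + D' (fst x) * \<phi> x), kap * (D (fst x) * partial2 \<phi> x))" for x
      unfolding gradient_def partial_scale[OF test_function_smooth[OF \<psi>]] partial_mult_fst[OF t\<phi>(2) cf(5)] ..
    let ?w = "\<lambda>x. ((1 + kap * ?c x) * fst (w x), snd (w x))"
    let ?e = "\<lambda>x. (kap * (\<phi> x * (D' (fst x) - ?c x)) + (kap * (?c x * (\<phi> x - fst (w x))) + kap * (D (fst x) * partial1 \<phi> x)), kap * (D (fst x) * partial2 \<phi> x))"
    have dec: "?v = (\<lambda>x. ?w x + 1 *\<^sub>R ?e x)"
      unfolding grad by (rule ext) (simp add: prod_eq_iff algebra_simps)
    note D1 = sqi_bounded_mult[OF s\<phi>(2) cf(1) cf(3) Bn] and D2 = sqi_bounded_mult[OF s\<phi>(3) cf(1) cf(3) Bn]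
    have m\<phi>: "\<phi> \<in> borel_measurable ?N" using s\<phi>(1) by (rule sqi_measurable)
    have \<rho>: "sqi ?N (\<lambda>x. \<phi> x * (D' (fst x) - ?c x))" "l2 ?N (\<lambda>x. \<phi> x * (D' (fst x) - ?c x)) \<le> b * \<delta>"
    proof -
      have "l2 ?N (\<lambda>x. \<phi> x * (D' (fst x) - ?c x)) \<le> b * l2 ?N (\<lambda>x. D' (fst x) - ?c x)"
        by (rule sqi_bounded_mult(2)[where c=b, OF cf(6) m\<phi>]) (use \<phi> in auto)
      also have "\<dots> \<le> b * \<delta>" using cor \<phi>(4) by (intro mult_left_mono) (auto simp: corrector_def)
      finally show "l2 ?N (\<lambda>x. \<phi> x * (D' (fst x) - ?c x)) \<le> b * \<delta>" .
      show "sqi ?N (\<lambda>x. \<phi> x * (D' (fst x) - ?c x))" by (rule sqi_bounded_mult(1)[where c=b, OF cf(6) m\<phi>]) (use \<phi> in auto)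
    qed
    have sd: "sqi ?N (\<lambda>x. \<phi> x - fst (w x))" "l2 ?N (\<lambda>x. \<phi> x - fst (w x)) \<le> \<eta>"
      using sqi_diff[OF s\<phi>(1) sw(2)] \<phi>(2) l2_minus_commute[of ?N \<phi> "\<lambda>x. fst (w x)"] by auto
    note cd = chi_mult[OF dom sd(1), of n]
    have se: "sq2 L H ?e" unfolding sq2_def fst_conv snd_conv by (intro conjI sqi_add sqi_scale \<rho>(1) cd(1) D1(1) D2(1))
    have kl: "l2 ?N (\<lambda>x. kap * h x) \<le> k * y" if "l2 ?N h \<le> y" for h y
      unfolding l2_scale using that k l2_nonneg by (intro mult_mono) auto
    have le1: "l2 ?N (\<lambda>x. fst (?e x)) \<le> k * (b * \<delta>) + (k * \<eta> + k * (B / real n * l2 ?N (partial1 \<phi>)))"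
      unfolding fst_conv
      using l2_triangle[OF sqi_scale[OF \<rho>(1), of kap] sqi_add[OF sqi_scale[OF cd(1), of kap] sqi_scale[OF D1(1), of kap]]]
        l2_triangle[OF sqi_scale[OF cd(1), of kap] sqi_scale[OF D1(1), of kap]]
        kl[OF \<rho>(2)] kl[OF order_trans[OF cd(2) sd(2)]] kl[OF D1(2)] by linarith
    have le2: "l2 ?N (\<lambda>x. snd (?e x)) \<le> k * (B / real n * l2 ?N (partial2 \<phi>))"
      unfolding snd_conv by (rule kl[OF D2(2)])
    have "k * (X * p1) + k * (X * p2) = X * ((p1 + p2) * k)" for X p1 p2 :: real
      by (simp add: algebra_simps)
    then have "k * (B / real n * l2 ?N (partial1 \<phi>)) + k * (B / real n * l2 ?N (partial2 \<phi>)) \<le> r / 3"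
      using elim(3) by (simp only:)
    moreover have "0 \<le> k * (B / real n * l2 ?N (partial1 \<phi>))" "0 \<le> k * (B / real n * l2 ?N (partial2 \<phi>))"
      by (intro mult_nonneg_nonneg less_imp_le[OF k(1)] Bn l2_nonneg)+
    ultimately have le: "l2 ?N (\<lambda>x. fst (?e x)) \<le> r" "l2 ?N (\<lambda>x. snd (?e x)) \<le> r"
      using le1 le2 \<eta>(2) \<delta>(2) r(1) by linarith+
    have "(l2 ?N (\<lambda>x. fst (?e x)))\<^sup>2 + (l2 ?N (\<lambda>x. snd (?e x)))\<^sup>2 \<le> r\<^sup>2 + r\<^sup>2"
      using le by (intro add_mono power_mono l2_nonneg)
    then have "K * ((l2 ?N (\<lambda>x. fst (?e x)))\<^sup>2 + (l2 ?N (\<lambda>x. snd (?e x)))\<^sup>2) \<le> K * (2 * r\<^sup>2)"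
      using mK by (intro mult_left_mono) auto
    then have ene: "en L H (Cn n) ?e \<le> 2 * K * r\<^sup>2" using en_bounds(2)[OF ell(2)[of n] se] by linarith
    let ?P = "LINT x|?N. (?c x * fst (w x)) * fst (w x)" and ?Q = "LINT x|?N. (?c x * snd (w x)) * snd (w x)"
    have "\<bar>ah * kap * ?P\<bar> \<le> \<bar>ah * kap\<bar> * \<zeta>" "\<bar>bet * ?Q\<bar> \<le> \<bar>bet\<bar> * \<zeta>"
      using elim by (auto simp only: abs_mult intro!: mult_left_mono abs_ge_zero mult_nonneg_nonneg)
    moreover have "\<bar>ah * kap\<bar> * \<zeta> + \<bar>bet\<bar> * \<zeta> + \<zeta> = min 1 \<epsilon> / 2"
      using \<zeta>(2) unfolding c_def by (simp only: distrib_right mult_1_left)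
    ultimately have enw: "en L H (Cn n) ?w \<le> en L H Ch w + min 1 \<epsilon> / 2"
      using en_layer_corrected[OF sw(1), of n] \<zeta>(1) by linarith
    have sww: "sq2 L H ?w"
    proof -
      have "sqi ?N (\<lambda>x. fst (w x) + kap * (?c x * fst (w x)))" by (intro sqi_add sqi_scale chi_mult[OF dom] sw)
      then show ?thesis using sw by (simp add: sq2_def algebra_simps)
    qed
    have "(bil L H (Cn n) ?w ?e)\<^sup>2 \<le> en L H (Cn n) ?w * en L H (Cn n) ?e" by (rule bil_Cauchy_Schwarz[OF ell(2) sww se])
    also have "\<dots> \<le> W * (2 * K * r\<^sup>2)"
      using enw ene assms(2) W en_bounds(3)[OF ell(2) se] by (intro mult_mono) (auto simp: W_def)
    also have "\<dots> \<le> (2 * sqrt (W * K) * r)\<^sup>2" using W mK by (simp add: power_mult_distrib)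
    finally have "\<bar>bil L H (Cn n) ?w ?e\<bar> \<le> \<bar>2 * sqrt (W * K) * r\<bar>" by (simp only: abs_le_square_iff)
    then have "\<bar>bil L H (Cn n) ?w ?e\<bar> \<le> 2 * sqrt (W * K) * r"
      using W mK r(1) by (simp add: abs_mult)
    moreover have "2 * K * r\<^sup>2 \<le> 2 * (K * r)"
    proof -
      have "r * r \<le> r * 1" using r by (intro mult_left_mono) auto
      then have "K * (r * r) \<le> K * r" using mK(2) by (intro mult_left_mono) auto
      then show ?thesis by (simp add: power2_eq_square)
    qed
    moreover have "en L H (Cn n) ?v = en L H (Cn n) ?w + 2 * bil L H (Cn n) ?w ?e + en L H (Cn n) ?e"
      unfolding dec using en_add[OF ell(2) sww se, of n 1] by simp
    moreover have "S * r = 2 * sqrt (W * K) * r + 2 * (K * r)" by (simp add: S_def algebra_simps)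
    moreover have "min 1 \<epsilon> \<le> \<epsilon>" "0 \<le> K * r" using mK r(1) by simp_all
    ultimately have "1/2 * en L H (Cn n) ?v \<le> E + \<epsilon>"
      using w(2) r(3) enw ene by linarith
    then show ?case using energy_lower[OF ell(2) v, of n] unfolding E_def by linarith
  qed
qed

lemma energy_homogenization:
  assumes "grads L H g l \<noteq> {}"
  shows "(\<lambda>n. energy L H g (Cn n) l) \<longlonglongrightarrow> energy L H g Ch l"
proof (rule LIMSEQ_I)
  fix e :: real assume "e > 0"
  then have "e / 2 > 0" by simp
  have "\<forall>\<^sub>F n in sequentially. norm (energy L H g (Cn n) l - energy L H g Ch l) < e"
    using energy_liminf[OF assms \<open>e / 2 > 0\<close>] energy_limsup[OF assms \<open>e / 2 > 0\<close>]
    by eventually_elim (use \<open>e > 0\<close> in simp)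
  then show "\<exists>no. \<forall>n\<ge>no. norm (energy L H g (Cn n) l - energy L H g Ch l) < e"
    by (simp add: eventually_sequentially)
qed

end

section \<open>Transport of the energy along horizontal diffeomorphisms\<close>

definition diffeo :: "real \<Rightarrow> real \<Rightarrow> (real \<Rightarrow> real) \<Rightarrow> (real \<Rightarrow> real) \<Rightarrow> (real \<Rightarrow> real) \<Rightarrow> (real \<Rightarrow> real) \<Rightarrow> bool" where
  "diffeo L K \<Phi> \<Phi>' \<Psi> \<Psi>' \<longleftrightarrow> smooth1 \<Phi> \<and> smooth1 \<Psi> \<and>
     (\<forall>t. (\<Phi> has_real_derivative \<Phi>' t) (at t)) \<and> (\<forall>t. (\<Psi> has_real_derivative \<Psi>' t) (at t)) \<and>
     (\<forall>t. \<Phi> (\<Psi> t) = t \<and> \<Psi> (\<Phi> t) = t) \<and>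
     (\<forall>t. 0 < \<Phi>' t \<and> \<Phi>' t \<le> K) \<and> (\<forall>t. 0 < \<Psi>' t \<and> \<Psi>' t \<le> K) \<and> \<Phi> 0 = 0 \<and> \<Phi> L = L"

lemma diffeo_swap: "diffeo L K \<Phi> \<Phi>' \<Psi> \<Psi>' \<Longrightarrow> diffeo L K \<Psi> \<Psi>' \<Phi> \<Phi>'"
  unfolding diffeo_def by metis

text \<open>Moving points horizontally by an amount that depends on \<open>x\<^sub>1\<close> only preserves the rectangle, the mid-line and vertical
lines, and it keeps diagonal tensors diagonal.\<close>

definition shear :: "(real \<Rightarrow> real) \<Rightarrow> real \<times> real \<Rightarrow> real \<times> real" where
  "shear \<Phi> x = (\<Phi> (fst x), snd x)"

text \<open>Composition with a diffeomorphism is only safe for Borel functions: Lebesgue measurability is not preserved by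
composition without further argument. Gradients and traces are therefore transported through Borel representatives.\<close>

lemma borel_representative:
  fixes f :: "real \<times> real \<Rightarrow> real"
  assumes "f \<in> borel_measurable (lebesgue_on U)" "U \<in> sets lebesgue"
  shows "\<exists>h\<in>borel_measurable borel. AE x in lebesgue_on U. f x = h x"
proof -
  have "(\<lambda>x. indicator U x *\<^sub>R f x) \<in> borel_measurable lebesgue"
    using assms borel_measurable_restrict_space_iff[of U lebesgue f] by auto
  then obtain h where h: "h \<in> borel_measurable lborel" "AE x in lborel. indicator U x *\<^sub>R f x = h x"
    using completion_ex_borel_measurable_real[of _ lborel] by (auto simp del: scaleR_conv_of_real real_scaleR_def)
  have "AE x in lebesgue_on U. f x = h x"
    using AE_completion[OF h(2)] assms(2) by (auto simp: AE_restrict_space_iff elim!: eventually_mono)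
  then show ?thesis using h(1) by auto
qed

lemma H1_gradient_cong_AE:
  assumes H: "H1_gradient U u v" and U: "U \<in> lmeasurable"
    and "u' \<in> borel_measurable borel" "v1 \<in> borel_measurable borel" "v2 \<in> borel_measurable borel"
    and "AE x in lebesgue_on U. u x = u' x" "AE x in lebesgue_on U. fst (v x) = v1 x" "AE x in lebesgue_on U. snd (v x) = v2 x"
  shows "H1_gradient U u' (\<lambda>x. (v1 x, v2 x))"
proof -
  let ?M = "lebesgue_on U"
  have sym: "AE x in ?M. u' x = u x" "AE x in ?M. v1 x = fst (v x)" "AE x in ?M. v2 x = snd (v x)"
    using assms(6-8) by (eventually_elim, simp)+
  note HH = H[unfolded H1_gradient_iff[OF U]]
  note m = assms(3-5)[THEN borel_measurable_lebesgue_onI]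
  have s: "sqi ?M u'" "sqi ?M v1" "sqi ?M v2"
    using sqi_cong_AE(1)[OF _ m(1) sym(1)] sqi_cong_AE(1)[OF _ m(2) sym(2)] sqi_cong_AE(1)[OF _ m(3) sym(3)] HH by auto
  have e: "(LINT x|?M. h' x * k x) = (LINT x|?M. h x * k x)"
    if "sqi ?M h" "sqi ?M h'" "sqi ?M k" "AE x in ?M. h' x = h x" for h h' k
  proof (rule integral_cong_AE)
    show "(\<lambda>x. h' x * k x) \<in> borel_measurable ?M" "(\<lambda>x. h x * k x) \<in> borel_measurable ?M"
      using that by (auto intro!: borel_measurable_times dest: sqi_measurable)
    show "AE x in ?M. h' x * k x = h x * k x" using that(4) by eventually_elim simp
  qed
  show ?thesis unfolding H1_gradient_iff[OF U] fst_conv snd_conv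
  proof (intro conjI allI impI s)
    fix \<phi> assume \<phi>: "test_function U \<phi>"
    note t = test_sqi_on[OF \<phi> U] test_sqi_on[OF test_function_partial(1)[OF \<phi>] U] test_sqi_on[OF test_function_partial(2)[OF \<phi>] U]
    show "(LINT x|?M. u' x * partial1 \<phi> x) = - (LINT x|?M. \<phi> x * v1 x)"
      using HH \<phi> e[OF _ s(1) t(2) sym(1)] e[OF _ s(2) t(1) sym(2)] by (simp add: mult.commute[of "\<phi> _"])
    show "(LINT x|?M. u' x * partial2 \<phi> x) = - (LINT x|?M. \<phi> x * v2 x)"
      using HH \<phi> e[OF _ s(1) t(3) sym(1)] e[OF _ s(3) t(1) sym(3)] by (simp add: mult.commute[of "\<phi> _"])
  qed
qed

text \<open>The pull-back of a diagonal tensor under \<open>shear \<Phi>\<close>: the Jacobian \<open>\<Phi>'\<close> multiplies both entries, and the chain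
rule contributes the factor \<open>\<Phi>'\<^sup>-\<^sup>2\<close> to the first.\<close>

definition warp :: "(real \<Rightarrow> real) \<Rightarrow> (real \<times> real \<Rightarrow> real \<times> real) \<Rightarrow> real \<times> real \<Rightarrow> real \<times> real" where
  "warp \<Phi>' C x = (fst (C x) / \<Phi>' (fst x), snd (C x) * \<Phi>' (fst x))"

context
  fixes L K :: real and \<Phi> \<Phi>' \<Psi> \<Psi>' :: "real \<Rightarrow> real"
  assumes D: "diffeo L K \<Phi> \<Phi>' \<Psi> \<Psi>'"
begin

lemma diffeo_facts:
  "smooth1 \<Phi>" "smooth1 \<Psi>" "smooth1 \<Phi>'" "smooth1 \<Psi>'"
  "(\<Phi> has_real_derivative \<Phi>' t) (at t)" "(\<Psi> has_real_derivative \<Psi>' t) (at t)"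
  "\<Phi> (\<Psi> t) = t" "\<Psi> (\<Phi> t) = t" "0 < \<Phi>' t" "\<Phi>' t \<le> K" "0 < \<Psi>' t" "\<Psi>' t \<le> K" "\<Phi> 0 = 0" "\<Phi> L = L" "\<Psi> 0 = 0" "\<Psi> L = L"
proof -
  note d = D[unfolded diffeo_def]
  show 1: "smooth1 \<Phi>" "smooth1 \<Psi>" "\<And>t. (\<Phi> has_real_derivative \<Phi>' t) (at t)" "\<And>t. (\<Psi> has_real_derivative \<Psi>' t) (at t)"
    "\<Phi> (\<Psi> t) = t" "\<Psi> (\<Phi> t) = t" "0 < \<Phi>' t" "\<Phi>' t \<le> K" "0 < \<Psi>' t" "\<Psi>' t \<le> K" "\<Phi> 0 = 0" "\<Phi> L = L"
    using d by auto
  show "smooth1 \<Phi>'" "smooth1 \<Psi>'" using smooth1_deriv 1 by blast+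
  have "\<Psi> (\<Phi> 0) = 0" "\<Psi> (\<Phi> L) = L" using d by blast+
  then show "\<Psi> 0 = 0" "\<Psi> L = L" using d by simp_all
qed

lemma diffeo_less_iff: "\<Phi> s < \<Phi> t \<longleftrightarrow> s < t" "\<Phi> s \<le> \<Phi> t \<longleftrightarrow> s \<le> t"
proof -
  have mono: "\<Phi> s < \<Phi> t" if "s < t" for s t
    using that by (rule DERIV_pos_imp_increasing) (use diffeo_facts(5,9) in blast)
  show 1: "\<Phi> s < \<Phi> t \<longleftrightarrow> s < t" for s t
    using mono[of s t] mono[of t s] by (metis less_asym' linorder_cases)
  show "\<Phi> s \<le> \<Phi> t \<longleftrightarrow> s \<le> t" using 1[of t s] by (simp add: not_less[symmetric])
qed

lemma diffeo_interval:
  "0 < \<Phi> t \<longleftrightarrow> 0 < t" "\<Phi> t < L \<longleftrightarrow> t < L" "0 \<le> \<Phi> t \<longleftrightarrow> 0 \<le> t"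
  using diffeo_less_iff(1)[of 0 t] diffeo_less_iff(1)[of t L] diffeo_less_iff(2)[of 0 t] by (simp_all add: diffeo_facts)

lemma derivative_product: "\<Phi>' t * \<Psi>' (\<Phi> t) = 1"
proof -
  have "((\<lambda>t. \<Psi> (\<Phi> t)) has_real_derivative \<Psi>' (\<Phi> t) * \<Phi>' t) (at t)"
    by (rule DERIV_chain2[OF diffeo_facts(6) diffeo_facts(5)])
  moreover have "(\<lambda>t. \<Psi> (\<Phi> t)) = (\<lambda>t. t)" using diffeo_facts(8) by blast
  ultimately have "\<Psi>' (\<Phi> t) * \<Phi>' t = 1" using DERIV_unique DERIV_ident by metis
  then show ?thesis by (simp add: mult.commute)
qed

lemma derivative_lower: "1 \<le> K * \<Phi>' t"
proof -
  have "\<Phi>' t * \<Psi>' (\<Phi> t) \<le> \<Phi>' t * K" by (intro mult_left_mono diffeo_facts less_imp_le)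
  then show ?thesis by (simp add: derivative_product mult.commute)
qed

lemma shear_inverse: "shear \<Psi> (shear \<Phi> x) = x" "shear \<Phi> (shear \<Psi> x) = x"
  by (simp_all add: shear_def diffeo_facts)

lemma borel_1: "h \<in> borel_measurable borel" if "smooth1 h" for h
proof -
  have "h = (\<lambda>t. h (fst (t, 0::real)))" by simp
  also have "\<dots> \<in> borel_measurable borel"
    by (rule measurable_compose[OF _ smooth_borel[OF that], of "\<lambda>t. (t, 0)"])
      (intro borel_measurable_continuous_onI continuous_intros)
  finally show ?thesis .
qed

lemma shear_measurable: "shear \<Phi> \<in> borel_measurable borel"
  unfolding shear_def[abs_def] using smooth_borel[OF diffeo_facts(1)] smooth_borel[OF smooth_snd]
  by (intro borel_measurable_Pair) auto

text \<open>It suffices to compare the measures on boxes; by the fundamental theorem of calculus \<open>\<Phi>'\<close> integrates over the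
preimage of an interval to the length of the interval.\<close>

lemma lborel_shear: "lborel = distr (density lborel (\<lambda>x. ennreal (\<Phi>' (fst x)))) borel (shear \<Phi>)"
proof (rule lborel_eqI)
  fix l u :: "real \<times> real"
  assume "\<And>b. b \<in> Basis \<Longrightarrow> l \<bullet> b \<le> u \<bullet> b"
  from this[of "(1,0)"] this[of "(0,1)"] have le: "fst l \<le> fst u" "snd l \<le> snd u"
    by (cases l; cases u; simp add: Basis_prod_def)+
  have mb: "(\<lambda>x::real \<times> real. ennreal (\<Phi>' (fst x))) \<in> borel_measurable lborel"
    using smooth_borel[OF diffeo_facts(3)] by simp
  have m1: "\<Phi>' \<in> borel_measurable borel" by (rule borel_1[OF diffeo_facts(3)])
  have iff: "l1 < \<Phi> t \<longleftrightarrow> \<Psi> l1 < t" "\<Phi> t < l1 \<longleftrightarrow> t < \<Psi> l1" for l1 t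
    using diffeo_less_iff(1)[of "\<Psi> l1" t] diffeo_less_iff(1)[of t "\<Psi> l1"] by (simp_all add: diffeo_facts)
  let ?I = "{\<Psi> (fst l)<..<\<Psi> (fst u)}" and ?J = "{snd l<..<snd u}"
  have ind: "indicator (shear \<Phi> -` box l u) (s, t) = (indicator ?I s * indicator ?J t :: ennreal)" for s t
    by (auto simp: indicator_def box_prod shear_def iff)
  have "emeasure (distr (density lborel (\<lambda>x. ennreal (\<Phi>' (fst x)))) borel (shear \<Phi>)) (box l u)
     = emeasure (density lborel (\<lambda>x. ennreal (\<Phi>' (fst x)))) (shear \<Phi> -` box l u)"
    using shear_measurable by (subst emeasure_distr) auto
  also have "\<dots> = (\<integral>\<^sup>+x. ennreal (\<Phi>' (fst x)) * indicator (shear \<Phi> -` box l u) x \<partial>lborel)"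
    using mb shear_measurable by (intro emeasure_density) (auto simp: measurable_sets_borel)
  also have "\<dots> = (\<integral>\<^sup>+x. (\<lambda>(s, t). ennreal (\<Phi>' s) * (indicator ?I s * indicator ?J t)) x \<partial>(lborel \<Otimes>\<^sub>M lborel))"
    by (simp add: lborel_prod ind[symmetric] case_prod_beta')
  also have "\<dots> = (\<integral>\<^sup>+s. \<integral>\<^sup>+t. ennreal (\<Phi>' s) * (indicator ?I s * indicator ?J t) \<partial>lborel \<partial>lborel)"
  proof (subst lborel.nn_integral_fst[symmetric])
    show "(\<lambda>(s, t). ennreal (\<Phi>' s) * (indicator ?I s * indicator ?J t)) \<in> borel_measurable (lborel \<Otimes>\<^sub>M lborel)"
      using m1 by measurable
  qed simp
  also have "\<dots> = (\<integral>\<^sup>+s. (ennreal (\<Phi>' s) * indicator ?I s) * ennreal (snd u - snd l) \<partial>lborel)"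
  proof (rule nn_integral_cong)
    fix s
    have "(\<integral>\<^sup>+t. ennreal (\<Phi>' s) * (indicator ?I s * indicator ?J t) \<partial>lborel) = (\<integral>\<^sup>+t. (ennreal (\<Phi>' s) * indicator ?I s) * indicator ?J t \<partial>lborel)"
      by (simp add: mult.assoc)
    also have "\<dots> = (ennreal (\<Phi>' s) * indicator ?I s) * emeasure lborel ?J" by (rule nn_integral_cmult_indicator) simp
    finally show "(\<integral>\<^sup>+t. ennreal (\<Phi>' s) * (indicator ?I s * indicator ?J t) \<partial>lborel) = (ennreal (\<Phi>' s) * indicator ?I s) * ennreal (snd u - snd l)"
      using le by simp
  qed
  also have "\<dots> = (\<integral>\<^sup>+s. ennreal (\<Phi>' s) * indicator ?I s \<partial>lborel) * ennreal (snd u - snd l)"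
    using m1 by (intro nn_integral_multc) auto
  also have "(\<integral>\<^sup>+s. ennreal (\<Phi>' s) * indicator ?I s \<partial>lborel) = (\<integral>\<^sup>+s. ennreal (\<Phi>' s) * indicator {\<Psi> (fst l)..\<Psi> (fst u)} s \<partial>lborel)"
  proof (rule nn_integral_cong_AE)
    show "AE s in lborel. ennreal (\<Phi>' s) * indicator ?I s = ennreal (\<Phi>' s) * indicator {\<Psi> (fst l)..\<Psi> (fst u)} s"
      using AE_lborel_singleton[of "\<Psi> (fst l)"] AE_lborel_singleton[of "\<Psi> (fst u)"]
      by eventually_elim (auto simp: indicator_def)
  qed
  also have "\<dots> = ennreal (\<Phi> (\<Psi> (fst u)) - \<Phi> (\<Psi> (fst l)))"
  proof (rule nn_integral_FTC_Icc)
    show "\<Psi> (fst l) \<le> \<Psi> (fst u)" using diffeo_less_iff(2)[of "\<Psi> (fst l)" "\<Psi> (fst u)"] le by (simp add: diffeo_facts)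
  qed (use m1 diffeo_facts(5,9) in \<open>auto intro: less_imp_le\<close>)
  finally have "emeasure (distr (density lborel (\<lambda>x. ennreal (\<Phi>' (fst x)))) borel (shear \<Phi>)) (box l u)
     = ennreal (fst u - fst l) * ennreal (snd u - snd l)"
    by (simp add: diffeo_facts)
  also have "\<dots> = ennreal ((fst u - fst l) * (snd u - snd l))" using le by (simp add: ennreal_mult)
  also have "(fst u - fst l) * (snd u - snd l) = (\<Prod>b\<in>Basis. (u - l) \<bullet> b)"
    by (cases l; cases u) (simp add: Basis_prod_def)
  finally show "emeasure (distr (density lborel (\<lambda>x. ennreal (\<Phi>' (fst x)))) borel (shear \<Phi>)) (box l u) = (\<Prod>b\<in>Basis. (u - l) \<bullet> b)" .
qed simp

lemma change_of_variables_lborel: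
  fixes f :: "real \<times> real \<Rightarrow> real"
  assumes "f \<in> borel_measurable borel"
  shows "(LINT x|lborel. f x) = (LINT x|lborel. \<Phi>' (fst x) * f (shear \<Phi> x))"
    "integrable lborel f \<longleftrightarrow> integrable lborel (\<lambda>x. \<Phi>' (fst x) * f (shear \<Phi> x))"
proof -
  have P: "shear \<Phi> \<in> measurable (density lborel (\<lambda>x. ennreal (\<Phi>' (fst x)))) borel"
    using shear_measurable by simp
  have mb: "(\<lambda>x::real \<times> real. \<Phi>' (fst x)) \<in> borel_measurable lborel"
    using smooth_borel[OF diffeo_facts(3)] by simp
  have fP: "(\<lambda>x. f (shear \<Phi> x)) \<in> borel_measurable lborel"
    using measurable_compose[OF shear_measurable assms] by simp
  have nn: "AE x in lborel. 0 \<le> \<Phi>' (fst (x::real \<times> real))" using diffeo_facts(9) by (simp add: less_imp_le)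
  show "(LINT x|lborel. f x) = (LINT x|lborel. \<Phi>' (fst x) * f (shear \<Phi> x))"
    by (subst lborel_shear) (simp add: integral_distr[OF P assms] integral_density[OF fP mb nn])
  show "integrable lborel f \<longleftrightarrow> integrable lborel (\<lambda>x. \<Phi>' (fst x) * f (shear \<Phi> x))"
    by (subst lborel_shear) (simp add: integrable_distr_eq[OF P assms] integrable_density[OF fP mb nn])
qed

lemma change_of_variables:
  fixes f :: "real \<times> real \<Rightarrow> real"
  assumes "f \<in> borel_measurable borel" "U \<in> sets borel"
  shows "(LINT x|lebesgue_on U. f x) = (LINT x|lebesgue_on (shear \<Phi> -` U). \<Phi>' (fst x) * f (shear \<Phi> x))" (is ?A)
    "integrable (lebesgue_on U) f \<longleftrightarrow> integrable (lebesgue_on (shear \<Phi> -` U)) (\<lambda>x. \<Phi>' (fst x) * f (shear \<Phi> x))" (is ?B)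
proof -
  let ?V = "shear \<Phi> -` U"
  have V: "?V \<in> sets borel" using measurable_sets_borel[OF shear_measurable assms(2)] .
  have fb: "(\<lambda>x. indicator U x * f x) \<in> borel_measurable borel"
    by (intro borel_measurable_times borel_measurable_indicator assms)
  have gb: "(\<lambda>x. \<Phi>' (fst x) * (indicator U (shear \<Phi> x) * f (shear \<Phi> x))) \<in> borel_measurable borel"
    by (rule borel_measurable_times[OF smooth_borel[OF diffeo_facts(3)] measurable_compose[OF shear_measurable fb]])
  have eq: "(LINT x|lebesgue_on U. f x) = (LINT x|lebesgue_on U. indicator U x * f x)"
    "integrable (lebesgue_on U) f \<longleftrightarrow> integrable (lebesgue_on U) (\<lambda>x. indicator U x * f x)"
    by (auto intro!: Bochner_Integration.integral_cong Bochner_Integration.integrable_cong)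
  have eq': "(LINT x|lebesgue_on ?V. \<Phi>' (fst x) * f (shear \<Phi> x)) = (LINT x|lebesgue_on ?V. \<Phi>' (fst x) * (indicator U (shear \<Phi> x) * f (shear \<Phi> x)))"
    "integrable (lebesgue_on ?V) (\<lambda>x. \<Phi>' (fst x) * f (shear \<Phi> x)) \<longleftrightarrow> integrable (lebesgue_on ?V) (\<lambda>x. \<Phi>' (fst x) * (indicator U (shear \<Phi> x) * f (shear \<Phi> x)))"
    by (auto intro!: Bochner_Integration.integral_cong Bochner_Integration.integrable_cong)
  note a = integral_lebesgue_on_lborel[OF fb, of U] and b = integral_lebesgue_on_lborel[OF gb, of ?V]
  note c = change_of_variables_lborel[OF fb]
  show ?A unfolding eq(1) eq'(1) using a(1) b(1) c(1) assms(2) V by simp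
  show ?B unfolding eq(2) eq'(2) using a(2) b(2) c(2) assms(2) V by simp
qed

text \<open>The bound \<open>\<Psi>' \<le> K\<close> on the inverse controls the missing Jacobian.\<close>

lemma sqi_shear:
  assumes "f \<in> borel_measurable borel" "U \<in> sets borel" "sqi (lebesgue_on U) f"
  shows "sqi (lebesgue_on (shear \<Phi> -` U)) (\<lambda>x. f (shear \<Phi> x))"
    "l2 (lebesgue_on (shear \<Phi> -` U)) (\<lambda>x. f (shear \<Phi> x)) \<le> sqrt K * l2 (lebesgue_on U) f"
proof -
  let ?V = "shear \<Phi> -` U"
  have K: "K > 0" using diffeo_facts(9,10)[of 0] by linarith
  have f2: "(\<lambda>x. (f x)\<^sup>2) \<in> borel_measurable borel" using assms by simp
  have i: "integrable (lebesgue_on ?V) (\<lambda>x. K * (\<Phi>' (fst x) * (f (shear \<Phi> x))\<^sup>2))"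
    using change_of_variables(2)[OF f2 assms(2)] sqi_integrable[OF assms(3)] by simp
  have m: "(\<lambda>x. f (shear \<Phi> x)) \<in> borel_measurable (lebesgue_on ?V)"
    by (rule borel_measurable_lebesgue_onI[OF measurable_compose[OF shear_measurable assms(1)]])
  have le: "(f (shear \<Phi> x))\<^sup>2 \<le> K * (\<Phi>' (fst x) * (f (shear \<Phi> x))\<^sup>2)" for x
    using mult_right_mono[OF derivative_lower[of "fst x"] zero_le_power2[of "f (shear \<Phi> x)"]] by (simp add: mult.assoc)
  have ii: "integrable (lebesgue_on ?V) (\<lambda>x. (f (shear \<Phi> x))\<^sup>2)"
  proof (rule Bochner_Integration.integrable_bound[OF i])
    show "(\<lambda>x. (f (shear \<Phi> x))\<^sup>2) \<in> borel_measurable (lebesgue_on ?V)" using m by simp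
    show "AE x in lebesgue_on ?V. norm ((f (shear \<Phi> x))\<^sup>2) \<le> norm (K * (\<Phi>' (fst x) * (f (shear \<Phi> x))\<^sup>2))"
      using le by (intro AE_I2) (simp add: order_trans[OF _ abs_ge_self])
  qed
  then show "sqi (lebesgue_on ?V) (\<lambda>x. f (shear \<Phi> x))" using m by (simp add: sqi_def)
  have "(LINT x|lebesgue_on ?V. (f (shear \<Phi> x))\<^sup>2) \<le> (LINT x|lebesgue_on ?V. K * (\<Phi>' (fst x) * (f (shear \<Phi> x))\<^sup>2))"
    by (rule Bochner_Integration.integral_mono[OF ii i le])
  also have "\<dots> = K * (LINT x|lebesgue_on U. (f x)\<^sup>2)" using change_of_variables(1)[OF f2 assms(2)] by simp
  finally show "l2 (lebesgue_on ?V) (\<lambda>x. f (shear \<Phi> x)) \<le> sqrt K * l2 (lebesgue_on U) f"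
    unfolding l2_def by (metis real_sqrt_le_iff real_sqrt_mult)
qed

lemma partial_shear:
  assumes "smooth \<phi>"
  shows "partial1 (\<lambda>x. \<phi> (shear \<Phi> x)) = (\<lambda>x. partial1 \<phi> (shear \<Phi> x) * \<Phi>' (fst x))"
    "partial2 (\<lambda>x. \<phi> (shear \<Phi> x)) = (\<lambda>x. partial2 \<phi> (shear \<Phi> x))" "smooth (\<lambda>x. \<phi> (shear \<Phi> x))"
  unfolding shear_def
  using partial_comp2[OF smooth_differentiable[OF assms] smooth_differentiable[OF diffeo_facts(1)] smooth_differentiable[OF smooth_snd]]
  by (simp_all add: partial_of_fst(1,2)[OF diffeo_facts(5)] partial_snd smooth_comp[OF assms diffeo_facts(1) smooth_snd])

lemma test_function_shear:
  assumes "test_function U \<phi>"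
  shows "test_function (shear \<Phi> -` U) (\<lambda>x. \<phi> (shear \<Phi> x))"
proof -
  obtain C where C: "smooth \<phi>" "compact C" "C \<subseteq> U" "\<forall>x. x \<notin> C \<longrightarrow> \<phi> x = 0" using test_functionD[OF assms] by blast
  have "continuous_on C (shear \<Psi>)" unfolding shear_def[abs_def]
    using smooth_continuous[OF diffeo_facts(2)] by (intro continuous_intros) auto
  then have c: "compact (shear \<Psi> ` C)" using C(2) by (rule compact_continuous_image)
  show ?thesis
  proof (rule test_functionI[OF partial_shear(3)[OF C(1)] c])
    show "shear \<Psi> ` C \<subseteq> shear \<Phi> -` U" using C(3) by (auto simp: shear_inverse)
    show "\<phi> (shear \<Phi> x) = 0" if "x \<notin> shear \<Psi> ` C" for x
      using C(4) that by (metis image_eqI shear_inverse(1))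
  qed
qed

end

text \<open>A test function is pushed forward by the inverse, the identity is used there, and the change of variables pulls
the integrals back.\<close>

lemma H1_gradient_shear:
  assumes D: "diffeo L K \<Phi> \<Phi>' \<Psi> \<Psi>'" and U: "U \<in> lmeasurable" "U \<in> sets borel" "shear \<Phi> -` U \<in> lmeasurable"
    and m: "u \<in> borel_measurable borel" "v1 \<in> borel_measurable borel" "v2 \<in> borel_measurable borel"
    and H: "H1_gradient U u (\<lambda>x. (v1 x, v2 x))"
  shows "H1_gradient (shear \<Phi> -` U) (\<lambda>x. u (shear \<Phi> x)) (\<lambda>x. (\<Phi>' (fst x) * v1 (shear \<Phi> x), v2 (shear \<Phi> x)))"
proof -
  let ?V = "shear \<Phi> -` U"
  let ?M = "lebesgue_on U" and ?N = "lebesgue_on (shear \<Phi> -` U)"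
  note sw = diffeo_swap[OF D]
  note f = diffeo_facts[OF D]
  note HH = H[unfolded H1_gradient_iff[OF U(1)] fst_conv snd_conv]
  have K: "K \<ge> 0" using f(9,10)[of 0] by linarith
  note s = sqi_shear(1)[OF D _ U(2)]
  have s1: "sqi ?N (\<lambda>x. \<Phi>' (fst x) * v1 (shear \<Phi> x))"
  proof (rule sqi_bounded_mult(1)[where c=K])
    show "AE x in ?N. \<bar>\<Phi>' (fst x)\<bar> \<le> K" using f(9,10) by (intro AE_I2) (simp add: abs_of_pos)
  qed (use HH m K s borel_measurable_lebesgue_onI[OF smooth_borel[OF f(3)]] in auto)
  have P: "\<Psi>' (fst (shear \<Phi> x)) * \<Phi>' (fst x) = 1" for x
    using derivative_product[OF D, of "fst x"] by (simp add: shear_def mult.commute)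
  have cov: "(LINT x|?M. h x) = (LINT x|?N. \<Phi>' (fst x) * h (shear \<Phi> x))" if "h \<in> borel_measurable borel" for h
    by (rule change_of_variables(1)[OF D that U(2)])
  show ?thesis unfolding H1_gradient_iff[OF U(3)] fst_conv snd_conv
  proof (intro conjI allI impI s1)
    show "sqi ?N (\<lambda>x. u (shear \<Phi> x))" "sqi ?N (\<lambda>x. v2 (shear \<Phi> x))" using HH m s by auto
    fix \<phi> assume \<phi>: "test_function ?V \<phi>"
    have sm: "smooth \<phi>" by (rule test_function_smooth[OF \<phi>])
    let ?\<psi> = "\<lambda>y. \<phi> (shear \<Psi> y)"
    have "shear \<Psi> -` ?V = U" by (rule set_eqI) (simp only: vimage_eq shear_inverse[OF D])
    then have t: "test_function U ?\<psi>" using test_function_shear[OF sw \<phi>] by simp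
    have t2: "test_function U (\<lambda>y. \<Psi>' (fst y) * ?\<psi> y)" by (rule test_function_mult[OF t f(4)])
    note pb = smooth_borel[OF test_function_smooth[OF t]] smooth_borel[OF test_function_smooth[OF t2]]
      smooth_borel[OF test_function_smooth[OF test_function_partial(1)[OF t]]] smooth_borel[OF test_function_smooth[OF test_function_partial(2)[OF t2]]]
    have p1: "partial1 ?\<psi> = (\<lambda>x. partial1 \<phi> (shear \<Psi> x) * \<Psi>' (fst x))" by (rule partial_shear(1)[OF sw sm])
    obtain \<Psi>'' where d: "\<And>t. (\<Psi>' has_real_derivative \<Psi>'' t) (at t)" using smooth1_derivE[OF f(4)] by blast
    have p2: "partial2 (\<lambda>y. \<Psi>' (fst y) * ?\<psi> y) = (\<lambda>y. \<Psi>' (fst y) * partial2 \<phi> (shear \<Psi> y))"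
      unfolding partial_mult_fst(2)[OF test_function_smooth[OF t] d] partial_shear(2)[OF sw sm] ..
    have c: "\<Phi>' (fst x) * (a * (b * \<Psi>' (fst (shear \<Phi> x)))) = a * b" "\<Phi>' (fst x) * (a * (\<Psi>' (fst (shear \<Phi> x)) * b)) = a * b"
      "\<Phi>' (fst x) * (\<Psi>' (fst (shear \<Phi> x)) * a * b) = a * b" for a b x
      using P[of x] by (simp_all add: mult.commute mult.left_commute)
    have "(LINT x|?N. u (shear \<Phi> x) * partial1 \<phi> x) = (LINT y|?M. u y * partial1 ?\<psi> y)"
      using cov[OF borel_measurable_times[OF m(1) pb(3)]] by (simp add: p1 c shear_inverse[OF D])
    also have "\<dots> = - (LINT y|?M. ?\<psi> y * v1 y)" using HH t by blast
    also have "(LINT y|?M. ?\<psi> y * v1 y) = (LINT x|?N. \<phi> x * (\<Phi>' (fst x) * v1 (shear \<Phi> x)))"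
      using cov[OF borel_measurable_times[OF pb(1) m(2)]] by (simp add: shear_inverse[OF D] mult.left_commute)
    finally show "(LINT x|?N. u (shear \<Phi> x) * partial1 \<phi> x) = - (LINT x|?N. \<phi> x * (\<Phi>' (fst x) * v1 (shear \<Phi> x)))" .
    have "(LINT x|?N. u (shear \<Phi> x) * partial2 \<phi> x) = (LINT y|?M. u y * partial2 (\<lambda>y. \<Psi>' (fst y) * ?\<psi> y) y)"
      using cov[OF borel_measurable_times[OF m(1) pb(4)]] by (simp add: p2 c shear_inverse[OF D])
    also have "\<dots> = - (LINT y|?M. (\<Psi>' (fst y) * ?\<psi> y) * v2 y)" using HH t2 by blast
    also have "(LINT y|?M. (\<Psi>' (fst y) * ?\<psi> y) * v2 y) = (LINT x|?N. \<phi> x * v2 (shear \<Phi> x))"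
      using cov[OF borel_measurable_times[OF pb(2) m(3)]] by (simp only: c shear_inverse[OF D])
    finally show "(LINT x|?N. u (shear \<Phi> x) * partial2 \<phi> x) = - (LINT x|?N. \<phi> x * v2 (shear \<Phi> x))" .
  qed
qed

lemma L2_shear_tendsto:
  fixes f :: "real \<times> real \<Rightarrow> 'b::euclidean_space" and G :: "nat \<Rightarrow> real \<times> real \<Rightarrow> 'c::euclidean_space"
  assumes D: "diffeo L K \<Phi> \<Phi>' \<Psi> \<Psi>'" and R: "R \<in> sets borel" "shear \<Phi> -` R = R"
    and m: "\<And>k. F k \<in> borel_measurable borel" "f \<in> borel_measurable borel" "L2_tendsto R F f"
    and G: "\<And>k. L2 R (G k)" "L2 R h" and le: "\<And>k x. norm (G k x - h x) \<le> c * norm (F k (shear \<Phi> x) - f (shear \<Phi> x))" "c \<ge> 0"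
  shows "L2_tendsto R G h"
  unfolding L2_tendsto_iff
proof (intro conjI allI G)
  let ?M = "lebesgue_on R"
  have l: "L2 R (\<lambda>x. F k x - f x)" "L2 R (\<lambda>x. G k x - h x)" for k
    using L2_lincomb[of R "F k" f 1 "-1"] L2_lincomb[of R "G k" h 1 "-1"] m(3) G by (simp_all add: L2_tendsto_def)
  have bound: "l2 ?M (\<lambda>x. norm (G k x - h x)) \<le> c * sqrt K * l2 ?M (\<lambda>x. norm (F k x - f x))" for k
  proof -
    have nb: "(\<lambda>x. norm (F k x - f x)) \<in> borel_measurable borel" using m by measurable
    note s = sqi_shear[OF D nb R(1) L2_norm[OF l(1)], unfolded R(2)]
    have "l2 ?M (\<lambda>x. norm (G k x - h x)) \<le> l2 ?M (\<lambda>x. c * norm (F k (shear \<Phi> x) - f (shear \<Phi> x)))"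
    proof (rule sqi_mono(2)[OF sqi_measurable[OF L2_norm[OF l(2)]] sqi_scale[OF s(1)]])
      show "AE x in ?M. \<bar>norm (G k x - h x)\<bar> \<le> \<bar>c * norm (F k (shear \<Phi> x) - f (shear \<Phi> x))\<bar>"
        using le by (intro AE_I2) (simp add: order_trans[OF _ abs_ge_self])
    qed
    also have "\<dots> \<le> c * (sqrt K * l2 ?M (\<lambda>x. norm (F k x - f x)))"
      unfolding l2_scale using s(2) le(2) by (simp add: mult_left_mono)
    finally show ?thesis by simp
  qed
  show "(\<lambda>k. l2 ?M (\<lambda>x. norm (G k x - h x))) \<longlonglongrightarrow> 0"
  proof (rule tendsto_sandwich)
    show "(\<lambda>_. 0) \<longlonglongrightarrow> (0::real)" by simp
    have "(\<lambda>k. c * sqrt K * l2 ?M (\<lambda>x. norm (F k x - f x))) \<longlonglongrightarrow> c * sqrt K * 0"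
      using m(3) unfolding L2_tendsto_iff by (intro tendsto_mult tendsto_const) auto
    then show "(\<lambda>k. c * sqrt K * l2 ?M (\<lambda>x. norm (F k x - f x))) \<longlonglongrightarrow> 0" by simp
  qed (auto simp: l2_nonneg bound)
qed

lemma H1_gradient_measurable:
  assumes "H1_gradient U u v" shows "u \<in> borel_measurable (lebesgue_on U)" "(\<lambda>x. fst (v x)) \<in> borel_measurable (lebesgue_on U)"
    "(\<lambda>x. snd (v x)) \<in> borel_measurable (lebesgue_on U)"
  using assms unfolding H1_gradient_def L2_real L2_pair by (auto dest: sqi_measurable)

lemma L2_tendsto_cong_AE:
  fixes f f' :: "'a::euclidean_space \<Rightarrow> 'b::euclidean_space"
  assumes "L2_tendsto U F f" "L2 U f'" "AE x in lebesgue_on U. f x = f' x"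
  shows "L2_tendsto U F f'"
  unfolding L2_tendsto_iff
proof (intro conjI allI)
  show "L2 U (F k)" for k using assms(1) by (simp add: L2_tendsto_def)
  have l: "L2 U (\<lambda>x. F k x - f x)" "L2 U (\<lambda>x. F k x - f' x)" for k
    using L2_lincomb[of U "F k" f 1 "-1"] L2_lincomb[of U "F k" f' 1 "-1"] assms(1,2) by (simp_all add: L2_tendsto_def)
  have "l2 (lebesgue_on U) (\<lambda>x. norm (F k x - f' x)) = l2 (lebesgue_on U) (\<lambda>x. norm (F k x - f x))" for k
    by (rule sqi_cong_AE(2)[OF L2_norm[OF l(1)] sqi_measurable[OF L2_norm[OF l(2)]]])
      (use assms(3) in eventually_elim, simp)
  then show "(\<lambda>k. l2 (lebesgue_on U) (\<lambda>x. norm (F k x - f' x))) \<longlonglongrightarrow> 0"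
    using assms(1) unfolding L2_tendsto_iff by simp
qed (rule assms(2))

text \<open>The approximating smooth functions are composed with the shear. It fixes the vertical line \<open>x\<^sub>1 = c\<close>
pointwise, so the trace is unchanged.\<close>

lemma has_trace_shear:
  assumes D: "diffeo L K \<Phi> \<Phi>' \<Psi> \<Psi>'" and R: "R = {0<..<L} \<times> {a<..<b}" and c: "\<Phi> c = c"
    and tr: "has_trace R c I u g" and u': "u' \<in> borel_measurable borel" "AE x in lebesgue_on R. u x = u' x"
  shows "has_trace R c I (\<lambda>x. u' (shear \<Phi> x)) g"
proof -
  note f = diffeo_facts[OF D]
  obtain v \<phi> where 1: "H1_gradient R u v" "\<forall>k. smooth (\<phi> k)" "L2_tendsto R \<phi> u"
    "L2_tendsto R (\<lambda>k. gradient (\<phi> k)) v" "L2_tendsto I (\<lambda>k y. \<phi> k (c, y)) (\<lambda>y. g (c, y))"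
    using tr unfolding has_trace_def by blast
  have Rm: "R \<in> lmeasurable" "R \<in> sets lebesgue" "R \<in> sets borel" "bounded R"
    using rect_lmeasurable[of 0 L a b] unfolding R by (auto simp: open_Times)
  have RR: "shear \<Phi> -` R = R" unfolding R using diffeo_interval[OF D] by (auto simp: shear_def)
  obtain v1 where v1: "v1 \<in> borel_measurable borel" "AE x in lebesgue_on R. fst (v x) = v1 x"
    using borel_representative[OF H1_gradient_measurable(2)[OF 1(1)] Rm(2)] by blast
  obtain v2 where v2: "v2 \<in> borel_measurable borel" "AE x in lebesgue_on R. snd (v x) = v2 x"
    using borel_representative[OF H1_gradient_measurable(3)[OF 1(1)] Rm(2)] by blast
  let ?v = "\<lambda>x. (v1 x, v2 x)"
  have h: "H1_gradient R u' ?v" by (rule H1_gradient_cong_AE[OF 1(1) Rm(1) u'(1) v1(1) v2(1) u'(2) v1(2) v2(2)])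
  let ?w = "\<lambda>x. (\<Phi>' (fst x) * v1 (shear \<Phi> x), v2 (shear \<Phi> x))"
  have H: "H1_gradient R (\<lambda>x. u' (shear \<Phi> x)) ?w"
    using H1_gradient_shear[OF D Rm(1) Rm(3) _ u'(1) v1(1) v2(1) h] Rm(1) unfolding RR by simp
  have vae: "AE x in lebesgue_on R. v x = ?v x" using v1(2) v2(2) by eventually_elim (simp add: prod_eq_iff)
  have c1: "L2_tendsto R \<phi> u'" by (rule L2_tendsto_cong_AE[OF 1(3) _ u'(2)]) (use h in \<open>simp add: H1_gradient_def\<close>)
  have c2: "L2_tendsto R (\<lambda>k. gradient (\<phi> k)) ?v" by (rule L2_tendsto_cong_AE[OF 1(4) _ vae]) (use h in \<open>simp add: H1_gradient_def\<close>)
  let ?\<phi> = "\<lambda>k x. \<phi> k (shear \<Phi> x)"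
  have sm: "smooth (?\<phi> k)" for k using partial_shear(3)[OF D] 1(2) by blast
  have gr: "gradient (?\<phi> k) x = (\<Phi>' (fst x) * fst (gradient (\<phi> k) (shear \<Phi> x)), snd (gradient (\<phi> k) (shear \<Phi> x)))" for k x
    using partial_shear(1,2)[OF D 1(2)[rule_format, of k]] by (simp add: gradient_def mult.commute)
  have K: "K \<ge> 0" using f(9,10)[of 0] by linarith
  have l: "L2 R (?\<phi> k)" "L2 R (gradient (?\<phi> k))" for k
    using H1_gradient_smooth[OF sm Rm(4,1)] by (auto simp: H1_gradient_def)
  show ?thesis unfolding has_trace_def
  proof (intro exI conjI allI)
    show "H1_gradient R (\<lambda>x. u' (shear \<Phi> x)) ?w" by (rule H)
    show "smooth (?\<phi> k)" for k by (rule sm)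
    show "L2_tendsto R ?\<phi> (\<lambda>x. u' (shear \<Phi> x))"
      by (rule L2_shear_tendsto[OF D Rm(3) RR _ u'(1) c1, where c=1]) (use l H 1(2) in \<open>auto simp: H1_gradient_def intro: smooth_borel\<close>)
    show "L2_tendsto R (\<lambda>k. gradient (?\<phi> k)) ?w"
    proof (rule L2_shear_tendsto[OF D Rm(3) RR _ _ c2, where c="K + 1"])
      show "gradient (\<phi> k) \<in> borel_measurable borel" for k using 1(2) smooth_gradient_borel by blast
      show "?v \<in> borel_measurable borel" using v1 v2 by (intro borel_measurable_Pair)
      show "L2 R ?w" using H by (simp add: H1_gradient_def)
      fix k x
      have k: "norm (a * s, t) \<le> (K + 1) * norm (s, t)" if "0 < a" "a \<le> K" for a s t :: real
      proof -
        have "norm (a * s, t) \<le> \<bar>a * s\<bar> + \<bar>t\<bar>" using norm_Pair_le[of "a * s" t] by simp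
        also have "\<dots> \<le> K * norm (s, t) + norm (s, t)"
          using that norm_fst_le[of s t] norm_snd_le[of t s] K by (intro add_mono) (auto simp: abs_mult intro!: mult_mono)
        finally show ?thesis by (simp add: algebra_simps)
      qed
      show "norm (gradient (?\<phi> k) x - ?w x) \<le> (K + 1) * norm (gradient (\<phi> k) (shear \<Phi> x) - ?v (shear \<Phi> x))"
        using k[OF f(9,10), of "fst x" "fst (gradient (\<phi> k) (shear \<Phi> x)) - v1 (shear \<Phi> x)" "snd (gradient (\<phi> k) (shear \<Phi> x)) - v2 (shear \<Phi> x)"]
        unfolding gr by (simp add: minus_prod_def algebra_simps)
    qed (use l K in auto)
    show "L2_tendsto I (\<lambda>k y. ?\<phi> k (c, y)) (\<lambda>y. g (c, y))" using 1(5) c by (simp add: shear_def)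
  qed
qed

lemma shear_vimage:
  assumes "diffeo L K \<Phi> \<Phi>' \<Psi> \<Psi>'"
  shows "shear \<Phi> -` Omega L H = Omega L H" "shear \<Phi> -` cracked L H (\<Phi> l) = cracked L H l"
  using diffeo_interval[OF assms] diffeo_less_iff(2)[OF assms] by (auto simp: shear_def Omega_def crack_def)

lemma cracked_borel: "cracked L H l \<in> sets borel"
proof -
  have "closed (crack l)" unfolding crack_def by (intro closed_Times) auto
  then show ?thesis using Omega_facts(3) by (intro sets.Diff) auto
qed

lemma transport:
  assumes D: "diffeo L K \<Phi> \<Phi>' \<Psi> \<Psi>'" and "H > 0" and v: "v \<in> grads L H g (\<Phi> l)" and C: "C \<in> borel_measurable borel"
  shows "\<exists>w\<in>grads L H g l. en L H (\<lambda>x. warp \<Phi>' (\<lambda>x. C (shear \<Phi> x)) x) w = en L H C v"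
proof -
  note f = diffeo_facts[OF D]
  obtain u where u: "u \<in> admissible L H g (\<Phi> l)" "H1_gradient (cracked L H (\<Phi> l)) u v"
    using v by (auto simp: grads_def)
  have ms: "u \<in> borel_measurable (OM L H)" "(\<lambda>x. fst (v x)) \<in> borel_measurable (OM L H)" "(\<lambda>x. snd (v x)) \<in> borel_measurable (OM L H)"
    using u(2) unfolding H1_gradient_cracked_iff by (auto dest: sqi_measurable)
  obtain u' where u': "u' \<in> borel_measurable borel" "AE x in OM L H. u x = u' x"
    using borel_representative[OF ms(1) Omega_facts(4)] by blast
  obtain v1 where v1: "v1 \<in> borel_measurable borel" "AE x in OM L H. fst (v x) = v1 x"
    using borel_representative[OF ms(2) Omega_facts(4)] by blast
  obtain v2 where v2: "v2 \<in> borel_measurable borel" "AE x in OM L H. snd (v x) = v2 x"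
    using borel_representative[OF ms(3) Omega_facts(4)] by blast
  have ae: "AE x in lebesgue_on U. P x" if "AE x in OM L H. P x" "U \<subseteq> Omega L H" "U \<in> sets lebesgue" for U P
    using that Omega_facts(4)[of L H] by (auto simp: AE_restrict_space_iff elim!: eventually_mono)
  have cs: "cracked L H (\<Phi> l) \<in> sets lebesgue" using cracked_borel by simp
  have h: "H1_gradient (cracked L H (\<Phi> l)) u' (\<lambda>x. (v1 x, v2 x))"
    by (rule H1_gradient_cong_AE[OF u(2) cracked_lmeasurable u'(1) v1(1) v2(1)])
      (rule ae[OF u'(2) Diff_subset cs] ae[OF v1(2) Diff_subset cs] ae[OF v2(2) Diff_subset cs])+
  let ?u = "\<lambda>x. u' (shear \<Phi> x)" and ?w = "\<lambda>x. (\<Phi>' (fst x) * v1 (shear \<Phi> x), v2 (shear \<Phi> x))"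
  have "H1_gradient (shear \<Phi> -` cracked L H (\<Phi> l)) ?u ?w"
    by (rule H1_gradient_shear[OF D cracked_lmeasurable cracked_borel _ u'(1) v1(1) v2(1) h])
      (simp only: shear_vimage[OF D] cracked_lmeasurable)
  then have H1: "H1_gradient (cracked L H l) ?u ?w" unfolding shear_vimage[OF D] .
  have tr: "has_trace ({0<..<L} \<times> J) c J ?u g"
    if "has_trace ({0<..<L} \<times> J) c J u g" "J = {a<..<b}" "-H \<le> a" "b \<le> H" "c = 0 \<or> c = L" for c J a b
  proof (rule has_trace_shear[OF D _ _ that(1) u'(1)])
    show "{0<..<L} \<times> J = {0<..<L} \<times> {a<..<b}" using that by simp
    show "\<Phi> c = c" using that f by auto
    show "AE x in lebesgue_on ({0<..<L} \<times> J). u x = u' x"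
      using rect_lmeasurable(1)[of 0 L a b] that by (intro ae[OF u'(2)]) (auto simp: Omega_def)
  qed
  have "?u \<in> admissible L H g l"
  proof -
    have "has_trace ({0<..<L} \<times> {0<..<H}) 0 {0<..<H} u g" "has_trace ({0<..<L} \<times> {-H<..<0}) 0 {-H<..<0} u g"
      "has_trace ({0<..<L} \<times> {0<..<H}) L {0<..<H} u g" "has_trace ({0<..<L} \<times> {-H<..<0}) L {-H<..<0} u g"
      using u(1) unfolding admissible_def by blast+
    from tr[OF this(1) refl] tr[OF this(2) refl] tr[OF this(3) refl] tr[OF this(4) refl] \<open>H > 0\<close>
    have "has_trace ({0<..<L} \<times> {0<..<H}) 0 {0<..<H} ?u g" "has_trace ({0<..<L} \<times> {-H<..<0}) 0 {-H<..<0} ?u g"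
      "has_trace ({0<..<L} \<times> {0<..<H}) L {0<..<H} ?u g" "has_trace ({0<..<L} \<times> {-H<..<0}) L {-H<..<0} ?u g"
      by simp_all
    then show ?thesis using H1 unfolding admissible_def H1_def by blast
  qed
  then have wg: "?w \<in> grads L H g l" using H1 by (auto simp: grads_def)
  have Cb: "(\<lambda>x. fst (C x)) \<in> borel_measurable borel" "(\<lambda>x. snd (C x)) \<in> borel_measurable borel"
    using measurable_compose[OF C borel_measurable_continuous_onI[OF continuous_on_fst[OF continuous_on_id]]]
      measurable_compose[OF C borel_measurable_continuous_onI[OF continuous_on_snd[OF continuous_on_id]]] by auto
  let ?q = "\<lambda>x. quad_form (C x) (v1 x, v2 x)"
  have qb: "?q \<in> borel_measurable borel" unfolding quad_form_def fst_conv snd_conv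
    using Cb v1(1) v2(1) by (intro borel_measurable_add borel_measurable_times borel_measurable_power)
  have "en L H C v = (LINT x|OM L H. ?q x)"
    unfolding en_def
  proof (rule integral_cong_AE)
    show "(\<lambda>x. quad_form (C x) (v x)) \<in> borel_measurable (OM L H)" unfolding quad_form_def
      using Cb[THEN borel_measurable_lebesgue_onI] ms by (intro borel_measurable_add borel_measurable_times borel_measurable_power)
    show "AE x in OM L H. quad_form (C x) (v x) = ?q x" using v1(2) v2(2) by eventually_elim (simp add: quad_form_def)
  qed (rule borel_measurable_lebesgue_onI[OF qb])
  also have "\<dots> = (LINT x|OM L H. \<Phi>' (fst x) * ?q (shear \<Phi> x))"
    using change_of_variables(1)[OF D qb Omega_facts(3)[of L H]] unfolding shear_vimage[OF D] .
  also have "\<dots> = en L H (\<lambda>x. warp \<Phi>' (\<lambda>x. C (shear \<Phi> x)) x) ?w"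
    unfolding en_def
  proof (rule Bochner_Integration.integral_cong)
    show "\<Phi>' (fst x) * ?q (shear \<Phi> x) = quad_form (warp \<Phi>' (\<lambda>x. C (shear \<Phi> x)) x) (?w x)" for x
      using f(9)[of "fst x"] by (simp add: quad_form_def warp_def power2_eq_square field_simps)
  qed simp
  finally have "en L H C v = en L H (\<lambda>x. warp \<Phi>' (\<lambda>x. C (shear \<Phi> x)) x) ?w" .
  then show ?thesis by (intro bexI[OF _ wg]) (rule sym)
qed

lemma en_cong: "(\<And>x. x \<in> Omega L H \<Longrightarrow> C x = C' x) \<Longrightarrow> en L H C v = en L H C' v"
  unfolding en_def by (rule Bochner_Integration.integral_cong) auto

text \<open>Both inequalities come from transporting competitors, once with the diffeomorphism and once with its inverse.\<close>

lemma transport_energy: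
  assumes D: "diffeo L K \<Phi> \<Phi>' \<Psi> \<Psi>'" and H: "H > 0" and C: "C \<in> borel_measurable borel"
    and inv: "\<And>x. x \<in> Omega L H \<Longrightarrow> C (shear \<Phi> x) = C x"
  shows "energy L H g C (\<Phi> l) = energy L H g (warp \<Phi>' C) l" "grads L H g (\<Phi> l) = {} \<longleftrightarrow> grads L H g l = {}"
proof -
  note f = diffeo_facts[OF D]
  note sw = diffeo_swap[OF D]
  have 1: "\<exists>w\<in>grads L H g l. en L H (warp \<Phi>' C) w = en L H C v" if vv: "v \<in> grads L H g (\<Phi> l)" for v
  proof -
    obtain w where w: "w \<in> grads L H g l" "en L H (\<lambda>x. warp \<Phi>' (\<lambda>x. C (shear \<Phi> x)) x) w = en L H C v"
      using transport[OF D H vv C] by blast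
    moreover have "en L H (\<lambda>x. warp \<Phi>' (\<lambda>x. C (shear \<Phi> x)) x) w = en L H (warp \<Phi>' C) w"
      by (rule en_cong) (simp add: warp_def inv)
    ultimately show ?thesis by auto
  qed
  have Wb: "warp \<Phi>' C \<in> borel_measurable borel"
  proof -
    have "(\<lambda>x. fst (C x)) \<in> borel_measurable borel" "(\<lambda>x. snd (C x)) \<in> borel_measurable borel"
      using measurable_compose[OF C borel_measurable_continuous_onI[OF continuous_on_fst[OF continuous_on_id]]]
        measurable_compose[OF C borel_measurable_continuous_onI[OF continuous_on_snd[OF continuous_on_id]]] by auto
    then show ?thesis unfolding warp_def[abs_def] using smooth_borel[OF f(3)]
      by (intro borel_measurable_Pair borel_measurable_divide borel_measurable_times)
  qed
  have 2: "\<exists>v\<in>grads L H g (\<Phi> l). en L H C v = en L H (warp \<Phi>' C) w" if "w \<in> grads L H g l" for w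
  proof -
    have "w \<in> grads L H g (\<Psi> (\<Phi> l))" using that by (simp add: f)
    then obtain v where v: "v \<in> grads L H g (\<Phi> l)" "en L H (\<lambda>x. warp \<Psi>' (\<lambda>x. warp \<Phi>' C (shear \<Psi> x)) x) v = en L H (warp \<Phi>' C) w"
      using transport[OF sw H _ Wb] by blast
    moreover have "en L H (\<lambda>x. warp \<Psi>' (\<lambda>x. warp \<Phi>' C (shear \<Psi> x)) x) v = en L H C v"
    proof (rule en_cong)
      fix x assume x: "x \<in> Omega L H"
      then have "shear \<Psi> x \<in> Omega L H" using shear_vimage(1)[OF sw, of H] by blast
      from inv[OF this] have i: "C (shear \<Psi> x) = C x" by (simp add: shear_inverse[OF D])
      have p: "\<Phi>' (\<Psi> (fst x)) * \<Psi>' (fst x) = 1" using derivative_product[OF D, of "\<Psi> (fst x)"] by (simp add: f)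
      have "fst (C x) / \<Phi>' (\<Psi> (fst x)) / \<Psi>' (fst x) = fst (C x)" "snd (C x) * \<Phi>' (\<Psi> (fst x)) * \<Psi>' (fst x) = snd (C x)"
        using p by (simp_all add: mult.assoc)
      then show "warp \<Psi>' (\<lambda>x. warp \<Phi>' C (shear \<Psi> x)) x = C x"
        unfolding warp_def shear_def fst_conv snd_conv i[unfolded shear_def] by (simp only: prod.collapse)
    qed
    ultimately show ?thesis by auto
  qed
  have "(\<lambda>v. 1/2 * en L H C v) ` grads L H g (\<Phi> l) = (\<lambda>v. 1/2 * en L H (warp \<Phi>' C) v) ` grads L H g l"
  proof (intro equalityI subsetI)
    fix y assume "y \<in> (\<lambda>v. 1/2 * en L H C v) ` grads L H g (\<Phi> l)"
    then obtain v where v: "v \<in> grads L H g (\<Phi> l)" "y = 1/2 * en L H C v" by blast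
    obtain w where "w \<in> grads L H g l" "en L H (warp \<Phi>' C) w = en L H C v" using 1[OF v(1)] by blast
    then show "y \<in> (\<lambda>v. 1/2 * en L H (warp \<Phi>' C) v) ` grads L H g l" by (intro image_eqI[of _ _ w]) (simp_all only: v(2))
  next
    fix y assume "y \<in> (\<lambda>v. 1/2 * en L H (warp \<Phi>' C) v) ` grads L H g l"
    then obtain w where w: "w \<in> grads L H g l" "y = 1/2 * en L H (warp \<Phi>' C) w" by blast
    obtain v where "v \<in> grads L H g (\<Phi> l)" "en L H C v = en L H (warp \<Phi>' C) w" using 2[OF w(1)] by blast
    then show "y \<in> (\<lambda>v. 1/2 * en L H C v) ` grads L H g (\<Phi> l)" by (intro image_eqI[of _ _ v]) (simp_all only: w(2))
  qed
  then show "energy L H g C (\<Phi> l) = energy L H g (warp \<Phi>' C) l" by (simp add: energy_eq)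
  show "grads L H g (\<Phi> l) = {} \<longleftrightarrow> grads L H g l = {}" using 1 2 by blast
qed

section \<open>Differentiability of the energy in the crack length\<close>

text \<open>Smoothness of the inverse is the only subtle point. With \<open>\<rho> = \<Psi>'\<close> one has
\<open>\<rho>' = - \<rho>\<^sup>3 * (\<Phi>'' \<circ> \<Psi>)\<close>, so the family \<open>{\<Psi>, \<rho>}\<close> is closed under differentiation up to the generated class.\<close>

lemma diffeo_of_field:
  assumes sm: "smooth1 \<psi>" and d: "\<And>t. (\<psi> has_real_derivative \<psi>' t) (at t)"
    and b: "\<And>t. \<bar>\<psi> t\<bar> \<le> 1" "\<And>t. \<bar>\<psi>' t\<bar> \<le> M" and z: "\<psi> 0 = 0" "\<psi> L = 0"
    and s: "\<bar>s\<bar> \<le> 1" "\<bar>s\<bar> * M \<le> 1/2"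
  shows "\<exists>\<Psi> \<Psi>'. diffeo L 2 (\<lambda>t. t + s * \<psi> t) (\<lambda>t. 1 + s * \<psi>' t) \<Psi> \<Psi>'"
proof -
  define \<Phi> where "\<Phi> = (\<lambda>t. t + s * \<psi> t)"
  define \<Phi>' where "\<Phi>' = (\<lambda>t. 1 + s * \<psi>' t)"
  have sm\<Phi>: "smooth1 \<Phi>" unfolding \<Phi>_def by (intro smooth_add smooth_fst smooth_scale sm)
  have D: "(\<Phi> has_real_derivative \<Phi>' t) (at t)" for t
    unfolding \<Phi>_def \<Phi>'_def by (auto intro!: derivative_eq_intros d)
  have small: "\<bar>s * \<psi>' t\<bar> \<le> 1/2" for t
    unfolding abs_mult using mult_left_mono[OF b(2)[of t] abs_ge_zero[of s]] s(2) by linarith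
  have \<Phi>'b: "1/2 \<le> \<Phi>' t" "\<Phi>' t \<le> 3/2" for t using small[of t] unfolding \<Phi>'_def by linarith+
  have mono: "\<Phi> x < \<Phi> y" if "x < y" for x y
    using that by (rule DERIV_pos_imp_increasing) (use D \<Phi>'b(1) in \<open>force intro: less_le_trans[of 0 "1/2"]\<close>)
  have inj: "x = y" if "\<Phi> x = \<Phi> y" for x y using mono[of x y] mono[of y x] that by (cases x y rule: linorder_cases) auto
  have cont: "isCont \<Phi> t" for t using D DERIV_isCont by blast
  have sb: "\<bar>s * \<psi> t\<bar> \<le> 1" for t
    unfolding abs_mult using mult_mono[OF s(1) b(1)[of t]] by simp
  have surj: "\<exists>t. \<Phi> t = y" for y
  proof -
    have "\<exists>t. y - 1 \<le> t \<and> t \<le> y + 1 \<and> \<Phi> t = y"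
    proof (rule IVT)
      show "\<Phi> (y - 1) \<le> y" using sb[of "y - 1"] unfolding \<Phi>_def by linarith
      show "y \<le> \<Phi> (y + 1)" using sb[of "y + 1"] unfolding \<Phi>_def by linarith
    qed (use cont in auto)
    then show ?thesis by blast
  qed
  define \<Psi> where "\<Psi> = (\<lambda>y. SOME t. \<Phi> t = y)"
  have r: "\<Phi> (\<Psi> y) = y" for y unfolding \<Psi>_def by (rule someI_ex[OF surj])
  have l: "\<Psi> (\<Phi> t) = t" for t by (rule inj) (rule r)
  define \<rho> where "\<rho> = (\<lambda>y. inverse (\<Phi>' (\<Psi> y)))"
  have cont\<Psi>: "isCont \<Psi> y" for y
    using isCont_inverse_function[of 1 "\<Psi> y" \<Psi> \<Phi>] l cont r by simp
  have D\<Psi>: "(\<Psi> has_real_derivative \<rho> y) (at y)" for y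
    unfolding \<rho>_def
  proof (rule DERIV_inverse_function[OF D, where a="y - 1" and b="y + 1"])
    show "\<Phi>' (\<Psi> y) \<noteq> 0" using \<Phi>'b(1)[of "\<Psi> y"] by linarith
  qed (use r cont\<Psi> in auto)
  have sm\<Phi>': "smooth1 \<Phi>'" by (rule smooth1_deriv[OF sm\<Phi> D])
  obtain \<Phi>'' where D2: "\<And>t. (\<Phi>' has_real_derivative \<Phi>'' t) (at t)" using smooth1_derivE[OF sm\<Phi>'] by blast
  have sm\<Phi>'': "smooth1 \<Phi>''" by (rule smooth1_deriv[OF sm\<Phi>' D2])
  have D\<rho>: "(\<rho> has_real_derivative - 1 * (\<rho> y * \<rho> y * \<rho> y * \<Phi>'' (\<Psi> y))) (at y)" for y
  proof -
    have n: "\<Phi>' (\<Psi> y) \<noteq> 0" using \<Phi>'b(1)[of "\<Psi> y"] by linarith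
    have "((\<lambda>y. \<Phi>' (\<Psi> y)) has_real_derivative \<Phi>'' (\<Psi> y) * \<rho> y) (at y)"
      by (rule DERIV_chain2[OF D2 D\<Psi>])
    from DERIV_inverse_fun[OF this n] show ?thesis
      unfolding \<rho>_def by (simp add: power2_eq_square mult_ac)
  qed
  define F where "F = (\<lambda>i. if i then \<Psi> else \<rho>)"
  have "smooth1 (F i)" for i
  proof (rule smooth1_genI[where F'="\<lambda>i. if i then \<rho> else (\<lambda>y. - 1 * (\<rho> y * \<rho> y * \<rho> y * \<Phi>'' (\<Psi> y)))"])
    let ?B = "range (\<lambda>i (x::real \<times> real). F i (fst x))"
    show "(F i has_real_derivative (if i then \<rho> else (\<lambda>y. - 1 * (\<rho> y * \<rho> y * \<rho> y * \<Phi>'' (\<Psi> y)))) t) (at t)" for i t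
      using D\<Psi> D\<rho> by (cases i) (auto simp: F_def)
    have "(\<lambda>x::real \<times> real. F True (fst x)) \<in> ?B" "(\<lambda>x::real \<times> real. F False (fst x)) \<in> ?B" by (rule rangeI)+
    then have B: "gen ?B (\<lambda>x. \<Psi> (fst x))" "gen ?B (\<lambda>x. \<rho> (fst x))" by (auto simp: F_def intro: gen.base)
    have "gen ?B (\<lambda>x. \<Phi>'' (\<Psi> (fst x)))"
      using gen.comp[OF gen.smooth[OF sm\<Phi>''] B(1) gen.snd] by simp
    then have "gen ?B (\<lambda>x. - 1 * (\<rho> (fst x) * \<rho> (fst x) * \<rho> (fst x) * \<Phi>'' (\<Psi> (fst x))))"
      by (intro gen.mult gen.const B)
    then show "gen ?B (\<lambda>x. (if i then \<rho> else (\<lambda>y. - 1 * (\<rho> y * \<rho> y * \<rho> y * \<Phi>'' (\<Psi> y)))) (fst x))" for i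
      using B by (cases i) auto
  qed
  from this[of True] have sm\<Psi>: "smooth1 \<Psi>" by (simp add: F_def)
  have \<rho>b: "0 < \<rho> y" "\<rho> y \<le> 2" for y
    using \<Phi>'b(1)[of "\<Psi> y"] le_imp_inverse_le[of "1/2" "\<Phi>' (\<Psi> y)"] by (auto simp: \<rho>_def)
  have "0 < \<Phi>' t" "\<Phi>' t \<le> 2" for t using \<Phi>'b[of t] by linarith+
  then have "diffeo L 2 \<Phi> \<Phi>' \<Psi> \<rho>"
    unfolding diffeo_def using sm\<Phi> sm\<Psi> D D\<Psi> r l \<rho>b z by (simp add: \<Phi>_def)
  then show ?thesis unfolding \<Phi>_def \<Phi>'_def by blast
qed

text \<open>A product of sines serves as a smooth field on the line that is bounded by 1 and vanishes at prescribed points.\<close>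

lemma vanishing_field:
  fixes S :: "real set"
  assumes "finite S"
  shows "smooth1 (\<lambda>t. \<Prod>p\<in>S. sin (a * t + - (a * p)))" (is ?A)
    "\<exists>\<psi>' M. \<forall>t. ((\<lambda>t. \<Prod>p\<in>S. sin (a * t + - (a * p))) has_real_derivative \<psi>' t) (at t) \<and> \<bar>\<psi>' t\<bar> \<le> M" (is ?B)
    "\<bar>\<Prod>p\<in>S. sin (a * t + - (a * p))\<bar> \<le> 1"
proof -
  have b: "\<bar>\<Prod>p\<in>S. sin (a * t + - (a * p))\<bar> \<le> 1" for S t
    unfolding abs_prod by (intro prod_le_1) auto
  then show "\<bar>\<Prod>p\<in>S. sin (a * t + - (a * p))\<bar> \<le> 1" .
  have "?A \<and> ?B" using assms
  proof induction
    case empty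
    show ?case by (auto intro!: smooth_const exI[of _ "\<lambda>_. 0"])
  next
    case (insert p S)
    let ?f = "\<lambda>t. \<Prod>p\<in>S. sin (a * t + - (a * p))" and ?g = "\<lambda>t. sin (a * t + - (a * p))"
    obtain f' M where f: "\<And>t. (?f has_real_derivative f' t) (at t)" "\<And>t. \<bar>f' t\<bar> \<le> M" using insert by blast
    have e: "(\<lambda>t. \<Prod>p\<in>insert p S. sin (a * t + - (a * p))) = (\<lambda>t. ?g t * ?f t)" using insert by simp
    have g: "(?g has_real_derivative cos (a * t + - (a * p)) * a) (at t)" for t
      by (auto intro!: derivative_eq_intros)
    have "smooth1 ?g" by (rule smooth1_sin)
    then have 1: "smooth1 (\<lambda>t. ?g t * ?f t)" using insert by (intro smooth_mult) auto
    have 2: "((\<lambda>t. ?g t * ?f t) has_real_derivative cos (a * t + - (a * p)) * a * ?f t + f' t * ?g t) (at t)" for t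
      by (rule DERIV_mult[OF g f(1)])
    have 3: "\<bar>cos (a * t + - (a * p)) * a * ?f t + f' t * ?g t\<bar> \<le> \<bar>a\<bar> + M" for t
    proof -
      have "\<bar>cos (a * t + - (a * p)) * a * ?f t\<bar> \<le> 1 * \<bar>a\<bar> * 1"
        unfolding abs_mult using b[of t S] by (intro mult_mono) auto
      moreover have "\<bar>f' t * ?g t\<bar> \<le> M * 1"
        unfolding abs_mult using f(2)[of t] by (intro mult_mono) auto
      ultimately show ?thesis by linarith
    qed
    have e2: "(\<lambda>x::real \<times> real. \<Prod>p\<in>insert p S. sin (a * fst x + - (a * p))) = (\<lambda>x. ?g (fst x) * ?f (fst x))"
      using insert by simp
    show ?case unfolding e e2
      by (intro conjI exI[of _ "\<lambda>t. cos (a * t + - (a * p)) * a * ?f t + f' t * ?g t"] exI[of _ "\<bar>a\<bar> + M"] allI) (rule 1 2 3)+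
  qed
  then show ?A ?B by auto
qed

text \<open>For \<open>p\<close> and \<open>l\<close> in \<open>[0, L]\<close> with \<open>0 < l < L\<close> the argument of each sine lies strictly between \<open>- \<pi>\<close> and \<open>\<pi>\<close>.\<close>

lemma vanishing_field_zero_iff:
  assumes "finite S" "S \<subseteq> {0..L}" "L > 0" "0 < l" "l < L"
  shows "(\<Prod>p\<in>S. sin (pi / L * l + - (pi / L * p))) = 0 \<longleftrightarrow> l \<in> S"
proof -
  have "sin (pi / L * l + - (pi / L * p)) = 0 \<longleftrightarrow> l = p" if "p \<in> S" for p
  proof
    assume z: "sin (pi / L * l + - (pi / L * p)) = 0"
    have p: "0 \<le> p" "p \<le> L" using that assms(2) by auto
    define q where "q = (l - p) / L"
    have e: "pi / L * l + - (pi / L * p) = pi * q" by (simp add: q_def diff_divide_distrib algebra_simps)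
    have "\<bar>q\<bar> < 1" unfolding q_def using p assms(3-5) by (simp add: abs_less_iff pos_divide_less_eq)
    then have "- 1 < q" "q < 1" by linarith+
    then have "pi * (- 1) < pi * q" "pi * q < pi * 1" by (simp_all only: mult_less_cancel_left_pos[OF pi_gt_zero])
    then have "pi * q = 0" using z sin_eq_0_pi[of "pi * q"] unfolding e by linarith
    then show "l = p" using assms(3) by (simp add: q_def)
  qed simp
  then show ?thesis using assms(1) by (auto simp: prod_zero_iff)
qed

lemma quadratic_error_derivative:
  fixes e :: "real \<Rightarrow> real"
  assumes "s0 > 0" "\<And>s. \<bar>s\<bar> \<le> s0 \<Longrightarrow> \<bar>e s - e 0 - s * D\<bar> \<le> A * s\<^sup>2"
  shows "(e has_real_derivative D) (at 0)"
proof -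
  have "((\<lambda>h. (e (0 + h) - e 0) / h - D) \<longlongrightarrow> 0) (at 0)"
  proof (rule tendsto_0_le[where K="\<bar>A\<bar>"])
    show "((\<lambda>h::real. h) \<longlongrightarrow> 0) (at 0)" by (rule tendsto_ident_at)
    have "norm ((e (0 + h) - e 0) / h - D) \<le> norm h * \<bar>A\<bar>" if "h \<noteq> 0" "\<bar>h\<bar> < s0" for h
    proof -
      have "\<bar>e h - e 0 - h * D\<bar> \<le> \<bar>A\<bar> * (\<bar>h\<bar> * \<bar>h\<bar>)"
        using assms(2)[of h] that mult_right_mono[OF abs_ge_self[of A] zero_le_power2[of h]] by (simp add: power2_eq_square)
      moreover have "(e h - e 0) / h - D = (e h - e 0 - h * D) / h" using that by (simp add: field_simps)
      ultimately show ?thesis using that by (simp add: abs_divide pos_divide_le_eq mult_ac)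
    qed
    then show "\<forall>\<^sub>F h in at 0. norm ((e (0 + h) - e 0) / h - D) \<le> norm h * \<bar>A\<bar>"
      using assms(1) by (auto simp: eventually_at dist_real_def)
  qed
  then have "((\<lambda>h. (e (0 + h) - e 0) / h) \<longlongrightarrow> D) (at 0)" by (simp add: LIM_zero_iff)
  then show ?thesis by (simp add: DERIV_def)
qed

lemma sum_product_bound:
  fixes x y \<theta> :: real
  assumes "\<theta> > 0" shows "2 * \<bar>x * y\<bar> \<le> \<theta> * x\<^sup>2 + y\<^sup>2 / \<theta>"
proof -
  have "0 \<le> (\<theta> * \<bar>x\<bar> - \<bar>y\<bar>)\<^sup>2 / \<theta>" using assms by simp
  also have "\<dots> = \<theta> * x\<^sup>2 + y\<^sup>2 / \<theta> - 2 * \<bar>x * y\<bar>"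
    using assms by (simp add: power2_eq_square abs_mult field_simps)
  finally show ?thesis by simp
qed

context
  fixes L H l m K M :: real and g :: "real \<times> real \<Rightarrow> real" and C :: "real \<times> real \<Rightarrow> real \<times> real" and \<tau> :: "real \<Rightarrow> real"
  assumes ell: "elliptic m K C" and ne: "grads L H g l \<noteq> {}"
    and \<tau>: "\<tau> \<in> borel_measurable borel" "\<And>t. \<bar>\<tau> t\<bar> \<le> M"
begin

text \<open>The first variation of the quadratic form under \<open>warp (1 + s \<tau>)\<close> at \<open>s = 0\<close>.\<close>

definition warp_form where
  "warp_form v = (LINT x|OM L H. \<tau> (fst x) * (snd (C x) * (snd (v x))\<^sup>2 - fst (C x) * (fst (v x))\<^sup>2))"

lemma M_nonneg: "M \<ge> 0"
  using \<tau>(2)[of 0] by linarith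

lemma C_pos: "fst (C x) > 0" "snd (C x) > 0"
  using elliptic_components(6)[OF ell] elliptic_components(7,8)[OF ell, of x] by auto

lemma quad_integrable: "sq2 L H v \<Longrightarrow> integrable (OM L H) (\<lambda>x. quad_form (C x) (v x))"
  using bil_integrable[OF ell, of L H v v] by (simp add: quad_form_def power2_eq_square mult.assoc)

lemma warp_form_integrable:
  assumes "sq2 L H v"
  shows "integrable (OM L H) (\<lambda>x. \<tau> (fst x) * (snd (C x) * (snd (v x))\<^sup>2 - fst (C x) * (fst (v x))\<^sup>2))"
proof -
  have i: "integrable (OM L H) (\<lambda>x. snd (C x) * (snd (v x))\<^sup>2 - fst (C x) * (fst (v x))\<^sup>2)"
    using bil_integrable[OF ell assms assms] by (simp add: power2_eq_square mult.assoc)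
  show ?thesis
  proof (rule Bochner_Integration.integrable_bound[OF integrable_mult_right[of M, OF i]])
    show "(\<lambda>x. \<tau> (fst x) * (snd (C x) * (snd (v x))\<^sup>2 - fst (C x) * (fst (v x))\<^sup>2)) \<in> borel_measurable (OM L H)"
      by (rule borel_measurable_times[OF fst_borel[OF \<tau>(1)] borel_measurable_integrable[OF i]])
    show "AE x in OM L H. norm (\<tau> (fst x) * (snd (C x) * (snd (v x))\<^sup>2 - fst (C x) * (fst (v x))\<^sup>2))
       \<le> norm (M * (snd (C x) * (snd (v x))\<^sup>2 - fst (C x) * (fst (v x))\<^sup>2))"
      using \<tau>(2) M_nonneg by (intro AE_I2) (simp add: abs_mult mult_right_mono)
  qed
qed

lemma warp_form_bound:
  assumes "sq2 L H v" shows "\<bar>warp_form v\<bar> \<le> M * en L H C v"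
proof -
  have "\<bar>warp_form v\<bar> \<le> (LINT x|OM L H. M * quad_form (C x) (v x))"
    unfolding warp_form_def
  proof (rule order_trans[OF integral_abs_bound], rule Bochner_Integration.integral_mono)
    show "integrable (OM L H) (\<lambda>x. \<bar>\<tau> (fst x) * (snd (C x) * (snd (v x))\<^sup>2 - fst (C x) * (fst (v x))\<^sup>2)\<bar>)"
      using warp_form_integrable[OF assms] by simp
    show "integrable (OM L H) (\<lambda>x. M * quad_form (C x) (v x))" using quad_integrable[OF assms] by simp
    fix x
    have "0 \<le> snd (C x) * (snd (v x))\<^sup>2" "0 \<le> fst (C x) * (fst (v x))\<^sup>2" using C_pos[of x] by simp_all
    then have "\<bar>snd (C x) * (snd (v x))\<^sup>2 - fst (C x) * (fst (v x))\<^sup>2\<bar> \<le> quad_form (C x) (v x)"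
      unfolding quad_form_def by linarith
    then show "\<bar>\<tau> (fst x) * (snd (C x) * (snd (v x))\<^sup>2 - fst (C x) * (fst (v x))\<^sup>2)\<bar> \<le> M * quad_form (C x) (v x)"
      unfolding abs_mult using \<tau>(2) M_nonneg by (intro mult_mono) auto
  qed
  then show ?thesis by (simp add: en_def)
qed

lemma warp_form_difference:
  assumes v: "sq2 L H v" and w: "sq2 L H w" and "\<theta> > 0"
  shows "2 * \<bar>warp_form v - warp_form w\<bar> \<le> M * (\<theta> * en L H C (\<lambda>x. v x - w x) + en L H C (\<lambda>x. v x + 1 *\<^sub>R w x) / \<theta>)"
proof -
  let ?N = "OM L H"
  let ?q = "\<lambda>v x. \<tau> (fst x) * (snd (C x) * (snd (v x))\<^sup>2 - fst (C x) * (fst (v x))\<^sup>2)"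
  let ?R = "\<lambda>x. M * (\<theta> * quad_form (C x) (v x - w x) + quad_form (C x) (v x + 1 *\<^sub>R w x) / \<theta>)"
  note i = quad_integrable[OF sq2_diff[OF v w]] quad_integrable[OF sq2_add_scale[OF v w, of 1]]
  have "(LINT x|?N. 2 * (?q v x - ?q w x)) = 2 * (warp_form v - warp_form w)"
    unfolding warp_form_def using warp_form_integrable[OF v] warp_form_integrable[OF w] by simp
  then have "2 * \<bar>warp_form v - warp_form w\<bar> = \<bar>LINT x|?N. 2 * (?q v x - ?q w x)\<bar>" by (simp only: abs_mult abs_numeral)
  also have "\<dots> \<le> (LINT x|?N. ?R x)"
  proof (rule order_trans[OF integral_abs_bound], rule Bochner_Integration.integral_mono)
    show "integrable ?N (\<lambda>x. \<bar>2 * (?q v x - ?q w x)\<bar>)"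
      using warp_form_integrable[OF v] warp_form_integrable[OF w] by (intro integrable_abs integrable_mult_right Bochner_Integration.integrable_diff)
    show "integrable ?N ?R" using i by (intro integrable_mult_right Bochner_Integration.integrable_add integrable_divide)
    fix x
    let ?a = "fst (C x)" and ?b = "snd (C x)"
    let ?d1 = "fst (v x) - fst (w x)" and ?s1 = "fst (v x) + fst (w x)" and ?d2 = "snd (v x) - snd (w x)" and ?s2 = "snd (v x) + snd (w x)"
    have e: "2 * (?q v x - ?q w x) = \<tau> (fst x) * (?b * (2 * (?d2 * ?s2)) - ?a * (2 * (?d1 * ?s1)))"
      by (simp add: power2_eq_square algebra_simps)
    have "\<bar>?b * (2 * (?d2 * ?s2)) - ?a * (2 * (?d1 * ?s1))\<bar> \<le> ?b * (2 * \<bar>?d2 * ?s2\<bar>) + ?a * (2 * \<bar>?d1 * ?s1\<bar>)"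
      using C_pos[of x] by (intro order_trans[OF abs_triangle_ineq4]) (simp add: abs_mult)
    also have "\<dots> \<le> ?b * (\<theta> * ?d2\<^sup>2 + ?s2\<^sup>2 / \<theta>) + ?a * (\<theta> * ?d1\<^sup>2 + ?s1\<^sup>2 / \<theta>)"
      using C_pos[of x] sum_product_bound[OF assms(3)] by (intro add_mono mult_left_mono) auto
    also have "\<dots> = \<theta> * quad_form (C x) (v x - w x) + quad_form (C x) (v x + 1 *\<^sub>R w x) / \<theta>"
      by (simp add: quad_form_def algebra_simps add_divide_distrib)
    finally have "\<bar>?b * (2 * (?d2 * ?s2)) - ?a * (2 * (?d1 * ?s1))\<bar> \<le> \<theta> * quad_form (C x) (v x - w x) + quad_form (C x) (v x + 1 *\<^sub>R w x) / \<theta>" .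
    then show "\<bar>2 * (?q v x - ?q w x)\<bar> \<le> ?R x"
      unfolding e abs_mult using \<tau>(2)[of "fst x"] M_nonneg by (intro mult_mono) auto
  qed
  also have "\<dots> = M * (\<theta> * en L H C (\<lambda>x. v x - w x) + en L H C (\<lambda>x. v x + 1 *\<^sub>R w x) / \<theta>)"
    unfolding en_def using i by simp
  finally show ?thesis .
qed

text \<open>Pointwise, \<open>1 - x \<le> 1 / (1 + x) \<le> 1 - x + 2 x\<^sup>2\<close> for \<open>\<bar>x\<bar> \<le> 1/2\<close>.\<close>

lemma en_warp_bounds:
  assumes v: "sq2 L H v" and s: "\<bar>s\<bar> * M \<le> 1/2"
  shows "en L H C v + s * warp_form v \<le> en L H (warp (\<lambda>t. 1 + s * \<tau> t) C) v"
    "en L H (warp (\<lambda>t. 1 + s * \<tau> t) C) v \<le> en L H C v + s * warp_form v + 2 * M\<^sup>2 * s\<^sup>2 * en L H C v"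
proof -
  let ?N = "OM L H"
  let ?q = "\<lambda>x. \<tau> (fst x) * (snd (C x) * (snd (v x))\<^sup>2 - fst (C x) * (fst (v x))\<^sup>2)"
  let ?W = "\<lambda>x. quad_form (warp (\<lambda>t. 1 + s * \<tau> t) C x) (v x)"
  let ?Q = "\<lambda>x. quad_form (C x) (v x)"
  have y: "\<bar>s * \<tau> t\<bar> \<le> 1/2" "\<bar>s * \<tau> t\<bar> \<le> \<bar>s\<bar> * M" for t
    unfolding abs_mult using mult_left_mono[OF \<tau>(2)[of t] abs_ge_zero[of s]] s by linarith+
  have pt: "?Q x + s * ?q x \<le> ?W x" "?W x \<le> ?Q x + s * ?q x + 2 * M\<^sup>2 * s\<^sup>2 * ?Q x" for x
  proof -
    let ?y = "s * \<tau> (fst x)" and ?A = "fst (C x) * (fst (v x))\<^sup>2" and ?B = "snd (C x) * (snd (v x))\<^sup>2"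
    have p: "1 + ?y \<ge> 1/2" using y(1)[of "fst x"] by linarith
    have A: "?A \<ge> 0" "?B \<ge> 0" using C_pos[of x] by simp_all
    have e: "?W x - (?Q x + s * ?q x) = ?A * (?y\<^sup>2 / (1 + ?y))"
      using p by (simp add: quad_form_def warp_def power2_eq_square field_simps)
    have 0: "0 \<le> ?y\<^sup>2 / (1 + ?y)" using p by simp
    have "?y\<^sup>2 / (1 + ?y) \<le> ?y\<^sup>2 / (1/2)" using p by (intro divide_left_mono) auto
    also have "\<dots> = 2 * ?y\<^sup>2" by simp
    also have "?y\<^sup>2 \<le> (\<bar>s\<bar> * M)\<^sup>2" using y(2)[of "fst x"] M_nonneg by (intro abs_le_square_iff[THEN iffD1]) (simp add: abs_mult)
    finally have 1: "?y\<^sup>2 / (1 + ?y) \<le> 2 * (M\<^sup>2 * s\<^sup>2)" by (simp add: power_mult_distrib mult.commute)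
    have "?A * (?y\<^sup>2 / (1 + ?y)) \<le> ?Q x * (2 * (M\<^sup>2 * s\<^sup>2))"
      using A 1 0 by (intro mult_mono) (auto simp: quad_form_def)
    then show "?W x \<le> ?Q x + s * ?q x + 2 * M\<^sup>2 * s\<^sup>2 * ?Q x" using e by (simp add: mult_ac)
    show "?Q x + s * ?q x \<le> ?W x" using mult_nonneg_nonneg[OF A(1) 0] e by linarith
  qed
  note i = quad_integrable[OF v] warp_form_integrable[OF v]
  have i1: "integrable ?N (\<lambda>x. ?Q x + s * ?q x)" using i by (intro Bochner_Integration.integrable_add integrable_mult_right)
  have i2: "integrable ?N (\<lambda>x. ?Q x + s * ?q x + 2 * M\<^sup>2 * s\<^sup>2 * ?Q x)" using i i1 by (intro Bochner_Integration.integrable_add integrable_mult_right)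
  have mW: "?W \<in> borel_measurable ?N"
  proof -
    have t: "(\<lambda>x. 1 + s * \<tau> (fst x)) \<in> borel_measurable ?N"
      by (intro borel_measurable_add borel_measurable_const borel_measurable_times fst_borel[OF \<tau>(1)])
    show ?thesis unfolding warp_def quad_form_def fst_conv snd_conv
      using t elliptic_components(1,2)[OF ell, THEN borel_measurable_lebesgue_onI] v[unfolded sq2_def]
      by (intro borel_measurable_add borel_measurable_times borel_measurable_divide borel_measurable_power fst_borel[OF \<tau>(1)]) (auto dest: sqi_measurable)
  qed
  have iW: "integrable ?N ?W"
  proof (rule Bochner_Integration.integrable_bound[OF Bochner_Integration.integrable_add[OF integrable_abs[OF i1] integrable_abs[OF i2]] mW])
    have "\<bar>a\<bar> \<le> \<bar>\<bar>b\<bar> + \<bar>c\<bar>\<bar>" if "b \<le> a" "a \<le> c" for a b c :: real using that by linarith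
    then show "AE x in ?N. norm (?W x) \<le> norm (\<bar>?Q x + s * ?q x\<bar> + \<bar>?Q x + s * ?q x + 2 * M\<^sup>2 * s\<^sup>2 * ?Q x\<bar>)"
      using pt by (intro AE_I2) (simp only: real_norm_def)
  qed
  have "(LINT x|?N. ?Q x + s * ?q x) = en L H C v + s * warp_form v" unfolding en_def warp_form_def using i by simp
  moreover have "(LINT x|?N. ?Q x + s * ?q x + 2 * M\<^sup>2 * s\<^sup>2 * ?Q x) = en L H C v + s * warp_form v + 2 * M\<^sup>2 * s\<^sup>2 * en L H C v"
    unfolding en_def warp_form_def using i by simp
  ultimately show "en L H C v + s * warp_form v \<le> en L H (warp (\<lambda>t. 1 + s * \<tau> t) C) v"
    "en L H (warp (\<lambda>t. 1 + s * \<tau> t) C) v \<le> en L H C v + s * warp_form v + 2 * M\<^sup>2 * s\<^sup>2 * en L H C v"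
    using Bochner_Integration.integral_mono[OF i1 iW pt(1)] Bochner_Integration.integral_mono[OF iW i2 pt(2)]
    unfolding en_def[of L H "warp (\<lambda>t. 1 + s * \<tau> t) C"] by simp_all
qed

text \<open>Near-minimizers are a Cauchy family for the energy norm, so the first variation converges along them to a number \<open>2 D\<close>,
and it differs from \<open>2 D\<close> by \<open>O(\<surd>\<eta>)\<close> at a competitor of excess \<open>\<eta>\<close>. For the upper bound use a competitor of excess \<open>s\<^sup>2\<close>. For
the lower bound the error \<open>\<bar>s\<bar> \<surd>\<eta>\<close> is absorbed by the excess itself, leaving \<open>O(s\<^sup>2)\<close>.\<close>

lemma warped_energy_expansion:
  "\<exists>D A s0. s0 > 0 \<and> (\<forall>s. \<bar>s\<bar> \<le> s0 \<longrightarrow>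
     \<bar>energy L H g (warp (\<lambda>t. 1 + s * \<tau> t) C) l - energy L H g C l - s * D\<bar> \<le> A * s\<^sup>2)"
proof -
  define E where "E = energy L H g C l"
  let ?W = "\<lambda>s. warp (\<lambda>t. 1 + s * \<tau> t) C"
  have E0: "E \<ge> 0" unfolding E_def
    by (rule energy_greatest[OF ne]) (use en_bounds(3)[OF ell grads_sq2] in simp)
  define N where "N = 8 * (E + 1)"
  have N: "N \<ge> 8" using E0 by (simp add: N_def)
  have near: "\<bar>warp_form v - warp_form w\<bar> \<le> M * (sqrt (\<eta> + \<epsilon>) * (1 + N))"
    if v: "v \<in> grads L H g l" "1/2 * en L H C v \<le> E + \<eta>" and w: "w \<in> grads L H g l" "1/2 * en L H C w \<le> E + \<epsilon>"
      and \<eta>: "0 \<le> \<eta>" "\<eta> \<le> 1" "0 < \<epsilon>" "\<epsilon> \<le> 1" for v w \<eta> \<epsilon>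
  proof -
    define \<delta> where "\<delta> = sqrt (\<eta> + \<epsilon>)"
    have \<delta>: "\<delta> > 0" "\<delta>\<^sup>2 = \<eta> + \<epsilon>" using \<eta> by (auto simp: \<delta>_def)
    note sv = grads_sq2[OF v(1)] and sw = grads_sq2[OF w(1)]
    have 1: "en L H C (\<lambda>x. v x - w x) \<le> 4 * \<delta>\<^sup>2"
      using near_minimizers_close[OF ell w(1) v(1)] w(2) v(2) unfolding E_def \<delta>(2) by (simp add: add.commute)
    have 2: "en L H C (\<lambda>x. v x + 1 *\<^sub>R w x) \<le> N"
    proof -
      have "0 \<le> en L H C (\<lambda>x. v x + (-1) *\<^sub>R w x)" by (rule en_bounds(3)[OF ell sq2_add_scale[OF sv sw]])
      then have "2 * bil L H C v w \<le> en L H C v + en L H C w" unfolding en_add[OF ell sv sw] by simp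
      then have "en L H C (\<lambda>x. v x + 1 *\<^sub>R w x) \<le> 2 * en L H C v + 2 * en L H C w" unfolding en_add[OF ell sv sw] by simp
      moreover have "en L H C v \<le> 2 * (E + \<eta>)" "en L H C w \<le> 2 * (E + \<epsilon>)" using v(2) w(2) by simp_all
      moreover have "a \<le> 8 * (e + 1)"
        if "a \<le> 2 * b + 2 * c" "b \<le> 2 * (e + x)" "c \<le> 2 * (e + y)" "x \<le> 1" "y \<le> 1" for a b c e x y :: real
        using that unfolding distrib_left by linarith
      ultimately show ?thesis unfolding N_def using \<eta>(2,4) by blast
    qed
    have "1 / \<delta> > 0" using \<delta> by simp
    from warp_form_difference[OF sv sw this]
    have "2 * \<bar>warp_form v - warp_form w\<bar> \<le> M * (1 / \<delta> * en L H C (\<lambda>x. v x - w x) + en L H C (\<lambda>x. v x + 1 *\<^sub>R w x) / (1 / \<delta>))" .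
    also have "\<dots> \<le> M * (1 / \<delta> * (4 * \<delta>\<^sup>2) + N / (1 / \<delta>))"
      using 1 2 \<delta> M_nonneg by (intro mult_left_mono add_mono divide_right_mono) auto
    also have "1 / \<delta> * (4 * \<delta>\<^sup>2) + N / (1 / \<delta>) = \<delta> * (4 + N)" using \<delta>(1) by (simp add: power2_eq_square field_simps)
    also have "M * (\<delta> * (4 + N)) \<le> M * (\<delta> * (2 * (1 + N)))"
      using N \<delta>(1) M_nonneg by (intro mult_left_mono) auto
    finally have "2 * \<bar>warp_form v - warp_form w\<bar> \<le> M * (\<delta> * (2 * (1 + N)))" .
    moreover have "M * (\<delta> * (2 * (1 + N))) = 2 * (M * (\<delta> * (1 + N)))" by (simp add: algebra_simps)
    moreover have "a \<le> y" if "2 * a \<le> x" "x = 2 * y" for a x y :: real using that by linarith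
    ultimately show ?thesis unfolding \<delta>_def by blast
  qed
  have "\<exists>v. v \<in> grads L H g l \<and> 1/2 * en L H C v \<le> E + 1 / real (Suc k)" for k
    using energy_approx[OF ell ne, of "1 / real (Suc k)"] unfolding E_def by (auto intro: less_imp_le)
  then obtain V where V: "\<And>k. V k \<in> grads L H g l" "\<And>k. 1/2 * en L H C (V k) \<le> E + 1 / real (Suc k)" by metis
  have inv: "0 < 1 / real (Suc k)" "1 / real (Suc k) \<le> 1" for k by auto
  have lim0: "(\<lambda>k. M * (sqrt (\<eta> + 1 / real (Suc k)) * (1 + N))) \<longlonglongrightarrow> M * (sqrt (\<eta> + 0) * (1 + N))" for \<eta>
    by (intro tendsto_intros LIMSEQ_Suc lim_inverse_n'[unfolded inverse_eq_divide])
  have "Cauchy (\<lambda>k. warp_form (V k))"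
  proof (rule metric_CauchyI)
    fix e :: real assume e: "e > 0"
    have "(\<lambda>k. M * (sqrt (1 / real (Suc k) + 1 / real (Suc k)) * (1 + N))) \<longlonglongrightarrow> M * (sqrt (0 + 0) * (1 + N))"
      by (intro tendsto_intros LIMSEQ_Suc lim_inverse_n'[unfolded inverse_eq_divide])
    then have "\<forall>\<^sub>F k in sequentially. M * (sqrt (1 / real (Suc k) + 1 / real (Suc k)) * (1 + N)) < e"
      using e by (intro order_tendstoD) auto
    then obtain k0 where k0: "M * (sqrt (1 / real (Suc k0) + 1 / real (Suc k0)) * (1 + N)) < e"
      by (auto simp: eventually_sequentially)
    show "\<exists>n. \<forall>i\<ge>n. \<forall>j\<ge>n. dist (warp_form (V i)) (warp_form (V j)) < e"
    proof (intro exI[of _ k0] allI impI)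
      fix i j assume ij: "i \<ge> k0" "j \<ge> k0"
      have le: "1 / real (Suc i) \<le> 1 / real (Suc k0)" "1 / real (Suc j) \<le> 1 / real (Suc k0)" using ij by (auto simp: frac_le)
      have "\<bar>warp_form (V i) - warp_form (V j)\<bar> \<le> M * (sqrt (1 / real (Suc k0) + 1 / real (Suc k0)) * (1 + N))"
        using V(2)[of i] V(2)[of j] le inv[of k0] by (intro near[OF V(1) _ V(1)]) auto
      then show "dist (warp_form (V i)) (warp_form (V j)) < e" using k0 by (simp add: dist_real_def)
    qed
  qed
  then obtain D2 where D2: "(\<lambda>k. warp_form (V k)) \<longlonglongrightarrow> D2" using Cauchy_convergent convergent_def by blast
  have D2b: "\<bar>warp_form v - D2\<bar> \<le> M * (sqrt \<eta> * (1 + N))"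
    if v: "v \<in> grads L H g l" "1/2 * en L H C v \<le> E + \<eta>" "0 \<le> \<eta>" "\<eta> \<le> 1" for v \<eta>
  proof (rule LIMSEQ_le)
    show "(\<lambda>k. \<bar>warp_form v - warp_form (V k)\<bar>) \<longlonglongrightarrow> \<bar>warp_form v - D2\<bar>" by (intro tendsto_intros D2)
    show "(\<lambda>k. M * (sqrt (\<eta> + 1 / real (Suc k)) * (1 + N))) \<longlonglongrightarrow> M * (sqrt \<eta> * (1 + N))" using lim0[of \<eta>] by simp
    show "\<exists>n0. \<forall>k\<ge>n0. \<bar>warp_form v - warp_form (V k)\<bar> \<le> M * (sqrt (\<eta> + 1 / real (Suc k)) * (1 + N))"
      using near[OF v(1,2) V(1) V(2) v(3,4) inv] by blast
  qed
  define c where "c = M * (1 + N)"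
  have c: "c \<ge> 0" using M_nonneg N by (simp add: c_def)
  \<comment> \<open>The energy carries the factor \<open>1/2\<close>.\<close>
  define D where "D = D2 / 2"
  define s0 where "s0 = min 1 (1 / (2 * (M * (E + 1) + \<bar>D\<bar> + M + 1)))"
  have den: "2 * (M * (E + 1) + \<bar>D\<bar> + M + 1) > 0" using M_nonneg E0 by (simp add: add_nonneg_pos)
  have s0: "s0 > 0" using den by (simp add: s0_def)
  have s_small: "\<bar>s\<bar> \<le> 1" "\<bar>s\<bar> * M \<le> 1/2" "\<bar>s\<bar> * (M * (E + 1) + \<bar>D\<bar>) \<le> 1/2" if "\<bar>s\<bar> \<le> s0" for s
  proof -
    show "\<bar>s\<bar> \<le> 1" using that by (simp add: s0_def)
    have "\<bar>s\<bar> \<le> 1 / (2 * (M * (E + 1) + \<bar>D\<bar> + M + 1))" using that by (simp add: s0_def)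
    then have p: "\<bar>s\<bar> * (2 * (M * (E + 1) + \<bar>D\<bar> + M + 1)) \<le> 1" using den by (simp add: pos_le_divide_eq)
    have "\<bar>s\<bar> * y \<le> 1/2" if "y \<le> M * (E + 1) + \<bar>D\<bar> + M + 1" for y
    proof -
      have "\<bar>s\<bar> * (2 * y) \<le> \<bar>s\<bar> * (2 * (M * (E + 1) + \<bar>D\<bar> + M + 1))" using that by (intro mult_left_mono) auto
      then show ?thesis using p by linarith
    qed
    moreover have "M \<le> M * (E + 1) + \<bar>D\<bar> + M + 1" "M * (E + 1) + \<bar>D\<bar> \<le> M * (E + 1) + \<bar>D\<bar> + M + 1"
      using M_nonneg E0 by (auto simp: add_nonneg_nonneg)
    ultimately show "\<bar>s\<bar> * M \<le> 1/2" "\<bar>s\<bar> * (M * (E + 1) + \<bar>D\<bar>) \<le> 1/2" by blast+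
  qed
  define A where "A = 1 + c + c\<^sup>2 + 2 * M\<^sup>2 * (E + 1)"
  have upper: "energy L H g (?W s) l \<le> E + s * D + A * s\<^sup>2" if s: "\<bar>s\<bar> \<le> s0" "s \<noteq> 0" for s
  proof -
    note ss = s_small[OF s(1)]
    have "s\<^sup>2 > 0" "s\<^sup>2 \<le> 1" using s(2) ss(1) abs_le_square_iff[of s 1] by auto
    obtain v where v: "v \<in> grads L H g l" "1/2 * en L H C v < E + s\<^sup>2"
      using energy_approx[OF ell ne \<open>s\<^sup>2 > 0\<close>] unfolding E_def by blast
    have e1: "energy L H g (?W s) l \<le> 1/2 * en L H (?W s) v"
    proof -
      have "bdd_below ((\<lambda>v. 1/2 * en L H (?W s) v) ` grads L H g l)"
      proof (rule bdd_belowI2[of _ 0])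
        fix w assume "w \<in> grads L H g l"
        note sw = grads_sq2[OF this]
        have "\<bar>s * warp_form w\<bar> \<le> (\<bar>s\<bar> * M) * en L H C w" unfolding abs_mult using mult_left_mono[OF warp_form_bound[OF sw] abs_ge_zero[of s]] by simp
        also have "\<dots> \<le> 1/2 * en L H C w" using ss(2) en_bounds(3)[OF ell sw] by (rule mult_right_mono)
        finally show "0 \<le> 1/2 * en L H (?W s) w" using en_warp_bounds(1)[OF sw ss(2)] en_bounds(3)[OF ell sw] by linarith
      qed
      then show ?thesis unfolding energy_eq by (intro cInf_lower imageI v(1))
    qed
    have e2: "\<bar>warp_form v - D2\<bar> \<le> c * \<bar>s\<bar>"
      using D2b[OF v(1), of "s\<^sup>2"] v(2) \<open>s\<^sup>2 \<le> 1\<close> by (simp add: c_def mult_ac)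
    have "\<bar>s * (warp_form v - D2)\<bar> \<le> \<bar>s\<bar> * (c * \<bar>s\<bar>)" unfolding abs_mult using e2 by (intro mult_left_mono) auto
    also have "\<dots> = c * s\<^sup>2" by (simp add: power2_eq_square mult_ac abs_mult[symmetric])
    finally have e3: "s * warp_form v \<le> 2 * (s * D) + c * s\<^sup>2" unfolding D_def by (simp add: algebra_simps)
    have "M\<^sup>2 * s\<^sup>2 * (1/2 * en L H C v) \<le> M\<^sup>2 * s\<^sup>2 * (E + 1)" using v(2) \<open>s\<^sup>2 \<le> 1\<close> by (intro mult_left_mono) auto
    then have e4: "2 * M\<^sup>2 * s\<^sup>2 * en L H C v \<le> 4 * M\<^sup>2 * (E + 1) * s\<^sup>2" by (simp add: mult_ac)
    have "A * s\<^sup>2 = s\<^sup>2 + c * s\<^sup>2 + c\<^sup>2 * s\<^sup>2 + 2 * M\<^sup>2 * (E + 1) * s\<^sup>2" by (simp add: A_def distrib_right)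
    moreover have "0 \<le> c\<^sup>2 * s\<^sup>2" "0 \<le> c * s\<^sup>2" using c by simp_all
    ultimately show ?thesis using e1 en_warp_bounds(2)[OF grads_sq2[OF v(1)] ss(2)] v(2) e3 e4 by linarith
  qed
  have lower: "E + s * D - A * s\<^sup>2 \<le> energy L H g (?W s) l" if s: "\<bar>s\<bar> \<le> s0" for s
  proof (rule energy_greatest[OF ne])
    note ss = s_small[OF s]
    fix v assume v: "v \<in> grads L H g l"
    define \<eta> where "\<eta> = 1/2 * en L H C v - E"
    have \<eta>: "\<eta> \<ge> 0" using energy_lower[OF ell v] by (simp add: \<eta>_def E_def)
    have w: "en L H C v + s * warp_form v \<le> en L H (?W s) v" by (rule en_warp_bounds(1)[OF grads_sq2[OF v] ss(2)])
    have en: "en L H C v = 2 * (E + \<eta>)" by (simp add: \<eta>_def)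
    have A0: "0 \<le> A * s\<^sup>2" "c\<^sup>2 * s\<^sup>2 \<le> A * s\<^sup>2" using c E0 by (auto simp: A_def intro!: mult_right_mono)
    show "E + s * D - A * s\<^sup>2 \<le> 1/2 * en L H (?W s) v"
    proof (cases "\<eta> \<le> 1")
      case True
      have "\<bar>warp_form v - D2\<bar> \<le> c * sqrt \<eta>" using D2b[OF v _ \<eta> True] by (simp add: \<eta>_def c_def mult_ac)
      then have "\<bar>s * (warp_form v - D2)\<bar> \<le> \<bar>s\<bar> * (c * sqrt \<eta>)" unfolding abs_mult by (intro mult_left_mono) auto
      also have "\<dots> = (c * \<bar>s\<bar>) * sqrt \<eta>" by simp
      also have "\<dots> \<le> (c * \<bar>s\<bar>)\<^sup>2 / 2 + (sqrt \<eta>)\<^sup>2 / 2"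
        using sum_squares_bound[of "c * \<bar>s\<bar>" "sqrt \<eta>"] by simp
      finally have "\<bar>s * (warp_form v - D2)\<bar> \<le> c\<^sup>2 * s\<^sup>2 / 2 + \<eta> / 2" using \<eta> by (simp add: power_mult_distrib)
      then have "s * warp_form v \<ge> 2 * (s * D) - (c\<^sup>2 * s\<^sup>2 / 2 + \<eta> / 2)" unfolding D_def by (simp add: algebra_simps)
      then show ?thesis using w en A0 \<eta> zero_le_power2[of "c * s"] unfolding power_mult_distrib distrib_left by linarith
    next
      case False
      have "\<bar>s * warp_form v\<bar> \<le> \<bar>s\<bar> * (M * en L H C v)" unfolding abs_mult using warp_form_bound[OF grads_sq2[OF v]] by (intro mult_left_mono) auto
      also have "\<dots> = 2 * ((\<bar>s\<bar> * M) * (E + 1)) + 2 * ((\<bar>s\<bar> * M) * (\<eta> - 1))" unfolding en by (simp add: algebra_simps)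
      also have "(\<bar>s\<bar> * M) * (\<eta> - 1) \<le> 1/2 * (\<eta> - 1)" using False ss(2) by (intro mult_right_mono) auto
      finally have q: "\<bar>s * warp_form v\<bar> \<le> 2 * ((\<bar>s\<bar> * M) * (E + 1)) + 2 * (1/2 * (\<eta> - 1))" by simp
      have h: "2 * (1/2 * (\<eta> - 1)) = \<eta> - 1" by simp
      have 1: "\<bar>s * warp_form v\<bar> \<le> 2 * (\<bar>s\<bar> * M * (E + 1)) + (\<eta> - 1)" using q unfolding h .
      have 2: "s * D \<le> \<bar>s\<bar> * \<bar>D\<bar>" by (metis abs_ge_self abs_mult)
      have "\<bar>s\<bar> * (M * (E + 1) + \<bar>D\<bar>) = \<bar>s\<bar> * M * (E + 1) + \<bar>s\<bar> * \<bar>D\<bar>" by (simp add: algebra_simps)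
      then show ?thesis using 1 2 ss(3) w en A0(1) False unfolding distrib_left by linarith
    qed
  qed
  have id: "warp (\<lambda>t. 1 + 0 * \<tau> t) C = C" by (simp add: warp_def fun_eq_iff)
  have "\<bar>energy L H g (?W s) l - energy L H g C l - s * D\<bar> \<le> A * s\<^sup>2" if "\<bar>s\<bar> \<le> s0" for s
  proof (cases "s = 0")
    case True then show ?thesis unfolding True id by simp
  next
    case False
    then show ?thesis using upper[OF that False] lower[OF that] unfolding E_def by linarith
  qed
  then show ?thesis using s0 by blast
qed

end

text \<open>The field \<open>\<psi>\<close> vanishes on \<open>S\<close>, which contains the lines across which the tensor may change, and not at \<open>l\<close>. Since
\<open>s \<mapsto> l + s * \<psi> l\<close> is an affine reparametrization of the crack length, the expansion in \<open>s\<close> is a derivative in \<open>l\<close>.\<close>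

lemma energy_differentiable:
  assumes LH: "L > 0" "H > 0" and ell: "elliptic m K C" and ne: "grads L H g l \<noteq> {}" and l: "0 < l" "l < L"
    and S: "finite S" "{0, L} \<subseteq> S" "S \<subseteq> {0..L}" "l \<notin> S"
    and inv: "\<And>\<Phi> \<Phi>' \<Psi> \<Psi>' x. diffeo L 2 \<Phi> \<Phi>' \<Psi> \<Psi>' \<Longrightarrow> (\<And>p. p \<in> S \<Longrightarrow> \<Phi> p = p) \<Longrightarrow> x \<in> Omega L H \<Longrightarrow> C (shear \<Phi> x) = C x"
  shows "\<exists>D. (energy L H g C has_real_derivative D) (at l)"
proof -
  define \<psi> where "\<psi> = (\<lambda>t. \<Prod>p\<in>S. sin (pi / L * t + - (pi / L * p)))"
  have sm: "smooth1 \<psi>" and b: "\<bar>\<psi> t\<bar> \<le> 1" for t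
    unfolding \<psi>_def by (rule vanishing_field(1)[OF S(1)], rule vanishing_field(3)[OF S(1)])
  obtain \<psi>' M where \<psi>': "\<And>t. (\<psi> has_real_derivative \<psi>' t) (at t)" "\<And>t. \<bar>\<psi>' t\<bar> \<le> M"
    using vanishing_field(2)[OF S(1), of "pi / L"] unfolding \<psi>_def by blast
  have z: "\<psi> p = 0" if "p \<in> S" for p unfolding \<psi>_def using S(1) that by (auto simp: prod_zero_iff intro!: bexI[of _ p])
  have nz: "\<psi> l \<noteq> 0" using vanishing_field_zero_iff[OF S(1,3) LH(1) l] S(4) by (simp add: \<psi>_def)
  have \<tau>: "\<psi>' \<in> borel_measurable borel"
  proof -
    have "\<psi>' = (\<lambda>t. \<psi>' (fst (t, 0::real)))" by simp
    also have "\<dots> \<in> borel_measurable borel"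
      by (rule measurable_compose[OF _ smooth_borel[OF smooth1_deriv[OF sm \<psi>'(1)]], of "\<lambda>t. (t, 0)"])
        (intro borel_measurable_continuous_onI continuous_intros)
    finally show ?thesis .
  qed
  have M: "M \<ge> 0" using \<psi>'(2)[of 0] by linarith
  obtain D A s0 where D: "s0 > 0" "\<And>s. \<bar>s\<bar> \<le> s0 \<Longrightarrow>
     \<bar>energy L H g (warp (\<lambda>t. 1 + s * \<psi>' t) C) l - energy L H g C l - s * D\<bar> \<le> A * s\<^sup>2"
    using warped_energy_expansion[OF ell ne \<tau> \<psi>'(2)] by blast
  define s1 where "s1 = min s0 (min 1 (1 / (2 * (M + 1))))"
  have "1 / (2 * (M + 1)) > 0" using M by simp
  then have s1: "s1 > 0" "s1 \<le> s0" "s1 \<le> 1" unfolding s1_def using D(1) by linarith+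
  have Cb: "C \<in> borel_measurable borel" using ell by (simp add: elliptic_def)
  have tr: "energy L H g C (l + s * \<psi> l) = energy L H g (warp (\<lambda>t. 1 + s * \<psi>' t) C) l" if "\<bar>s\<bar> \<le> s1" for s
  proof -
    have "\<bar>s\<bar> * M \<le> \<bar>s\<bar> * (M + 1)" by (intro mult_left_mono) auto
    also have "\<dots> \<le> (1 / (2 * (M + 1))) * (M + 1)" using that M by (intro mult_right_mono) (auto simp: s1_def)
    also have "\<dots> = 1/2" using M by (simp add: field_simps)
    finally have "\<bar>s\<bar> * M \<le> 1/2" .
    moreover have "\<bar>s\<bar> \<le> 1" using that s1 by linarith
    ultimately obtain \<Psi> \<Psi>' where d: "diffeo L 2 (\<lambda>t. t + s * \<psi> t) (\<lambda>t. 1 + s * \<psi>' t) \<Psi> \<Psi>'"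
      using diffeo_of_field[OF sm \<psi>'(1) b \<psi>'(2)] z S(2) by blast
    have "\<And>x. x \<in> Omega L H \<Longrightarrow> C (shear (\<lambda>t. t + s * \<psi> t) x) = C x" by (rule inv[OF d]) (simp_all add: z)
    from transport_energy(1)[OF d LH(2) Cb this] show ?thesis by blast
  qed
  define e where "e = (\<lambda>s. energy L H g C (l + s * \<psi> l))"
  have "(e has_real_derivative D) (at 0)"
  proof (rule quadratic_error_derivative[OF s1(1)])
    fix s assume "\<bar>s\<bar> \<le> s1"
    then show "\<bar>e s - e 0 - s * D\<bar> \<le> A * s\<^sup>2" using D(2)[of s] s1(2) tr[of s] by (simp add: e_def)
  qed
  moreover have "((\<lambda>x. (x - l) / \<psi> l) has_real_derivative 1 / \<psi> l) (at l)"
    using nz by (auto intro!: derivative_eq_intros)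
  ultimately have "((\<lambda>x. e ((x - l) / \<psi> l)) has_real_derivative D * (1 / \<psi> l)) (at l)"
    by (intro DERIV_chain2[where f=e]) auto
  moreover have "(\<lambda>x. e ((x - l) / \<psi> l)) = energy L H g C" using nz by (auto simp: e_def)
  ultimately show ?thesis by auto
qed

section \<open>Energy release near a given crack length\<close>

text \<open>Transport moves competitors at \<open>l\<close> to competitors at every nearby crack length.\<close>

lemma nonempty_locally_constant:
  assumes LH: "L > 0" "H > 0" and l: "0 < l" "l < L"
  shows "\<exists>\<delta>>0. \<forall>l'. \<bar>l' - l\<bar> < \<delta> \<longrightarrow> 0 < l' \<and> l' < L \<and> (grads L H g l' = {} \<longleftrightarrow> grads L H g l = {})"
proof -
  define \<psi> where "\<psi> = (\<lambda>t. \<Prod>p\<in>{0, L}. sin (pi / L * t + - (pi / L * p)))"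
  have S: "finite {0, L}" by simp
  have sm: "smooth1 \<psi>" and b: "\<bar>\<psi> t\<bar> \<le> 1" for t
    unfolding \<psi>_def by (rule vanishing_field(1)[OF S], rule vanishing_field(3)[OF S])
  obtain \<psi>' M where \<psi>': "\<And>t. (\<psi> has_real_derivative \<psi>' t) (at t)" "\<And>t. \<bar>\<psi>' t\<bar> \<le> M"
    using vanishing_field(2)[OF S, of "pi / L"] unfolding \<psi>_def by blast
  have z: "\<psi> 0 = 0" "\<psi> L = 0" unfolding \<psi>_def by (auto simp: prod_zero_iff)
  have nz: "\<psi> l \<noteq> 0" using vanishing_field_zero_iff[OF S _ LH(1) l] LH(1) l by (simp add: \<psi>_def)
  have M: "M \<ge> 0" using \<psi>'(2)[of 0] by linarith
  define s1 where "s1 = min 1 (1 / (2 * (M + 1)))"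
  have "1 / (2 * (M + 1)) > 0" using M by simp
  then have s1: "s1 > 0" "s1 \<le> 1" unfolding s1_def by linarith+
  define \<delta> where "\<delta> = min (s1 * \<bar>\<psi> l\<bar>) (min l (L - l))"
  have \<delta>: "\<delta> > 0" using s1 nz l by (simp add: \<delta>_def)
  have "0 < l' \<and> l' < L \<and> (grads L H g l' = {} \<longleftrightarrow> grads L H g l = {})" if l': "\<bar>l' - l\<bar> < \<delta>" for l'
  proof -
    define s where "s = (l' - l) / \<psi> l"
    have ll: "l' = l + s * \<psi> l" using nz by (simp add: s_def)
    have "\<bar>l' - l\<bar> < s1 * \<bar>\<psi> l\<bar>" using l' by (simp add: \<delta>_def)
    then have "\<bar>s\<bar> \<le> s1" using nz by (simp add: s_def abs_divide pos_divide_le_eq)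
    then have s: "\<bar>s\<bar> \<le> 1" "\<bar>s\<bar> \<le> 1 / (2 * (M + 1))" by (auto simp: s1_def)
    have "\<bar>s\<bar> * M \<le> \<bar>s\<bar> * (M + 1)" by (intro mult_left_mono) auto
    also have "\<dots> \<le> (1 / (2 * (M + 1))) * (M + 1)" using s M by (intro mult_right_mono) auto
    also have "\<dots> = 1/2" using M by (simp add: field_simps)
    finally have "\<bar>s\<bar> * M \<le> 1/2" .
    then obtain \<Psi> \<Psi>' where d: "diffeo L 2 (\<lambda>t. t + s * \<psi> t) (\<lambda>t. 1 + s * \<psi>' t) \<Psi> \<Psi>'"
      using diffeo_of_field[OF sm \<psi>'(1) b \<psi>'(2) z s(1)] by blast
    have "grads L H g l' = {} \<longleftrightarrow> grads L H g l = {}"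
      unfolding ll by (rule transport_energy(2)[OF d LH(2), of "\<lambda>_. (1, 1)"]) simp_all
    moreover have "0 < l'" "l' < L" using l' unfolding \<delta>_def by linarith+
    ultimately show ?thesis by blast
  qed
  then show ?thesis using \<delta> by blast
qed

lemma interfaces_facts:
  assumes "L > 0" "0 < lam" "lam < 1" "n \<ge> 1"
  shows "finite (interfaces L lam n)" "{0, L} \<subseteq> interfaces L lam n" "interfaces L lam n \<subseteq> {0..L}"
proof -
  have n: "real n > 0" using assms by simp
  have e: "interfaces L lam n = (\<lambda>k. real k * L / real n) ` {..n} \<union> (\<lambda>k. (real k + lam) * L / real n) ` {..<n}"
    by (auto simp: interfaces_def)
  show "finite (interfaces L lam n)" unfolding e by simp
  have "0 = real 0 * L / real n" "L = real n * L / real n" using n by simp_all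
  then show "{0, L} \<subseteq> interfaces L lam n" unfolding interfaces_def by blast
  have "0 \<le> y * L / real n \<and> y * L / real n \<le> L" if "0 \<le> y" "y \<le> real n" for y
  proof -
    have "y * L \<le> real n * L" using that assms by (intro mult_right_mono) auto
    then show ?thesis using n that assms by (simp add: pos_divide_le_eq mult.commute)
  qed
  moreover have "0 \<le> real k + lam \<and> real k + lam \<le> real n" if "k < n" for k
  proof -
    have "real k + 1 \<le> real n" using that by linarith
    then show ?thesis using assms by linarith
  qed
  ultimately show "interfaces L lam n \<subseteq> {0..L}" unfolding interfaces_def by auto
qed

context
  fixes L H lam GA GB :: real and CA CB :: "real \<times> real" and g :: "real \<times> real \<Rightarrow> real"
  assumes dom: "L > 0" "H > 0" "0 < lam" "lam < 1"
    and CA: "fst CA > 0" "snd CA > 0" and CB: "fst CB > 0" "snd CB > 0"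
    and G: "GA > 0" "GB > 0"
begin

abbreviation "En n \<equiv> energy L H g (layer_tensor L lam CA CB n)"
abbreviation "Eh \<equiv> energy L H g (\<lambda>_. hom_tensor lam CA CB)"
abbreviation "Gcn \<equiv> layer_toughness L lam GA GB"

text \<open>A diffeomorphism that fixes all interfaces is increasing, so it maps each layer onto itself.\<close>

lemma En_differentiable:
  assumes n: "n \<ge> 1" and l: "0 < l" "l < L" "l \<notin> interfaces L lam n" and ne: "grads L H g l \<noteq> {}"
  shows "(En n has_real_derivative deriv (En n) l) (at l)"
proof -
  obtain m K where ell: "elliptic m K (layer_tensor L lam CA CB n)"
    using common_ellipticity[OF dom(3,4) CA CB] by blast
  have "\<exists>D. (En n has_real_derivative D) (at l)"
  proof (rule energy_differentiable[OF dom(1,2) ell ne l(1,2) interfaces_facts[OF dom(1,3,4) n] l(3)])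
    fix \<Phi> \<Phi>' \<Psi> \<Psi>' :: "real \<Rightarrow> real" and x :: "real \<times> real"
    assume d: "diffeo L 2 \<Phi> \<Phi>' \<Psi> \<Psi>'" and fixed: "\<And>p. p \<in> interfaces L lam n \<Longrightarrow> \<Phi> p = p"
    have "p < \<Phi> t \<longleftrightarrow> p < t" "\<Phi> t < p \<longleftrightarrow> t < p" if "p \<in> interfaces L lam n" for p t
      using diffeo_less_iff(1)[OF d, of p t] diffeo_less_iff(1)[OF d, of t p] fixed[OF that] by simp_all
    moreover have "real k * L / real n \<in> interfaces L lam n" "(real k + lam) * L / real n \<in> interfaces L lam n" if "k < n" for k
      using that by (auto simp: interfaces_def intro: less_imp_le)
    ultimately have "in_layer L lam n (\<Phi> t) \<longleftrightarrow> in_layer L lam n t" for t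
      unfolding in_layer_def by (intro ex_cong1 conj_cong refl) blast+
    then show "layer_tensor L lam CA CB n (shear \<Phi> x) = layer_tensor L lam CA CB n x"
      unfolding layer_tensor_eq by (simp add: shear_def)
  qed
  then show ?thesis using DERIV_imp_deriv by blast
qed

lemma Eh_differentiable:
  assumes l: "0 < l" "l < L" and ne: "grads L H g l \<noteq> {}"
  shows "(Eh has_real_derivative deriv Eh l) (at l)"
proof -
  obtain m K where ell: "elliptic m K (\<lambda>_. hom_tensor lam CA CB)"
    using common_ellipticity[OF dom(3,4) CA CB] by blast
  have "\<exists>D. (Eh has_real_derivative D) (at l)"
    by (rule energy_differentiable[OF dom(1,2) ell ne l, of "{0, L}"]) (use l dom in auto)
  then show ?thesis using DERIV_imp_deriv by blast
qed

lemma En_antimono: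
  assumes "grads L H g l \<noteq> {}" "l \<le> l'" shows "En n l' \<le> En n l"
proof -
  obtain m K where ell: "elliptic m K (layer_tensor L lam CA CB n)"
    using common_ellipticity[OF dom(3,4) CA CB] by blast
  show ?thesis by (rule energy_antimono[OF ell assms])
qed

context
  fixes l \<delta> :: real
  assumes near: "\<And>x. \<bar>x - l\<bar> < \<delta> \<Longrightarrow> 0 < x \<and> x < L \<and> grads L H g x \<noteq> {}" and \<delta>: "\<delta> > 0"
begin

lemma En_derivative_nonpos:
  assumes "n \<ge> 1" "\<bar>x - l\<bar> < \<delta>" "x \<notin> interfaces L lam n"
  shows "deriv (En n) x \<le> 0"
proof (rule ccontr)
  assume "\<not> deriv (En n) x \<le> 0"
  then have "deriv (En n) x > 0" by simp
  note x = near[OF assms(2)]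
  have "(En n has_real_derivative deriv (En n) x) (at x)" using x assms by (intro En_differentiable) auto
  from has_real_derivative_pos_inc_right[OF this \<open>deriv (En n) x > 0\<close>]
  obtain d where "d > 0" "\<And>h. h > 0 \<Longrightarrow> h < d \<Longrightarrow> En n x < En n (x + h)" by auto
  from this(2)[of "d / 2"] this(1) have "En n x < En n (x + d / 2)" by simp
  then show False using En_antimono[of x "x + d / 2" n] x \<open>d > 0\<close> by simp
qed

context
  fixes n :: nat and c :: real
  assumes n: "n \<ge> 1" and c: "c \<ge> 0"
    and lower: "\<And>x. \<bar>x - l\<bar> < \<delta> \<Longrightarrow> x \<notin> interfaces L lam n \<Longrightarrow> c * Gcn n x \<le> - deriv (En n) x"
begin

text \<open>The energies need not be continuous at the interfaces. The mean value theorem is applied on a slightly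
smaller interval and monotonicity provides the comparison at the end points.\<close>

lemma gap_drop:
  assumes pq: "p < q" "\<bar>p - l\<bar> < \<delta>" "\<bar>q - l\<bar> < \<delta>"
    and gap: "\<And>x. p < x \<Longrightarrow> x < q \<Longrightarrow> x \<notin> interfaces L lam n \<and> Gcn n x = G0" and "G0 > 0"
  shows "c * G0 * (q - p) \<le> En n p - En n q"
proof -
  have inside: "\<bar>x - l\<bar> < \<delta>" if "p \<le> x" "x \<le> q" for x using that pq by linarith
  define k where "k = c * G0"
  have k: "k \<ge> 0" using c assms by (simp add: k_def)
  have st: "k * (t - s) \<le> En n p - En n q" if "p < s" "s < t" "t < q" for s t
  proof -
    have d: "(En n has_real_derivative deriv (En n) x) (at x)" if "s \<le> x" "x \<le> t" for x
      using near[OF inside[of x]] gap[of x] that \<open>p < s\<close> \<open>t < q\<close> n by (intro En_differentiable) auto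
    obtain z where z: "s < z" "z < t" "En n t - En n s = (t - s) * deriv (En n) z"
      using MVT2[OF \<open>s < t\<close> d] by blast
    have "k \<le> - deriv (En n) z" using lower[OF inside[of z]] gap[of z] z that by (auto simp: k_def)
    then have "(t - s) * k \<le> (t - s) * (- deriv (En n) z)" using that by (intro mult_left_mono) auto
    then have "k * (t - s) \<le> En n s - En n t" using z(3) by (simp add: mult.commute)
    moreover have "En n s \<le> En n p" "En n q \<le> En n t"
      using near[OF inside[of p]] near[OF inside[of t]] that pq by (auto intro!: En_antimono)
    ultimately show ?thesis by linarith
  qed
  show ?thesis
  proof (rule ccontr)
    define X where "X = En n p - En n q"
    assume "\<not> c * G0 * (q - p) \<le> En n p - En n q"
    then have gt: "k * (q - p) - X > 0" by (simp add: k_def X_def)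
    \<comment> \<open>Shrinking the interval by \<open>\<eta>\<close> at both ends loses \<open>2 \<eta> k\<close>, less than the assumed deficit.\<close>
    define \<eta> where "\<eta> = min ((q - p) / 4) ((k * (q - p) - X) / (4 * (k + 1)))"
    have \<eta>: "\<eta> > 0" "\<eta> \<le> (q - p) / 4" "\<eta> \<le> (k * (q - p) - X) / (4 * (k + 1))"
      using gt k pq by (simp add: \<eta>_def, simp_all only: \<eta>_def min.cobounded1 min.cobounded2)
    have "\<eta> * (4 * (k + 1)) \<le> k * (q - p) - X" using \<eta>(3) k by (simp add: pos_le_divide_eq)
    then have "4 * (\<eta> * k) < k * (q - p) - X" using \<eta>(1) by (simp add: algebra_simps)
    moreover have "k * ((q - \<eta>) - (p + \<eta>)) \<le> X" unfolding X_def using \<eta>(1,2) pq by (intro st) auto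
    then have "k * (q - p) - 2 * (\<eta> * k) \<le> X" by (simp add: algebra_simps)
    moreover have "0 \<le> \<eta> * k" using \<eta> k by simp
    ultimately show False by linarith
  qed
qed

lemma cell_drop:
  assumes k: "\<bar>real k * L / real n - l\<bar> < \<delta>" "\<bar>real (Suc k) * L / real n - l\<bar> < \<delta>"
  shows "c * (lam * GA + (1 - lam) * GB) * (L / real n) \<le> En n (real k * L / real n) - En n (real (Suc k) * L / real n)"
proof -
  have n': "real n > 0" using n by simp
  let ?p = "real k * L / real n" and ?r = "(real k + lam) * L / real n" and ?q = "real (Suc k) * L / real n"
  have cmp: "y * L / real n < x \<longleftrightarrow> y < real n * x / L" "x < y * L / real n \<longleftrightarrow> real n * x / L < y"
    "y * L / real n \<le> x \<longleftrightarrow> y \<le> real n * x / L" for x y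
    using n' dom(1) by (simp_all add: pos_divide_less_eq pos_less_divide_eq pos_divide_le_eq pos_le_divide_eq mult.commute)
  have eqi: "x = y * L / real n \<longleftrightarrow> real n * x / L = y" for x y using n' dom(1) by (auto simp: field_simps)
  have qL: "?q < L" using near[OF k(2)] by blast
  then have "real (Suc k) < real n" using cmp(1)[of "real (Suc k)" L] n' dom(1) by simp
  then have kn: "Suc k < n" by simp
  have between: False if "real a < real b" "real b < real a + 1" for a b :: nat
  proof -
    have "a < b" using that(1) by simp
    then have "real a + 1 \<le> real b" by linarith
    then show False using that(2) by linarith
  qed
  have pr: "?p < ?r" "?r < ?q" using n' dom by (auto intro!: divide_strict_right_mono mult_strict_right_mono)
  have rd: "\<bar>?r - l\<bar> < \<delta>" using pr k by linarith
  have A: "x \<notin> interfaces L lam n \<and> Gcn n x = GA" if "?p < x" "x < ?r" for x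
  proof -
    let ?y = "real n * x / L"
    have y: "real k < ?y" "?y < real k + lam" using that unfolding cmp by auto
    have "?y \<noteq> real j" "?y \<noteq> real j + lam" for j
    proof
      assume "?y = real j"
      then have "real k < real j" "real j < real k + 1" using y dom by linarith+
      then show False by (rule between)
    next
      show "?y \<noteq> real j + lam"
      proof
        assume "?y = real j + lam"
        then have "real j < real k" "real k < real j + 1" using y dom by linarith+
        then show False by (rule between)
      qed
    qed
    then have "x \<notin> interfaces L lam n" unfolding interfaces_def eqi by blast
    moreover have "\<exists>k<n. real k * L / real n \<le> x \<and> x < (real k + lam) * L / real n"
      using that kn by (intro exI[of _ k]) auto
    then have "Gcn n x = GA" unfolding layer_toughness_def by simp
    ultimately show ?thesis ..
  qed
  have B: "x \<notin> interfaces L lam n \<and> Gcn n x = GB" if "?r < x" "x < ?q" for x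
  proof -
    let ?y = "real n * x / L"
    have y: "real k + lam < ?y" "?y < real k + 1" using that unfolding cmp by auto
    have "?y \<noteq> real j" "?y \<noteq> real j + lam" for j
    proof
      assume "?y = real j"
      then have "real k < real j" "real j < real k + 1" using y dom by linarith+
      then show False by (rule between)
    next
      show "?y \<noteq> real j + lam"
      proof
        assume "?y = real j + lam"
        then have "real k < real j" "real j < real k + 1" using y dom by linarith+
        then show False by (rule between)
      qed
    qed
    then have "x \<notin> interfaces L lam n" unfolding interfaces_def eqi by blast
    moreover have "\<not> (\<exists>j<n. real j * L / real n \<le> x \<and> x < (real j + lam) * L / real n)"
    proof
      assume "\<exists>j<n. real j * L / real n \<le> x \<and> x < (real j + lam) * L / real n"
      then obtain j where "real j \<le> ?y" "?y < real j + lam" unfolding cmp by blast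
      then have "real k < real j" "real j < real k + 1" using y dom by linarith+
      then show False by (rule between)
    qed
    moreover have "x \<noteq> L" using that qL by linarith
    ultimately have nn: "x \<notin> interfaces L lam n" "\<not> (x = L \<or> (\<exists>j<n. real j * L / real n \<le> x \<and> x < (real j + lam) * L / real n))" by blast+
    show ?thesis unfolding layer_toughness_def if_not_P[OF nn(2)] using nn(1) by simp
  qed
  have 1: "c * GA * (?r - ?p) \<le> En n ?p - En n ?r" by (rule gap_drop[OF pr(1) k(1) rd A G(1)])
  have 2: "c * GB * (?q - ?r) \<le> En n ?r - En n ?q" by (rule gap_drop[OF pr(2) rd k(2) B G(2)])
  have "?r - ?p = lam * (L / real n)" "?q - ?r = (1 - lam) * (L / real n)"
    using n' by (simp_all add: field_simps)
  moreover have "c * GA * (lam * h) + c * GB * ((1 - lam) * h) = c * (lam * GA + (1 - lam) * GB) * h" for h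
    by (simp add: algebra_simps)
  ultimately have "c * GA * (?r - ?p) + c * GB * (?q - ?r) = c * (lam * GA + (1 - lam) * GB) * (L / real n)"
    by (simp only:)
  then show ?thesis using 1 2 by linarith
qed

lemma cells_drop:
  assumes "\<bar>real a * L / real n - l\<bar> < \<delta>" "\<bar>real (a + d) * L / real n - l\<bar> < \<delta>"
  shows "real d * (c * (lam * GA + (1 - lam) * GB) * (L / real n)) \<le> En n (real a * L / real n) - En n (real (a + d) * L / real n)"
  using assms(2)
proof (induction d)
  case (Suc d)
  have n': "real n > 0" using n by simp
  have le: "real a * L / real n \<le> real (a + d) * L / real n" "real (a + d) * L / real n \<le> real (a + Suc d) * L / real n"
    using n' dom(1) by (auto intro!: divide_right_mono mult_right_mono)
  have in_d: "\<bar>real (a + d) * L / real n - l\<bar> < \<delta>" using le assms(1) Suc.prems by linarith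
  have e: "real (Suc d) * X = real d * X + X" for X by (simp add: distrib_right)
  have s: "a + Suc d = Suc (a + d)" by simp
  show ?case unfolding s e using Suc.IH[OF in_d] cell_drop[OF in_d Suc.prems[unfolded s]] by linarith
qed simp

text \<open>The interval from \<open>x1\<close> to \<open>x2\<close> contains whole cells of total length at least \<open>x2 - x1 - 2 L / n\<close>.\<close>

lemma energy_drop:
  assumes l12: "x1 < x2" "\<bar>x1 - l\<bar> < \<delta>" "\<bar>x2 - l\<bar> < \<delta>"
  shows "c * (lam * GA + (1 - lam) * GB) * (x2 - x1 - 2 * L / real n) \<le> En n x1 - En n x2"
proof -
  have n': "real n > 0" using n by simp
  define h where "h = L / real n"
  have h: "h > 0" using n' dom(1) by (simp add: h_def)
  define Gh where "Gh = c * (lam * GA + (1 - lam) * GB)"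
  have Gh: "Gh \<ge> 0" unfolding Gh_def using c G dom by (intro mult_nonneg_nonneg add_nonneg_nonneg) auto
  define a where "a = nat \<lceil>x1 / h\<rceil>"
  define b where "b = nat \<lfloor>x2 / h\<rfloor>"
  have pos: "x1 > 0" "x2 > 0" using near l12 by blast+
  have "x1 / h > 0" "x2 / h > 0" using pos h by auto
  then have a: "x1 / h \<le> real a" "real a < x1 / h + 1" and b: "real b \<le> x2 / h" "x2 / h < real b + 1"
    unfolding a_def b_def by linarith+
  have ah: "x1 \<le> real a * h" "real a * h < x1 + h" using a h by (simp_all add: pos_divide_le_eq field_simps)
  have bh: "real b * h \<le> x2" "x2 < real b * h + h" using b h by (simp_all add: pos_le_divide_eq field_simps)
  have e: "real k * L / real n = real k * h" for k by (simp add: h_def)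
  have 2: "2 * L / real n = 2 * h" by (simp add: h_def)
  have goal: "Gh * (x2 - x1 - 2 * h) \<le> En n x1 - En n x2"
  proof (cases "a \<le> b")
    case True
    then have "real a * h \<le> real b * h" using h by (intro mult_right_mono) auto
    then have near_ab: "\<bar>real a * h - l\<bar> < \<delta>" "\<bar>real b * h - l\<bar> < \<delta>" using ah bh l12 by linarith+
    have "real (b - a) * (Gh * h) \<le> En n (real a * h) - En n (real b * h)"
      using cells_drop[of a "b - a"] near_ab True unfolding e Gh_def h_def[symmetric] by simp
    moreover have "Gh * (x2 - x1 - 2 * h) \<le> Gh * (real (b - a) * h)"
      using ah bh True Gh by (intro mult_left_mono) (auto simp: of_nat_diff left_diff_distrib)
    moreover have "En n (real a * h) \<le> En n x1" "En n x2 \<le> En n (real b * h)"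
      using near[OF l12(2)] near[OF near_ab(2)] ah bh by (auto intro!: En_antimono)
    ultimately show ?thesis by (simp add: mult_ac)
  next
    case False
    then have "real b + 1 \<le> real a" by linarith
    then have "(real b + 1) * h \<le> real a * h" using h by (intro mult_right_mono) auto
    then have "x2 - x1 - 2 * h \<le> 0" using ah bh by (simp add: distrib_right)
    then have "Gh * (x2 - x1 - 2 * h) \<le> 0" using Gh by (simp add: mult_nonneg_nonpos)
    moreover have "En n x2 \<le> En n x1" using near[OF l12(2)] l12(1) by (auto intro!: En_antimono)
    ultimately show ?thesis by linarith
  qed
  then show ?thesis unfolding 2 Gh_def .
qed

end

lemma hom_release_lower:
  fixes r :: "nat \<Rightarrow> nat"
  assumes r: "strict_mono r" "\<And>j. r j \<ge> 1" and c: "c \<ge> 0"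
    and lower: "\<And>j x. j \<ge> N \<Longrightarrow> \<bar>x - l\<bar> < \<delta> \<Longrightarrow> x \<notin> interfaces L lam (r j) \<Longrightarrow> c * Gcn (r j) x \<le> - deriv (En (r j)) x"
  shows "c * (lam * GA + (1 - lam) * GB) \<le> - deriv Eh l"
proof -
  define Gh where "Gh = c * (lam * GA + (1 - lam) * GB)"
  have drop: "Gh * (x2 - x1) \<le> Eh x1 - Eh x2" if l12: "x1 < x2" "\<bar>x1 - l\<bar> < \<delta>" "\<bar>x2 - l\<bar> < \<delta>" for x1 x2
  proof (rule LIMSEQ_le)
    have "(\<lambda>j. 2 * L / real (r j)) \<longlonglongrightarrow> 0"
      by (intro tendsto_divide_0[OF tendsto_const] filterlim_at_top_imp_at_infinity
        filterlim_compose[OF filterlim_real_sequentially filterlim_subseq[OF r(1)]])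
    then have "(\<lambda>j. Gh * (x2 - x1 - 2 * L / real (r j))) \<longlonglongrightarrow> Gh * (x2 - x1 - 0)" by (intro tendsto_intros)
    then show "(\<lambda>j. Gh * (x2 - x1 - 2 * L / real (r j))) \<longlonglongrightarrow> Gh * (x2 - x1)" by simp
    have lim: "(\<lambda>j. En (r j) x) \<longlonglongrightarrow> Eh x" if "\<bar>x - l\<bar> < \<delta>" for x
      using LIMSEQ_subseq_LIMSEQ[OF energy_homogenization[OF dom CA CB] r(1), of g x] near[OF that] by (simp add: o_def)
    show "(\<lambda>j. En (r j) x1 - En (r j) x2) \<longlonglongrightarrow> Eh x1 - Eh x2" using lim l12 by (intro tendsto_diff) auto
    show "\<exists>N. \<forall>j\<ge>N. Gh * (x2 - x1 - 2 * L / real (r j)) \<le> En (r j) x1 - En (r j) x2"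
      unfolding Gh_def using energy_drop[OF r(2) c lower l12] by blast
  qed
  have l0: "\<bar>l - l\<bar> < \<delta>" using \<delta> by simp
  have "(Eh has_real_derivative deriv Eh l) (at l)" using near[OF l0] by (intro Eh_differentiable) auto
  then have D: "((\<lambda>x. Eh x + Gh * x) has_real_derivative deriv Eh l + Gh) (at l)"
    by (auto intro!: derivative_eq_intros)
  have "\<not> deriv Eh l + Gh > 0"
  proof
    assume "deriv Eh l + Gh > 0"
    from has_real_derivative_pos_inc_right[OF D this]
    obtain d where d: "d > 0" "\<And>h. h > 0 \<Longrightarrow> h < d \<Longrightarrow> Eh l + Gh * l < Eh (l + h) + Gh * (l + h)" by auto
    define h where "h = min d \<delta> / 2"
    have h: "h > 0" "h < d" "h < \<delta>" using d(1) \<delta> by (auto simp: h_def min_def)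
    have "Gh * (l + h - l) \<le> Eh l - Eh (l + h)" using h \<delta> by (intro drop) auto
    with d(2)[OF h(1,2)] show False by (simp add: algebra_simps)
  qed
  then show ?thesis unfolding Gh_def by linarith
qed

end

end

section \<open>The effective toughness\<close>

text \<open>Otherwise there are indices \<open>J k\<close>, strictly increasing, and points within \<open>1 / (k + 1)\<close> of \<open>l\<close> violating the bound. Filling
the gaps with the constant \<open>l\<close> gives a sequence converging to \<open>l\<close> along which the liminf is at most \<open>c\<close>.\<close>

lemma Gamma_liminf_lower:
  assumes "ereal c < Gamma_liminf L F l" "l \<in> {0..L}"
  shows "\<exists>\<delta>>0. \<exists>N. \<forall>j\<ge>N. \<forall>x\<in>{0..L}. \<bar>x - l\<bar> < \<delta> \<longrightarrow> ereal c \<le> F j x"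
proof (rule ccontr)
  assume "\<not> ?thesis"
  then have bad: "\<exists>j\<ge>N. \<exists>x\<in>{0..L}. \<bar>x - l\<bar> < \<delta> \<and> F j x < ereal c" if "\<delta> > 0" for \<delta> N
    using that by (meson not_le)
  have "\<exists>p. (\<exists>x. x \<in> {0..L} \<and> \<bar>x - l\<bar> < 1 / real (Suc 0) \<and> F p x < ereal c)"
  proof -
    obtain j x where "x \<in> {0..L}" "\<bar>x - l\<bar> < 1" "F j x < ereal c" using bad[of 1 0] by auto
    then show ?thesis by (intro exI[of _ j] exI[of _ x]) simp
  qed
  moreover have "\<exists>q. (\<exists>x. x \<in> {0..L} \<and> \<bar>x - l\<bar> < 1 / real (Suc (Suc k)) \<and> F q x < ereal c) \<and> p < q" for p k
  proof -
    have "1 / real (Suc (Suc k)) > 0" by simp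
    from bad[OF this, of "Suc p"] obtain j x where "j \<ge> Suc p" "x \<in> {0..L}" "\<bar>x - l\<bar> < 1 / real (Suc (Suc k))" "F j x < ereal c" by blast
    then show ?thesis by (intro exI[of _ j] conjI exI[of _ x]) simp_all
  qed
  ultimately obtain J where J: "\<And>k. \<exists>x. x \<in> {0..L} \<and> \<bar>x - l\<bar> < 1 / real (Suc k) \<and> F (J k) x < ereal c" "\<And>k. J k < J (Suc k)"
    using dependent_nat_choice[of "\<lambda>k p. \<exists>x. x \<in> {0..L} \<and> \<bar>x - l\<bar> < 1 / real (Suc k) \<and> F p x < ereal c" "\<lambda>k p q. p < q"] by blast
  have sm: "strict_mono J" using J(2) by (simp add: strict_mono_Suc_iff)
  obtain y where y: "\<And>k. y k \<in> {0..L}" "\<And>k. \<bar>y k - l\<bar> < 1 / real (Suc k)" "\<And>k. F (J k) (y k) < ereal c"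
    using J(1) by metis
  define x where "x = (\<lambda>j. if j \<in> range J then y (inv J j) else l)"
  have inj: "inv J (J k) = k" for k using sm by (simp add: strict_mono_imp_inj_on)
  have xJ: "x (J k) = y k" for k by (simp add: x_def inj)
  have xr: "x j \<in> {0..L}" for j using y(1) assms(2) by (simp add: x_def)
  have "x \<longlonglongrightarrow> l"
  proof (rule metric_LIMSEQ_I)
    fix e :: real assume "e > 0"
    then obtain k0 where k0: "1 / real (Suc k0) < e" using nat_approx_posE by blast
    have "dist (x j) l < e" if "j \<ge> J k0" for j
    proof (cases "j \<in> range J")
      case True
      then obtain k where k: "j = J k" by blast
      then have "k0 \<le> k" using that sm by (simp add: strict_mono_less_eq)
      then have "1 / real (Suc k) \<le> 1 / real (Suc k0)" by (simp add: frac_le)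
      then show ?thesis using y(2)[of k] k0 k xJ by (simp add: dist_real_def)
    qed (use \<open>e > 0\<close> in \<open>simp add: x_def\<close>)
    then show "\<exists>no. \<forall>n\<ge>no. dist (x n) l < e" by blast
  qed
  then have "Gamma_liminf L F l \<le> liminf (\<lambda>j. F j (x j))"
    unfolding Gamma_liminf_def using xr by (intro Inf_lower) blast
  also have "\<dots> \<le> liminf ((\<lambda>j. F j (x j)) \<circ> J)" by (rule liminf_subseq_mono[OF sm])
  also have "\<dots> \<le> liminf (\<lambda>k::nat. ereal c)"
    using y(3) by (intro Liminf_mono always_eventually) (auto simp: xJ intro: less_imp_le)
  also have "\<dots> = ereal c" by (simp add: Liminf_const)
  finally show False using assms(1) by simp
qed

lemma right_limit_range:
  assumes "mono_on {0..<T} f" "\<And>t. t \<in> {0..<T} \<Longrightarrow> a \<le> f t \<and> f t \<le> b" "0 \<le> t" "t < T"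
  shows "a \<le> right_limit f t" "right_limit f t \<le> b"
proof -
  have "(f \<longlongrightarrow> Inf (f ` ({t<..} \<inter> {0..<T}))) (at t within ({t<..} \<inter> {0..<T}))"
    by (rule Lim_right_bound[where K=a]) (use assms in \<open>auto simp: mono_on_def\<close>)
  moreover have "at t within ({t<..} \<inter> {0..<T}) = at_right t"
    by (rule at_within_nhd[of t "{..<T}"]) (use assms in auto)
  ultimately have lim: "(f \<longlongrightarrow> Inf (f ` ({t<..} \<inter> {0..<T}))) (at_right t)" by simp
  have R: "right_limit f t = Inf (f ` ({t<..} \<inter> {0..<T}))"
    unfolding right_limit_def by (rule tendsto_Lim[OF _ lim]) (simp add: trivial_limit_at_right_real)
  have ev: "eventually (\<lambda>x. x \<in> {0..<T}) (at_right t)"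
    using eventually_at_right_less[of t] eventually_at_right_real[OF assms(4)] by eventually_elim (use assms in auto)
  show "a \<le> right_limit f t" unfolding R
    by (rule tendsto_lowerbound[OF lim]) (use ev assms(2) in \<open>auto elim!: eventually_mono\<close>)
  show "right_limit f t \<le> b" unfolding R
    by (rule tendsto_upperbound[OF lim]) (use ev assms(2) in \<open>auto elim!: eventually_mono\<close>)
qed

theorem mainTheorem7:
  fixes L H lam GA GB T L0 ta tb :: real
    and CA CB :: "real \<times> real"
    and g :: "real \<times> real \<Rightarrow> real"
    and f f' :: "real \<Rightarrow> real"
    and ell :: "nat \<Rightarrow> real \<Rightarrow> real"
    and r :: "nat \<Rightarrow> nat"
    and ell_lim :: "real \<Rightarrow> real"
  defines "G \<equiv> layer_release L H g lam CA CB"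
    and "Gc \<equiv> layer_toughness L lam GA GB"
    and "Ghom \<equiv> hom_release L H g lam CA CB"
    and "Gc_hom \<equiv> lam * GA + (1 - lam) * GB"
    and "ell_hom \<equiv> right_limit ell_lim"
  defines "Gc_eff \<equiv> eff_toughness Ghom
             (Gamma_liminf L (\<lambda>j l. G (r j) l / ereal (Gc (r j) l)))"
  assumes "L > 0" and "H > 0"
    and "boundary_datum L H g"
    and "0 < lam" and "lam < 1"
    and "fst CA > 0" and "snd CA > 0" and "fst CB > 0" and "snd CB > 0"
    and "GA > 0" and "GB > 0"
    and "T > 0"
    and "\<forall>t\<in>{0..T}. (f has_real_derivative f' t) (at t within {0..T})"
    and "continuous_on {0..T} f'"
    and "f 0 = 0"
    and "\<forall>t\<in>{0..T}. f' t > 0"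
    and "0 < L0" and "L0 < L"
    and "\<forall>n\<ge>1. evolution T f L0 L (G n) (Gc n) (ell n)"
    and "strict_mono r" and "\<forall>j. r j \<ge> 1"
    and "\<forall>t\<in>{0..<T}. (\<lambda>j. ell (r j) t) \<longlonglongrightarrow> ell_lim t"
    and "0 \<le> ta" and "ta \<le> tb" and "tb < T"
    and "ell_hom ta < ell_hom tb"
    and "jump_set T ell_hom \<inter> {ta..tb} = {}"
  shows "\<forall>l\<in>{ell_hom ta..ell_hom tb}. ereal Gc_hom \<le> Gc_eff l"
proof
  fix l assume l: "l \<in> {ell_hom ta..ell_hom tb}"
  note defs = assms(1-6)
  note A = assms(7-)
  define \<gamma> where "\<gamma> = Gamma_liminf L (\<lambda>j l. G (r j) l / ereal (Gc (r j) l)) l"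
  have dom: "L > 0" "H > 0" "0 < lam" "lam < 1" and C: "fst CA > 0" "snd CA > 0" "fst CB > 0" "snd CB > 0"
    and GG: "GA > 0" "GB > 0" using A by auto
  have r: "strict_mono r" "\<And>j. r j \<ge> 1" using A by auto
  have ev: "evolution T f L0 L (G (r j)) (Gc (r j)) (ell (r j))" for j using A r by blast
  have lim: "\<And>t. t \<in> {0..<T} \<Longrightarrow> (\<lambda>j. ell (r j) t) \<longlonglongrightarrow> ell_lim t" using A by blast
  have T: "0 \<le> ta" "ta < T" "0 \<le> tb" "tb < T" "L0 > 0" using A by auto
  have er: "L0 \<le> ell (r j) t" "ell (r j) t \<le> L" if "t \<in> {0..<T}" for t j
  proof -
    have "ell (r j) ` {0..<T} \<subseteq> {L0..L}" using ev[of j] unfolding evolution_def by blast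
    then show "L0 \<le> ell (r j) t" "ell (r j) t \<le> L" using that by (auto simp: image_subset_iff)
  qed
  have em: "ell (r j) s \<le> ell (r j) t" if "s \<in> {0..<T}" "t \<in> {0..<T}" "s \<le> t" for s t j
    using ev[of j] that unfolding evolution_def mono_on_def by blast
  have lr: "L0 \<le> ell_lim t \<and> ell_lim t \<le> L" if "t \<in> {0..<T}" for t
    by (intro conjI LIMSEQ_le_const[OF lim[OF that]] LIMSEQ_le_const2[OF lim[OF that]] exI[of _ 0] allI impI er[OF that])
  have lm: "mono_on {0..<T} ell_lim"
    by (intro mono_onI LIMSEQ_le[OF lim lim] exI[of _ 0] allI impI em)
  have "L0 \<le> ell_hom ta" "ell_hom tb \<le> L"
    unfolding defs(5) using right_limit_range[OF lm lr] T by auto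
  then have l0: "0 < l" "l \<le> L" using l T(5) by auto
  have eff: "Gc_eff l = (if Ghom l = 0 \<or> \<gamma> = 0 then \<infinity> else ereal (Ghom l) / \<gamma>)"
    unfolding defs(6) eff_toughness_def \<gamma>_def ..
  show "ereal Gc_hom \<le> Gc_eff l"
  proof (cases "Ghom l = 0 \<or> \<gamma> = 0")
    case True
    then show ?thesis unfolding eff by simp
  next
    case False
    then have lL: "l < L" using l0 unfolding defs(3) hom_release_def by (cases "l = L") auto
    obtain \<delta> where \<delta>: "\<delta> > 0" "\<And>x. \<bar>x - l\<bar> < \<delta> \<Longrightarrow> 0 < x \<and> x < L \<and> (grads L H g x = {} \<longleftrightarrow> grads L H g l = {})"
      using nonempty_locally_constant[OF dom(1,2) l0(1) lL] by metis
    let ?Eh = "energy L H g (\<lambda>_. hom_tensor lam CA CB)"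
    let ?E = "\<lambda>n. energy L H g (layer_tensor L lam CA CB n)"
    have Gl: "Ghom l = - deriv ?Eh l" unfolding defs(3) hom_release_def using lL by simp
    have ne: "grads L H g l \<noteq> {}"
    proof
      assume e: "grads L H g l = {}"
      have "(?Eh has_real_derivative 0) (at l)"
      proof (rule has_field_derivative_transform_within[OF DERIV_const \<delta>(1)])
        show "Inf {} = ?Eh x" if "dist x l < \<delta>" for x
          using \<delta>(2)[of x] that e unfolding energy_eq by (simp add: dist_real_def)
      qed simp
      then have "Ghom l = 0" unfolding Gl using DERIV_imp_deriv by fastforce
      with False show False by simp
    qed
    have near: "0 < x \<and> x < L \<and> grads L H g x \<noteq> {}" if "\<bar>x - l\<bar> < \<delta>" for x using \<delta>(2)[OF that] ne by blast
    have Gcpos: "Gc n x > 0" for n x using GG unfolding defs(2) layer_toughness_def by auto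
    have Gx: "G n x = ereal (- deriv (?E n) x)" if "\<bar>x - l\<bar> < \<delta>" "x \<notin> interfaces L lam n" for n x
      unfolding defs(1) layer_release_def Let_def using near[OF that(1)] that(2) by simp
    have G0: "0 \<le> G n x" if "n \<ge> 1" "\<bar>x - l\<bar> < \<delta>" for n x
    proof (cases "x \<in> interfaces L lam n")
      case False
      then show ?thesis using Gx[OF that(2) False] En_derivative_nonpos[OF dom C GG near \<delta>(1) that False] by simp
    next
      case True
      have "finite (interfaces L lam n)" by (rule interfaces_facts(1)[OF dom(1,3,4) that(1)])
      then have "open (- (interfaces L lam n - {x}))" by (intro open_Compl finite_imp_closed) simp
      then have "\<forall>\<^sub>F s in at x. s \<in> - (interfaces L lam n - {x}) - {x}"
        by (rule eventually_at_in_open) simp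
      then have "\<forall>\<^sub>F s in at_right x. s \<notin> interfaces L lam n"
        unfolding eventually_at_split by (auto elim: eventually_mono)
      moreover have "\<forall>\<^sub>F s in at_right x. \<bar>s - l\<bar> < \<delta>"
      proof -
        have "((\<lambda>s. \<bar>s - l\<bar>) \<longlongrightarrow> \<bar>x - l\<bar>) (at_right x)" by (intro tendsto_intros)
        then show ?thesis using that(2) by (rule order_tendstoD(2))
      qed
      ultimately have "\<forall>\<^sub>F s in at_right x. 0 \<le> ereal (- deriv (?E n) s)"
      proof eventually_elim
        case (elim s)
        then show ?case using En_derivative_nonpos[OF dom C GG near \<delta>(1) that(1) elim(2,1)] by simp
      qed
      then have "0 \<le> Liminf (at_right x) (\<lambda>s. ereal (- deriv (?E n) s))" by (rule Liminf_bounded)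
      then show ?thesis unfolding defs(1) layer_release_def Let_def using near[OF that(2)] True by simp
    qed
    have \<gamma>0: "0 \<le> \<gamma>"
      unfolding \<gamma>_def Gamma_liminf_def
    proof (rule Inf_greatest)
      fix z assume "z \<in> {liminf (\<lambda>j. G (r j) (x j) / ereal (Gc (r j) (x j))) |x. (\<forall>j. x j \<in> {0..L}) \<and> x \<longlonglongrightarrow> l}"
      then obtain x where x: "x \<longlonglongrightarrow> l" "z = liminf (\<lambda>j. G (r j) (x j) / ereal (Gc (r j) (x j)))" by blast
      have "\<forall>\<^sub>F j in sequentially. \<bar>x j - l\<bar> < \<delta>" using tendstoD[OF x(1) \<delta>(1)] by (simp add: dist_real_def)
      then have "\<forall>\<^sub>F j in sequentially. 0 \<le> G (r j) (x j) / ereal (Gc (r j) (x j))"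
      proof eventually_elim
        case (elim j)
        then show ?case using G0[OF r(2)[of j] elim] Gcpos[of "r j" "x j"] by (cases "G (r j) (x j)") auto
      qed
      then show "0 \<le> z" unfolding x(2) by (rule Liminf_bounded)
    qed
    have main: "c * Gc_hom \<le> Ghom l" if c: "ereal c < \<gamma>" "c \<ge> 0" for c
    proof -
      obtain \<delta>' N where d: "\<delta>' > 0" "\<And>j x. j \<ge> N \<Longrightarrow> x \<in> {0..L} \<Longrightarrow> \<bar>x - l\<bar> < \<delta>' \<Longrightarrow> ereal c \<le> G (r j) x / ereal (Gc (r j) x)"
        using Gamma_liminf_lower[of c L "\<lambda>j l. G (r j) l / ereal (Gc (r j) l)" l] c(1) l0 unfolding \<gamma>_def by (auto simp: Ball_def)
      define \<delta>m where "\<delta>m = min \<delta> \<delta>'"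
      have m: "\<delta>m > 0" "\<delta>m \<le> \<delta>" "\<delta>m \<le> \<delta>'" using \<delta>(1) d(1) by (auto simp: \<delta>m_def)
      have nearm: "0 < x \<and> x < L \<and> grads L H g x \<noteq> {}" if "\<bar>x - l\<bar> < \<delta>m" for x using near[of x] that m by linarith
      have "c * layer_toughness L lam GA GB (r j) x \<le> - deriv (?E (r j)) x"
        if "j \<ge> N" "\<bar>x - l\<bar> < \<delta>m" "x \<notin> interfaces L lam (r j)" for j x
      proof -
        have "ereal c \<le> G (r j) x / ereal (Gc (r j) x)" using nearm[OF that(2)] that m by (intro d(2)) auto
        moreover have "G (r j) x = ereal (- deriv (?E (r j)) x)" using that m by (intro Gx) auto
        ultimately have "c \<le> - deriv (?E (r j)) x / Gc (r j) x" using Gcpos[of "r j" x] by simp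
        from this[unfolded pos_le_divide_eq[OF Gcpos]] show ?thesis unfolding defs(2) .
      qed
      from hom_release_lower[OF dom C GG nearm m(1) r c(2) this]
      show ?thesis unfolding Gl defs(4) .
    qed
    have \<gamma>p: "\<gamma> > 0" using \<gamma>0 False by (simp add: less_le)
    have Ghp: "Gc_hom > 0" unfolding defs(4) using GG dom by (simp add: add_pos_pos)
    show ?thesis
    proof (cases \<gamma>)
      case (real c0)
      then have c0: "c0 > 0" using \<gamma>p by simp
      have "c0 * Gc_hom \<le> Ghom l"
      proof (rule ccontr)
        assume "\<not> c0 * Gc_hom \<le> Ghom l"
        then have "Ghom l / Gc_hom < c0" using Ghp by (simp add: pos_divide_less_eq)
        then have "max 0 (Ghom l / Gc_hom) < c0" using c0 by simp
        then obtain c where c: "max 0 (Ghom l / Gc_hom) < c" "c < c0" using dense by blast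
        then have "c * Gc_hom \<le> Ghom l" using real by (intro main) auto
        then show False using c(1) Ghp by (simp add: pos_divide_less_eq)
      qed
      then show ?thesis unfolding eff using False real c0 by (simp add: pos_le_divide_eq mult.commute)
    next
      case PInf
      define c where "c = \<bar>Ghom l\<bar> / Gc_hom + 1"
      have "c * Gc_hom \<le> Ghom l" using PInf Ghp by (intro main) (auto simp: c_def)
      then show ?thesis using Ghp by (simp add: c_def distrib_right)
    next
      case MInf
      then show ?thesis using \<gamma>p by simp
    qed
  qed
qed

end
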